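(* Consider a state $\rho_{ABEE'}$ and let $\mathcal P$ be a key distillation protocol for $\rho_{ABE}=\mathrm{Tr}_{E'}\rho_{ABEE'}$ with rate $R_{\mathcal P}$. Then there exists another protocol $\mathcal P'$ for $\rho_{ABEE'}$ (with Eve holding $EE'$) with rate $$R_{\mathcal P'}\ge R_{\mathcal P}-2S(\rho_{E'}).$$ If, in addition, $E'$ is classical, then there exists such a protocol $\mathcal P'$ with $R_{\mathcal P'}\ge R_{\mathcal P}-S(\rho_{E'})$.
   Context: Hilbert spaces are finite-dimensional and $\log$ is to base 2; $S$ denotes von Neumann entropy. $E'$ is classical if $\rho_{ABEE'}=\sum_kp_k\,\rho^k_{ABE}\otimes|k\rangle\langle k|_{E'}$ for an orthonormal basis $\{|k\rangle\}$. Key distillation protocols. A tripartite state $\rho_{ABE}$ is a density operator on $\mathcal H_A\otimes\mathcal H_B\otimes\mathcal H_E$, held by Alice, Bob and the adversary Eve. Distance: $\|\rho-\sigma\|:=\frac12\mathrm{Tr}|\rho-\sigma|$. LOPC operation: a concatenation of finitely many steps, each being either (i) a local quantum operation of Bob, $\rho_{ABE}\mapsto(I_{AE}\otimes\Lambda_B)(\rho_{ABE})$ with $\Lambda_B$ completely positive trace preserving (CPTP), or the analogue for Alice; or (ii) public classical communication from Alice to Bob: a state $\sum_i\rho^i_{ABE}\otimes|i\rangle\langle i|_{A'}$ ($A'$ a classical register of Alice) is transformed into $\sum_i\rho^i_{ABE}\otimes|iii\rangle\langle iii|_{A'B'E''}$ (with Eve's copy of the message stored in a new register $E''$), or the analogue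 from Bob to Alice. LOPC protocol: a family $\mathcal P=\{\Lambda_n\}_{n\in\mathbb N}$ of CPTP maps $\Lambda_n:(\mathcal H_A\otimes\mathcal H_B\otimes\mathcal H_E)^{\otimes n}\to\mathcal H_A^n\otimes\mathcal H_B^n\otimes\mathcal H_E^n$, each an LOPC operation. Let $\tau^\ell_{ABE}:=\frac1{2^\ell}\sum_{i=1}^{2^\ell}|ii\rangle\langle ii|_{AB}\otimes\tau_E$ for some arbitrary state $\tau_E$. $\mathcal P$ is a key distillation protocol for $\rho_{ABE}$ with rate $R_{\mathcal P}$ if there is a sequence $\{\ell_n\}$ with $\limsup_{n\to\infty}\ell_n/n=R_{\mathcal P}$ and $\lim_{n\to\infty}\|\Lambda_n(\rho_{ABE}^{\otimes n})-\tau^{\ell_n}_{ABE}\|=0$. *)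

theory Defs
  imports
    Complex_Main
    "HOL-Library.Extended_Real"
    "HOL-Library.Liminf_Limsup"
    "Jordan_Normal_Form.Schur_Decomposition"
begin

text \<open>
  Operators on the Hilbert space \<open>\<complex>\<^sup>n\<close> are complex \<open>n \<times> n\<close> matrices. The basis of a tensor
  product is indexed in mixed radix, the last factor varying fastest. With this convention
  the tensor product is strictly associative, so a matrix of dimension \<open>a * b * e * f\<close> is at
  the same time an operator on \<open>A \<otimes> B \<otimes> E \<otimes> E'\<close>, on \<open>(A \<otimes> B \<otimes> E) \<otimes> E'\<close> and on the tripartite
  system \<open>A \<otimes> B \<otimes> (E \<otimes> E')\<close>.
\<close>

subsection \<open>Operators and states\<close>

definition mat_trace :: "complex mat \<Rightarrow> complex" where
  "mat_trace M = (\<Sum>i<dim_row M. M $$ (i, i))"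

definition mat_sum :: "nat \<Rightarrow> ('k \<Rightarrow> complex mat) \<Rightarrow> 'k set \<Rightarrow> complex mat" where
  "mat_sum n F K = mat n n (\<lambda>rs. \<Sum>k\<in>K. F k $$ rs)"

definition unitary :: "nat \<Rightarrow> complex mat \<Rightarrow> bool" where
  "unitary n U \<longleftrightarrow> U \<in> carrier_mat n n \<and> mat_adjoint U * U = 1\<^sub>m n \<and> U * mat_adjoint U = 1\<^sub>m n"

text \<open>
  The order on \<^typ>\<open>complex\<close> is the one of Complex\_Order: \<open>0 \<le> z\<close> says that \<open>z\<close> is real and
  nonnegative. Over the complex numbers this forces \<open>M\<close> to be Hermitian.
\<close>

definition positive_op :: "nat \<Rightarrow> complex mat \<Rightarrow> bool" where
  "positive_op n M \<longleftrightarrow> M \<in> carrier_mat n n \<and> (\<forall>v\<in>carrier_vec n. 0 \<le> (M *\<^sub>v v) \<bullet>c v)"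

definition density_op :: "nat \<Rightarrow> complex mat \<Rightarrow> bool" where
  "density_op n \<rho> \<longleftrightarrow> positive_op n \<rho> \<and> mat_trace \<rho> = 1"

text \<open>Functional calculus \<open>f(M)\<close>; only meaningful for Hermitian \<open>M\<close>.\<close>

definition herm_fun :: "(real \<Rightarrow> real) \<Rightarrow> complex mat \<Rightarrow> complex mat" where
  "herm_fun f M = (THE N. \<exists>U d. unitary (dim_row M) U
      \<and> M = U * mat_diag (dim_row M) (\<lambda>i. complex_of_real (d i)) * mat_adjoint U
      \<and> N = U * mat_diag (dim_row M) (\<lambda>i. complex_of_real (f (d i))) * mat_adjoint U)"

text \<open>
  \<open>- Tr \<rho> log \<rho>\<close>. The value given to the logarithm at \<open>0\<close> is irrelevant, because \<open>\<rho>\<close> vanishes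
  on the corresponding eigenspace.
\<close>

definition entropy :: "complex mat \<Rightarrow> real" where
  "entropy \<rho> = - Re (mat_trace (\<rho> * herm_fun (log 2) \<rho>))"

definition abs_op :: "complex mat \<Rightarrow> complex mat" where
  "abs_op M = herm_fun sqrt (mat_adjoint M * M)"

definition trace_dist :: "complex mat \<Rightarrow> complex mat \<Rightarrow> real" where
  "trace_dist \<rho> \<sigma> = 1 / 2 * Re (mat_trace (abs_op (\<rho> - \<sigma>)))"


subsection \<open>Tensor products and partial traces\<close>

definition kron :: "complex mat \<Rightarrow> complex mat \<Rightarrow> complex mat" where
  "kron X Y = mat (dim_row X * dim_row Y) (dim_col X * dim_col Y)
     (\<lambda>(r, c). X $$ (r div dim_row Y, c div dim_col Y) * Y $$ (r mod dim_row Y, c mod dim_col Y))"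

definition ptrace_fst :: "nat \<Rightarrow> nat \<Rightarrow> complex mat \<Rightarrow> complex mat" where
  "ptrace_fst m n X = mat n n (\<lambda>(r, c). \<Sum>k<m. X $$ (k * n + r, k * n + c))"

definition ptrace_snd :: "nat \<Rightarrow> nat \<Rightarrow> complex mat \<Rightarrow> complex mat" where
  "ptrace_snd m n X = mat m m (\<lambda>(r, c). \<Sum>k<n. X $$ (r * n + k, c * n + k))"

definition ketbra :: "complex vec \<Rightarrow> complex mat" where
  "ketbra v = mat (dim_vec v) (dim_vec v) (\<lambda>(r, c). v $ r * cnj (v $ c))"

definition orthonormal_basis :: "nat \<Rightarrow> (nat \<Rightarrow> complex vec) \<Rightarrow> bool" where
  "orthonormal_basis n v \<longleftrightarrow> (\<forall>k<n. v k \<in> carrier_vec n)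
     \<and> (\<forall>k<n. \<forall>l<n. v k \<bullet>c v l = (if k = l then 1 else 0))"

definition classical_snd :: "nat \<Rightarrow> nat \<Rightarrow> complex mat \<Rightarrow> bool" where
  "classical_snd m n \<rho> \<longleftrightarrow> (\<exists>v p \<sigma>. orthonormal_basis n v
     \<and> (\<forall>k<n. 0 \<le> p k \<and> density_op m (\<sigma> k)) \<and> (\<Sum>k<n. p k) = 1
     \<and> \<rho> = mat_sum (m * n) (\<lambda>k. complex_of_real (p k) \<cdot>\<^sub>m kron (\<sigma> k) (ketbra (v k))) {..<n})"


subsection \<open>Tripartite systems\<close>

text \<open>
  A tripartite system is given by its dimensions \<open>(a, b, e)\<close>; the basis vector \<open>|i j k\<rangle>\<close> has
  index \<open>(i * b + j) * e + k\<close>.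
\<close>

type_synonym dims = "nat \<times> nat \<times> nat"

fun tri_enc :: "nat \<Rightarrow> nat \<Rightarrow> nat \<times> nat \<times> nat \<Rightarrow> nat" where
  "tri_enc b e (i, j, k) = (i * b + j) * e + k"

definition tri_dec :: "nat \<Rightarrow> nat \<Rightarrow> nat \<Rightarrow> nat \<times> nat \<times> nat" where
  "tri_dec b e r = (r div (b * e), r div e mod b, r mod e)"

definition tri_mat ::
  "nat \<Rightarrow> nat \<Rightarrow> nat \<Rightarrow> (nat \<times> nat \<times> nat \<Rightarrow> nat \<times> nat \<times> nat \<Rightarrow> complex) \<Rightarrow> complex mat" where
  "tri_mat a b e f = mat (a * b * e) (a * b * e) (\<lambda>(r, c). f (tri_dec b e r) (tri_dec b e c))"

text \<open>
  The tensor product of operators on \<open>A \<otimes> B \<otimes> E\<close> and \<open>A' \<otimes> B' \<otimes> E'\<close>, with factors regrouped as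
  \<open>(A \<otimes> A') \<otimes> (B \<otimes> B') \<otimes> (E \<otimes> E')\<close>.
\<close>

fun tri_tensor :: "dims \<Rightarrow> complex mat \<Rightarrow> dims \<Rightarrow> complex mat \<Rightarrow> complex mat" where
  "tri_tensor (a, b, e) X (a', b', e') Y = tri_mat (a * a') (b * b') (e * e')
     (\<lambda>(i, j, k) (i', j', k').
        X $$ (tri_enc b e (i div a', j div b', k div e'), tri_enc b e (i' div a', j' div b', k' div e'))
      * Y $$ (tri_enc b' e' (i mod a', j mod b', k mod e'), tri_enc b' e' (i' mod a', j' mod b', k' mod e')))"

fun dims_pow :: "dims \<Rightarrow> nat \<Rightarrow> dims" where
  "dims_pow (a, b, e) n = (a ^ n, b ^ n, e ^ n)"

fun tri_power :: "dims \<Rightarrow> complex mat \<Rightarrow> nat \<Rightarrow> complex mat" where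
  "tri_power d \<rho> 0 = 1\<^sub>m 1"
| "tri_power d \<rho> (Suc n) = tri_tensor d \<rho> (dims_pow d n) (tri_power d \<rho> n)"


subsection \<open>Quantum operations\<close>

text \<open>\<open>id\<^sub>k \<otimes> \<Lambda> \<otimes> id\<^sub>l\<close>, for \<open>\<Lambda>\<close> mapping \<open>d \<times> d\<close> to \<open>d' \<times> d'\<close> matrices.\<close>

definition lift_op ::
  "nat \<Rightarrow> nat \<Rightarrow> nat \<Rightarrow> nat \<Rightarrow> (complex mat \<Rightarrow> complex mat) \<Rightarrow> complex mat \<Rightarrow> complex mat" where
  "lift_op k l d d' \<Lambda> X = tri_mat k d' l (\<lambda>(p, q, s) (p', q', s').
     \<Lambda> (mat d d (\<lambda>(u, v). X $$ (tri_enc d l (p, u, s), tri_enc d l (p', v, s')))) $$ (q, q'))"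

definition cptp :: "nat \<Rightarrow> nat \<Rightarrow> (complex mat \<Rightarrow> complex mat) \<Rightarrow> bool" where
  "cptp d d' \<Lambda> \<longleftrightarrow>
     (\<forall>X\<in>carrier_mat d d. \<Lambda> X \<in> carrier_mat d' d')
   \<and> (\<forall>X\<in>carrier_mat d d. \<forall>Y\<in>carrier_mat d d. \<Lambda> (X + Y) = \<Lambda> X + \<Lambda> Y)
   \<and> (\<forall>c. \<forall>X\<in>carrier_mat d d. \<Lambda> (c \<cdot>\<^sub>m X) = c \<cdot>\<^sub>m \<Lambda> X)
   \<and> (\<forall>X\<in>carrier_mat d d. mat_trace (\<Lambda> X) = mat_trace X)
   \<and> (\<forall>k X. positive_op (k * d) X \<longrightarrow> positive_op (k * d') (lift_op k 1 d d' \<Lambda> X))"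

text \<open>
  Public communication of an \<open>m\<close>-valued message held by Alice in the last tensor factor \<open>A'\<close>
  of her system: \<open>\<Sum>\<^sub>x \<rho>\<^sup>x \<otimes> |x\<rangle>\<langle>x|\<^sub>A\<^sub>' \<mapsto> \<Sum>\<^sub>x \<rho>\<^sup>x \<otimes> |xxx\<rangle>\<langle>xxx|\<close> on \<open>A' B' E''\<close>, where the new registers \<open>B'\<close> and
  \<open>E''\<close> become the last factors of Bob's and Eve's systems. Operators that are not classical on
  \<open>A'\<close> are first dephased in the computational basis of \<open>A'\<close>. As dephasing is itself a local
  operation of Alice and leaves classical registers unchanged, this total extension generates
  the same LOPC operations.
\<close>

definition comm_A :: "nat \<Rightarrow> nat \<Rightarrow> nat \<Rightarrow> nat \<Rightarrow> complex mat \<Rightarrow> complex mat" where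
  "comm_A a b e m X = tri_mat (a * m) (b * m) (e * m) (\<lambda>(i, j, k) (i', j', k').
     if \<forall>y\<in>{j mod m, k mod m, i' mod m, j' mod m, k' mod m}. y = i mod m
     then X $$ (tri_enc b e (i, j div m, k div m), tri_enc b e (i', j' div m, k' div m))
     else 0)"

definition comm_B :: "nat \<Rightarrow> nat \<Rightarrow> nat \<Rightarrow> nat \<Rightarrow> complex mat \<Rightarrow> complex mat" where
  "comm_B a b e m X = tri_mat (a * m) (b * m) (e * m) (\<lambda>(i, j, k) (i', j', k').
     if \<forall>y\<in>{i mod m, k mod m, i' mod m, j' mod m, k' mod m}. y = j mod m
     then X $$ (tri_enc (b * m) e (i div m, j, k div m), tri_enc (b * m) e (i' div m, j', k' div m))
     else 0)"

text \<open>
  \<open>lopc D D' \<Lambda>\<close>: \<open>\<Lambda>\<close> is an LOPC operation from the tripartite system with dimensions \<open>D\<close> to the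
  one with dimensions \<open>D'\<close>. Every single step is completely positive and trace preserving,
  hence so is \<open>\<Lambda>\<close>. Registers are always split off or appended at the end of a system; other
  arrangements arise by composing with local unitaries.
\<close>

inductive lopc :: "dims \<Rightarrow> dims \<Rightarrow> (complex mat \<Rightarrow> complex mat) \<Rightarrow> bool" for D :: dims where
  lopc_id: "lopc D D (\<lambda>X. X)"
| lopc_local_A: "lopc D (a, b, e) F \<Longrightarrow> cptp a a' \<Lambda> \<Longrightarrow>
     lopc D (a', b, e) (\<lambda>X. lift_op 1 (b * e) a a' \<Lambda> (F X))"
| lopc_local_B: "lopc D (a, b, e) F \<Longrightarrow> cptp b b' \<Lambda> \<Longrightarrow>
     lopc D (a, b', e) (\<lambda>X. lift_op a e b b' \<Lambda> (F X))"
| lopc_comm_A: "lopc D (a * m, b, e) F \<Longrightarrow>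
     lopc D (a * m, b * m, e * m) (\<lambda>X. comm_A a b e m (F X))"
| lopc_comm_B: "lopc D (a, b * m, e) F \<Longrightarrow>
     lopc D (a * m, b * m, e * m) (\<lambda>X. comm_B a b e m (F X))"


subsection \<open>Key distillation\<close>

text \<open>The \<open>n\<close>-th component consists of the output dimensions and the map \<open>\<Lambda>\<^sub>n\<close>.\<close>

type_synonym protocol = "nat \<Rightarrow> dims \<times> (complex mat \<Rightarrow> complex mat)"

definition lopc_protocol :: "dims \<Rightarrow> protocol \<Rightarrow> bool" where
  "lopc_protocol d P \<longleftrightarrow> (\<forall>n. lopc (dims_pow d n) (fst (P n)) (snd (P n)))"

text \<open>
  \<open>\<tau>\<^sup>l = 2\<^sup>-\<^sup>l \<Sum>\<^sub>i |ii\<rangle>\<langle>ii| \<otimes> \<tau>\<^sub>E\<close>. The output systems of Alice and Bob may be larger than \<open>2\<^sup>l\<close>; the key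
  is then carried by the first \<open>2\<^sup>l\<close> vectors of the computational basis.
\<close>

fun key_state :: "dims \<Rightarrow> nat \<Rightarrow> complex mat \<Rightarrow> complex mat" where
  "key_state (a, b, e) l \<tau> = complex_of_real (1 / 2 ^ l) \<cdot>\<^sub>m
     kron (mat_sum (a * b) (\<lambda>i. kron (ketbra (unit_vec a i)) (ketbra (unit_vec b i))) {..<2 ^ l}) \<tau>"

fun key_fits :: "dims \<Rightarrow> nat \<Rightarrow> bool" where
  "key_fits (a, b, e) l \<longleftrightarrow> 2 ^ l \<le> a \<and> 2 ^ l \<le> b"

fun eve_dim :: "dims \<Rightarrow> nat" where
  "eve_dim (a, b, e) = e"

definition key_distillation :: "dims \<Rightarrow> complex mat \<Rightarrow> protocol \<Rightarrow> ereal \<Rightarrow> bool" where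
  "key_distillation d \<rho> P R \<longleftrightarrow> lopc_protocol d P \<and>
     (\<exists>(l :: nat \<Rightarrow> nat) (\<tau> :: nat \<Rightarrow> complex mat).
        (\<forall>n. key_fits (fst (P n)) (l n) \<and> density_op (eve_dim (fst (P n))) (\<tau> n))
      \<and> limsup (\<lambda>n. ereal (real (l n) / real n)) = R
      \<and> (\<lambda>n. trace_dist (snd (P n) (tri_power d \<rho> n)) (key_state (fst (P n)) (l n) (\<tau> n)))
          \<longlonglongrightarrow> 0)"

end

theory Submission
  imports Defs "Jordan_Normal_Form.Spectral_Radius" "HOL-Real_Asymp.Real_Asymp"
begin

text \<open>
  Alice and Bob run \<open>P\<close> on their parts of \<open>\<rho>\<^sup>\<otimes>\<^sup>n\<close>, while Eve keeps \<open>F\<^sup>n\<close> in addition to what \<open>P\<close> leaves her. Then both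
  measure their keys, of \<open>L = 2\<^sup>l\<close> values, and apply the same fixed hash function to \<open>m = 2\<^sup>l\<^sup>'\<close> values; nothing needs
  to be announced. Let \<open>\<eta>\<^sub>x\<close> be Eve's unnormalised state given the key \<open>x\<close>. Its marginal without \<open>F\<^sup>n\<close> is close to \<open>\<tau>/L\<close>,
  and up to a small error \<open>F\<^sup>n\<close> lies in a typical subspace \<open>T\<close> of dimension about \<open>2\<^sup>n\<^sup>S\<close>. By the pinching inequality
  the compression of \<open>\<eta>\<^sub>x\<close> to \<open>T\<close> is at most \<open>|T| (\<tau>/L) \<otimes> 1\<^sub>T\<close>, and the factor \<open>|T|\<close> disappears if \<open>F\<close> is classical.
  As in the leftover hash lemma this bounds the collision terms \<open>tr(\<eta>\<^sub>x \<sigma>\<^sup>-\<^sup>1 \<eta>\<^sub>x)\<close> for \<open>\<sigma> = \<tau> \<otimes> 1\<^sub>T\<close>, and a suitable hash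
  function leaves a key that is almost uniform and independent of Eve as soon as \<open>m |T|\<^sup>2 / L\<close>, respectively \<open>m |T| / L\<close>,
  is small. Hence \<open>l'\<close> can be chosen as \<open>l - 2nS - o(n)\<close>, respectively \<open>l - nS - o(n)\<close>.
\<close>

text \<open>The marginal of Eve's state given a key x is close to \<tau>/L only in trace norm,
  whereas the collision argument needs an operator inequality; moreover the dimension of E, an
  output of \<open>P\<close>, is under no control. Therefore the deviation is first dominated by its
  absolute value, which is added to \<tau>/L, and this addition is then removed by conjugating with
  an operator on E alone (\<open>smoothing\<close>). The loss depends on the trace of the deviation
  and on the weight outside T, not on a dimension. A multiple of the identity of trace 1/L makes the
  reference operator invertible and doubles its trace, whence the constant 2 in later bounds.

  Trace norms are treated by duality: the distance to be bounded is the real part of tr (K M) for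
  one unitary K, and the estimates hold for all contractions K.

  The hash function can be fixed in advance because the state is known and one function serves all K
  at once. When the intended key length is negative, \<open>nat\<close> sets it to 0; the key is
  then trivial, the hashing error is 0, and no case distinction on the rate is needed.\<close>

section \<open>Finitely supported matrices\<close>

text \<open>
  Matrices over an arbitrary index type form an algebra, so that block and tensor structures are
  expressed by the index type, without carrier sets and dimensions.
\<close>

typedef 'i fmat = "{f :: 'i \<Rightarrow> 'i \<Rightarrow> complex. \<exists>S. finite S \<and> (\<forall>i j. i \<notin> S \<or> j \<notin> S \<longrightarrow> f i j = 0)}"
  morphisms ent Fmat
  by (rule exI[of _ "\<lambda>_ _. 0"]) auto

setup_lifting type_definition_fmat

definition supp :: "'i fmat \<Rightarrow> 'i set" where
  "supp f = {i. \<exists>j. ent f i j \<noteq> 0 \<or> ent f j i \<noteq> 0}"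

lemma finite_supp [simp]: "finite (supp f)"
proof -
  obtain S where S: "finite S" "\<And>i j. i \<notin> S \<or> j \<notin> S \<Longrightarrow> ent f i j = 0"
    using ent[of f] by blast
  then have "supp f \<subseteq> S" unfolding supp_def by fast
  then show ?thesis using S(1) finite_subset by blast
qed

lemma ent_outside: "i \<notin> supp f \<or> j \<notin> supp f \<Longrightarrow> ent f i j = 0"
  unfolding supp_def by blast

lemma fmat_eqI: "(\<And>i j. ent f i j = ent g i j) \<Longrightarrow> f = g"
  by (simp add: ent_inject[symmetric] fun_eq_iff)

lemma supp_subsetI: "(\<And>i j. i \<notin> S \<or> j \<notin> S \<Longrightarrow> ent f i j = 0) \<Longrightarrow> supp f \<subseteq> S"
  unfolding supp_def by blast

lemma supp_subsetD: "supp f \<subseteq> S \<Longrightarrow> i \<notin> S \<or> j \<notin> S \<Longrightarrow> ent f i j = 0"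
  unfolding supp_def by blast

text \<open>The test \<open>finite S\<close> sits inside the body to make the operator total: an
  infinite \<open>S\<close> gives the zero matrix, a default that \<open>idm\<close>
  inherits.\<close>

definition fmat_of :: "'i set \<Rightarrow> ('i \<Rightarrow> 'i \<Rightarrow> complex) \<Rightarrow> 'i fmat" where
  "fmat_of S f = Fmat (\<lambda>i j. if finite S \<and> i \<in> S \<and> j \<in> S then f i j else 0)"

lemma ent_fmat_of: "finite S \<Longrightarrow> ent (fmat_of S f) i j = (if i \<in> S \<and> j \<in> S then f i j else 0)"
  unfolding fmat_of_def by (subst Fmat_inverse) (auto intro: exI[of _ S])

lemma supp_fmat_of: "finite S \<Longrightarrow> supp (fmat_of S f) \<subseteq> S"
  by (rule supp_subsetI) (auto simp: ent_fmat_of)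

instantiation fmat :: (type) ab_group_add
begin

lift_definition zero_fmat :: "'a fmat" is "\<lambda>_ _. 0" by auto

lift_definition plus_fmat :: "'a fmat \<Rightarrow> 'a fmat \<Rightarrow> 'a fmat" is "\<lambda>f g i j. f i j + g i j"
proof -
  fix f g :: "'a \<Rightarrow> 'a \<Rightarrow> complex"
  assume "\<exists>S. finite S \<and> (\<forall>i j. i \<notin> S \<or> j \<notin> S \<longrightarrow> f i j = 0)"
    and "\<exists>S. finite S \<and> (\<forall>i j. i \<notin> S \<or> j \<notin> S \<longrightarrow> g i j = 0)"
  then obtain S T where "finite S" "\<forall>i j. i \<notin> S \<or> j \<notin> S \<longrightarrow> f i j = 0"
    "finite T" "\<forall>i j. i \<notin> T \<or> j \<notin> T \<longrightarrow> g i j = 0" by blast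
  then show "\<exists>S. finite S \<and> (\<forall>i j. i \<notin> S \<or> j \<notin> S \<longrightarrow> f i j + g i j = 0)"
    by (intro exI[of _ "S \<union> T"]) simp
qed

lift_definition uminus_fmat :: "'a fmat \<Rightarrow> 'a fmat" is "\<lambda>f i j. - f i j" by auto

definition minus_fmat :: "'a fmat \<Rightarrow> 'a fmat \<Rightarrow> 'a fmat" where "minus_fmat f g = f + - g"

lemma ent_zero [simp]: "ent 0 i j = 0" by transfer auto
lemma ent_plus [simp]: "ent (f + g) i j = ent f i j + ent g i j" by transfer auto
lemma ent_uminus [simp]: "ent (- f) i j = - ent f i j" by transfer auto
lemma ent_minus [simp]: "ent (f - g) i j = ent f i j - ent g i j"
  by (simp add: minus_fmat_def)

instance
proof
  fix a b c :: "'a fmat"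
  show "a + b + c = a + (b + c)" by (intro fmat_eqI) simp
  show "a + b = b + a" by (intro fmat_eqI) simp
  show "0 + a = a" by (intro fmat_eqI) simp
  show "- a + a = 0" by (intro fmat_eqI) simp
  show "a - b = a + - b" by (rule minus_fmat_def)
qed

end

instantiation fmat :: (type) real_algebra
begin

lift_definition scaleR_fmat :: "real \<Rightarrow> 'a fmat \<Rightarrow> 'a fmat" is "\<lambda>c f i j. complex_of_real c * f i j"
  by auto

definition times_fmat :: "'a fmat \<Rightarrow> 'a fmat \<Rightarrow> 'a fmat" where
  "f * g = fmat_of (supp f \<union> supp g) (\<lambda>i k. \<Sum>j\<in>supp f. ent f i j * ent g j k)"

lemma ent_times_supp: "ent (f * g) i k = (\<Sum>j\<in>supp f. ent f i j * ent g j k)"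
proof -
  have "(\<Sum>j\<in>supp f. ent f i j * ent g j k) = 0" if "i \<notin> supp f \<union> supp g \<or> k \<notin> supp f \<union> supp g"
    using that by (intro sum.neutral) (auto simp: ent_outside)
  then show ?thesis
    unfolding times_fmat_def by (subst ent_fmat_of) auto
qed

text \<open>A term vanishes as soon as one of its factors does, so a set containing either support
  may index the sum. Later proofs choose it to fit the block structure at hand.\<close>

lemma ent_times:
  assumes "finite S" "supp f \<subseteq> S \<or> supp g \<subseteq> S"
  shows "ent (f * g) i k = (\<Sum>j\<in>S. ent f i j * ent g j k)"
proof -
  have "(\<Sum>j\<in>supp f. ent f i j * ent g j k) = (\<Sum>j\<in>supp f \<union> S. ent f i j * ent g j k)"
    using assms finite_supp by (intro sum.mono_neutral_left) (auto simp: ent_outside)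
  also have "\<dots> = (\<Sum>j\<in>S. ent f i j * ent g j k)"
    using assms
    by (intro sum.mono_neutral_right) (auto, (metis ent_outside mult_zero_left mult_zero_right subsetD)+)
  finally show ?thesis by (simp add: ent_times_supp)
qed

lemma ent_scaleR [simp]: "ent (c *\<^sub>R f) i j = complex_of_real c * ent f i j"
  by transfer auto

instance
proof
  fix a b c :: "'a fmat"
  define S where "S = supp a \<union> supp b \<union> supp c"
  have S: "finite S" "supp a \<subseteq> S" "supp b \<subseteq> S" "supp c \<subseteq> S"
    by (auto simp: S_def finite_supp)
  note e = ent_times[OF S(1)]
  show "a * b * c = a * (b * c)"
  proof (rule fmat_eqI)
    fix i k
    have "ent (a * b * c) i k = (\<Sum>j\<in>S. (\<Sum>l\<in>S. ent a i l * ent b l j) * ent c j k)"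
      using S by (simp add: e)
    also have "\<dots> = (\<Sum>j\<in>S. \<Sum>l\<in>S. ent a i l * ent b l j * ent c j k)"
      by (simp add: sum_distrib_right)
    also have "\<dots> = (\<Sum>l\<in>S. \<Sum>j\<in>S. ent a i l * ent b l j * ent c j k)"
      by (rule sum.swap)
    also have "\<dots> = ent (a * (b * c)) i k"
      using S by (simp add: e sum_distrib_left mult.assoc)
    finally show "ent (a * b * c) i k = ent (a * (b * c)) i k" .
  qed
  have "supp (a + b) \<subseteq> S" by (rule supp_subsetI) (auto simp: S_def ent_outside)
  then show "(a + b) * c = a * c + b * c"
    using S by (intro fmat_eqI) (simp add: e sum.distrib distrib_right)
  show "a * (b + c) = a * b + a * c"
    using S by (intro fmat_eqI) (simp add: e sum.distrib distrib_left)
  fix r s :: real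
  show "r *\<^sub>R (a + b) = r *\<^sub>R a + r *\<^sub>R b" by (intro fmat_eqI) (simp add: distrib_left)
  show "(r + s) *\<^sub>R a = r *\<^sub>R a + s *\<^sub>R a" by (intro fmat_eqI) (simp add: distrib_right)
  show "r *\<^sub>R s *\<^sub>R a = (r * s) *\<^sub>R a" by (intro fmat_eqI) simp
  show "1 *\<^sub>R a = a" by (intro fmat_eqI) simp
  have "supp (r *\<^sub>R a) \<subseteq> S" by (rule supp_subsetI) (auto simp: S_def ent_outside)
  then show "r *\<^sub>R a * b = r *\<^sub>R (a * b)"
    using S by (intro fmat_eqI) (simp add: e sum_distrib_left mult_ac)
  show "a * r *\<^sub>R b = r *\<^sub>R (a * b)"
    using S by (intro fmat_eqI) (simp add: e sum_distrib_left mult_ac)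
qed

end

section \<open>Trace, adjoint and coordinate projections\<close>

definition tr :: "'i fmat \<Rightarrow> complex" where
  "tr f = (\<Sum>i\<in>supp f. ent f i i)"

lemma tr_eq: "finite S \<Longrightarrow> supp f \<subseteq> S \<Longrightarrow> tr f = (\<Sum>i\<in>S. ent f i i)"
  unfolding tr_def by (intro sum.mono_neutral_left) (auto simp: ent_outside)

lemma tr_zero [simp]: "tr 0 = 0"
  by (simp add: tr_def)

lemma tr_add [simp]: "tr (f + g) = tr f + tr g"
proof -
  have "supp (f + g) \<subseteq> supp f \<union> supp g" by (rule supp_subsetI) (auto simp: ent_outside)
  then show ?thesis
    by (subst (1 2 3) tr_eq[of "supp f \<union> supp g"]) (auto simp: finite_supp sum.distrib)
qed

lemma tr_scaleR [simp]: "tr (c *\<^sub>R f) = complex_of_real c * tr f"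
proof -
  have "supp (c *\<^sub>R f) \<subseteq> supp f" by (rule supp_subsetI) (auto simp: ent_outside)
  then show ?thesis
    by (subst (1 2) tr_eq[of "supp f"]) (auto simp: finite_supp sum_distrib_left)
qed

lemma tr_uminus [simp]: "tr (- f) = - tr f"
  using tr_scaleR[of "-1" f] by simp

lemma tr_diff [simp]: "tr (f - g) = tr f - tr g"
  unfolding diff_conv_add_uminus[of f g] by (simp only: tr_add tr_uminus) simp

lemma tr_sum: "tr (\<Sum>x\<in>X. f x) = (\<Sum>x\<in>X. tr (f x))"
  by (induction X rule: infinite_finite_induct) auto

lemma supp_times: "supp (f * g) \<subseteq> supp f \<union> supp g"
  by (rule supp_subsetI) (auto simp: ent_times_supp ent_outside)

lemma tr_times:
  assumes "finite S" "supp f \<subseteq> S" "supp g \<subseteq> S"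
  shows "tr (f * g) = (\<Sum>i\<in>S. \<Sum>j\<in>S. ent f i j * ent g j i)"
  using assms supp_times[of f g] by (subst tr_eq[of S]) (auto simp: ent_times)

lemma tr_commute: "tr (f * g) = tr (g * f)"
proof -
  let ?S = "supp f \<union> supp g"
  have "tr (f * g) = (\<Sum>i\<in>?S. \<Sum>j\<in>?S. ent f i j * ent g j i)"
    by (intro tr_times) (auto simp: finite_supp)
  also have "\<dots> = (\<Sum>j\<in>?S. \<Sum>i\<in>?S. ent g j i * ent f i j)"
    by (subst sum.swap) (simp add: mult.commute)
  also have "\<dots> = tr (g * f)"
    by (intro tr_times[symmetric]) (auto simp: finite_supp)
  finally show ?thesis .
qed

lift_definition adj :: "'i fmat \<Rightarrow> 'i fmat" is "\<lambda>f i j. cnj (f j i)"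
  by simp (metis (no_types))

lemma ent_adj [simp]: "ent (adj f) i j = cnj (ent f j i)" by transfer auto

lemma supp_adj [simp]: "supp (adj f) = supp f" by (auto simp: supp_def)

lemma adj_adj [simp]: "adj (adj f) = f" by (intro fmat_eqI) simp
lemma adj_zero [simp]: "adj 0 = 0" by (intro fmat_eqI) simp
lemma adj_add [simp]: "adj (f + g) = adj f + adj g" by (intro fmat_eqI) simp
lemma adj_diff [simp]: "adj (f - g) = adj f - adj g" by (intro fmat_eqI) simp
lemma adj_scaleR [simp]: "adj (c *\<^sub>R f) = c *\<^sub>R adj f" by (intro fmat_eqI) simp
lemma adj_sum: "adj (\<Sum>x\<in>X. f x) = (\<Sum>x\<in>X. adj (f x))"
  by (induction X rule: infinite_finite_induct) auto

lemma adj_times [simp]: "adj (f * g) = adj g * adj f"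
proof (rule fmat_eqI)
  fix i j
  let ?S = "supp f \<union> supp g"
  show "ent (adj (f * g)) i j = ent (adj g * adj f) i j"
    by (simp add: ent_times[of ?S] finite_supp mult.commute)
qed

lemma tr_adj: "tr (adj f) = cnj (tr f)"
  by (simp add: tr_def)

text \<open>Over an infinite index type the algebra has no unit; \<open>idm S\<close> acts as one on
  the matrices supported in \<open>S\<close>.\<close>

definition idm :: "'i set \<Rightarrow> 'i fmat" where
  "idm S = fmat_of S (\<lambda>i j. if i = j then 1 else 0)"

lemma ent_idm: "finite S \<Longrightarrow> ent (idm S) i j = (if i \<in> S \<and> i = j then 1 else 0)"
  by (auto simp: idm_def ent_fmat_of)

lemma supp_idm: "finite S \<Longrightarrow> supp (idm S) = S"
  by (auto simp: supp_def ent_idm)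

lemma idm_infinite: "infinite S \<Longrightarrow> idm S = 0"
  unfolding idm_def fmat_of_def zero_fmat_def by simp

lemma idm_times: "finite S \<Longrightarrow> supp f \<subseteq> S \<Longrightarrow> idm S * f = f"
proof (rule fmat_eqI)
  fix i j assume S: "finite S" "supp f \<subseteq> S"
  have "ent (idm S * f) i j = (\<Sum>k\<in>S. ent (idm S) i k * ent f k j)"
    using S by (simp add: ent_times[of S])
  also have "\<dots> = (\<Sum>k\<in>S. if i = k then ent f k j else 0)"
    using S by (intro sum.cong) (auto simp: ent_idm)
  also have "\<dots> = ent f i j"
    using S supp_subsetD[OF S(2), of i j] by simp
  finally show "ent (idm S * f) i j = ent f i j" .
qed

lemma adj_idm [simp]: "adj (idm S) = idm S"
  by (cases "finite S") (auto intro!: fmat_eqI simp: ent_idm idm_infinite)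

lemma times_idm: "finite S \<Longrightarrow> supp f \<subseteq> S \<Longrightarrow> f * idm S = f"
  using idm_times[of S "adj f"] by (metis adj_adj adj_idm adj_times supp_adj)

lemma tr_idm: "finite S \<Longrightarrow> tr (idm S) = of_nat (card S)"
  by (subst tr_eq[of S]) (auto simp: supp_idm ent_idm)


section \<open>Positive semidefinite matrices\<close>

text \<open>All finite index sets are tested so that a user may pick one; \<open>psdI\<close>
  reduces the test to a single set containing the support. As \<open>adj f = f\<close> makes the
  form real, taking the real part merely moves the inequality into the reals.\<close>

definition psd :: "'i fmat \<Rightarrow> bool" where
  "psd f \<longleftrightarrow> adj f = f \<and>
     (\<forall>S v. finite S \<longrightarrow> 0 \<le> Re (\<Sum>i\<in>S. \<Sum>j\<in>S. v i * ent f i j * cnj (v j)))"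

lemma psd_adj: "psd f \<Longrightarrow> adj f = f"
  by (simp add: psd_def)

lemma psdD: "psd f \<Longrightarrow> finite S \<Longrightarrow> 0 \<le> Re (\<Sum>i\<in>S. \<Sum>j\<in>S. v i * ent f i j * cnj (v j))"
  by (simp add: psd_def)

lemma psdI:
  assumes "adj f = f" "finite S" "supp f \<subseteq> S"
    and nonneg: "\<And>v. 0 \<le> Re (\<Sum>i\<in>S. \<Sum>j\<in>S. v i * ent f i j * cnj (v j))"
  shows "psd f"
  unfolding psd_def
proof (intro conjI allI impI)
  fix T :: "'a set" and v :: "'a \<Rightarrow> complex" assume T: "finite T"
  define v' where "v' i = (if i \<in> T then v i else 0)" for i
  have "(\<Sum>i\<in>T. \<Sum>j\<in>T. v i * ent f i j * cnj (v j))
      = (\<Sum>i\<in>T. \<Sum>j\<in>T. v' i * ent f i j * cnj (v' j))"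
    by (simp add: v'_def)
  also have "\<dots> = (\<Sum>i\<in>T. \<Sum>j\<in>T \<union> S. v' i * ent f i j * cnj (v' j))"
    using T assms(2) by (intro sum.cong refl sum.mono_neutral_left) (auto simp: v'_def)
  also have "\<dots> = (\<Sum>i\<in>T \<union> S. \<Sum>j\<in>T \<union> S. v' i * ent f i j * cnj (v' j))"
    using T assms(2) by (intro sum.mono_neutral_left) (auto simp: v'_def)
  also have "\<dots> = (\<Sum>i\<in>T \<union> S. \<Sum>j\<in>S. v' i * ent f i j * cnj (v' j))"
    using T assms(2) supp_subsetD[OF assms(3)]
    by (intro sum.cong refl sum.mono_neutral_right) auto
  also have "\<dots> = (\<Sum>i\<in>S. \<Sum>j\<in>S. v' i * ent f i j * cnj (v' j))"
    using T assms(2) supp_subsetD[OF assms(3)]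
    by (intro sum.mono_neutral_right) (auto intro!: sum.neutral)
  finally show "0 \<le> Re (\<Sum>i\<in>T. \<Sum>j\<in>T. v i * ent f i j * cnj (v j))"
    using nonneg by simp
qed (use assms in auto)

lemma psd_zero [simp]: "psd 0"
  by (simp add: psd_def)

lemma psd_add: "psd f \<Longrightarrow> psd g \<Longrightarrow> psd (f + g)"
  by (auto simp: psd_def distrib_left distrib_right sum.distrib)

lemma psd_sum: "(\<And>x. x \<in> X \<Longrightarrow> psd (f x)) \<Longrightarrow> psd (\<Sum>x\<in>X. f x)"
  by (induction X rule: infinite_finite_induct) (auto intro: psd_add)

lemma psd_scaleR: "psd f \<Longrightarrow> 0 \<le> c \<Longrightarrow> psd (c *\<^sub>R f)"
proof -
  assume f: "psd f" and c: "0 \<le> c"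
  have eq: "(\<Sum>i\<in>S. \<Sum>j\<in>S. v i * ent (c *\<^sub>R f) i j * cnj (v j))
     = of_real c * (\<Sum>i\<in>S. \<Sum>j\<in>S. v i * ent f i j * cnj (v j))" for S and v :: "'a \<Rightarrow> complex"
    by (simp add: sum_distrib_left mult_ac)
  show ?thesis
    unfolding psd_def eq using f c by (auto simp: psd_def simp del: Re_sum)
qed

text \<open>The trace is the sum, over the rows of \<open>w\<close>, of the quadratic form of
  \<open>f\<close> at that row.\<close>

lemma psd_form: "psd f \<Longrightarrow> 0 \<le> Re (tr (w * f * adj w))"
proof -
  assume f: "psd f"
  define S where "S = supp w \<union> supp f"
  have S: "finite S" "supp w \<subseteq> S" "supp f \<subseteq> S" by (auto simp: S_def finite_supp)
  have wf: "supp (w * f) \<subseteq> S" using supp_times[of w f] by (auto simp: S_def)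
  have "tr (w * f * adj w) = (\<Sum>i\<in>S. \<Sum>k\<in>S. (\<Sum>j\<in>S. ent w i j * ent f j k) * cnj (ent w i k))"
    using S wf by (subst tr_times[of S]) (auto simp: ent_times[of S])
  also have "\<dots> = (\<Sum>i\<in>S. \<Sum>j\<in>S. \<Sum>k\<in>S. ent w i j * ent f j k * cnj (ent w i k))"
    unfolding sum_distrib_right by (intro sum.cong refl sum.swap)
  also have "Re \<dots> = (\<Sum>i\<in>S. Re (\<Sum>j\<in>S. \<Sum>k\<in>S. ent w i j * ent f j k * cnj (ent w i k)))"
    by (rule Re_sum)
  also have "\<dots> \<ge> 0"
    by (intro sum_nonneg psdD[OF f S(1)])
  finally show ?thesis .
qed

lemma psd_tr: "psd f \<Longrightarrow> 0 \<le> Re (tr f)"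
  using psd_form[of f "idm (supp f)"] by (simp add: idm_times times_idm finite_supp)

lemma sum_swap4:
  "(\<Sum>i\<in>I. \<Sum>j\<in>J. \<Sum>k\<in>K. \<Sum>l\<in>L. F i j k l) = (\<Sum>k\<in>K. \<Sum>l\<in>L. \<Sum>i\<in>I. \<Sum>j\<in>J. F i j k l)"
proof -
  have "(\<Sum>i\<in>I. \<Sum>j\<in>J. \<Sum>k\<in>K. \<Sum>l\<in>L. F i j k l) = (\<Sum>i\<in>I. \<Sum>k\<in>K. \<Sum>j\<in>J. \<Sum>l\<in>L. F i j k l)"
    by (intro sum.cong refl sum.swap)
  also have "\<dots> = (\<Sum>k\<in>K. \<Sum>i\<in>I. \<Sum>j\<in>J. \<Sum>l\<in>L. F i j k l)"
    by (rule sum.swap)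
  also have "\<dots> = (\<Sum>k\<in>K. \<Sum>i\<in>I. \<Sum>l\<in>L. \<Sum>j\<in>J. F i j k l)"
    by (intro sum.cong refl sum.swap)
  also have "\<dots> = (\<Sum>k\<in>K. \<Sum>l\<in>L. \<Sum>i\<in>I. \<Sum>j\<in>J. F i j k l)"
    by (intro sum.cong refl sum.swap)
  finally show ?thesis .
qed

lemma psd_conj: assumes f: "psd f" shows "psd (w * f * adj w)"
proof (rule psdI)
  define S where "S = supp w \<union> supp f"
  have S: "finite S" "supp w \<subseteq> S" "supp f \<subseteq> S" by (auto simp: S_def finite_supp)
  have wf: "supp (w * f) \<subseteq> S" using supp_times[of w f] by (auto simp: S_def)
  show "adj (w * f * adj w) = w * f * adj w"
    using f by (simp add: psd_adj mult.assoc)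
  show "finite S" by fact
  show "supp (w * f * adj w) \<subseteq> S"
    using supp_times[of "w * f" "adj w"] wf S by auto
  fix v :: "'a \<Rightarrow> complex"
  define F where "F i j k l = v i * ent w i l * ent f l k * cnj (v j * ent w j k)" for i j k l
  have "(\<Sum>i\<in>S. \<Sum>j\<in>S. v i * ent (w * f * adj w) i j * cnj (v j))
    = (\<Sum>i\<in>S. \<Sum>j\<in>S. \<Sum>l\<in>S. \<Sum>k\<in>S. F i j k l)"
    using S wf by (simp add: F_def ent_times[of S] sum_distrib_left sum_distrib_right mult_ac)
  also have "\<dots> = (\<Sum>l\<in>S. \<Sum>k\<in>S. \<Sum>i\<in>S. \<Sum>j\<in>S. F i j k l)"
    by (rule sum_swap4)
  also have "\<dots> = (\<Sum>k\<in>S. \<Sum>l\<in>S. (\<Sum>i\<in>S. v i * ent w i k) * ent f k l * cnj (\<Sum>j\<in>S. v j * ent w j l))"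
    by (simp add: F_def sum_distrib_left sum_distrib_right mult_ac)
  finally show "0 \<le> Re (\<Sum>i\<in>S. \<Sum>j\<in>S. v i * ent (w * f * adj w) i j * cnj (v j))"
    using psdD[OF f S(1), of "\<lambda>k. \<Sum>i\<in>S. v i * ent w i k"] by simp
qed

lemma psd_idm [simp]: "psd (idm S)"
proof (cases "finite S")
  case True
  then show ?thesis
    by (intro psdI[of _ S]) (auto simp: supp_idm ent_idm if_distrib[of "\<lambda>x. _ * x"]
        if_distrib[of "\<lambda>x. x * _"] sum_nonneg complex_mult_cnj cong: if_cong)
next
  case False
  then show ?thesis by (simp add: idm_infinite)
qed

lemma psd_square: "psd (w * adj w)"
  using psd_conj[OF psd_idm, of w "supp w"] by (simp add: times_idm finite_supp)

section \<open>Cauchy--Schwarz and gentle measurement\<close>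

text \<open>The discriminant bound for a polynomial in \<open>t\<close> that is nonnegative
  everywhere; a negative \<open>c\<close> is refuted by a large \<open>t\<close>.\<close>

lemma nonneg_quadratic:
  fixes a b c :: real
  assumes nonneg: "\<And>t. 0 \<le> a + 2 * t * b + t\<^sup>2 * c"
  shows "b \<le> sqrt a * sqrt c"
proof -
  have a: "0 \<le> a" using nonneg[of 0] by simp
  have "b\<^sup>2 \<le> a * c"
  proof (cases "c = 0")
    case True
    have "b = 0"
    proof (rule ccontr)
      assume "b \<noteq> 0"
      then have "a + 2 * (- (a + 1) / (2 * b)) * b + (- (a + 1) / (2 * b))\<^sup>2 * c = -1"
        using True by (simp add: field_simps)
      then show False using nonneg[of "- (a + 1) / (2 * b)"] by simp
    qed
    then show ?thesis using True by simp
  next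
    case False
    have c: "0 < c"
    proof (rule ccontr)
      assume "\<not> 0 < c"
      then have c: "c < 0" using False by simp
      \<comment> \<open>Chosen so that \<open>a + 2 * \<bar>b\<bar> + t * c\<close> equals
        \<open>c - 1\<close>, which is negative.\<close>
      define t where "t = (\<bar>b\<bar> * 2 + a + 1) / (- c) + 1"
      have t: "1 \<le> t" using a c by (simp add: t_def divide_nonneg_neg field_simps)
      have "a + 2 * t * b + t\<^sup>2 * c \<le> a * t + 2 * t * \<bar>b\<bar> + t * t * c"
      proof -
        have "t * b \<le> t * \<bar>b\<bar>" using t by (intro mult_left_mono) auto
        moreover have "a * 1 \<le> a * t" using t a by (intro mult_left_mono) auto
        ultimately show ?thesis by (simp add: power2_eq_square)
      qed
      also have "\<dots> = t * (a + 2 * \<bar>b\<bar> + t * c)" by (simp add: algebra_simps)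
      also have "a + 2 * \<bar>b\<bar> + t * c = c - 1" using c by (simp add: t_def field_simps)
      finally have "a + 2 * t * b + t\<^sup>2 * c \<le> t * (c - 1)" .
      moreover have "t * (c - 1) < 0" using t c by (intro mult_pos_neg) auto
      ultimately show False using nonneg[of t] by simp
    qed
    \<comment> \<open>Evaluation at the minimiser \<open>- b / c\<close>.\<close>
    have "0 \<le> c * (a + 2 * (- b / c) * b + (- b / c)\<^sup>2 * c)"
      using nonneg[of "- b / c"] c by simp
    also have "\<dots> = a * c - b\<^sup>2" using c by (simp add: field_simps power2_eq_square)
    finally show ?thesis by simp
  qed
  then have "sqrt (b\<^sup>2) \<le> sqrt (a * c)" by (rule real_sqrt_le_mono)
  then show ?thesis by (simp add: real_sqrt_mult)
qed

lemma sum_sqrt_mult_le: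
  assumes "\<And>x. x \<in> X \<Longrightarrow> 0 \<le> f x" "\<And>x. x \<in> X \<Longrightarrow> 0 \<le> g x"
  shows "(\<Sum>x\<in>X. sqrt (f x) * sqrt (g x)) \<le> sqrt (\<Sum>x\<in>X. f x) * sqrt (\<Sum>x\<in>X. g x)"
proof (rule nonneg_quadratic)
  fix t :: real
  have "0 \<le> (\<Sum>x\<in>X. (sqrt (f x) + t * sqrt (g x))\<^sup>2)" by (intro sum_nonneg) auto
  also have "\<dots> = (\<Sum>x\<in>X. f x + 2 * t * (sqrt (f x) * sqrt (g x)) + t\<^sup>2 * g x)"
    using assms by (intro sum.cong) (auto simp: power2_sum power_mult_distrib)
  finally show "0 \<le> sum f X + 2 * t * (\<Sum>x\<in>X. sqrt (f x) * sqrt (g x)) + t\<^sup>2 * sum g X"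
    by (simp add: sum.distrib sum_distrib_left)
qed

text \<open>The trace of \<open>X * f * adj Y\<close> is a positive semidefinite inner product of
  \<open>X\<close> and \<open>Y\<close> with weight \<open>f\<close>; expanding its square at
  \<open>X + t *\<^sub>R Y\<close> gives the quadratic polynomial to which
  \<open>nonneg_quadratic\<close> applies.\<close>

lemma psd_Cauchy_Schwarz:
  assumes "psd f"
  shows "Re (tr (X * f * adj Y)) \<le> sqrt (Re (tr (X * f * adj X))) * sqrt (Re (tr (Y * f * adj Y)))"
proof (rule nonneg_quadratic)
  fix t :: real
  have "Re (tr (Y * f * adj X)) = Re (tr (X * f * adj Y))"
    using tr_adj[of "Y * f * adj X"] psd_adj[OF assms] by (simp add: mult.assoc)
  then show "0 \<le> Re (tr (X * f * adj X)) + 2 * t * Re (tr (X * f * adj Y)) + t\<^sup>2 * Re (tr (Y * f * adj Y))"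
    using psd_form[OF assms, of "X + t *\<^sub>R Y"]
    by (simp add: algebra_simps power2_eq_square)
qed

text \<open>Equivalently, \<open>K\<^sup>* K \<le> 1\<close>.\<close>

definition contr :: "'i fmat \<Rightarrow> bool" where
  "contr K \<longleftrightarrow> (\<forall>f. psd f \<longrightarrow> Re (tr (K * f * adj K)) \<le> Re (tr f))"

lemma contr_uminus: "contr K \<Longrightarrow> contr (- K)"
proof -
  have "adj (- K) = - adj K" by (intro fmat_eqI) simp
  then show "contr K \<Longrightarrow> contr (- K)" by (simp add: contr_def)
qed

text \<open>Cauchy-Schwarz with weight \<open>f\<close>, against the identity on the support of
  \<open>f\<close>.\<close>

lemma contr_tr_le:
  assumes "contr K" "psd f"
  shows "Re (tr (K * f)) \<le> Re (tr f)"
proof -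
  let ?I = "idm (supp f)"
  have "Re (tr (K * f)) = Re (tr (K * f * adj ?I))"
    by (simp add: mult.assoc times_idm)
  also have "\<dots> \<le> sqrt (Re (tr (K * f * adj K))) * sqrt (Re (tr (?I * f * adj ?I)))"
    by (rule psd_Cauchy_Schwarz) fact
  also have "\<dots> \<le> sqrt (Re (tr f)) * sqrt (Re (tr f))"
    using assms by (intro mult_mono) (auto simp: contr_def idm_times times_idm intro: psd_form psd_tr)
  finally show ?thesis using psd_tr[OF assms(2)] by simp
qed

text \<open>With \<open>X = I - H\<close> the difference is
  \<open>X * f + f * adj X - X * f * adj X\<close>. Cauchy-Schwarz bounds each of the first two
  terms by the square root of \<open>q\<close> times that of the trace of \<open>f\<close>, and the
  contraction property bounds the third by \<open>q\<close>. Letting \<open>K\<close> range over all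
  contractions takes the place of a trace norm.\<close>

lemma gentle:
  fixes f H I K :: "'i fmat"
  assumes K: "contr K" and f: "psd f" and I: "I * f = f" "adj I = I"
  defines "q \<equiv> Re (tr ((I - H) * f * adj (I - H)))"
  shows "Re (tr (K * (f - H * f * adj H))) \<le> 2 * (sqrt q * sqrt (Re (tr f))) + q"
proof -
  define X where "X = I - H"
  have H: "H = I - X" by (simp add: X_def)
  have fI: "f * I = f" using arg_cong[OF I(1), of adj] I(2) psd_adj[OF f] by simp
  have q: "q = Re (tr (X * f * adj X))" by (simp add: q_def X_def)
  have q0: "0 \<le> q" unfolding q by (rule psd_form) fact
  have t0: "0 \<le> Re (tr f)" by (rule psd_tr) fact
  have I': "I * (f * g) = f * g" for g by (simp add: I flip: mult.assoc)
  have split: "f - H * f * adj H = X * f + f * adj X - X * f * adj X"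
    unfolding H by (simp add: algebra_simps I I' fI)
  have eq: "Re (tr (K * (f - H * f * adj H)))
      = Re (tr (K * X * f)) + Re (tr (K * f * adj X)) + Re (tr (- K * (X * f * adj X)))"
    unfolding split by (simp add: algebra_simps)
  have Kf: "sqrt (Re (tr (K * f * adj K))) \<le> sqrt (Re (tr f))"
    using K f by (simp add: contr_def)
  have "Re (tr (K * X * f)) = Re (tr (K * X * f * adj I))"
    by (simp add: I fI mult.assoc)
  also have "\<dots> \<le> sqrt (Re (tr (K * X * f * adj (K * X)))) * sqrt (Re (tr (I * f * adj I)))"
    by (rule psd_Cauchy_Schwarz) fact
  also have "I * f * adj I = f" by (simp add: I fI)
  also have "Re (tr (K * X * f * adj (K * X))) = Re (tr (K * (X * f * adj X) * adj K))"
    by (simp add: mult.assoc)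
  also have "sqrt \<dots> * sqrt (Re (tr f)) \<le> sqrt q * sqrt (Re (tr f))"
    using K psd_conj[OF f, of X] t0 by (intro mult_right_mono) (auto simp: contr_def q)
  finally have 1: "Re (tr (K * X * f)) \<le> sqrt q * sqrt (Re (tr f))" .
  have "Re (tr (K * f * adj X)) \<le> sqrt (Re (tr (K * f * adj K))) * sqrt q"
    unfolding q by (rule psd_Cauchy_Schwarz) fact
  also have "\<dots> \<le> sqrt (Re (tr f)) * sqrt q"
    using Kf q0 by (intro mult_right_mono) auto
  finally have 2: "Re (tr (K * f * adj X)) \<le> sqrt q * sqrt (Re (tr f))" by (simp add: mult.commute)
  have 3: "Re (tr (- K * (X * f * adj X))) \<le> q"
    unfolding q by (intro contr_tr_le contr_uminus K psd_conj f)
  show ?thesis unfolding eq using 1 2 3 by simp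
qed

text \<open>
  For invertible \<open>\<sigma>\<close> with \<open>Z = \<sigma>\<^sup>-\<^sup>1\<close> this is \<open>f \<sigma>\<^sup>-\<^sup>1 f \<le> c f\<close> whenever \<open>f \<le> c \<sigma>\<close>. It follows from writing
  the difference as a sum of two conjugates of positive matrices, so that no square roots
  are needed.
\<close>

lemma psd_inverse_bound:
  assumes f: "psd f" and le: "psd (c *\<^sub>R \<sigma> - f)" and Z: "adj Z = Z" "Z * \<sigma> * Z = Z" and c: "c > 0"
  shows "psd (c *\<^sub>R f - f * Z * f)"
proof -
  define I where "I = idm (supp f)"
  have I: "I * f = f" "f * I = f" "adj I = I"
    by (simp_all add: I_def idm_times times_idm)
  define w where "w = I - (1 / c) *\<^sub>R (f * Z)"
  define u where "u = (1 / c) *\<^sub>R (f * Z)"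
  have Z': "Z * (\<sigma> * (Z * g)) = Z * g" for g
    by (metis Z(2) mult.assoc)
  define x where "x = f * (Z * f)"
  define y where "y = f * (Z * (f * (Z * f)))"
  have I': "I * (f * g) = f * g" for g by (simp add: I flip: mult.assoc)
  have two: "(2 / c) *\<^sub>R x = (1 / c) *\<^sub>R x + (1 / c) *\<^sub>R x"
    by (simp flip: scaleR_add_left)
  have 1: "w * f * adj w = f - (2 / c) *\<^sub>R x + (1 / c\<^sup>2) *\<^sub>R y"
    unfolding w_def two unfolding x_def y_def
    by (simp add: algebra_simps I I' psd_adj[OF f] Z(1) power2_eq_square)
  have 2: "u * (c *\<^sub>R \<sigma> - f) * adj u = (1 / c) *\<^sub>R x - (1 / c\<^sup>2) *\<^sub>R y"
    unfolding u_def x_def y_def using c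
    by (simp add: algebra_simps psd_adj[OF f] Z(1) Z' power2_eq_square)
  have "c *\<^sub>R (w * f * adj w + u * (c *\<^sub>R \<sigma> - f) * adj u) = c *\<^sub>R f - f * Z * f"
    unfolding 1 2 two using c by (simp add: algebra_simps flip: x_def)
  then show ?thesis
    using psd_scaleR[OF psd_add[OF psd_conj[OF f, of w] psd_conj[OF le, of u]], of c] c by simp
qed


section \<open>Bipartite matrices\<close>

text \<open>This is the tensor product of \<open>f\<close> with the projection onto the coordinates
  in \<open>T\<close>. With the subset as an argument the same operator covers the identity, the
  typical projection and a single coordinate.\<close>

definition emb :: "'s set \<Rightarrow> 'e fmat \<Rightarrow> ('e \<times> 's) fmat" where
  "emb T f = fmat_of (supp f \<times> T) (\<lambda>p q. if snd p = snd q then ent f (fst p) (fst q) else 0)"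

text \<open>The partial trace over the second factor after compression to the coordinates in
  \<open>T\<close>.\<close>

definition ptr :: "'s set \<Rightarrow> ('e \<times> 's) fmat \<Rightarrow> 'e fmat" where
  "ptr T h = fmat_of (fst ` supp h) (\<lambda>m m'. \<Sum>s\<in>T. ent h (m, s) (m', s))"

lemma sum_Times: "(\<Sum>p\<in>A \<times> B. F p) = (\<Sum>a\<in>A. \<Sum>b\<in>B. F (a, b))"
  by (simp add: sum.cartesian_product split_def)

lemma ent_emb: "finite T \<Longrightarrow>
  ent (emb T f) p q = (if snd p = snd q \<and> snd p \<in> T then ent f (fst p) (fst q) else 0)"
  unfolding emb_def by (subst ent_fmat_of) (auto simp: mem_Times_iff ent_outside)

lemma supp_emb: "finite T \<Longrightarrow> supp (emb T f) \<subseteq> supp f \<times> T"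
  unfolding emb_def by (intro supp_fmat_of) auto

lemma ent_ptr: "ent (ptr T h) m m' = (\<Sum>s\<in>T. ent h (m, s) (m', s))"
proof -
  have "(\<Sum>s\<in>T. ent h (m, s) (m', s)) = 0" if "m \<notin> fst ` supp h \<or> m' \<notin> fst ` supp h"
    using that by (intro sum.neutral ballI ent_outside) force
  then show ?thesis unfolding ptr_def by (subst ent_fmat_of) auto
qed

lemma emb_add: "finite T \<Longrightarrow> emb T (f + g) = emb T f + emb T g"
  by (intro fmat_eqI) (auto simp: ent_emb)

lemma emb_diff: "finite T \<Longrightarrow> emb T (f - g) = emb T f - emb T g"
  by (intro fmat_eqI) (auto simp: ent_emb)

lemma emb_adj: "finite T \<Longrightarrow> adj (emb T f) = emb T (adj f)"
  by (intro fmat_eqI) (auto simp: ent_emb)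

lemma emb_empty [simp]: "emb {} f = 0"
  by (intro fmat_eqI) (auto simp: ent_emb)

lemma emb_union: "finite T \<Longrightarrow> finite U \<Longrightarrow> T \<inter> U = {} \<Longrightarrow> emb (T \<union> U) f = emb T f + emb U f"
  by (intro fmat_eqI) (auto simp: ent_emb)

lemma emb_sum_singleton: "finite T \<Longrightarrow> emb T f = (\<Sum>s\<in>T. emb {s} f)"
proof (induction T rule: finite_induct)
  case (insert s T)
  then show ?case using emb_union[of "{s}" T f] by simp
qed simp

lemma emb_mult:
  assumes "finite T" "finite U"
  shows "emb T f * emb U g = emb (T \<inter> U) (f * g)"
proof (rule fmat_eqI)
  fix p q :: "'b \<times> 'a"
  obtain m s m' s' where pq: "p = (m, s)" "q = (m', s')" by (cases p, cases q)
  have "ent (emb T f * emb U g) p q = (\<Sum>r\<in>supp f \<times> T. ent (emb T f) p r * ent (emb U g) r q)"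
    using assms supp_emb[OF assms(1), of f] by (intro ent_times) auto
  also have "\<dots> = (\<Sum>k\<in>supp f. \<Sum>u\<in>T. ent (emb T f) p (k, u) * ent (emb U g) (k, u) q)"
    by (simp add: sum_Times)
  also have "\<dots> = (\<Sum>k\<in>supp f. \<Sum>u\<in>T. if u = s then if s \<in> T \<inter> U \<and> s = s' then ent f m k * ent g k m' else 0 else 0)"
    by (intro sum.cong refl) (auto simp: ent_emb assms pq)
  also have "\<dots> = ent (emb (T \<inter> U) (f * g)) p q"
    using assms by (auto simp: ent_emb pq ent_times_supp intro!: sum.neutral)
  finally show "ent (emb T f * emb U g) p q = ent (emb (T \<inter> U) (f * g)) p q" .
qed

text \<open>The duality that characterises the partial trace. It moves traces of conjugations by
  \<open>emb T f\<close> to the first factor, where the dimension of the second one is no longer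
  visible.\<close>

lemma tr_emb_times:
  assumes T: "finite T"
  shows "tr (emb T f * h) = tr (f * ptr T h)"
proof -
  define E where "E = supp f \<union> fst ` supp h"
  define S where "S = T \<union> snd ` supp h"
  have fin: "finite E" "finite S" using T by (auto simp: E_def S_def)
  have sub: "supp f \<subseteq> E" "supp h \<subseteq> E \<times> S" "T \<subseteq> S" by (force simp: E_def S_def)+
  have e: "supp (emb T f) \<subseteq> E \<times> S" using supp_emb[OF T, of f] sub by auto
  have p: "supp (ptr T h) \<subseteq> E"
    unfolding ptr_def using supp_fmat_of[of "fst ` supp h"] by (auto simp: E_def)
  have "tr (emb T f * h) = (\<Sum>p\<in>E \<times> S. \<Sum>q\<in>E \<times> S. ent (emb T f) p q * ent h q p)"
    using fin sub e by (intro tr_times) auto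
  also have "\<dots> = (\<Sum>m\<in>E. \<Sum>s\<in>S. \<Sum>m'\<in>E. \<Sum>s'\<in>S. ent (emb T f) (m, s) (m', s') * ent h (m', s') (m, s))"
    by (simp add: sum_Times)
  also have "\<dots> = (\<Sum>m\<in>E. \<Sum>s\<in>S. \<Sum>m'\<in>E. \<Sum>s'\<in>S. if s' = s then if s \<in> T then ent f m m' * ent h (m', s) (m, s) else 0 else 0)"
    by (intro sum.cong refl) (auto simp: ent_emb T)
  also have "\<dots> = (\<Sum>m\<in>E. \<Sum>s\<in>S. \<Sum>m'\<in>E. if s \<in> T then ent f m m' * ent h (m', s) (m, s) else 0)"
    using fin by (intro sum.cong refl) simp
  also have "\<dots> = (\<Sum>m\<in>E. \<Sum>m'\<in>E. \<Sum>s\<in>S. if s \<in> T then ent f m m' * ent h (m', s) (m, s) else 0)"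
    by (intro sum.cong refl sum.swap)
  also have "\<dots> = (\<Sum>m\<in>E. \<Sum>m'\<in>E. \<Sum>s\<in>T. ent f m m' * ent h (m', s) (m, s))"
    using fin sub by (intro sum.cong refl sum.mono_neutral_cong_right) auto
  also have "\<dots> = (\<Sum>m\<in>E. \<Sum>m'\<in>E. ent f m m' * ent (ptr T h) m' m)"
    by (simp add: ent_ptr sum_distrib_left)
  also have "\<dots> = tr (f * ptr T h)"
    using fin sub p by (intro tr_times[symmetric]) auto
  finally show ?thesis .
qed

lemma tr_emb: "finite T \<Longrightarrow> tr (emb T f) = of_nat (card T) * tr f"
proof -
  assume T: "finite T"
  have "tr (emb T f) = (\<Sum>p\<in>supp f \<times> T. ent (emb T f) p p)"
    using T by (intro tr_eq supp_emb) auto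
  also have "\<dots> = (\<Sum>m\<in>supp f. \<Sum>s\<in>T. ent f m m)"
    using T by (simp add: sum_Times ent_emb)
  finally show ?thesis by (simp add: tr_def sum_distrib_left)
qed

lemma psd_emb: assumes "finite T" "psd f" shows "psd (emb T f)"
proof (rule psdI)
  show "supp (emb T f) \<subseteq> supp f \<times> T" by (rule supp_emb) fact
  show "adj (emb T f) = emb T f" using assms by (simp add: emb_adj psd_adj)
  show "finite (supp f \<times> T)" using assms by simp
  fix v :: "'b \<times> 'a \<Rightarrow> complex"
  have "(\<Sum>p\<in>supp f \<times> T. \<Sum>q\<in>supp f \<times> T. v p * ent (emb T f) p q * cnj (v q))
    = (\<Sum>m\<in>supp f. \<Sum>s\<in>T. \<Sum>m'\<in>supp f. \<Sum>s'\<in>T. v (m, s) * ent (emb T f) (m, s) (m', s') * cnj (v (m', s')))"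
    by (simp add: sum_Times)
  also have "\<dots> = (\<Sum>m\<in>supp f. \<Sum>s\<in>T. \<Sum>m'\<in>supp f. \<Sum>s'\<in>T. if s' = s then v (m, s) * ent f m m' * cnj (v (m', s)) else 0)"
    using assms by (intro sum.cong refl) (auto simp: ent_emb)
  also have "\<dots> = (\<Sum>m\<in>supp f. \<Sum>s\<in>T. \<Sum>m'\<in>supp f. v (m, s) * ent f m m' * cnj (v (m', s)))"
    using assms by (intro sum.cong refl) simp
  also have "\<dots> = (\<Sum>s\<in>T. \<Sum>m\<in>supp f. \<Sum>m'\<in>supp f. v (m, s) * ent f m m' * cnj (v (m', s)))"
    by (rule sum.swap)
  also have "Re \<dots> = (\<Sum>s\<in>T. Re (\<Sum>m\<in>supp f. \<Sum>m'\<in>supp f. v (m, s) * ent f m m' * cnj (v (m', s))))"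
    by (rule Re_sum)
  also have "\<dots> \<ge> 0"
    using assms by (intro sum_nonneg psdD[of f "supp f" "\<lambda>m. v (m, _)"]) auto
  finally show "0 \<le> Re (\<Sum>p\<in>supp f \<times> T. \<Sum>q\<in>supp f \<times> T. v p * ent (emb T f) p q * cnj (v q))" .
qed

lemma psd_ptr: assumes "psd h" shows "psd (ptr T h)"
  unfolding psd_def
proof (intro conjI allI impI)
  show "adj (ptr T h) = ptr T h"
    using psd_adj[OF assms] by (intro fmat_eqI) (metis (mono_tags, lifting) ent_adj ent_ptr cnj_sum sum.cong)
  fix S and v :: "'a \<Rightarrow> complex" assume S: "finite (S :: 'a set)"
  show "0 \<le> Re (\<Sum>i\<in>S. \<Sum>j\<in>S. v i * ent (ptr T h) i j * cnj (v j))"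
  proof (cases "finite T")
    case T: True
    have "(\<Sum>i\<in>S. \<Sum>j\<in>S. v i * ent (ptr T h) i j * cnj (v j))
      = (\<Sum>i\<in>S. \<Sum>j\<in>S. \<Sum>s\<in>T. v i * ent h (i, s) (j, s) * cnj (v j))"
      by (simp add: ent_ptr sum_distrib_left sum_distrib_right)
    also have "\<dots> = (\<Sum>i\<in>S. \<Sum>s\<in>T. \<Sum>j\<in>S. v i * ent h (i, s) (j, s) * cnj (v j))"
      by (intro sum.cong refl sum.swap)
    also have "\<dots> = (\<Sum>s\<in>T. \<Sum>i\<in>S. \<Sum>j\<in>S. v i * ent h (i, s) (j, s) * cnj (v j))"
      by (rule sum.swap)
    also have "Re \<dots> = (\<Sum>s\<in>T. Re (\<Sum>i\<in>S. \<Sum>j\<in>S. v i * ent h (i, s) (j, s) * cnj (v j)))"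
      by (rule Re_sum)
    also have "\<dots> \<ge> 0"
    proof (rule sum_nonneg)
      fix s assume "s \<in> T"
      have "(\<Sum>p\<in>S \<times> {s}. \<Sum>q\<in>S \<times> {s}. v (fst p) * ent h p q * cnj (v (fst q)))
        = (\<Sum>i\<in>S. \<Sum>j\<in>S. v i * ent h (i, s) (j, s) * cnj (v j))"
        by (simp add: sum_Times)
      then show "0 \<le> Re (\<Sum>i\<in>S. \<Sum>j\<in>S. v i * ent h (i, s) (j, s) * cnj (v j))"
        using psdD[OF assms, of "S \<times> {s}" "\<lambda>p. v (fst p)"] S by simp
    qed
    finally show ?thesis .
  qed (simp add: ent_ptr)
qed

lemma ptr_union: "finite T \<Longrightarrow> finite U \<Longrightarrow> T \<inter> U = {} \<Longrightarrow> ptr (T \<union> U) h = ptr T h + ptr U h"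
  by (intro fmat_eqI) (simp add: ent_ptr sum.union_disjoint)

lemma supp_ptr: "supp h \<subseteq> E \<times> S \<Longrightarrow> supp (ptr T h) \<subseteq> E"
  by (rule supp_subsetI) (auto simp: ent_ptr intro!: sum.neutral ent_outside)

section \<open>Pinching\<close>

lemma sum_indicator_mult:
  fixes f :: "'a \<Rightarrow> complex"
  assumes "finite A"
  shows "(\<Sum>a\<in>A. (if x = a then 1 else 0) * f a) = (if x \<in> A then f x else 0)"
    and "(\<Sum>a\<in>A. f a * (if a = x then 1 else 0)) = (if x \<in> A then f x else 0)"
proof -
  have "(\<Sum>a\<in>A. (if x = a then 1 else 0) * f a) = (\<Sum>a\<in>A. if x = a then f a else 0)"
    "(\<Sum>a\<in>A. f a * (if a = x then 1 else 0)) = (\<Sum>a\<in>A. if a = x then f a else 0)"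
    by (auto intro!: sum.cong)
  then show "(\<Sum>a\<in>A. (if x = a then 1 else 0) * f a) = (if x \<in> A then f x else 0)"
    "(\<Sum>a\<in>A. f a * (if a = x then 1 else 0)) = (if x \<in> A then f x else 0)"
    using assms by simp_all
qed

text \<open>The second system is classical in the coordinate basis.\<close>

definition diag_snd :: "('e \<times> 's) fmat \<Rightarrow> bool" where
  "diag_snd h \<longleftrightarrow> (\<forall>m s m' s'. s \<noteq> s' \<longrightarrow> ent h (m, s) (m', s') = 0)"

lemma pinch_singleton:
  assumes "finite E" "supp h \<subseteq> E \<times> S"
  shows "emb {s} (idm E) * h * emb {s} (idm E) = emb {s} (ptr {s} h)"
proof (rule fmat_eqI)
  fix p q :: "'a \<times> 'b"
  obtain m t m' t' where pq: "p = (m, t)" "q = (m', t')" by (cases p, cases q)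
  have sub: "supp (emb {s} (idm E)) \<subseteq> E \<times> {s}"
    using supp_emb[of "{s}" "idm E"] assms by (simp add: supp_idm)
  have h0: "ent h (k, u) (k', u') = 0" if "k \<notin> E \<or> k' \<notin> E" for k u k' u'
    using that by (intro supp_subsetD[OF assms(2)]) auto
  have l: "ent (emb {s} (idm E) * g) (m, t) r = (if t = s \<and> m \<in> E then ent g (m, s) r else 0)" for g m t r
    using assms sub by (subst ent_times[of "E \<times> {s}"]) (auto simp: sum_Times ent_emb ent_idm sum_indicator_mult)
  have r: "ent (g * emb {s} (idm E)) r (m, t) = (if t = s \<and> m \<in> E then ent g r (m, s) else 0)" for g m t r
  proof (cases "m \<in> E")
    case True
    then show ?thesis
      using assms sub by (subst ent_times[of "E \<times> {s}"]) (auto simp: sum_Times ent_emb ent_idm sum_indicator_mult)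
  next
    case False
    then show ?thesis
      using assms sub by (subst ent_times[of "E \<times> {s}"])
        (auto simp: sum_Times ent_emb ent_idm intro!: sum.neutral)
  qed
  show "ent (emb {s} (idm E) * h * emb {s} (idm E)) p q = ent (emb {s} (ptr {s} h)) p q"
    unfolding pq l r by (auto simp: l r ent_emb ent_ptr h0)
qed

text \<open>The diagonal block at \<open>s\<close> is one of the positive summands of
  \<open>ptr T h\<close>, so the difference is made of the remaining ones.\<close>

lemma pinch_singleton_le:
  assumes "finite E" "supp h \<subseteq> E \<times> S" "psd h" "finite T" "s \<in> T"
  shows "psd (emb {s} (ptr T h) - emb {s} (idm E) * h * emb {s} (idm E))"
proof -
  have "T = {s} \<union> (T - {s})" using assms by auto
  then have "ptr T h = ptr {s} h + ptr (T - {s}) h"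
    using ptr_union[of "{s}" "T - {s}" h] assms by simp
  then have "emb {s} (ptr T h) - emb {s} (idm E) * h * emb {s} (idm E) = emb {s} (ptr (T - {s}) h)"
    unfolding pinch_singleton[OF assms(1,2)] by (simp add: emb_add)
  then show ?thesis using assms by (simp add: psd_emb psd_ptr)
qed

text \<open>From \<open>\<Sum>\<^sub>s\<^sub>,\<^sub>t (P\<^sub>s - P\<^sub>t) h (P\<^sub>s - P\<^sub>t) \<ge> 0\<close>.\<close>

lemma pinching:
  assumes "finite E" "supp h \<subseteq> E \<times> S" "psd h" "finite T"
  shows "psd (real (card T) *\<^sub>R emb T (ptr T h) - emb T (idm E) * h * emb T (idm E))"
proof -
  define P where "P s = emb {s} (idm E)" for s :: 'b
  have adjP: "adj (P s) = P s" for s by (simp add: P_def emb_adj)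
  have sumP: "emb T (idm E) = (\<Sum>s\<in>T. P s)"
    unfolding P_def by (rule emb_sum_singleton) fact
  have e: "(P s - P t) * h * adj (P s - P t) = P s * h * P s + P t * h * P t - P s * h * P t - P t * h * P s" for s t
    by (simp add: adjP algebra_simps)
  have "(\<Sum>s\<in>T. \<Sum>t\<in>T. (P s - P t) * h * adj (P s - P t))
    = (\<Sum>s\<in>T. real (card T) *\<^sub>R (P s * h * P s)) + (\<Sum>s\<in>T. real (card T) *\<^sub>R (P s * h * P s))
      - (\<Sum>s\<in>T. \<Sum>t\<in>T. P s * h * P t) - (\<Sum>s\<in>T. \<Sum>t\<in>T. P t * h * P s)"
    unfolding e by (simp add: sum.distrib sum_subtractf sum_constant_scaleR scaleR_sum_right)
  also have "(\<Sum>s\<in>T. \<Sum>t\<in>T. P t * h * P s) = (\<Sum>s\<in>T. \<Sum>t\<in>T. P s * h * P t)"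
    by (rule sum.swap)
  also have "(\<Sum>s\<in>T. \<Sum>t\<in>T. P s * h * P t) = emb T (idm E) * h * emb T (idm E)"
    unfolding sumP by (simp add: sum_distrib_left sum_distrib_right) (rule sum.swap)
  finally have dbl: "(\<Sum>s\<in>T. \<Sum>t\<in>T. (P s - P t) * h * adj (P s - P t))
    = (\<Sum>s\<in>T. real (card T) *\<^sub>R (P s * h * P s)) + (\<Sum>s\<in>T. real (card T) *\<^sub>R (P s * h * P s))
      - emb T (idm E) * h * emb T (idm E) - emb T (idm E) * h * emb T (idm E)" .
  have half: "(1/2) *\<^sub>R (x + x - y - y) = x - y" for x y :: "('a \<times> 'b) fmat"
  proof -
    have "x + x - y - y = 2 *\<^sub>R (x - y)" by (simp add: scaleR_2)
    then show ?thesis by simp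
  qed
  have "(1/2) *\<^sub>R (\<Sum>s\<in>T. \<Sum>t\<in>T. (P s - P t) * h * adj (P s - P t))
    = (\<Sum>s\<in>T. real (card T) *\<^sub>R (P s * h * P s)) - emb T (idm E) * h * emb T (idm E)"
    unfolding dbl by (rule half)
  moreover have "psd ((1/2) *\<^sub>R (\<Sum>s\<in>T. \<Sum>t\<in>T. (P s - P t) * h * adj (P s - P t)))"
    using assms by (intro psd_scaleR psd_sum psd_conj) auto
  ultimately have 1: "psd ((\<Sum>s\<in>T. real (card T) *\<^sub>R (P s * h * P s)) - emb T (idm E) * h * emb T (idm E))"
    by simp
  \<comment> \<open>Enlarging every diagonal block to the whole marginal turns their sum into
    \<open>emb T (ptr T h)\<close>.\<close>
  have 2: "psd (\<Sum>s\<in>T. real (card T) *\<^sub>R (emb {s} (ptr T h) - P s * h * P s))"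
    unfolding P_def using assms by (intro psd_sum psd_scaleR pinch_singleton_le[where S = S]) auto
  have eq: "(\<Sum>s\<in>T. real (card T) *\<^sub>R (P s * h * P s)) - emb T (idm E) * h * emb T (idm E)
    + (\<Sum>s\<in>T. real (card T) *\<^sub>R (emb {s} (ptr T h) - P s * h * P s))
    = real (card T) *\<^sub>R emb T (ptr T h) - emb T (idm E) * h * emb T (idm E)"
    unfolding emb_sum_singleton[OF assms(4), of "ptr T h"]
    by (simp add: scaleR_diff_right sum_subtractf scaleR_sum_right)
  show ?thesis using psd_add[OF 1 2] unfolding eq .
qed

text \<open>Here the compression is already the sum of its diagonal blocks, so the factor
  \<open>card T\<close> of \<open>pinching\<close> does not arise. The explicit
  \<open>1 *\<^sub>R\<close> gives both bounds the same shape, with a constant that later proofs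
  call \<open>c\<close>.\<close>

lemma pinching_diag:
  assumes "finite E" "supp h \<subseteq> E \<times> S" "psd h" "finite T" "diag_snd h"
  shows "psd (1 *\<^sub>R emb T (ptr T h) - emb T (idm E) * h * emb T (idm E))"
proof -
  define P where "P s = emb {s} (idm E)" for s :: 'b
  have sumP: "emb T (idm E) = (\<Sum>s\<in>T. P s)"
    unfolding P_def by (rule emb_sum_singleton) fact
  have sub: "supp (P s) \<subseteq> E \<times> {s}" for s
    unfolding P_def using supp_emb[of "{s}" "idm E"] assms by (simp add: supp_idm)
  have off: "P s * h * P t = 0" if "s \<noteq> t" for s t
  proof (rule fmat_eqI)
    fix p q
    have hP: "ent (h * P t) (k, s) q = 0" for k
      using assms sub that
      by (subst ent_times[of "E \<times> {t}"]) (auto simp: sum_Times diag_snd_def intro!: sum.neutral)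
    have "ent (P s * (h * P t)) p q = 0"
      using assms sub by (subst ent_times[of "E \<times> {s}"]) (auto simp: sum_Times hP)
    then show "ent (P s * h * P t) p q = ent 0 p q" by (simp add: mult.assoc)
  qed
  have "emb T (idm E) * h * emb T (idm E) = (\<Sum>s\<in>T. \<Sum>t\<in>T. P s * h * P t)"
    unfolding sumP by (simp add: sum_distrib_left sum_distrib_right) (rule sum.swap)
  also have "\<dots> = (\<Sum>s\<in>T. \<Sum>t\<in>T. if s = t then P s * h * P s else 0)"
    by (intro sum.cong refl) (auto simp: off)
  also have "\<dots> = (\<Sum>s\<in>T. P s * h * P s)"
    using assms by simp
  finally have "1 *\<^sub>R emb T (ptr T h) - emb T (idm E) * h * emb T (idm E)
      = (\<Sum>s\<in>T. emb {s} (ptr T h) - P s * h * P s)"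
    unfolding emb_sum_singleton[OF assms(4), of "ptr T h"] by (simp add: sum_subtractf)
  then show ?thesis
    unfolding P_def using assms by (auto intro!: psd_sum pinch_singleton_le[where S = S])
qed


section \<open>Smoothing\<close>

text \<open>A two-sided inverse on the coordinate subspace \<open>E\<close>, with
  \<open>idm E\<close> in place of a unit.\<close>

definition inv_on :: "'i set \<Rightarrow> 'i fmat \<Rightarrow> 'i fmat \<Rightarrow> bool" where
  "inv_on E f N \<longleftrightarrow> adj N = N \<and> supp N \<subseteq> E \<and> f * N = idm E \<and> N * f = idm E"

text \<open>
  If the marginal of \<open>h\<close> is at most \<open>A + D\<close>, then conjugation by \<open>A (A + D)\<^sup>-\<^sup>1\<close> brings it below \<open>A\<close>,
  at a cost controlled by the trace of \<open>D\<close>. The conjugation acts on the first factor only, so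
  that its cost does not depend on the dimension of the second one.
\<close>

lemma smoothing:
  fixes h :: "('e \<times> 's) fmat"
  assumes E: "finite E" and S: "finite S" and T: "T \<subseteq> S" and h: "psd h" "supp h \<subseteq> E \<times> S"
    and A: "psd A" "supp A \<subseteq> E" and D: "psd D" "supp D \<subseteq> E"
    and N: "inv_on E (A + D) N"
    and le: "psd (A + D - ptr S h)"
    and pinch: "psd (c *\<^sub>R emb T (ptr T h) - emb T (idm E) * h * emb T (idm E))" and c: "0 \<le> c"
  defines "H \<equiv> emb T (A * N)"
  defines "z \<equiv> H * h * adj H"
  shows "psd (c *\<^sub>R emb T A - z)" (is ?A)
    and "Re (tr z) \<le> Re (tr A)" (is ?B)
    and "Re (tr ((idm (E \<times> S) - H) * h * adj (idm (E \<times> S) - H)))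
           \<le> Re (tr (emb (S - T) (idm E) * h)) + Re (tr D)" (is ?C)
proof -
  have fT: "finite T" using T S finite_subset by blast
  define M where "M = A + D"
  define G where "G = A * N"
  define I where "I = idm E"
  have N': "adj N = N" "supp N \<subseteq> E" "M * N = I" "N * M = I"
    using N by (auto simp: inv_on_def M_def I_def)
  have I: "I * f = f" "f * I = f" if "supp f \<subseteq> E" for f
    using E that by (auto simp: I_def idm_times times_idm)
  have II: "I * I = I" "adj I = I" using I[of I] E by (auto simp: I_def supp_idm)
  have adjA: "adj A = A" and adjD: "adj D = D" using A D by (auto simp: psd_adj)
  have NMN: "N * M * N = N" by (simp add: N' I)
  have NMN': "N * (M * (N * f)) = N * f" for f
    using arg_cong[OF NMN, of "\<lambda>g. g * f"] by (simp add: mult.assoc)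
  have G': "adj G = N * A" by (simp add: G_def adjA N')
  have GMG: "G * M * adj G = A * N * A"
    unfolding G' by (simp add: G_def mult.assoc NMN')
  \<comment> \<open>\<open>psd_inverse_bound\<close> applies because \<open>A \<le> M\<close> and
    \<open>N\<close> inverts \<open>M\<close>. Hence conjugation by \<open>G\<close> brings
    \<open>M\<close>, and every marginal below \<open>M\<close>, under \<open>A\<close>.\<close>
  have "psd (1 *\<^sub>R A - A * N * A)"
    using D by (intro psd_inverse_bound[OF A(1), where \<sigma> = M]) (use NMN in \<open>simp_all add: N' M_def\<close>)
  then have AG: "psd (A - G * M * adj G)" unfolding GMG by simp
  \<comment> \<open>Since \<open>(A + D) * N = I\<close>, what \<open>G\<close> misses of the
    identity is governed by \<open>D\<close> alone.\<close>
  have IG: "I - G = D * N"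
    using N'(3) by (simp add: G_def M_def distrib_right diff_eq_eq add.commute)
  have "psd (1 *\<^sub>R D - D * N * D)"
    using A by (intro psd_inverse_bound[OF D(1), where \<sigma> = M]) (use NMN in \<open>simp_all add: N' M_def\<close>)
  moreover have IGM: "(I - G) * M * adj (I - G) = D * N * D"
    unfolding IG by (simp add: adjD N'(1) mult.assoc NMN')
  ultimately have DG: "Re (tr ((I - G) * M * adj (I - G))) \<le> Re (tr D)"
    using psd_tr by fastforce
  have ptrS: "ptr S h = ptr T h + ptr (S - T) h"
    using ptr_union[of T "S - T" h] T S fT by (simp add: Un_absorb1)
  have leT: "psd (M - ptr T h)"
    using psd_add[OF le psd_ptr[OF h(1), of "S - T"]] by (simp add: ptrS M_def)
  have G_ptr: "psd (A - G * ptr T h * adj G)"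
    using psd_add[OF AG psd_conj[OF leT, of G]] by (simp add: right_diff_distrib left_diff_distrib)
  have supG: "supp G \<subseteq> E" unfolding G_def using supp_times[of A N] A N' by auto
  have H: "H = emb T G" by (simp add: H_def G_def)
  have HT: "H * emb T I = H" unfolding H using fT by (simp add: emb_mult I supG)
  have TH: "emb T I * adj H = adj H"
    unfolding H using fT supG by (simp add: emb_mult emb_adj I)
  have "psd (H * (c *\<^sub>R emb T (ptr T h) - emb T (idm E) * h * emb T (idm E)) * adj H)"
    by (rule psd_conj) fact
  also have "H * (c *\<^sub>R emb T (ptr T h) - emb T (idm E) * h * emb T (idm E)) * adj H
     = c *\<^sub>R (H * emb T (ptr T h) * adj H) - H * emb T I * h * (emb T I * adj H)"
    by (simp add: algebra_simps I_def)
  also have "\<dots> = c *\<^sub>R emb T (G * ptr T h * adj G) - z"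
    unfolding HT TH unfolding H using fT by (simp add: z_def H emb_mult emb_adj)
  finally have 1: "psd (c *\<^sub>R emb T (G * ptr T h * adj G) - z)" .
  have 2: "psd (c *\<^sub>R emb T (A - G * ptr T h * adj G))"
    using c fT G_ptr by (intro psd_scaleR psd_emb) auto
  show ?A
    using psd_add[OF 1 2] fT by (simp add: emb_diff scaleR_diff_right)
  have tr_conj: "tr (emb T f * h * adj (emb T f)) = tr (f * ptr T h * adj f)" for f
  proof -
    have "tr (emb T f * h * adj (emb T f)) = tr (emb T (adj f * f) * h)"
      using fT by (subst tr_commute) (simp add: emb_adj emb_mult flip: mult.assoc)
    also have "\<dots> = tr (adj f * (f * ptr T h))" using fT by (simp add: tr_emb_times mult.assoc)
    also have "\<dots> = tr (f * ptr T h * adj f)" by (rule tr_commute)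
    finally show ?thesis .
  qed
  have "tr z = tr (G * ptr T h * adj G)" unfolding z_def H by (rule tr_conj)
  then show ?B using psd_tr[OF G_ptr] by simp
  \<comment> \<open>The complement of \<open>H\<close> splits into the projection \<open>U\<close>
    off \<open>T\<close> and the defect \<open>V\<close> on \<open>T\<close>. Their second factors
    are orthogonal, so the cross terms vanish and the two losses add.\<close>
  define U V where "U = emb (S - T) I" and "V = emb T (I - G)"
  have "idm (E \<times> S) = emb S I"
    using E S by (intro fmat_eqI) (auto simp: ent_idm ent_emb I_def)
  also have "\<dots> = emb T I + U"
    using emb_union[of T "S - T" I] T S fT by (simp add: Un_absorb1 U_def)
  finally have UV: "idm (E \<times> S) - H = U + V"
    using fT by (simp add: V_def H emb_diff)
  have disj: "T \<inter> (S - T) = {}" "(S - T) \<inter> T = {}" by auto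
  have "adj (U + V) * (U + V) = adj U * U + adj V * V + (adj U * V + adj V * U)"
    by (simp add: algebra_simps)
  also have "adj U * V + adj V * U = 0"
    using fT S by (simp add: U_def V_def emb_adj emb_mult disj)
  also have "adj U * U = U"
    using S by (simp add: U_def emb_adj emb_mult II)
  finally have sq: "adj (U + V) * (U + V) = U + adj V * V" by simp
  have "tr ((U + V) * h * adj (U + V)) = tr ((adj (U + V) * (U + V)) * h)"
    by (subst tr_commute) (simp only: mult.assoc)
  also have "\<dots> = tr (U * h) + tr (adj V * (V * h))"
    unfolding sq by (simp add: distrib_right mult.assoc)
  also have "tr (adj V * (V * h)) = tr (V * h * adj V)" by (rule tr_commute)
  also have "\<dots> = tr ((I - G) * ptr T h * adj (I - G))" unfolding V_def by (rule tr_conj)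
  finally have "Re (tr ((U + V) * h * adj (U + V))) = Re (tr (U * h)) + Re (tr ((I - G) * ptr T h * adj (I - G)))"
    by simp
  also have "Re (tr ((I - G) * ptr T h * adj (I - G))) \<le> Re (tr ((I - G) * M * adj (I - G)))"
    using psd_form[OF leT, of "I - G"]
    by (simp only: right_diff_distrib left_diff_distrib tr_diff minus_complex.simps)
  also note DG
  finally show ?C unfolding UV by (simp add: U_def I_def)
qed


section \<open>Hashing\<close>

text \<open>
  Derandomized two-universal hashing: the values are chosen one after the other, each time
  not exceeding the average over the possible values.
\<close>

lemma ex_hash:
  fixes t :: "nat \<Rightarrow> nat \<Rightarrow> real"
  assumes sym: "\<And>x y. t x y = t y x" and m: "0 < m"
  shows "\<exists>g. (\<forall>x<L. g x < m) \<and>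
    (\<Sum>x<L. \<Sum>y<L. (of_bool (g x = g y) - 1 / real m) * t x y) \<le> (1 - 1 / real m) * (\<Sum>x<L. t x x)"
proof (induction L)
  case 0
  then show ?case by simp
next
  case (Suc L)
  then obtain g :: "nat \<Rightarrow> nat" where g: "\<forall>x<L. g x < m"
    "(\<Sum>x<L. \<Sum>y<L. (of_bool (g x = g y) - 1 / real m) * t x y) \<le> (1 - 1 / real m) * (\<Sum>x<L. t x x)"
    by blast
  \<comment> \<open>\<open>w v\<close> is the cross term that the new value \<open>L\<close>
    contributes if it is hashed to \<open>v\<close>; it occurs twice by symmetry. These terms add up
    to 0 over all \<open>v\<close>, so one of them is not positive.\<close>
  define w where "w v = (\<Sum>x<L. (of_bool (g x = v) - 1 / real m) * t x L)" for v :: nat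
  have "(\<Sum>v<m. w v) = (\<Sum>x<L. \<Sum>v<m. (of_bool (g x = v) - 1 / real m) * t x L)"
    unfolding w_def by (rule sum.swap)
  also have "\<dots> = (\<Sum>x<L. 0)"
  proof (rule sum.cong)
    fix x assume "x \<in> {..<L}"
    then have "g x < m" using g by auto
    then have "(\<Sum>v<m. of_bool (g x = v) - 1 / real m) = 0"
      using m by (simp add: sum_subtractf of_bool_def)
    then show "(\<Sum>v<m. (of_bool (g x = v) - 1 / real m) * t x L) = 0"
      by (simp flip: sum_distrib_right)
  qed simp
  finally have "(\<Sum>v<m. w v) = 0" by simp
  then have "\<exists>v<m. w v \<le> 0"
    using m sum_pos[of "{..<m}" w] by (metis finite_lessThan lessThan_empty_iff lessThan_iff less_irrefl not_le)
  then obtain v where v: "v < m" "w v \<le> 0" by blast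
  define g' where "g' = g(L := v)"
  have g'L: "g' L = v" "\<And>x. x < L \<Longrightarrow> g' x = g x" by (auto simp: g'_def)
  have "(\<Sum>x<Suc L. \<Sum>y<Suc L. (of_bool (g' x = g' y) - 1 / real m) * t x y)
    = (\<Sum>x<L. \<Sum>y<L. (of_bool (g x = g y) - 1 / real m) * t x y) + w v
      + (\<Sum>y<L. (of_bool (v = g y) - 1 / real m) * t L y) + (1 - 1 / real m) * t L L"
    by (simp add: g'L sum.distrib w_def)
  also have "(\<Sum>y<L. (of_bool (v = g y) - 1 / real m) * t L y) = w v"
    unfolding w_def by (intro sum.cong refl) (simp add: sym eq_commute)
  finally have "(\<Sum>x<Suc L. \<Sum>y<Suc L. (of_bool (g' x = g' y) - 1 / real m) * t x y)
     \<le> (1 - 1 / real m) * (\<Sum>x<Suc L. t x x)"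
    using g(2) v(2) by (simp add: distrib_left)
  moreover have "\<forall>x<Suc L. g' x < m" using g(1) v(1) by (auto simp: g'_def)
  ultimately show ?case by blast
qed

text \<open>The inner product of two centred unit vectors. It converts a sum of squares over hash
  values into the collision sum of \<open>ex_hash\<close>.\<close>

lemma hash_coeff_sum:
  fixes u v m :: nat
  assumes "u < m" "v < m"
  shows "(\<Sum>y<m. (of_bool (u = y) - 1 / real m) * (of_bool (v = y) - 1 / real m)) = of_bool (u = v) - 1 / real m"
proof -
  have "(\<Sum>y<m. (of_bool (u = y) - 1 / real m) * (of_bool (v = y) - 1 / real m))
    = (\<Sum>y<m. (if u = y then of_bool (v = u) else 0) - (if u = y then 1 / real m else 0)
        - (if v = y then 1 / real m else 0) + 1 / real m * (1 / real m))"
    by (intro sum.cong refl) (auto simp: algebra_simps)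
  also have "\<dots> = of_bool (u = v) - 1 / real m"
    using assms by (auto simp: sum_subtractf sum.distrib)
  finally show ?thesis .
qed

section \<open>Privacy amplification\<close>

text \<open>Each \<open>\<eta> x\<close> is replaced by its smoothed version at the price given by
  \<open>gentle\<close>. For the smoothed operators, Cauchy-Schwarz with weight
  \<open>\<sigma>\<close> reduces the deviation from uniformity to collision terms;
  \<open>ex_hash\<close> leaves only the diagonal ones, which \<open>psd_inverse_bound\<close>
  controls. The function is chosen before \<open>K\<close>, so it serves every family of
  contractions. For \<open>m = 1\<close> no collision term remains, and this case stays valid
  however large \<open>T\<close> is.\<close>

lemma privacy_amplification:
  fixes \<eta> :: "nat \<Rightarrow> ('e \<times> 's) fmat"
  assumes E: "finite E" and S: "finite S" and T: "T \<subseteq> S" and c: "0 < c"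
    and \<eta>: "\<And>x. x < L \<Longrightarrow> psd (\<eta> x)" "\<And>x. x < L \<Longrightarrow> supp (\<eta> x) \<subseteq> E \<times> S"
    and A: "psd A" "supp A \<subseteq> E" and D: "\<And>x. x < L \<Longrightarrow> psd (D x)" "\<And>x. x < L \<Longrightarrow> supp (D x) \<subseteq> E"
    and Ai: "inv_on E A Ai" and N: "\<And>x. x < L \<Longrightarrow> inv_on E (A + D x) (N x)"
    and le: "\<And>x. x < L \<Longrightarrow> psd (A + D x - ptr S (\<eta> x))"
    and pinch: "\<And>x. x < L \<Longrightarrow> psd (c *\<^sub>R emb T (ptr T (\<eta> x)) - emb T (idm E) * \<eta> x * emb T (idm E))"
    and r: "(\<Sum>x<L. Re (tr (emb (S - T) (idm E) * \<eta> x)) + Re (tr (D x))) \<le> r"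
    and \<eta>1: "(\<Sum>x<L. Re (tr (\<eta> x))) \<le> 1"
    and A2: "real L * Re (tr A) \<le> 2" and L: "0 < L" and m: "0 < m"
  shows "\<exists>g. (\<forall>x<L. g x < m) \<and> (\<forall>K. (\<forall>y<m. contr (K y)) \<longrightarrow>
    (\<Sum>y<m. Re (tr (K y * (\<Sum>x<L. (of_bool (g x = y) - 1 / real m) *\<^sub>R \<eta> x))))
      \<le> 2 * (2 * sqrt r + r) + (if m = 1 then 0 else 2 * sqrt (real m * real (card T) * c / real L)))"
proof -
  have fT: "finite T" using T S finite_subset by blast
  define H where "H x = emb T (A * N x)" for x
  define z where "z x = H x * \<eta> x * adj (H x)" for x
  define J where "J = idm (E \<times> S)"
  define q where "q x = Re (tr ((J - H x) * \<eta> x * adj (J - H x)))" for x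
  define rx where "rx x = Re (tr (emb (S - T) (idm E) * \<eta> x)) + Re (tr (D x))" for x
  define tx where "tx x = Re (tr (\<eta> x))" for x
  note sm = smoothing[OF E S T \<eta>(1,2) A D(1,2) N le pinch less_imp_le[OF c], folded H_def, folded z_def J_def, folded q_def rx_def]
  have z: "psd (z x)" if "x < L" for x unfolding z_def using \<eta> that by (intro psd_conj) auto
  have q0: "0 \<le> q x" if "x < L" for x unfolding q_def using \<eta> that by (intro psd_form) auto
  have t0: "0 \<le> tx x" if "x < L" for x unfolding tx_def using \<eta> that by (intro psd_tr) auto
  have r0: "0 \<le> rx x" if "x < L" for x using sm(3)[OF that that that that that that that] q0[OF that] by simp
  define b where "b x = 2 * (sqrt (rx x) * sqrt (tx x)) + rx x" for x
  have b0: "0 \<le> b x" if "x < L" for x using r0[OF that] t0[OF that] by (simp add: b_def)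
  have gent: "Re (tr (K * (\<eta> x - z x))) \<le> b x" if K: "contr K" and x: "x < L" for K x
  proof -
    have "Re (tr (K * (\<eta> x - z x))) \<le> 2 * (sqrt (q x) * sqrt (tx x)) + q x"
      unfolding z_def q_def tx_def
    proof (rule gentle[OF K \<eta>(1)[OF x]])
      show "J * \<eta> x = \<eta> x" unfolding J_def using E S \<eta>(2)[OF x] by (intro idm_times) auto
    qed (simp add: J_def)
    also have "\<dots> \<le> b x"
      unfolding b_def using sm(3)[OF x x x x x x x] t0[OF x] q0[OF x]
      by (intro add_mono mult_left_mono mult_right_mono) auto
    finally show ?thesis .
  qed
  have "(\<Sum>x<L. b x) = 2 * (\<Sum>x<L. sqrt (rx x) * sqrt (tx x)) + (\<Sum>x<L. rx x)"
    by (simp add: b_def sum.distrib sum_distrib_left)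
  also have "(\<Sum>x<L. sqrt (rx x) * sqrt (tx x)) \<le> sqrt (\<Sum>x<L. rx x) * sqrt (\<Sum>x<L. tx x)"
    using r0 t0 by (intro sum_sqrt_mult_le) auto
  also have "\<dots> \<le> sqrt r * 1"
  proof (intro mult_mono)
    have "0 \<le> (\<Sum>x<L. rx x)" using r0 by (intro sum_nonneg) auto
    then show "0 \<le> sqrt r" using r by (simp add: rx_def)
    have "0 \<le> (\<Sum>x<L. tx x)" using t0 by (intro sum_nonneg) auto
    then show "0 \<le> sqrt (\<Sum>x<L. tx x)" by simp
  qed (use r \<eta>1 in \<open>simp_all add: rx_def tx_def\<close>)
  also have "(\<Sum>x<L. rx x) \<le> r" using r by (simp add: rx_def)
  finally have bsum: "(\<Sum>x<L. b x) \<le> 2 * sqrt r + r" by simp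
  define Z where "Z = emb T Ai"
  define \<sigma> where "\<sigma> = emb T A"
  have Ai': "adj Ai = Ai" "supp Ai \<subseteq> E" "A * Ai = idm E" "Ai * A = idm E"
    using Ai by (auto simp: inv_on_def)
  have adjZ: "adj Z = Z" using fT by (simp add: Z_def emb_adj Ai')
  have ZsZ: "Z * \<sigma> * Z = Z"
    using fT E by (simp add: Z_def \<sigma>_def emb_mult Ai' idm_times)
  have psd\<sigma>: "psd \<sigma>" unfolding \<sigma>_def using fT A by (intro psd_emb)
  have tr\<sigma>: "Re (tr \<sigma>) = real (card T) * Re (tr A)" using fT by (simp add: \<sigma>_def tr_emb)
  have trA0: "0 \<le> Re (tr A)" using A by (intro psd_tr)
  \<comment> \<open>\<open>\<sigma> * Z\<close> is the projection \<open>emb T (idm E)\<close>, and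
    it fixes \<open>z x\<close> because \<open>H x\<close> already maps into its range.\<close>
  have sZz: "\<sigma> * (Z * z x) = z x" if "x < L" for x
  proof -
    have "supp (A * N x) \<subseteq> E"
      using supp_times[of A "N x"] A N[OF that] by (auto simp: inv_on_def)
    then have "emb T (idm E) * H x = H x"
      using fT E by (simp add: H_def emb_mult idm_times)
    moreover have "\<sigma> * Z = emb T (idm E)"
      using fT by (simp add: Z_def \<sigma>_def emb_mult Ai')
    ultimately show ?thesis by (simp add: z_def flip: mult.assoc)
  qed
  \<comment> \<open>\<open>ex_hash\<close> asks for symmetry at all indices, while
    \<open>z x\<close> is known to be selfadjoint only below \<open>L\<close>. Ordering the
    arguments by \<open>min\<close> and \<open>max\<close> makes \<open>t\<close> symmetric
    everywhere.\<close>
  define t where "t x y = Re (tr (z (min x y) * Z * z (max x y)))" for x y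
  have tsym: "t x y = t y x" for x y by (simp add: t_def min.commute max.commute)
  have t_eq: "t x y = Re (tr (z x * Z * z y))" if "x < L" "y < L" for x y
  proof -
    have "Re (tr (z x * Z * z y)) = Re (tr (z y * Z * z x))"
      using tr_adj[of "z x * Z * z y"] psd_adj[OF z[OF that(1)]] psd_adj[OF z[OF that(2)]]
      by (simp add: adjZ mult.assoc)
    then show ?thesis by (auto simp: t_def min_def max_def)
  qed
  obtain g where g: "\<And>x. x < L \<Longrightarrow> g x < m"
    "(\<Sum>x<L. \<Sum>y<L. (of_bool (g x = g y) - 1 / real m) * t x y) \<le> (1 - 1 / real m) * (\<Sum>x<L. t x x)"
    using ex_hash[of t m L] tsym m by blast
  define a :: "nat \<Rightarrow> nat \<Rightarrow> real" where "a x y = of_bool (g x = y) - 1 / real m" for x y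
  \<comment> \<open>For fixed \<open>x\<close> there is one coefficient \<open>1 - 1 / m\<close>,
    and the other \<open>m - 1\<close> are \<open>- 1 / m\<close>.\<close>
  have abs_a: "(\<Sum>y<m. \<bar>a x y\<bar>) \<le> 2" if "x < L" for x
  proof -
    have "(\<Sum>y<m. \<bar>a x y\<bar>) \<le> (\<Sum>y<m. (if g x = y then 1 else 0) + 1 / real m)"
      unfolding a_def by (intro sum_mono) (auto simp: abs_if)
    also have "\<dots> = 2" using g(1)[OF that] m by (simp add: sum.distrib)
    finally show ?thesis .
  qed
  \<comment> \<open>\<open>M y\<close> is the smoothed deviation from uniformity at the hash value
    \<open>y\<close>, and \<open>B y\<close> is its collision form.\<close>
  define M where "M y = (\<Sum>x<L. a x y *\<^sub>R z x)" for y
  define B where "B y = Re (tr (M y * Z * M y))" for y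
  have adjM: "adj (M y) = M y" for y
    unfolding M_def adj_sum by (intro sum.cong) (auto simp: psd_adj[OF z])
  have B0: "0 \<le> B y" for y
  proof -
    have "M y * Z * M y = M y * Z * \<sigma> * adj (M y * Z)"
      using ZsZ by (simp add: adjM adjZ mult.assoc) (metis mult.assoc)
    then show ?thesis unfolding B_def using psd_form[OF psd\<sigma>, of "M y * Z"] by (simp only:)
  qed
  have "(\<Sum>y<m. B y) = (\<Sum>y<m. \<Sum>x<L. \<Sum>x'<L. a x y * a x' y * t x x')"
  proof (rule sum.cong)
    fix y
    have "M y * Z * M y = (\<Sum>x'<L. \<Sum>x<L. (a x' y * a x y) *\<^sub>R (z x * Z * z x'))"
      unfolding M_def by (simp add: sum_distrib_left sum_distrib_right mult.assoc scaleR_sum_right)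
    also have "\<dots> = (\<Sum>x<L. \<Sum>x'<L. (a x' y * a x y) *\<^sub>R (z x * Z * z x'))"
      by (rule sum.swap)
    also have "\<dots> = (\<Sum>x<L. \<Sum>x'<L. (a x y * a x' y) *\<^sub>R (z x * Z * z x'))"
    proof (intro sum.cong refl)
      fix x x'
      show "(a x' y * a x y) *\<^sub>R (z x * Z * z x') = (a x y * a x' y) *\<^sub>R (z x * Z * z x')"
        by (subst mult.commute[of "a x' y"]) (rule refl)
    qed
    finally have "M y * Z * M y = (\<Sum>x<L. \<Sum>x'<L. (a x y * a x' y) *\<^sub>R (z x * Z * z x'))" .
    then show "B y = (\<Sum>x<L. \<Sum>x'<L. a x y * a x' y * t x x')"
      by (simp add: B_def tr_sum t_eq)
  qed simp
  also have "\<dots> = (\<Sum>x<L. \<Sum>x'<L. \<Sum>y<m. a x y * a x' y * t x x')"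
    by (subst sum.swap) (intro sum.cong refl sum.swap)
  also have "\<dots> = (\<Sum>x<L. \<Sum>x'<L. (of_bool (g x = g x') - 1 / real m) * t x x')"
    using g(1) by (intro sum.cong refl) (simp add: a_def hash_coeff_sum flip: sum_distrib_right)
  also note g(2)
  \<comment> \<open>For \<open>m = 1\<close> the factor on the left is 0; otherwise it is at most
    1.\<close>
  also have "(1 - 1 / real m) * (\<Sum>x<L. t x x) \<le> of_bool (m \<noteq> 1) * (2 * c)"
  proof -
    have tz: "0 \<le> t x x \<and> t x x \<le> c * Re (tr A)" if x: "x < L" for x
    proof
      \<comment> \<open>Smoothing gives \<open>z x\<close> the bound
        \<open>c *\<^sub>R \<sigma>\<close>; dividing by \<open>\<sigma>\<close> costs only the
        constant \<open>c\<close>, so the trace of a single collision term is at most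
        \<open>c\<close> times that of \<open>A\<close>.\<close>
      have "psd (c *\<^sub>R z x - z x * Z * z x)"
        by (rule psd_inverse_bound[OF z[OF x] _ adjZ ZsZ c])
          (use sm(1)[OF x x x x x x x] in \<open>simp add: \<sigma>_def\<close>)
      then have "Re (tr (z x * Z * z x)) \<le> c * Re (tr (z x))" using psd_tr by fastforce
      also have "\<dots> \<le> c * Re (tr A)" using sm(2)[OF x x x x x x x] c by simp
      finally show "t x x \<le> c * Re (tr A)" by (simp add: t_eq x)
      have "z x * Z * z x = z x * Z * \<sigma> * adj (z x * Z)"
        using ZsZ by (simp add: psd_adj[OF z[OF x]] adjZ mult.assoc) (metis mult.assoc)
      then show "0 \<le> t x x" using psd_form[OF psd\<sigma>, of "z x * Z"] by (simp only: t_eq[OF x x])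
    qed
    have "(\<Sum>x<L. t x x) \<le> (\<Sum>x<L. c * Re (tr A))" using tz by (intro sum_mono) auto
    also have "\<dots> = c * (real L * Re (tr A))" by simp
    also have "\<dots> \<le> c * 2" using A2 c by (intro mult_left_mono) auto
    finally have "(\<Sum>x<L. t x x) \<le> 2 * c" by simp
    moreover have "0 \<le> (\<Sum>x<L. t x x)" using tz by (intro sum_nonneg) auto
    moreover have "1 - 1 / real m \<le> of_bool (m \<noteq> 1)" using m by (auto simp: field_simps)
    moreover have "0 \<le> 1 - 1 / real m" using m by (auto simp: field_simps)
    ultimately show ?thesis by (intro mult_mono) auto
  qed
  finally have Bsum: "(\<Sum>y<m. B y) \<le> of_bool (m \<noteq> 1) * (2 * c)" .
  show ?thesis
  proof (intro exI[of _ g] conjI allI impI)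
    fix K :: "nat \<Rightarrow> ('e \<times> 's) fmat" assume "\<forall>y<m. contr (K y)"
    then have K: "\<And>y. y < m \<Longrightarrow> contr (K y)" by blast
    have 1: "Re (tr (K y * (\<Sum>x<L. a x y *\<^sub>R \<eta> x))) \<le> (\<Sum>x<L. \<bar>a x y\<bar> * b x) + Re (tr (K y * M y))" if y: "y < m" for y
    proof -
      have "(\<Sum>x<L. a x y *\<^sub>R \<eta> x) = (\<Sum>x<L. a x y *\<^sub>R (\<eta> x - z x)) + M y"
        by (simp add: M_def scaleR_diff_right sum_subtractf)
      then have "Re (tr (K y * (\<Sum>x<L. a x y *\<^sub>R \<eta> x)))
          = (\<Sum>x<L. a x y * Re (tr (K y * (\<eta> x - z x)))) + Re (tr (K y * M y))"
        by (simp add: distrib_left sum_distrib_left tr_sum)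
      also have "(\<Sum>x<L. a x y * Re (tr (K y * (\<eta> x - z x)))) \<le> (\<Sum>x<L. \<bar>a x y\<bar> * b x)"
      proof (rule sum_mono)
        fix x assume "x \<in> {..<L}"
        then have x: "x < L" by simp
        have "Re (tr (K y * (\<eta> x - z x))) \<le> b x" by (rule gent[OF K[OF y] x])
        moreover have "- Re (tr (K y * (\<eta> x - z x))) \<le> b x"
          using gent[OF contr_uminus[OF K[OF y]] x] by simp
        ultimately have "\<bar>Re (tr (K y * (\<eta> x - z x)))\<bar> \<le> b x" by (rule abs_leI)
        then have "\<bar>a x y\<bar> * \<bar>Re (tr (K y * (\<eta> x - z x)))\<bar> \<le> \<bar>a x y\<bar> * b x"
          by (intro mult_left_mono) auto
        then show "a x y * Re (tr (K y * (\<eta> x - z x))) \<le> \<bar>a x y\<bar> * b x"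
          by (simp flip: abs_mult)
      qed
      finally show ?thesis by simp
    qed
    have 2: "Re (tr (K y * M y)) \<le> sqrt (Re (tr \<sigma>)) * sqrt (B y)" if y: "y < m" for y
    proof -
      \<comment> \<open>Inserting \<open>\<sigma> * Z\<close> in front of \<open>M y\<close>
        exhibits the trace as an inner product with weight \<open>\<sigma>\<close>; the second
        Cauchy-Schwarz factor then collapses to \<open>B y\<close>.\<close>
      have sZM: "\<sigma> * (Z * M y) = M y"
        unfolding M_def by (auto simp: sum_distrib_left sZz intro!: sum.cong)
      have "Re (tr (K y * M y)) = Re (tr (K y * \<sigma> * adj (M y * Z)))"
        by (simp add: adjM adjZ mult.assoc sZM)
      also have "\<dots> \<le> sqrt (Re (tr (K y * \<sigma> * adj (K y)))) * sqrt (Re (tr (M y * Z * \<sigma> * adj (M y * Z))))"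
        by (rule psd_Cauchy_Schwarz) fact
      also have "M y * Z * \<sigma> * adj (M y * Z) = M y * Z * M y"
        by (simp add: adjM adjZ mult.assoc sZM)
      also have "sqrt (Re (tr (K y * \<sigma> * adj (K y)))) * sqrt (Re (tr (M y * Z * M y))) \<le> sqrt (Re (tr \<sigma>)) * sqrt (B y)"
        using K[OF y] psd\<sigma> B0[of y] by (intro mult_mono) (auto simp: contr_def B_def psd_tr)
      finally show ?thesis .
    qed
    have "(\<Sum>y<m. Re (tr (K y * (\<Sum>x<L. (of_bool (g x = y) - 1 / real m) *\<^sub>R \<eta> x))))
      \<le> (\<Sum>y<m. (\<Sum>x<L. \<bar>a x y\<bar> * b x) + sqrt (Re (tr \<sigma>)) * sqrt (B y))"
      unfolding a_def[symmetric] using 1 2 by (intro sum_mono) force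
    also have "\<dots> = (\<Sum>x<L. (\<Sum>y<m. \<bar>a x y\<bar>) * b x) + (\<Sum>y<m. sqrt (Re (tr \<sigma>)) * sqrt (B y))"
      unfolding sum.distrib sum_distrib_right by (subst sum.swap) simp
    also have "(\<Sum>x<L. (\<Sum>y<m. \<bar>a x y\<bar>) * b x) \<le> (\<Sum>x<L. 2 * b x)"
      using abs_a b0 by (intro sum_mono mult_right_mono) auto
    also have "\<dots> \<le> 2 * (2 * sqrt r + r)" using bsum by (simp flip: sum_distrib_left)
    also have "(\<Sum>y<m. sqrt (Re (tr \<sigma>)) * sqrt (B y)) \<le> sqrt (\<Sum>y<m. Re (tr \<sigma>)) * sqrt (\<Sum>y<m. B y)"
      using psd_tr[OF psd\<sigma>] B0 by (intro sum_sqrt_mult_le) auto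
    also have "\<dots> = sqrt (real m * (real (card T) * Re (tr A)) * (\<Sum>y<m. B y))"
      by (simp add: tr\<sigma> real_sqrt_mult)
    also have "\<dots> \<le> (if m = 1 then 0 else 2 * sqrt (real m * real (card T) * c / real L))"
    proof (cases "m = 1")
      case True
      then have "(\<Sum>y<m. B y) = 0" using Bsum B0[of 0] by simp
      then show ?thesis using True by simp
    next
      case False
      \<comment> \<open>One factor 2 is that of \<open>A2\<close>, the other that of
        \<open>Bsum\<close>; their product leaves the square root as the final 2.\<close>
      have "Re (tr A) \<le> 2 / real L" using A2 L by (simp add: field_simps)
      then have "real m * (real (card T) * Re (tr A)) * (\<Sum>y<m. B y)
          \<le> real m * (real (card T) * (2 / real L)) * (2 * c)"
        using Bsum False trA0 B0 by (intro mult_mono mult_left_mono) (auto intro!: sum_nonneg)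
      also have "\<dots> = 2\<^sup>2 * (real m * real (card T) * c / real L)" by simp
      finally have "sqrt (real m * (real (card T) * Re (tr A)) * (\<Sum>y<m. B y))
         \<le> sqrt (2\<^sup>2 * (real m * real (card T) * c / real L))" by (rule real_sqrt_le_mono)
      then show ?thesis using False by (simp only: real_sqrt_mult) simp
    qed
    finally show "(\<Sum>y<m. Re (tr (K y * (\<Sum>x<L. (of_bool (g x = y) - 1 / real m) *\<^sub>R \<eta> x))))
      \<le> 2 * (2 * sqrt r + r) + (if m = 1 then 0 else 2 * sqrt (real m * real (card T) * c / real L))"
      by simp
  qed (use g in auto)
qed

section \<open>The spectral theorem\<close>

lemma mat_adjoint_dim [simp]:
  "dim_row (mat_adjoint M) = dim_col M" "dim_col (mat_adjoint M) = dim_row M"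
  by (auto simp: mat_adjoint_def)

lemma mat_adjoint_carrier [simp]: "M \<in> carrier_mat m n \<Longrightarrow> mat_adjoint M \<in> carrier_mat n m"
  by (intro carrier_matI) auto

lemma mat_adjoint_index:
  fixes M :: "complex mat"
  assumes "i < dim_col M" "j < dim_row M"
  shows "mat_adjoint M $$ (i, j) = cnj (M $$ (j, i))"
  unfolding mat_adjoint_def mat_of_rows_def using assms by simp

text \<open>On square matrices of size \<open>n\<close> this map is injective and respects products,
  adjoints and traces, so identities proved without carrier sets are brought back by
  \<open>fm_inj\<close>.\<close>

definition fm :: "nat \<Rightarrow> complex mat \<Rightarrow> nat fmat" where
  "fm n M = fmat_of {..<n} (\<lambda>i j. M $$ (i, j))"

lemma ent_fm: "ent (fm n M) i j = (if i < n \<and> j < n then M $$ (i, j) else 0)"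
  by (simp add: fm_def ent_fmat_of)

lemma supp_fm: "supp (fm n M) \<subseteq> {..<n}"
  by (simp add: fm_def supp_fmat_of)

lemma fm_mult:
  assumes "A \<in> carrier_mat n n" "B \<in> carrier_mat n n"
  shows "fm n (A * B) = fm n A * fm n B"
proof (rule fmat_eqI)
  fix i j
  show "ent (fm n (A * B)) i j = ent (fm n A * fm n B) i j"
    using assms supp_fm[of n A]
    by (subst ent_times[of "{..<n}"]) (auto simp: ent_fm scalar_prod_def lessThan_atLeast0 intro!: sum.neutral)
qed

lemma fm_adjoint: "A \<in> carrier_mat n n \<Longrightarrow> fm n (mat_adjoint A) = adj (fm n A)"
  by (intro fmat_eqI) (auto simp: ent_fm mat_adjoint_index)

lemma fm_one: "fm n (1\<^sub>m n) = idm {..<n}"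
  by (intro fmat_eqI) (auto simp: ent_fm ent_idm)

lemma fm_inj:
  assumes "A \<in> carrier_mat n n" "B \<in> carrier_mat n n" "fm n A = fm n B"
  shows "A = B"
proof (rule eq_matI)
  fix i j assume "i < dim_row B" "j < dim_col B"
  then show "A $$ (i, j) = B $$ (i, j)"
    using ent_fm[of n A i j] ent_fm[of n B i j] assms by simp
qed (use assms in auto)

lemma fm_tr: "A \<in> carrier_mat n n \<Longrightarrow> tr (fm n A) = mat_trace A"
  by (subst tr_eq[OF _ supp_fm]) (auto simp: mat_trace_def ent_fm)

lemma fm_mat_ent: "supp f \<subseteq> {..<n} \<Longrightarrow> fm n (mat n n (\<lambda>(i, j). ent f i j)) = f"
  by (intro fmat_eqI) (metis (no_types, lifting) case_prod_conv ent_fm index_mat(1) lessThan_iff supp_subsetD)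

definition diagm :: "nat \<Rightarrow> (nat \<Rightarrow> real) \<Rightarrow> nat fmat" where
  "diagm n d = fmat_of {..<n} (\<lambda>i j. if i = j then of_real (d i) else 0)"

lemma ent_diagm: "ent (diagm n d) i j = (if i < n \<and> i = j then of_real (d i) else 0)"
  by (auto simp: diagm_def ent_fmat_of)

lemma supp_diagm: "supp (diagm n d) \<subseteq> {..<n}"
  by (simp add: diagm_def supp_fmat_of)

lemma fm_mat_diag: "fm n (mat_diag n (\<lambda>i. complex_of_real (d i))) = diagm n d"
  by (intro fmat_eqI) (auto simp: ent_fm ent_diagm mat_diag_def)

lemma adj_diagm [simp]: "adj (diagm n d) = diagm n d"
  by (intro fmat_eqI) (auto simp: ent_diagm)

lemma ent_diagm_times: "ent (diagm n d * f) i j = (if i < n then of_real (d i) * ent f i j else 0)"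
proof -
  have "ent (diagm n d * f) i j = (\<Sum>k<n. (if i = k then 1 else 0) * ((if i < n then of_real (d i) else 0) * ent f k j))"
    using supp_diagm[of n d] by (subst ent_times[of "{..<n}"]) (auto simp: ent_diagm intro!: sum.cong)
  then show ?thesis by (simp add: sum_indicator_mult)
qed

lemma ent_times_diagm: "ent (f * diagm n d) i j = (if j < n then ent f i j * of_real (d j) else 0)"
proof -
  have "f * diagm n d = adj (diagm n d * adj f)" by simp
  then show ?thesis by (simp only: ent_adj ent_diagm_times) simp
qed

lemma diagm_mult: "diagm n c * diagm n d = diagm n (\<lambda>i. c i * d i)"
  by (intro fmat_eqI) (auto simp: ent_diagm_times ent_diagm)

lemma diagm_diff: "diagm n c - diagm n d = diagm n (\<lambda>i. c i - d i)"
  by (intro fmat_eqI) (auto simp: ent_diagm)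

lemma idm_diagm: "idm {..<n} = diagm n (\<lambda>_. 1)"
  by (intro fmat_eqI) (auto simp: ent_diagm ent_idm)

lemma tr_diagm: "tr (diagm n d) = of_real (\<Sum>i<n. d i)"
  by (subst tr_eq[OF _ supp_diagm]) (auto simp: ent_diagm)

lemma psd_diagm: "(\<And>i. i < n \<Longrightarrow> 0 \<le> d i) \<Longrightarrow> psd (diagm n d)"
proof -
  assume d: "\<And>i. i < n \<Longrightarrow> 0 \<le> d i"
  have "diagm n d = diagm n (\<lambda>i. sqrt (d i)) * adj (diagm n (\<lambda>i. sqrt (d i)))"
    unfolding adj_diagm diagm_mult by (intro fmat_eqI) (auto simp: ent_diagm d simp flip: of_real_mult)
  then show ?thesis by (metis psd_square)
qed

lemma psd_ent_nonneg: "psd f \<Longrightarrow> 0 \<le> Re (ent f i i)"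
  using psdD[of f "{i}" "\<lambda>_. 1"] by simp

text \<open>The direct sum of the 1 by 1 block \<open>z\<close> and of \<open>f\<close>. It adds one
  dimension in the induction of \<open>spectral_fm\<close>.\<close>

definition shiftm :: "complex \<Rightarrow> nat fmat \<Rightarrow> nat fmat" where
  "shiftm z f = fmat_of (insert 0 (Suc ` supp f))
     (\<lambda>i j. if i = 0 then (if j = 0 then z else 0) else if j = 0 then 0 else ent f (i - 1) (j - 1))"

lemma ent_shiftm: "ent (shiftm z f) i j =
   (if i = 0 then (if j = 0 then z else 0) else if j = 0 then 0 else ent f (i - 1) (j - 1))"
  unfolding shiftm_def by (subst ent_fmat_of) (auto simp: ent_outside image_iff gr0_conv_Suc split: nat.splits)

lemma supp_shiftm: "supp f \<subseteq> {..<n} \<Longrightarrow> supp (shiftm z f) \<subseteq> {..<Suc n}"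
  unfolding shiftm_def by (rule subset_trans[OF supp_fmat_of]) auto

lemma shiftm_mult: "shiftm z f * shiftm w g = shiftm (z * w) (f * g)"
proof (rule fmat_eqI)
  fix i j
  obtain n where n: "supp f \<subseteq> {..<n}"
    using finite_nat_bounded[OF finite_supp] by blast
  show "ent (shiftm z f * shiftm w g) i j = ent (shiftm (z * w) (f * g)) i j"
    using n supp_shiftm[OF n, of z]
    by (subst ent_times[of "{..<Suc n}"])
      (auto simp: ent_shiftm sum.lessThan_Suc_shift ent_times[of "{..<n}"] simp del: sum.lessThan_Suc)
qed

lemma adj_shiftm: "adj (shiftm z f) = shiftm (cnj z) (adj f)"
  by (intro fmat_eqI) (auto simp: ent_shiftm)

lemma shiftm_idm: "shiftm 1 (idm {..<n}) = idm {..<Suc n}"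
  by (intro fmat_eqI) (auto simp: ent_shiftm ent_idm)

lemma shiftm_diagm: "shiftm (of_real c) (diagm n d) = diagm (Suc n) (case_nat c d)"
  by (intro fmat_eqI) (auto simp: ent_shiftm ent_diagm split: nat.splits)

definition unitary_fm :: "nat \<Rightarrow> nat fmat \<Rightarrow> bool" where
  "unitary_fm n U \<longleftrightarrow> supp U \<subseteq> {..<n} \<and> adj U * U = idm {..<n} \<and> U * adj U = idm {..<n}"

lemma unitary_fm_fm: "unitary n U \<Longrightarrow> unitary_fm n (fm n U)"
  unfolding unitary_def unitary_fm_def
  by (metis fm_adjoint fm_mult fm_one mat_adjoint_carrier supp_fm)

lemma unitary_fm_mat: assumes "unitary_fm n U" shows "unitary n (mat n n (\<lambda>(i, j). ent U i j))"
proof -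
  let ?M = "mat n n (\<lambda>(i, j). ent U i j)"
  have M: "fm n ?M = U" using assms by (intro fm_mat_ent) (simp add: unitary_fm_def)
  have "mat_adjoint ?M * ?M = 1\<^sub>m n"
    by (rule fm_inj[of _ n]) (use assms in \<open>auto simp: fm_mult fm_adjoint fm_one M unitary_fm_def\<close>)
  moreover have "?M * mat_adjoint ?M = 1\<^sub>m n"
    by (rule fm_inj[of _ n]) (use assms in \<open>auto simp: fm_mult fm_adjoint fm_one M unitary_fm_def\<close>)
  ultimately show ?thesis by (simp add: unitary_def)
qed

text \<open>Complete \<open>v\<close> to a basis and apply Gram-Schmidt, which keeps
  \<open>v\<close> in front. The result is orthogonal but not normalised; dividing each column by
  its norm makes it unitary and turns the first column into a multiple of \<open>v\<close>.\<close>

lemma ex_unitary_first_col: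
  assumes v: "v \<in> carrier_vec n" "v \<noteq> 0\<^sub>v n"
  shows "\<exists>U c. unitary n U \<and> (\<forall>i<n. U $$ (i, 0) = c * v $ i)"
proof -
  interpret cof_vec_space n "TYPE(complex)" .
  have n: "0 < n" using v by (cases n) auto
  define b where "b = basis_completion v"
  note bc = basis_completion[OF v, folded b_def]
  obtain vs where bv: "b = v # vs" using bc(6,7) n by (cases b) auto
  define ws where "ws = gram_schmidt n b"
  note gs = gram_schmidt_result[OF bc(2,4,5) ws_def]
  have hd: "hd ws = v" using gram_schmidt_hd[OF v(1), of vs] by (simp add: ws_def bv)
  have len: "length ws = n" using gs(4) bc(6) by simp
  have wc: "ws ! k \<in> carrier_vec n" if "k < n" for k using gs(3) len that by (metis nth_mem subsetD)
  have orth: "ws ! k \<bullet>c ws ! l = 0 \<longleftrightarrow> k \<noteq> l" if "k < n" "l < n" for k l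
    using corthogonalD[OF gs(2)] that len by auto
  define s where "s k = Re (ws ! k \<bullet>c ws ! k)" for k
  have s: "ws ! k \<bullet>c ws ! k = of_real (s k)" "0 < s k" if "k < n" for k
  proof -
    have "0 \<le> ws ! k \<bullet>c ws ! k" by (rule conjugate_square_ge_0_vec)
    moreover have "ws ! k \<bullet>c ws ! k \<noteq> 0" using orth[OF that that] by simp
    ultimately show "ws ! k \<bullet>c ws ! k = of_real (s k)" "0 < s k"
      by (auto simp: s_def less_eq_complex_def complex_eq_iff)
  qed
  define U where "U = mat n n (\<lambda>(i, k). of_real (1 / sqrt (s k)) * ws ! k $ i)"
  have U: "U \<in> carrier_mat n n" by (simp add: U_def)
  have "mat_adjoint U * U = 1\<^sub>m n"
  proof (rule eq_matI)
    fix k l assume "k < dim_row (1\<^sub>m n)" "l < dim_col (1\<^sub>m n)"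
    then have kl: "k < n" "l < n" by auto
    have "(mat_adjoint U * U) $$ (k, l) = (\<Sum>i<n. cnj (U $$ (i, k)) * U $$ (i, l))"
      using kl U by (simp add: scalar_prod_def mat_adjoint_index lessThan_atLeast0)
    also have "\<dots> = (\<Sum>i<n. of_real (1 / sqrt (s k)) * of_real (1 / sqrt (s l)) * (ws ! l $ i * cnj (ws ! k $ i)))"
      using kl by (intro sum.cong) (auto simp: U_def)
    also have "\<dots> = of_real (1 / sqrt (s k)) * of_real (1 / sqrt (s l)) * (ws ! l \<bullet>c ws ! k)"
      using wc[OF kl(1)] wc[OF kl(2)] by (simp add: scalar_prod_def sum_distrib_left lessThan_atLeast0)
    also have "\<dots> = 1\<^sub>m n $$ (k, l)"
    proof (cases "k = l")
      case True
      then show ?thesis using s[OF kl(1)] kl by (simp flip: of_real_mult)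
    next
      case False
      then show ?thesis using orth[OF kl(2,1)] kl by simp
    qed
    finally show "(mat_adjoint U * U) $$ (k, l) = 1\<^sub>m n $$ (k, l)" .
  qed (use U in auto)
  moreover from this have "U * mat_adjoint U = 1\<^sub>m n"
    using mat_mult_left_right_inverse[OF mat_adjoint_carrier[OF U] U] by simp
  moreover have "\<forall>i<n. U $$ (i, 0) = of_real (1 / sqrt (s 0)) * v $ i"
    using n hd len by (cases ws) (auto simp: U_def)
  ultimately show ?thesis unfolding unitary_def using U by blast
qed

text \<open>Deflation: in an orthonormal basis that starts with an eigenvector, a selfadjoint matrix
  is the direct sum of its eigenvalue and a smaller selfadjoint matrix.\<close>

lemma spectral_fm:
  assumes "adj f = f" "supp f \<subseteq> {..<n}"
  shows "\<exists>U d. unitary_fm n U \<and> f = U * diagm n d * adj U"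
  using assms
proof (induction n arbitrary: f)
  case 0
  then have "f = 0" by (intro fmat_eqI) (auto intro: supp_subsetD[where S = "{}"])
  moreover have "idm {} = (0 :: nat fmat)" by (intro fmat_eqI) (simp add: ent_idm)
  ultimately show ?case
    by (intro exI[of _ 0] exI[of _ "\<lambda>_. 0"]) (auto simp: unitary_fm_def supp_def)
next
  case (Suc n)
  define M where "M = mat (Suc n) (Suc n) (\<lambda>(i, j). ent f i j)"
  have M: "M \<in> carrier_mat (Suc n) (Suc n)" by (simp add: M_def)
  have fM: "fm (Suc n) M = f" unfolding M_def by (rule fm_mat_ent) fact
  obtain v e where v: "v \<in> carrier_vec (Suc n)" "v \<noteq> 0\<^sub>v (Suc n)" "M *\<^sub>v v = e \<cdot>\<^sub>v v"
    using spectrum_non_empty[OF M] M by (auto simp: spectrum_def eigenvalue_def eigenvector_def)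
  obtain V c where V: "unitary (Suc n) V" "\<forall>i<Suc n. V $$ (i, 0) = c * v $ i"
    using ex_unitary_first_col[OF v(1,2)] by blast
  define W where "W = fm (Suc n) V"
  have W: "supp W \<subseteq> {..<Suc n}" "adj W * W = idm {..<Suc n}" "W * adj W = idm {..<Suc n}"
    using unitary_fm_fm[OF V(1)] by (auto simp: W_def unitary_fm_def)
  define g where "g = adj W * f * W"
  have adjg: "adj g = g" using Suc.prems by (simp add: g_def mult.assoc)
  have supg: "supp g \<subseteq> {..<Suc n}"
    using supp_times[of "adj W * f" W] supp_times[of "adj W" f] W(1) Suc.prems by (auto simp: g_def)
  have fg: "f = W * g * adj W"
  proof -
    have "W * g * adj W = (W * adj W) * f * (W * adj W)" by (simp add: g_def mult.assoc)
    then show ?thesis using Suc.prems by (simp add: W idm_times times_idm)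
  qed
  \<comment> \<open>The first column of \<open>W\<close> is a multiple of the eigenvector
    \<open>v\<close>.\<close>
  have col: "ent (f * W) i 0 = e * ent W i 0" for i
  proof (cases "i < Suc n")
    case True
    have "ent (f * W) i 0 = (\<Sum>j<Suc n. M $$ (i, j) * (c * v $ j))"
      using W(1) True V(2) by (subst ent_times[of "{..<Suc n}"]) (auto simp: W_def ent_fm M_def intro!: sum.cong)
    also have "\<dots> = c * (\<Sum>j<Suc n. M $$ (i, j) * v $ j)"
      by (simp only: sum_distrib_left mult_ac)
    also have "(\<Sum>j<Suc n. M $$ (i, j) * v $ j) = (M *\<^sub>v v) $ i"
      using True M v(1) by (simp add: scalar_prod_def lessThan_atLeast0 del: sum.lessThan_Suc)
    also have "\<dots> = e * v $ i" using True v by simp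
    finally show ?thesis using True V(2) by (simp add: W_def ent_fm)
  next
    case False
    have "supp (f * W) \<subseteq> {..<Suc n}" using supp_times[of f W] W(1) Suc.prems by auto
    then show ?thesis using False supp_subsetD[of "f * W" "{..<Suc n}" i 0] supp_subsetD[OF W(1), of i 0] by auto
  qed
  have "ent (adj W * (f * W)) i 0 = e * ent (adj W * W) i 0" for i
    using W(1) by (subst (1 2) ent_times[of "{..<Suc n}"]) (auto simp: col sum_distrib_left mult_ac simp del: sum.lessThan_Suc)
  \<comment> \<open>Only the corner entry of the first column survives. Selfadjointness carries this
    over to the first row and makes \<open>e\<close> real, so \<open>g\<close> splits.\<close>
  then have g0: "ent g i 0 = (if i = 0 then e else 0)" for i
    by (simp add: g_def W mult.assoc ent_idm)
  then have g0': "ent g 0 i = (if i = 0 then cnj e else 0)" for i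
    using arg_cong[OF adjg, of "\<lambda>h. ent h 0 i"] by (simp split: if_splits)
  have e: "e = of_real (Re e)" using g0[of 0] g0'[of 0] by (simp add: complex_eq_iff)
  define h where "h = fmat_of {..<n} (\<lambda>i j. ent g (Suc i) (Suc j))"
  have supg0: "ent g i j = 0" if "i \<notin> {..<Suc n} \<or> j \<notin> {..<Suc n}" for i j
    using that by (rule supp_subsetD[OF supg])
  have "cnj e = e" by (metis e complex_cnj_complex_of_real)
  then have "g = shiftm e h"
    using g0 g0' supg0 by (intro fmat_eqI) (auto simp: ent_shiftm h_def ent_fmat_of gr0_conv_Suc)
  then have gh: "g = shiftm (of_real (Re e)) h" using e by simp
  have "adj h = h"
    using arg_cong[OF adjg, of "\<lambda>h. ent h _ _"] by (intro fmat_eqI) (auto simp: h_def ent_fmat_of)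
  then obtain U d where U: "unitary_fm n U" "h = U * diagm n d * adj U"
    using Suc.IH[of h] by (auto simp: h_def supp_fmat_of)
  have gU: "g = shiftm 1 U * diagm (Suc n) (case_nat (Re e) d) * adj (shiftm 1 U)"
    by (simp add: gh U(2) adj_shiftm shiftm_mult flip: shiftm_diagm)
  have "unitary_fm (Suc n) (W * shiftm 1 U)"
  proof -
    have I: "idm {..<Suc n} * x = x" if "supp x \<subseteq> {..<Suc n}" for x :: "nat fmat"
      using that by (intro idm_times) auto
    have sU: "supp (shiftm 1 U) \<subseteq> {..<Suc n}" using U(1) by (intro supp_shiftm) (simp add: unitary_fm_def)
    have UU: "adj (shiftm 1 U) * shiftm 1 U = idm {..<Suc n}" "shiftm 1 U * adj (shiftm 1 U) = idm {..<Suc n}"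
      using U(1) by (auto simp: adj_shiftm shiftm_mult unitary_fm_def shiftm_idm)
    have "adj (W * shiftm 1 U) * (W * shiftm 1 U) = adj (shiftm 1 U) * ((adj W * W) * shiftm 1 U)"
      by (simp add: mult.assoc)
    also have "\<dots> = idm {..<Suc n}" unfolding W(2) I[OF sU] UU by simp
    finally have 1: "adj (W * shiftm 1 U) * (W * shiftm 1 U) = idm {..<Suc n}" .
    have "(W * shiftm 1 U) * adj (W * shiftm 1 U) = W * ((shiftm 1 U * adj (shiftm 1 U)) * adj W)"
      by (simp add: mult.assoc)
    also have "\<dots> = idm {..<Suc n}" unfolding UU using W by (simp add: I)
    finally show ?thesis
      using 1 supp_times[of W "shiftm 1 U"] W(1) sU by (auto simp: unitary_fm_def)
  qed
  moreover have "f = (W * shiftm 1 U) * diagm (Suc n) (case_nat (Re e) d) * adj (W * shiftm 1 U)"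
    unfolding fg gU by (simp add: mult.assoc)
  ultimately show ?case by blast
qed


lemma fm_decomp:
  assumes "unitary n U"
  shows "fm n (U * mat_diag n (\<lambda>i. complex_of_real (d i)) * mat_adjoint U) = fm n U * diagm n d * adj (fm n U)"
proof -
  have U: "U \<in> carrier_mat n n" using assms by (simp add: unitary_def)
  have "fm n (U * mat_diag n (\<lambda>i. complex_of_real (d i)) * mat_adjoint U)
      = fm n (U * mat_diag n (\<lambda>i. complex_of_real (d i))) * fm n (mat_adjoint U)"
    using U by (intro fm_mult mult_carrier_mat[of _ n n] mat_adjoint_carrier) auto
  also have "\<dots> = fm n U * diagm n d * adj (fm n U)"
    using U by (simp add: fm_mult fm_adjoint fm_mat_diag)
  finally show ?thesis .
qed

lemma spectral_mat:
  assumes "M \<in> carrier_mat n n" "mat_adjoint M = M"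
  shows "\<exists>U d. unitary n U \<and> M = U * mat_diag n (\<lambda>i. complex_of_real (d i)) * mat_adjoint U"
proof -
  have "adj (fm n M) = fm n M" using assms by (metis fm_adjoint)
  then obtain U d where U: "unitary_fm n U" "fm n M = U * diagm n d * adj U"
    using spectral_fm[OF _ supp_fm] by blast
  define V where "V = mat n n (\<lambda>(i, j). ent U i j)"
  have V: "unitary n V" unfolding V_def by (rule unitary_fm_mat) fact
  have "fm n V = U" unfolding V_def by (rule fm_mat_ent) (use U in \<open>simp add: unitary_fm_def\<close>)
  then have "fm n M = fm n (V * mat_diag n (\<lambda>i. complex_of_real (d i)) * mat_adjoint V)"
    by (simp add: fm_decomp[OF V] U(2))
  moreover have "V \<in> carrier_mat n n" by (simp add: V_def)
  ultimately have "M = V * mat_diag n (\<lambda>i. complex_of_real (d i)) * mat_adjoint V"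
    using assms by (intro fm_inj[of M n]) (auto intro!: mult_carrier_mat[of _ n n])
  with V show ?thesis by blast
qed

section \<open>Functional calculus and entropy\<close>

lemma unitary_fm_cancel:
  assumes "unitary_fm n U" "supp f \<subseteq> {..<n}"
  shows "adj U * (U * f) = f" "U * (adj U * f) = f"
  using assms by (simp_all add: unitary_fm_def idm_times flip: mult.assoc)

text \<open>The unitary \<open>W = adj V * U\<close> intertwines the two diagonal matrices: a
  nonzero entry at \<open>i\<close>, \<open>j\<close> forces \<open>d j = d' i\<close>, hence also
  \<open>f (d j) = f (d' i)\<close>. This makes the definite description in \<open>herm_fun\<close>
  well defined.\<close>

lemma diag_fun_unique:
  assumes U: "unitary_fm n U" and V: "unitary_fm n V"
    and eq: "U * diagm n d * adj U = V * diagm n d' * adj V"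
  shows "U * diagm n (\<lambda>i. f (d i)) * adj U = V * diagm n (\<lambda>i. f (d' i)) * adj V"
proof -
  have sU: "supp U \<subseteq> {..<n}" "supp V \<subseteq> {..<n}" using U V by (auto simp: unitary_fm_def)
  define W where "W = adj V * U"
  have UI: "adj U * U = idm {..<n}" "V * adj V = idm {..<n}" using U V by (auto simp: unitary_fm_def)
  have "W * diagm n d = adj V * (U * diagm n d * adj U) * U"
  proof -
    have "adj V * (U * diagm n d * adj U) * U = adj V * U * (diagm n d * (adj U * U))"
      by (simp add: mult.assoc)
    then show ?thesis by (simp add: UI times_idm supp_diagm W_def)
  qed
  also have "\<dots> = (adj V * V) * diagm n d' * (adj V * U)"
    unfolding eq by (simp add: mult.assoc)
  also have "\<dots> = diagm n d' * W"
    using V by (simp add: unitary_fm_def W_def idm_times supp_diagm)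
  finally have comm: "W * diagm n d = diagm n d' * W" .
  have "W * diagm n (\<lambda>i. f (d i)) = diagm n (\<lambda>i. f (d' i)) * W"
  proof (rule fmat_eqI)
    fix i j
    show "ent (W * diagm n (\<lambda>i. f (d i))) i j = ent (diagm n (\<lambda>i. f (d' i)) * W) i j"
    proof (cases "i < n \<and> j < n")
      case True
      then show ?thesis
        using arg_cong[OF comm, of "\<lambda>g. ent g i j"] by (auto simp: ent_diagm_times ent_times_diagm)
    next
      case False
      have "supp W \<subseteq> {..<n}" using supp_times[of "adj V" U] sU by (auto simp: W_def)
      then have "ent W i j = 0" using False by (intro supp_subsetD[of W "{..<n}"]) auto
      then show ?thesis by (simp add: ent_diagm_times ent_times_diagm)
    qed
  qed
  then have "V * (W * diagm n (\<lambda>i. f (d i))) * adj U = V * (diagm n (\<lambda>i. f (d' i)) * W) * adj U"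
    by simp
  moreover have "V * (W * diagm n (\<lambda>i. f (d i))) * adj U = U * diagm n (\<lambda>i. f (d i)) * adj U"
  proof -
    have "V * (W * diagm n (\<lambda>i. f (d i))) * adj U = (V * adj V) * U * diagm n (\<lambda>i. f (d i)) * adj U"
      by (simp add: W_def mult.assoc)
    then show ?thesis by (simp add: UI idm_times sU)
  qed
  moreover have "V * (diagm n (\<lambda>i. f (d' i)) * W) * adj U = V * diagm n (\<lambda>i. f (d' i)) * adj V"
  proof -
    have "U * adj U = idm {..<n}" using U by (simp add: unitary_fm_def)
    moreover have "V * (diagm n (\<lambda>i. f (d' i)) * W) * adj U = V * diagm n (\<lambda>i. f (d' i)) * (adj V * (U * adj U))"
      by (simp add: W_def mult.assoc)
    ultimately show ?thesis using sU by (simp add: times_idm)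
  qed
  ultimately show ?thesis by simp
qed

lemma herm_fun_eq:
  assumes U: "unitary n U" and M: "M = U * mat_diag n (\<lambda>i. complex_of_real (d i)) * mat_adjoint U"
  shows "herm_fun f M = U * mat_diag n (\<lambda>i. complex_of_real (f (d i))) * mat_adjoint U"
proof -
  have n: "dim_row M = n" using U by (auto simp: M unitary_def)
  have car: "V * mat_diag n g * mat_adjoint V \<in> carrier_mat n n" if "unitary n V" for V and g :: "nat \<Rightarrow> complex"
    using that by (auto simp: unitary_def intro!: mult_carrier_mat[of _ n n])
  show ?thesis
    unfolding herm_fun_def n
  proof (rule the_equality)
    fix N assume "\<exists>V d'. unitary n V \<and> M = V * mat_diag n (\<lambda>i. complex_of_real (d' i)) * mat_adjoint V \<and>
      N = V * mat_diag n (\<lambda>i. complex_of_real (f (d' i))) * mat_adjoint V"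
    then obtain V d' where V: "unitary n V"
      "M = V * mat_diag n (\<lambda>i. complex_of_real (d' i)) * mat_adjoint V"
      "N = V * mat_diag n (\<lambda>i. complex_of_real (f (d' i))) * mat_adjoint V" by blast
    have "fm n V * diagm n d' * adj (fm n V) = fm n U * diagm n d * adj (fm n U)"
      using fm_decomp[OF U, of d] fm_decomp[OF V(1), of d'] V(2) M by simp
    from diag_fun_unique[OF unitary_fm_fm[OF V(1)] unitary_fm_fm[OF U] this, of f]
    have "fm n N = fm n (U * mat_diag n (\<lambda>i. complex_of_real (f (d i))) * mat_adjoint U)"
      unfolding V(3) fm_decomp[OF U] fm_decomp[OF V(1)] .
    then show "N = U * mat_diag n (\<lambda>i. complex_of_real (f (d i))) * mat_adjoint U"
      using car[OF U] car[OF V(1)] V(3) by (intro fm_inj[of N n]) auto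
  qed (intro exI conjI, rule U, rule M, rule refl)
qed

lemma entropy_eq:
  assumes U: "unitary n U" and M: "M = U * mat_diag n (\<lambda>i. complex_of_real (d i)) * mat_adjoint U"
  shows "entropy M = - (\<Sum>i<n. d i * log 2 (d i))"
proof -
  let ?N = "U * mat_diag n (\<lambda>i. complex_of_real (log 2 (d i))) * mat_adjoint U"
  have UU: "unitary_fm n (fm n U)" by (rule unitary_fm_fm) fact
  have car: "M \<in> carrier_mat n n" "?N \<in> carrier_mat n n"
    using U by (auto simp: M unitary_def intro!: mult_carrier_mat[of _ n n])
  have "mat_trace (M * ?N) = tr (fm n M * fm n ?N)"
    using car fm_mult[OF car] fm_tr[of "M * ?N" n] by simp
  also have "\<dots> = tr (fm n U * (diagm n d * (adj (fm n U) * (fm n U * (diagm n (\<lambda>i. log 2 (d i)) * adj (fm n U))))))"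
    unfolding M fm_decomp[OF U] by (simp add: mult.assoc)
  also have "\<dots> = tr (fm n U * (diagm n d * (diagm n (\<lambda>i. log 2 (d i)) * adj (fm n U))))"
  proof -
    have "supp (diagm n (\<lambda>i. log 2 (d i)) * adj (fm n U)) \<subseteq> {..<n}"
      using supp_times[of "diagm n (\<lambda>i. log 2 (d i))" "adj (fm n U)"] supp_diagm[of n] supp_fm[of n U] by auto
    then show ?thesis by (simp add: unitary_fm_cancel(1)[OF UU])
  qed
  also have "\<dots> = tr (diagm n (\<lambda>i. d i * log 2 (d i)) * (adj (fm n U) * fm n U))"
    by (subst tr_commute) (simp add: mult.assoc flip: diagm_mult)
  also have "\<dots> = tr (diagm n (\<lambda>i. d i * log 2 (d i)))"
    using UU by (simp add: unitary_fm_def times_idm supp_diagm)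
  finally show ?thesis
    unfolding entropy_def herm_fun_eq[OF U M] by (simp add: tr_diagm)
qed

section \<open>Positive operators\<close>

lemma positive_op_iff:
  "positive_op n M \<longleftrightarrow> M \<in> carrier_mat n n \<and> (\<forall>v. 0 \<le> (\<Sum>i<n. \<Sum>j<n. v i * M $$ (i, j) * cnj (v j)))"
proof (cases "M \<in> carrier_mat n n")
  case M: True
  have form: "(M *\<^sub>v v) \<bullet>c v = (\<Sum>i<n. \<Sum>j<n. cnj (v $ i) * M $$ (i, j) * cnj (cnj (v $ j)))"
    if "v \<in> carrier_vec n" for v
    using M that by (simp add: scalar_prod_def sum_distrib_left sum_distrib_right lessThan_atLeast0 mult_ac)
  show ?thesis
  proof
    assume "positive_op n M"
    then have pos: "0 \<le> (M *\<^sub>v v) \<bullet>c v" if "v \<in> carrier_vec n" for v using that by (simp add: positive_op_def)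
    have "0 \<le> (\<Sum>i<n. \<Sum>j<n. v i * M $$ (i, j) * cnj (v j))" for v
      using pos[of "vec n (\<lambda>i. cnj (v i))"] form[of "vec n (\<lambda>i. cnj (v i))"] by simp
    then show "M \<in> carrier_mat n n \<and> (\<forall>v. 0 \<le> (\<Sum>i<n. \<Sum>j<n. v i * M $$ (i, j) * cnj (v j)))"
      using M by blast
  next
    assume *: "M \<in> carrier_mat n n \<and> (\<forall>v. 0 \<le> (\<Sum>i<n. \<Sum>j<n. v i * M $$ (i, j) * cnj (v j)))"
    show "positive_op n M"
      unfolding positive_op_def
    proof (intro conjI ballI)
      fix v :: "complex vec" assume v: "v \<in> carrier_vec n"
      show "0 \<le> (M *\<^sub>v v) \<bullet>c v"
        unfolding form[OF v] using spec[OF conjunct2[OF *], of "\<lambda>i. cnj (v $ i)"] .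
    qed (rule M)
  qed
qed (simp add: positive_op_def)

lemma positive_op_carrier: "positive_op n M \<Longrightarrow> M \<in> carrier_mat n n"
  by (simp add: positive_op_def)

text \<open>The sum is the quadratic form of \<open>M\<close> at the image of \<open>v\<close> under
  the transpose of \<open>W\<close>.\<close>

lemma positive_op_compress:
  assumes M: "positive_op n M"
  shows "0 \<le> (\<Sum>p\<in>I. \<Sum>q\<in>I. v p * (\<Sum>r<n. \<Sum>s<n. W p r * M $$ (r, s) * cnj (W q s)) * cnj (v q))"
proof -
  have "(\<Sum>p\<in>I. \<Sum>q\<in>I. v p * (\<Sum>r<n. \<Sum>s<n. W p r * M $$ (r, s) * cnj (W q s)) * cnj (v q))
    = (\<Sum>p\<in>I. \<Sum>q\<in>I. \<Sum>r<n. \<Sum>s<n. v p * W p r * M $$ (r, s) * cnj (v q * W q s))"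
    by (simp add: sum_distrib_left sum_distrib_right mult_ac)
  also have "\<dots> = (\<Sum>r<n. \<Sum>s<n. \<Sum>p\<in>I. \<Sum>q\<in>I. v p * W p r * M $$ (r, s) * cnj (v q * W q s))"
    by (rule sum_swap4)
  also have "\<dots> = (\<Sum>r<n. \<Sum>s<n. (\<Sum>p\<in>I. v p * W p r) * M $$ (r, s) * cnj (\<Sum>q\<in>I. v q * W q s))"
    by (simp add: sum_distrib_left sum_distrib_right mult_ac)
  also have "0 \<le> \<dots>"
    using M by (simp only: positive_op_iff)
  finally show ?thesis .
qed

text \<open>A compression by a 0-1 matrix. The index map \<open>f\<close> may repeat or omit
  indices, which is how all regroupings of tensor factors below preserve positivity.\<close>

lemma positive_op_select:
  assumes M: "positive_op n M" and I: "\<And>p. p \<in> I \<Longrightarrow> f p < n"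
  shows "0 \<le> (\<Sum>p\<in>I. \<Sum>q\<in>I. v p * M $$ (f p, f q) * cnj (v q))"
proof -
  have "(\<Sum>r<n. \<Sum>s<n. (if f p = r then 1 else 0) * M $$ (r, s) * cnj (if f q = s then 1 else 0)) = M $$ (f p, f q)"
    if "p \<in> I" "q \<in> I" for p q
  proof -
    have "(\<Sum>r<n. \<Sum>s<n. (if f p = r then 1 else 0) * M $$ (r, s) * cnj (if f q = s then 1 else 0))
      = (\<Sum>r<n. (if f p = r then 1 else 0) * (\<Sum>s<n. M $$ (r, s) * (if s = f q then 1 else 0)))"
      by (simp add: sum_distrib_left) (auto intro!: sum.cong)
    then show ?thesis using I[OF that(1)] I[OF that(2)] by (simp add: sum_indicator_mult)
  qed
  then have "(\<Sum>p\<in>I. \<Sum>q\<in>I. v p * M $$ (f p, f q) * cnj (v q)) =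
    (\<Sum>p\<in>I. \<Sum>q\<in>I. v p * (\<Sum>r<n. \<Sum>s<n. (if f p = r then 1 else 0) * M $$ (r, s) * cnj (if f q = s then 1 else 0)) * cnj (v q))"
    by (intro sum.cong refl) simp
  then show ?thesis
    using positive_op_compress[OF M, of v "\<lambda>p r. if f p = r then 1 else 0" I] by simp
qed

text \<open>Polarisation: the form is real at the sum of the unit vector at \<open>i\<close> and
  \<open>z\<close> times that at \<open>j\<close>; \<open>z = 1\<close> and \<open>z = \<i>\<close>
  determine the imaginary and the real part.\<close>

lemma positive_op_hermitian:
  assumes M: "positive_op n M" and ij: "i < n" "j < n"
  shows "M $$ (j, i) = cnj (M $$ (i, j))"
proof -
  have real_diag: "Im (M $$ (k, k)) = 0" if "k < n" for k
    using positive_op_select[OF M, of "{k}" id "\<lambda>_. 1"] that by (simp add: less_eq_complex_def)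
  have pair: "Im (M $$ (i, j) * cnj z + z * M $$ (j, i)) = 0" if "i \<noteq> j" for z
  proof -
    have "0 \<le> (\<Sum>p\<in>{i, j}. \<Sum>q\<in>{i, j}. (if p = i then 1 else z) * M $$ (id p, id q) * cnj (if q = i then 1 else z))"
      by (rule positive_op_select[OF M]) (use ij in auto)
    then show ?thesis
      using that real_diag[OF ij(1)] real_diag[OF ij(2)]
      by (auto simp: less_eq_complex_def algebra_simps)
  qed
  show ?thesis
  proof (cases "i = j")
    case True
    then show ?thesis using real_diag[OF ij(1)] by (simp add: complex_eq_iff)
  next
    case False
    then show ?thesis using pair[of 1] pair[of \<i>] by (simp add: complex_eq_iff)
  qed
qed

lemma positive_op_adjoint:
  assumes M: "positive_op n M"
  shows "mat_adjoint M = M"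
proof (rule eq_matI)
  have n: "dim_row M = n" "dim_col M = n" using positive_op_carrier[OF M] by auto
  fix i j assume "i < dim_row M" "j < dim_col M"
  then show "mat_adjoint M $$ (i, j) = M $$ (i, j)"
    using positive_op_hermitian[OF M, of j i] n by (simp add: mat_adjoint_index)
qed (use positive_op_carrier[OF M] in auto)

lemma psd_compress:
  assumes M: "positive_op n M" and I: "finite I"
  shows "psd (fmat_of I (\<lambda>p q. \<Sum>r<n. \<Sum>s<n. W p r * M $$ (r, s) * cnj (W q s)))" (is "psd ?f")
proof (rule psdI[OF _ I])
  show "adj ?f = ?f"
  proof (rule fmat_eqI)
    fix p q
    have "cnj (\<Sum>r<n. \<Sum>s<n. W q r * M $$ (r, s) * cnj (W p s)) = (\<Sum>r<n. \<Sum>s<n. W p s * M $$ (s, r) * cnj (W q r))"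
      unfolding cnj_sum
    proof (intro sum.cong refl)
      fix r s assume "r \<in> {..<n}" "s \<in> {..<n}"
      then show "cnj (W q r * M $$ (r, s) * cnj (W p s)) = W p s * M $$ (s, r) * cnj (W q r)"
        by (subst positive_op_hermitian[OF M, of r s]) (auto simp: mult_ac)
    qed
    also have "\<dots> = (\<Sum>r<n. \<Sum>s<n. W p r * M $$ (r, s) * cnj (W q s))"
      by (rule sum.swap)
    finally show "ent (adj ?f) p q = ent ?f p q" using I by (auto simp: ent_fmat_of)
  qed
  show "supp ?f \<subseteq> I" using I by (rule supp_fmat_of)
  fix v
  have "(\<Sum>p\<in>I. \<Sum>q\<in>I. v p * ent ?f p q * cnj (v q))
    = (\<Sum>p\<in>I. \<Sum>q\<in>I. v p * (\<Sum>r<n. \<Sum>s<n. W p r * M $$ (r, s) * cnj (W q s)) * cnj (v q))"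
    using I by (intro sum.cong refl) (simp add: ent_fmat_of)
  then show "0 \<le> Re (\<Sum>p\<in>I. \<Sum>q\<in>I. v p * ent ?f p q * cnj (v q))"
    using positive_op_compress[OF M, of v W I] by (simp add: less_eq_complex_def)
qed

lemma psd_select:
  assumes M: "positive_op n M" and I: "finite I" "\<And>p. p \<in> I \<Longrightarrow> f p < n"
  shows "psd (fmat_of I (\<lambda>p q. M $$ (f p, f q)))" (is "psd ?g")
proof (rule psdI[OF _ I(1)])
  show "adj ?g = ?g"
  proof (rule fmat_eqI)
    fix p q
    show "ent (adj ?g) p q = ent ?g p q"
      using I(1) positive_op_hermitian[OF M I(2) I(2), of q p] by (simp add: ent_fmat_of)
  qed
  show "supp ?g \<subseteq> I" using I(1) by (rule supp_fmat_of)
  fix v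
  have "(\<Sum>p\<in>I. \<Sum>q\<in>I. v p * ent ?g p q * cnj (v q)) = (\<Sum>p\<in>I. \<Sum>q\<in>I. v p * M $$ (f p, f q) * cnj (v q))"
    using I by (intro sum.cong refl) (simp add: ent_fmat_of)
  then show "0 \<le> Re (\<Sum>p\<in>I. \<Sum>q\<in>I. v p * ent ?g p q * cnj (v q))"
    using positive_op_select[OF M I(2), where v = v] by (simp add: less_eq_complex_def)
qed

lemma psd_fm: "positive_op n M \<Longrightarrow> psd (fm n M)"
  unfolding fm_def by (rule psd_select) auto

text \<open>The lower bound makes every eigenvalue positive, so the reciprocals can be taken in an
  eigenbasis.\<close>

lemma ex_inv_on:
  fixes f :: "nat fmat"
  assumes f: "supp f \<subseteq> {..<n}" and le: "psd (f - \<kappa> *\<^sub>R idm {..<n})" and \<kappa>: "0 < \<kappa>"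
  shows "\<exists>N. inv_on {..<n} f N"
proof -
  have "adj f = f" using psd_adj[OF le] by simp
  then obtain U d where U: "unitary_fm n U" "f = U * diagm n d * adj U"
    using spectral_fm[OF _ f] by blast
  have UU: "adj U * U = idm {..<n}" "U * adj U = idm {..<n}" "supp U \<subseteq> {..<n}"
    using U(1) by (auto simp: unitary_fm_def)
  have d: "0 < d i" if "i < n" for i
  proof -
    have "adj U * (f - \<kappa> *\<^sub>R idm {..<n}) * U = (adj U * U) * diagm n d * (adj U * U) - \<kappa> *\<^sub>R (adj U * (idm {..<n} * U))"
      by (simp add: U(2) algebra_simps)
    also have "\<dots> = diagm n d - \<kappa> *\<^sub>R idm {..<n}"
      using UU by (simp add: idm_times times_idm supp_diagm)
    finally have "psd (diagm n d - \<kappa> *\<^sub>R idm {..<n})"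
      using psd_conj[OF le, of "adj U"] by simp
    from psd_ent_nonneg[OF this, of i] show ?thesis using that \<kappa> by (simp add: ent_diagm ent_idm)
  qed
  define N where "N = U * diagm n (\<lambda>i. 1 / d i) * adj U"
  have inv: "diagm n (\<lambda>i. if d i = 0 then 0 else 1) = idm {..<n}"
    using less_imp_neq[OF d] by (intro fmat_eqI) (auto simp: ent_diagm ent_idm)
  have "f * N = U * (diagm n d * (adj U * U) * diagm n (\<lambda>i. 1 / d i)) * adj U"
    by (simp add: U(2) N_def mult.assoc)
  also have "\<dots> = idm {..<n}"
    using UU by (simp add: times_idm supp_diagm diagm_mult inv)
  finally have 1: "f * N = idm {..<n}" .
  have "N * f = U * (diagm n (\<lambda>i. 1 / d i) * (adj U * U) * diagm n d) * adj U"
    by (simp add: U(2) N_def mult.assoc)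
  also have "\<dots> = idm {..<n}"
    using UU by (simp add: times_idm supp_diagm diagm_mult inv)
  finally have 2: "N * f = idm {..<n}" .
  have "supp N \<subseteq> {..<n}"
    using supp_times[of "U * diagm n (\<lambda>i. 1 / d i)" "adj U"] supp_times[of U "diagm n (\<lambda>i. 1 / d i)"]
      UU(3) supp_diagm[of n "\<lambda>i. 1 / d i"] by (auto simp: N_def)
  then show ?thesis
    using 1 2 by (intro exI[of _ N]) (simp add: inv_on_def N_def mult.assoc)
qed

text \<open>\<open>B\<close> is the absolute value of \<rho> - \<sigma> and \<open>K\<close> its
  sign. \<open>B\<close> serves to exploit a small distance, as it dominates the difference and has
  small trace; \<open>K\<close> serves to bound a distance, as it turns it into a trace.\<close>

lemma trace_dist_witness:
  assumes "\<rho> \<in> carrier_mat n n" "\<sigma> \<in> carrier_mat n n" "mat_adjoint (\<rho> - \<sigma>) = \<rho> - \<sigma>"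
  shows "\<exists>B K. supp B \<subseteq> {..<n} \<and> psd B \<and> psd (B - fm n (\<rho> - \<sigma>)) \<and> Re (tr B) = 2 * trace_dist \<rho> \<sigma>
    \<and> supp K \<subseteq> {..<n} \<and> adj K * K = idm {..<n} \<and> 2 * trace_dist \<rho> \<sigma> = Re (tr (K * fm n (\<rho> - \<sigma>)))"
proof -
  define M where "M = \<rho> - \<sigma>"
  have M: "M \<in> carrier_mat n n" "mat_adjoint M = M" using assms by (auto simp: M_def)
  obtain V d where V: "unitary n V" "M = V * mat_diag n (\<lambda>i. complex_of_real (d i)) * mat_adjoint V"
    using spectral_mat[OF M] by blast
  define U where "U = fm n V"
  have U: "unitary_fm n U" unfolding U_def by (rule unitary_fm_fm) (rule V(1))
  have UU: "adj U * U = idm {..<n}" "U * adj U = idm {..<n}" "supp U \<subseteq> {..<n}"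
    using U by (auto simp: unitary_fm_def)
  have fM: "fm n M = U * diagm n d * adj U" unfolding V(2) U_def by (rule fm_decomp) (rule V(1))
  have conj_mult: "U * diagm n c * adj U * (U * diagm n c' * adj U) = U * diagm n (\<lambda>i. c i * c' i) * adj U" for c c'
  proof -
    have "U * diagm n c * adj U * (U * diagm n c' * adj U) = U * (diagm n c * (adj U * U) * diagm n c') * adj U"
      by (simp add: mult.assoc)
    then show ?thesis using UU by (simp add: times_idm supp_diagm diagm_mult)
  qed
  have supp_conj: "supp (U * diagm n c * adj U) \<subseteq> {..<n}" for c
    using supp_times[of "U * diagm n c" "adj U"] supp_times[of U "diagm n c"] UU(3) supp_diagm[of n c] by auto
  have "fm n (mat_adjoint M * M) = fm n (V * mat_diag n (\<lambda>i. complex_of_real (d i * d i)) * mat_adjoint V)"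
    using M fm_mult[OF M(1) M(1)] fm_decomp[OF V(1), of "\<lambda>i. d i * d i"]
    by (simp add: fM conj_mult flip: U_def)
  moreover have "V \<in> carrier_mat n n" using V by (simp add: unitary_def)
  ultimately have "mat_adjoint M * M = V * mat_diag n (\<lambda>i. complex_of_real (d i * d i)) * mat_adjoint V"
    using M by (intro fm_inj[of _ n]) (auto intro!: mult_carrier_mat[of _ n n])
  from herm_fun_eq[OF V(1) this, of sqrt]
  have abs: "abs_op M = V * mat_diag n (\<lambda>i. complex_of_real \<bar>d i\<bar>) * mat_adjoint V"
    by (simp add: abs_op_def)
  define B where "B = U * diagm n (\<lambda>i. \<bar>d i\<bar>) * adj U"
  have B: "fm n (abs_op M) = B" unfolding abs B_def U_def by (rule fm_decomp) (rule V(1))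
  have "abs_op M \<in> carrier_mat n n"
    unfolding abs using \<open>V \<in> carrier_mat n n\<close> by (auto intro!: mult_carrier_mat[of _ n n])
  then have trB: "tr B = mat_trace (abs_op M)" by (simp add: fm_tr flip: B)
  \<comment> \<open>The sign is set to 1 at the eigenvalue 0, so that \<open>K\<close> is unitary on
    all of the space.\<close>
  define K where "K = U * diagm n (\<lambda>i. if 0 \<le> d i then 1 else -1) * adj U"
  have adjK: "adj K = K" by (simp add: K_def mult.assoc)
  have "K * K = U * diagm n (\<lambda>_. 1) * adj U"
    unfolding K_def conj_mult by (simp add: if_distrib cong: if_cong)
  also have "\<dots> = idm {..<n}"
    using UU by (simp add: times_idm flip: idm_diagm)
  finally have KK: "adj K * K = idm {..<n}" by (simp add: adjK)
  have "K * fm n M = U * diagm n (\<lambda>i. (if 0 \<le> d i then 1 else -1) * d i) * adj U"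
    unfolding K_def fM by (rule conj_mult)
  also have "\<dots> = B" unfolding B_def by (intro arg_cong2[of _ _ _ _ "(*)"] refl arg_cong[of _ _ "diagm n"]) auto
  finally have KM: "K * fm n M = B" .
  have "psd (U * diagm n (\<lambda>i. \<bar>d i\<bar> - d i) * adj U)"
    by (intro psd_conj psd_diagm) auto
  then have "psd (B - fm n M)" by (simp add: B_def fM algebra_simps flip: diagm_diff)
  moreover have "psd B" unfolding B_def by (intro psd_conj psd_diagm) auto
  moreover have "2 * trace_dist \<rho> \<sigma> = Re (tr B)" by (simp add: trace_dist_def trB M_def)
  ultimately show ?thesis
    using KK KM supp_conj by (intro exI[of _ B] exI[of _ K]) (auto simp: B_def K_def simp flip: M_def)
qed

section \<open>LOPC operations in the presence of an additional system of Eve\<close>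

lemma sum_mult_index:
  "(\<Sum>r<a * b. F r) = (\<Sum>i<a. \<Sum>j<b. F (i * b + j :: nat))"
proof (induction a)
  case (Suc a)
  have "(\<Sum>r<Suc a * b. F r) = (\<Sum>r<a * b. F r) + (\<Sum>r=a * b..<a * b + b. F r)"
    using sum.atLeastLessThan_concat[of 0 "a * b" "a * b + b" F] by (simp add: lessThan_atLeast0 add.commute)
  also have "(\<Sum>r=a * b..<a * b + b. F r) = (\<Sum>j<b. F (a * b + j))"
    using sum.shift_bounds_nat_ivl[of F 0 "a * b" b] by (simp add: lessThan_atLeast0 add.commute)
  finally show ?case using Suc by simp
qed simp

lemma mult_index_less: "i < a \<Longrightarrow> j < b \<Longrightarrow> i * b + j < a * (b :: nat)"
proof -
  assume "i < a" "j < b"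
  then have "i * b + j < i * b + b" by simp
  also have "\<dots> = Suc i * b" by simp
  also have "\<dots> \<le> a * b" using \<open>i < a\<close> by (intro mult_le_mono1) simp
  finally show ?thesis .
qed

lemma index_divmod: "(r :: nat) < a * b \<Longrightarrow> r div b < a \<and> r mod b < b"
proof -
  assume r: "r < a * b"
  then have "b \<noteq> 0" by (cases b) auto
  then show ?thesis using r by (simp add: less_mult_imp_div_less)
qed

lemma index_less_multE:
  assumes "(r :: nat) < a * b"
  obtains i j where "i < a" "j < b" "r = i * b + j"
  using index_divmod[OF assms] that[of "r div b" "r mod b"] by simp

definition tri :: "nat \<Rightarrow> nat \<Rightarrow> nat \<Rightarrow> (nat \<times> nat \<times> nat) set" where
  "tri a b e = {..<a} \<times> {..<b} \<times> {..<e}"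

lemma mem_tri [simp]: "(i, j, k) \<in> tri a b e \<longleftrightarrow> i < a \<and> j < b \<and> k < e"
  by (simp add: tri_def)

lemma sum_tri: "(\<Sum>p\<in>tri a b e. F p) = (\<Sum>i<a. \<Sum>j<b. \<Sum>k<e. F (i, j, k))"
  by (simp add: tri_def sum_Times)

lemma tri_enc_less: "p \<in> tri a b e \<Longrightarrow> tri_enc b e p < a * b * e"
  by (cases p) (auto intro!: mult_index_less)

lemma tri_dec_enc: "p \<in> tri a b e \<Longrightarrow> tri_dec b e (tri_enc b e p) = p"
proof (cases p)
  case (fields i j k)
  assume "p \<in> tri a b e"
  then have lt: "j < b" "k < e" using fields by auto
  have "((i * b + j) * e + k) div e = i * b + j" using lt by simp
  moreover have "((i * b + j) * e + k) div (b * e) = i"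
  proof -
    have "((i * b + j) * e + k) div (b * e) = ((i * b + j) * e + k) div e div b"
      by (metis div_mult2_eq mult.commute)
    then show ?thesis using lt by simp
  qed
  ultimately show ?thesis using lt fields by (simp add: tri_dec_def)
qed

lemma tri_enc_surj:
  assumes "r < a * b * e"
  obtains p where "p \<in> tri a b e" "r = tri_enc b e p"
proof -
  obtain u k where 1: "u < a * b" "k < e" "r = u * e + k" using assms by (rule index_less_multE)
  obtain i j where "i < a" "j < b" "u = i * b + j" using 1(1) by (rule index_less_multE)
  then show ?thesis using 1 that[of "(i, j, k)"] by simp
qed

lemma sum_tri_enc: "(\<Sum>r<a * b * e. F r) = (\<Sum>p\<in>tri a b e. F (tri_enc b e p))"
  by (simp add: sum_tri sum_mult_index)

lemma tri_mat_carrier [simp]: "tri_mat a b e f \<in> carrier_mat (a * b * e) (a * b * e)"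
  by (simp add: tri_mat_def)

lemma tri_mat_dim [simp]: "dim_row (tri_mat a b e f) = a * b * e" "dim_col (tri_mat a b e f) = a * b * e"
  by (simp_all add: tri_mat_def)

lemma tri_mat_index:
  "p \<in> tri a b e \<Longrightarrow> q \<in> tri a b e \<Longrightarrow> tri_mat a b e f $$ (tri_enc b e p, tri_enc b e q) = f p q"
  using tri_enc_less[of p] tri_enc_less[of q] by (simp add: tri_mat_def tri_dec_enc[of _ a])

lemma tri_mat_eqI:
  assumes "X \<in> carrier_mat (a * b * e) (a * b * e)" "Y \<in> carrier_mat (a * b * e) (a * b * e)"
    and "\<And>p q. p \<in> tri a b e \<Longrightarrow> q \<in> tri a b e \<Longrightarrow>
      X $$ (tri_enc b e p, tri_enc b e q) = Y $$ (tri_enc b e p, tri_enc b e q)"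
  shows "X = Y"
proof (rule eq_matI)
  fix r s assume "r < dim_row Y" "s < dim_col Y"
  then have "r < a * b * e" "s < a * b * e" using assms by auto
  then obtain p q where "p \<in> tri a b e" "r = tri_enc b e p" "q \<in> tri a b e" "s = tri_enc b e q"
    by (metis tri_enc_surj)
  then show "X $$ (r, s) = Y $$ (r, s)" using assms(3) by simp
qed (use assms in auto)

lemma positive_op_tri:
  "positive_op (a * b * e) X \<longleftrightarrow> X \<in> carrier_mat (a * b * e) (a * b * e) \<and>
    (\<forall>v. 0 \<le> (\<Sum>p\<in>tri a b e. \<Sum>q\<in>tri a b e. v p * X $$ (tri_enc b e p, tri_enc b e q) * cnj (v q)))"
    (is "?L \<longleftrightarrow> ?R")
proof
  assume L: ?L
  then show ?R
    by (auto simp: positive_op_carrier intro!: positive_op_select tri_enc_less)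
next
  assume R: ?R
  show ?L
    unfolding positive_op_iff
  proof (intro conjI allI)
    fix v
    have "(\<Sum>i<a * b * e. \<Sum>j<a * b * e. v i * X $$ (i, j) * cnj (v j))
      = (\<Sum>p\<in>tri a b e. \<Sum>q\<in>tri a b e. v (tri_enc b e p) * X $$ (tri_enc b e p, tri_enc b e q) * cnj (v (tri_enc b e q)))"
      by (simp add: sum_tri_enc)
    then show "0 \<le> (\<Sum>i<a * b * e. \<Sum>j<a * b * e. v i * X $$ (i, j) * cnj (v j))"
      using spec[OF conjunct2[OF R], of "\<lambda>p. v (tri_enc b e p)"] by simp
  qed (use R in blast)
qed

lemma mat_trace_tri:
  "X \<in> carrier_mat (a * b * e) (a * b * e) \<Longrightarrow> mat_trace X = (\<Sum>p\<in>tri a b e. X $$ (tri_enc b e p, tri_enc b e p))"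
  by (simp add: mat_trace_def sum_tri_enc)

text \<open>The dimension is an explicit argument because an empty family of matrices does not
  determine the size of its zero sum.\<close>

definition lincomb :: "nat \<Rightarrow> ('k \<Rightarrow> complex) \<Rightarrow> ('k \<Rightarrow> complex mat) \<Rightarrow> 'k set \<Rightarrow> complex mat" where
  "lincomb n c X K = mat n n (\<lambda>rs. \<Sum>k\<in>K. c k * X k $$ rs)"

lemma lincomb_carrier [simp]: "lincomb n c X K \<in> carrier_mat n n"
  by (simp add: lincomb_def)

lemma lincomb_dim [simp]: "dim_row (lincomb n c X K) = n" "dim_col (lincomb n c X K) = n"
  by (simp_all add: lincomb_def)

lemma lincomb_index: "r < n \<Longrightarrow> s < n \<Longrightarrow> lincomb n c X K $$ (r, s) = (\<Sum>k\<in>K. c k * X k $$ (r, s))"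
  by (simp add: lincomb_def)

lemma lincomb_insert:
  assumes "finite K" "k \<notin> K" "X k \<in> carrier_mat n n"
  shows "lincomb n c X (insert k K) = c k \<cdot>\<^sub>m X k + lincomb n c X K"
  using assms by (intro eq_matI) (auto simp: lincomb_index)

lemma cptp_lincomb:
  assumes \<Lambda>: "cptp d d' \<Lambda>" and K: "finite K" "\<And>k. k \<in> K \<Longrightarrow> X k \<in> carrier_mat d d"
  shows "\<Lambda> (lincomb d c X K) = lincomb d' c (\<lambda>k. \<Lambda> (X k)) K"
  using K
proof (induction K rule: finite_induct)
  case empty
  \<comment> \<open>Homogeneity at the scalar 0 shows that the map sends zero to zero.\<close>
  have "\<Lambda> (0 \<cdot>\<^sub>m lincomb d c X {}) = 0 \<cdot>\<^sub>m \<Lambda> (lincomb d c X {})"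
    using \<Lambda> lincomb_carrier unfolding cptp_def by blast
  moreover have "0 \<cdot>\<^sub>m lincomb d c X {} = lincomb d c X {}"
    by (intro eq_matI) (auto simp: lincomb_def)
  moreover have "\<Lambda> (lincomb d c X {}) \<in> carrier_mat d' d'"
    using \<Lambda> lincomb_carrier unfolding cptp_def by blast
  ultimately show ?case
    by (intro eq_matI) (auto simp: lincomb_def, metis carrier_matD index_smult_mat(1) mult_zero_left)
next
  case (insert k K)
  have Xk: "X k \<in> carrier_mat d d" using insert.prems by simp
  have "\<Lambda> (lincomb d c X (insert k K)) = \<Lambda> (c k \<cdot>\<^sub>m X k) + \<Lambda> (lincomb d c X K)"
    unfolding lincomb_insert[where X = X and k = k, OF insert.hyps(1,2) Xk]
    using \<Lambda> Xk lincomb_carrier[of d c X K] smult_carrier_mat[OF Xk] unfolding cptp_def by blast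
  also have "\<Lambda> (c k \<cdot>\<^sub>m X k) = c k \<cdot>\<^sub>m \<Lambda> (X k)"
    using \<Lambda> Xk unfolding cptp_def by blast
  also have "\<Lambda> (lincomb d c X K) = lincomb d' c (\<lambda>k. \<Lambda> (X k)) K"
    using insert by simp
  also have "c k \<cdot>\<^sub>m \<Lambda> (X k) + \<dots> = lincomb d' c (\<lambda>k. \<Lambda> (X k)) (insert k K)"
    by (rule lincomb_insert[where X = "\<lambda>k. \<Lambda> (X k)", symmetric]) (use insert.hyps \<Lambda> Xk in \<open>auto simp: cptp_def\<close>)
  finally show ?case .
qed

definition slice :: "nat \<Rightarrow> nat \<Rightarrow> complex mat \<Rightarrow> nat \<times> nat \<Rightarrow> nat \<times> nat \<Rightarrow> complex mat" where
  "slice d l X = (\<lambda>(p, s) (p', s'). mat d d (\<lambda>(u, v). X $$ (tri_enc d l (p, u, s), tri_enc d l (p', v, s'))))"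

lemma slice_carrier [simp]: "slice d l X x y \<in> carrier_mat d d"
  by (simp add: slice_def split_def)

lemma slice_dim [simp]: "dim_row (slice d l X x y) = d" "dim_col (slice d l X x y) = d"
  by (simp_all add: slice_def split_def)

lemma slice_index: "u < d \<Longrightarrow> v < d \<Longrightarrow>
  slice d l X (p, s) (p', s') $$ (u, v) = X $$ (tri_enc d l (p, u, s), tri_enc d l (p', v, s'))"
  by (simp add: slice_def)

lemma lift_op_index:
  assumes "p < k" "q < d'" "s < l" "p' < k" "q' < d'" "s' < l"
  shows "lift_op k l d d' \<Lambda> X $$ (tri_enc d' l (p, q, s), tri_enc d' l (p', q', s'))
    = \<Lambda> (slice d l X (p, s) (p', s')) $$ (q, q')"
  using assms unfolding lift_op_def slice_def by (subst tri_mat_index) auto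

lemma lift_op_carrier [simp]: "lift_op k l d d' \<Lambda> X \<in> carrier_mat (k * d' * l) (k * d' * l)"
  by (simp add: lift_op_def)

text \<open>\<open>cptp\<close> tests complete positivity with a reference system on the left only.
  The two outer systems, of dimensions \<open>k\<close> and \<open>l\<close>, are therefore merged
  into one reference of dimension \<open>k * l\<close>.\<close>

lemma lift_op_positive:
  assumes \<Lambda>: "cptp d d' \<Lambda>" and X: "positive_op (k * d * l) X"
  shows "positive_op (k * d' * l) (lift_op k l d d' \<Lambda> X)"
proof -
  define X' where "X' = tri_mat (k * l) d 1 (\<lambda>(r, u, _) (r', u', _).
    X $$ (tri_enc d l (r div l, u, r mod l), tri_enc d l (r' div l, u', r' mod l)))"
  have l: "r div l < k \<and> r mod l < l" if "r < k * l" for r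
    using that by (rule index_divmod)
  have in1: "(fst p div l, fst (snd p), fst p mod l) \<in> tri k d l" if "p \<in> tri (k * l) d 1" for p
    using that l[of "fst p"] by (cases p) simp
  have in2: "(fst p * l + snd (snd p), fst (snd p), 0) \<in> tri (k * l) d' 1" if "p \<in> tri k d' l" for p
    using that by (cases p) (simp add: mult_index_less)
  have "positive_op (k * l * d * 1) X'"
    unfolding positive_op_tri
  proof (intro conjI allI)
    fix v :: "nat \<times> nat \<times> nat \<Rightarrow> complex"
    have "(\<Sum>p\<in>tri (k * l) d 1. \<Sum>q\<in>tri (k * l) d 1. v p * X' $$ (tri_enc d 1 p, tri_enc d 1 q) * cnj (v q))
      = (\<Sum>p\<in>tri (k * l) d 1. \<Sum>q\<in>tri (k * l) d 1. v p *
          X $$ (tri_enc d l (fst p div l, fst (snd p), fst p mod l), tri_enc d l (fst q div l, fst (snd q), fst q mod l)) * cnj (v q))"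
      unfolding X'_def by (intro sum.cong refl) (simp add: tri_mat_index split_def)
    also have "0 \<le> \<dots>"
      by (rule positive_op_select[OF X, where f = "\<lambda>p. tri_enc d l (fst p div l, fst (snd p), fst p mod l)"])
        (rule tri_enc_less[OF in1])
    finally show "0 \<le> (\<Sum>p\<in>tri (k * l) d 1. \<Sum>q\<in>tri (k * l) d 1. v p * X' $$ (tri_enc d 1 p, tri_enc d 1 q) * cnj (v q))" .
  qed (unfold X'_def, rule tri_mat_carrier)
  then have "positive_op (k * l * d) X'" by (simp only: mult_1_right)
  moreover have "\<forall>k X. positive_op (k * d) X \<longrightarrow> positive_op (k * d') (lift_op k 1 d d' \<Lambda> X)"
    using \<Lambda> unfolding cptp_def by blast
  ultimately have "positive_op (k * l * d') (lift_op (k * l) 1 d d' \<Lambda> X')" by blast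
  then have Y': "positive_op (k * l * d' * 1) (lift_op (k * l) 1 d d' \<Lambda> X')" by (simp only: mult_1_right)
  show ?thesis
    unfolding positive_op_tri
  proof (intro conjI allI)
    fix v :: "nat \<times> nat \<times> nat \<Rightarrow> complex"
    have eq: "lift_op k l d d' \<Lambda> X $$ (tri_enc d' l p, tri_enc d' l q) =
      lift_op (k * l) 1 d d' \<Lambda> X' $$ (tri_enc d' 1 (fst p * l + snd (snd p), fst (snd p), 0), tri_enc d' 1 (fst q * l + snd (snd q), fst (snd q), 0))"
      if pq: "p \<in> tri k d' l" "q \<in> tri k d' l" for p q
    proof -
      obtain i j s i' j' s' where p: "p = (i, j, s)" "q = (i', j', s')" by (cases p, cases q)
      have lt: "i < k" "j < d'" "s < l" "i' < k" "j' < d'" "s' < l" using pq by (auto simp: p)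
      have lt': "i * l + s < k * l" "i' * l + s' < k * l" using lt by (auto intro: mult_index_less)
      have "slice d l X (i, s) (i', s') = slice d 1 X' (i * l + s, 0) (i' * l + s', 0)"
      proof (rule eq_matI)
        fix u v assume "u < dim_row (slice d 1 X' (i * l + s, 0) (i' * l + s', 0))" "v < dim_col (slice d 1 X' (i * l + s, 0) (i' * l + s', 0))"
        then have uv: "u < d" "v < d" by simp_all
        show "slice d l X (i, s) (i', s') $$ (u, v) = slice d 1 X' (i * l + s, 0) (i' * l + s', 0) $$ (u, v)"
          unfolding slice_index[OF uv] unfolding X'_def using uv lt lt' by (subst tri_mat_index) (simp_all del: tri_enc.simps)
      qed simp_all
      then show ?thesis
        unfolding p fst_conv snd_conv using lt lt' by (subst (1 2) lift_op_index) auto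
    qed
    have "(\<Sum>p\<in>tri k d' l. \<Sum>q\<in>tri k d' l. v p * lift_op k l d d' \<Lambda> X $$ (tri_enc d' l p, tri_enc d' l q) * cnj (v q))
      = (\<Sum>p\<in>tri k d' l. \<Sum>q\<in>tri k d' l. v p * lift_op (k * l) 1 d d' \<Lambda> X' $$
          (tri_enc d' 1 (fst p * l + snd (snd p), fst (snd p), 0), tri_enc d' 1 (fst q * l + snd (snd q), fst (snd q), 0)) * cnj (v q))"
      by (intro sum.cong refl) (simp only: eq)
    also have "0 \<le> \<dots>"
      by (rule positive_op_select[OF Y', where f = "\<lambda>p. tri_enc d' 1 (fst p * l + snd (snd p), fst (snd p), 0)"])
        (rule tri_enc_less[OF in2])
    finally show "0 \<le> (\<Sum>p\<in>tri k d' l. \<Sum>q\<in>tri k d' l. v p * lift_op k l d d' \<Lambda> X $$ (tri_enc d' l p, tri_enc d' l q) * cnj (v q))" .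
  qed simp
qed

lemma lift_op_trace:
  assumes \<Lambda>: "cptp d d' \<Lambda>" and X: "X \<in> carrier_mat (k * d * l) (k * d * l)"
  shows "mat_trace (lift_op k l d d' \<Lambda> X) = mat_trace X"
proof -
  have "mat_trace (lift_op k l d d' \<Lambda> X) = (\<Sum>p<k. \<Sum>q<d'. \<Sum>s<l. \<Lambda> (slice d l X (p, s) (p, s)) $$ (q, q))"
    by (subst mat_trace_tri[OF lift_op_carrier]) (simp add: sum_tri lift_op_index del: tri_enc.simps)
  also have "\<dots> = (\<Sum>p<k. \<Sum>s<l. \<Sum>q<d'. \<Lambda> (slice d l X (p, s) (p, s)) $$ (q, q))"
    by (intro sum.cong refl sum.swap)
  also have "\<dots> = (\<Sum>p<k. \<Sum>s<l. mat_trace (slice d l X (p, s) (p, s)))"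
  proof (intro sum.cong refl)
    fix p s
    have "\<Lambda> (slice d l X (p, s) (p, s)) \<in> carrier_mat d' d'" "mat_trace (\<Lambda> (slice d l X (p, s) (p, s))) = mat_trace (slice d l X (p, s) (p, s))"
      using \<Lambda> slice_carrier unfolding cptp_def by blast+
    then show "(\<Sum>q<d'. \<Lambda> (slice d l X (p, s) (p, s)) $$ (q, q)) = mat_trace (slice d l X (p, s) (p, s))"
      by (metis carrier_matD(1) mat_trace_def)
  qed
  also have "\<dots> = (\<Sum>p<k. \<Sum>s<l. \<Sum>u<d. X $$ (tri_enc d l (p, u, s), tri_enc d l (p, u, s)))"
    unfolding mat_trace_def by (intro sum.cong) (auto simp: slice_def)
  also have "\<dots> = (\<Sum>p<k. \<Sum>u<d. \<Sum>s<l. X $$ (tri_enc d l (p, u, s), tri_enc d l (p, u, s)))"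
    by (intro sum.cong refl sum.swap)
  also have "\<dots> = mat_trace X" by (subst mat_trace_tri[OF X]) (simp add: sum_tri)
  finally show ?thesis .
qed

lemma lift_op_lincomb:
  assumes \<Lambda>: "cptp d d' \<Lambda>" and K: "finite K"
  shows "lift_op k l d d' \<Lambda> (lincomb (k * d * l) c X K) = lincomb (k * d' * l) c (\<lambda>x. lift_op k l d d' \<Lambda> (X x)) K"
proof (rule tri_mat_eqI[of _ k d' l])
  fix p q assume pq: "p \<in> tri k d' l" "q \<in> tri k d' l"
  obtain i j s i' j' s' where p: "p = (i, j, s)" "q = (i', j', s')" by (cases p, cases q)
  have lt: "i < k" "j < d'" "s < l" "i' < k" "j' < d'" "s' < l" using pq by (auto simp: p)
  have "slice d l (lincomb (k * d * l) c X K) (i, s) (i', s') = lincomb d c (\<lambda>x. slice d l (X x) (i, s) (i', s')) K"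
  proof (rule eq_matI)
    fix u v assume "u < dim_row (lincomb d c (\<lambda>x. slice d l (X x) (i, s) (i', s')) K)" "v < dim_col (lincomb d c (\<lambda>x. slice d l (X x) (i, s) (i', s')) K)"
    then have uv: "u < d" "v < d" by (auto simp: lincomb_def)
    have "tri_enc d l (i, u, s) < k * d * l" "tri_enc d l (i', v, s') < k * d * l"
      using lt uv by (auto intro!: tri_enc_less simp del: tri_enc.simps)
    then show "slice d l (lincomb (k * d * l) c X K) (i, s) (i', s') $$ (u, v) = lincomb d c (\<lambda>x. slice d l (X x) (i, s) (i', s')) K $$ (u, v)"
      by (simp add: slice_index uv lincomb_index del: tri_enc.simps)
  qed simp_all
  then show "lift_op k l d d' \<Lambda> (lincomb (k * d * l) c X K) $$ (tri_enc d' l p, tri_enc d' l q)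
    = lincomb (k * d' * l) c (\<lambda>x. lift_op k l d d' \<Lambda> (X x)) K $$ (tri_enc d' l p, tri_enc d' l q)"
    using lt pq[unfolded p] cptp_lincomb[OF \<Lambda> K, of "\<lambda>x. slice d l (X x) (i, s) (i', s')" c]
      tri_enc_less[OF pq(1)] tri_enc_less[OF pq(2)]
    unfolding p by (subst lift_op_index) (auto simp: lift_op_index lincomb_index simp del: tri_enc.simps)
qed simp_all

section \<open>Public communication\<close>

lemma comm_A_carrier [simp]: "comm_A a b e m X \<in> carrier_mat (a * m * (b * m) * (e * m)) (a * m * (b * m) * (e * m))"
  by (simp add: comm_A_def)

lemma comm_B_carrier [simp]: "comm_B a b e m X \<in> carrier_mat (a * m * (b * m) * (e * m)) (a * m * (b * m) * (e * m))"
  by (simp add: comm_B_def)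

definition same_msg :: "nat \<Rightarrow> nat \<times> nat \<times> nat \<Rightarrow> nat \<Rightarrow> bool" where
  "same_msg m p y \<longleftrightarrow> fst p mod m = y \<and> fst (snd p) mod m = y \<and> snd (snd p) mod m = y"

definition drop_A :: "nat \<Rightarrow> nat \<times> nat \<times> nat \<Rightarrow> nat \<times> nat \<times> nat" where
  "drop_A m p = (fst p, fst (snd p) div m, snd (snd p) div m)"

definition drop_B :: "nat \<Rightarrow> nat \<times> nat \<times> nat \<Rightarrow> nat \<times> nat \<times> nat" where
  "drop_B m p = (fst p div m, fst (snd p), snd (snd p) div m)"

lemma comm_A_index:
  assumes "p \<in> tri (a * m) (b * m) (e * m)" "q \<in> tri (a * m) (b * m) (e * m)"
  shows "comm_A a b e m X $$ (tri_enc (b * m) (e * m) p, tri_enc (b * m) (e * m) q) =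
    (if same_msg m p (fst p mod m) \<and> same_msg m q (fst p mod m)
     then X $$ (tri_enc b e (drop_A m p), tri_enc b e (drop_A m q)) else 0)"
  using assms unfolding comm_A_def
  by (subst tri_mat_index) (auto simp: same_msg_def drop_A_def split: prod.splits)

lemma comm_B_index:
  assumes "p \<in> tri (a * m) (b * m) (e * m)" "q \<in> tri (a * m) (b * m) (e * m)"
  shows "comm_B a b e m X $$ (tri_enc (b * m) (e * m) p, tri_enc (b * m) (e * m) q) =
    (if same_msg m p (fst p mod m) \<and> same_msg m q (fst p mod m)
     then X $$ (tri_enc (b * m) e (drop_B m p), tri_enc (b * m) e (drop_B m q)) else 0)"
  using assms unfolding comm_B_def
  by (subst tri_mat_index) (auto simp: same_msg_def drop_B_def split: prod.splits)

lemma drop_A_tri: "p \<in> tri (a * m) (b * m) (e * m) \<Longrightarrow> drop_A m p \<in> tri (a * m) b e"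
  by (cases p) (simp add: drop_A_def less_mult_imp_div_less)

lemma drop_B_tri: "p \<in> tri (a * m) (b * m) (e * m) \<Longrightarrow> drop_B m p \<in> tri a (b * m) e"
  by (cases p) (simp add: drop_B_def less_mult_imp_div_less)

text \<open>The condition that all registers of \<open>p\<close> and \<open>q\<close> agree is a sum
  over messages of products of indicators. The form is thus a sum of forms of \<open>X\<close>, one
  for each message, at the vector \<open>v\<close> masked by that message.\<close>

lemma same_msg_positive:
  assumes X: "positive_op n X" and f: "\<And>p. p \<in> I \<Longrightarrow> f p < n" and I: "\<And>p. p \<in> I \<Longrightarrow> fst p mod m < m"
  shows "0 \<le> (\<Sum>p\<in>I. \<Sum>q\<in>I. v p *
    (if same_msg m p (fst p mod m) \<and> same_msg m q (fst p mod m) then X $$ (f p, f q) else 0) * cnj (v q))"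
proof -
  have "(\<Sum>p\<in>I. \<Sum>q\<in>I. v p *
      (if same_msg m p (fst p mod m) \<and> same_msg m q (fst p mod m) then X $$ (f p, f q) else 0) * cnj (v q))
    = (\<Sum>p\<in>I. \<Sum>q\<in>I. \<Sum>y<m. (if same_msg m p y then v p else 0) * X $$ (f p, f q) * cnj (if same_msg m q y then v q else 0))"
  proof (intro sum.cong refl)
    fix p q assume p: "p \<in> I"
    have "(\<Sum>y<m. (if same_msg m p y then v p else 0) * X $$ (f p, f q) * cnj (if same_msg m q y then v q else 0))
      = (\<Sum>y<m. if y = fst p mod m then (if same_msg m p y \<and> same_msg m q y then v p * X $$ (f p, f q) * cnj (v q) else 0) else 0)"
      by (intro sum.cong refl) (auto simp: same_msg_def)
    also have "\<dots> = v p * (if same_msg m p (fst p mod m) \<and> same_msg m q (fst p mod m) then X $$ (f p, f q) else 0) * cnj (v q)"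
      using I[OF p] by simp
    finally show "v p * (if same_msg m p (fst p mod m) \<and> same_msg m q (fst p mod m) then X $$ (f p, f q) else 0) * cnj (v q)
      = (\<Sum>y<m. (if same_msg m p y then v p else 0) * X $$ (f p, f q) * cnj (if same_msg m q y then v q else 0))" ..
  qed
  also have "\<dots> = (\<Sum>p\<in>I. \<Sum>y<m. \<Sum>q\<in>I. (if same_msg m p y then v p else 0) * X $$ (f p, f q) * cnj (if same_msg m q y then v q else 0))"
    by (intro sum.cong refl sum.swap)
  also have "\<dots> = (\<Sum>y<m. \<Sum>p\<in>I. \<Sum>q\<in>I. (if same_msg m p y then v p else 0) * X $$ (f p, f q) * cnj (if same_msg m q y then v q else 0))"
    by (rule sum.swap)
  also have "0 \<le> \<dots>"
    by (intro sum_nonneg positive_op_select[OF X] f)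
  finally show ?thesis .
qed

lemma comm_positive:
  shows "positive_op (a * m * b * e) X \<Longrightarrow> positive_op (a * m * (b * m) * (e * m)) (comm_A a b e m X)"
    and "positive_op (a * (b * m) * e) X \<Longrightarrow> positive_op (a * m * (b * m) * (e * m)) (comm_B a b e m X)"
proof -
  let ?I = "tri (a * m) (b * m) (e * m)"
  have m: "fst p mod m < m" if "p \<in> ?I" for p
    using that index_divmod[of "fst p" a m] by (cases p) auto
  show "positive_op (a * m * (b * m) * (e * m)) (comm_A a b e m X)" if X: "positive_op (a * m * b * e) X"
    unfolding positive_op_tri
  proof (intro conjI allI)
    fix v :: "nat \<times> nat \<times> nat \<Rightarrow> complex"
    show "0 \<le> (\<Sum>p\<in>?I. \<Sum>q\<in>?I. v p * comm_A a b e m X $$ (tri_enc (b * m) (e * m) p, tri_enc (b * m) (e * m) q) * cnj (v q))"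
      using same_msg_positive[OF X, of ?I "\<lambda>p. tri_enc b e (drop_A m p)" m v] m
      by (simp add: comm_A_index tri_enc_less[OF drop_A_tri] del: tri_enc.simps cong: sum.cong)
  qed simp
  show "positive_op (a * m * (b * m) * (e * m)) (comm_B a b e m X)" if X: "positive_op (a * (b * m) * e) X"
    unfolding positive_op_tri
  proof (intro conjI allI)
    fix v :: "nat \<times> nat \<times> nat \<Rightarrow> complex"
    show "0 \<le> (\<Sum>p\<in>?I. \<Sum>q\<in>?I. v p * comm_B a b e m X $$ (tri_enc (b * m) (e * m) p, tri_enc (b * m) (e * m) q) * cnj (v q))"
      using same_msg_positive[OF X, of ?I "\<lambda>p. tri_enc (b * m) e (drop_B m p)" m v] m
      by (simp add: comm_B_index tri_enc_less[OF drop_B_tri] del: tri_enc.simps cong: sum.cong)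
  qed simp
qed

lemma sum_mod_select:
  fixes F :: "nat \<Rightarrow> complex"
  assumes "r < m"
  shows "(\<Sum>k<g * m. if k mod m = r then F k else 0) = (\<Sum>k<g. F (k * m + r))"
proof -
  have "(\<Sum>k<g * m. if k mod m = r then F k else 0) = (\<Sum>k<g. \<Sum>y<m. if (k * m + y) mod m = r then F (k * m + y) else 0)"
    by (rule sum_mult_index)
  also have "\<dots> = (\<Sum>k<g. \<Sum>y<m. if y = r then F (k * m + y) else 0)"
    by (intro sum.cong refl) (auto simp: mod_mult_self3)
  finally show ?thesis using assms by simp
qed

lemma comm_trace:
  shows "X \<in> carrier_mat (a * m * b * e) (a * m * b * e) \<Longrightarrow> mat_trace (comm_A a b e m X) = mat_trace X"
    and "X \<in> carrier_mat (a * (b * m) * e) (a * (b * m) * e) \<Longrightarrow> mat_trace (comm_B a b e m X) = mat_trace X"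
proof -
  have m: "i mod m < m" if "i < a * m" for i a :: nat
    using index_divmod[OF that] by simp
  show "mat_trace (comm_A a b e m X) = mat_trace X" if X: "X \<in> carrier_mat (a * m * b * e) (a * m * b * e)"
  proof -
    have "mat_trace (comm_A a b e m X) = (\<Sum>i<a * m. \<Sum>j<b * m. \<Sum>k<e * m. if j mod m = i mod m then if k mod m = i mod m then
        X $$ (tri_enc b e (i, j div m, k div m), tri_enc b e (i, j div m, k div m)) else 0 else 0)"
      unfolding mat_trace_tri[OF comm_A_carrier] sum_tri
      by (intro sum.cong refl) (simp add: comm_A_index same_msg_def drop_A_def del: tri_enc.simps)
    also have "\<dots> = (\<Sum>i<a * m. \<Sum>j<b * m. if j mod m = i mod m then (\<Sum>k<e * m. if k mod m = i mod m then
        X $$ (tri_enc b e (i, j div m, k div m), tri_enc b e (i, j div m, k div m)) else 0) else 0)"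
      by (intro sum.cong refl) simp
    also have "\<dots> = (\<Sum>i<a * m. \<Sum>j<b. \<Sum>k<e. X $$ (tri_enc b e (i, j, k), tri_enc b e (i, j, k)))"
      by (rule sum.cong[OF refl], cases "m = 0")
        (simp_all add: m sum_mod_select div_add1_eq del: tri_enc.simps)
    finally show ?thesis by (simp add: mat_trace_tri[OF X] sum_tri)
  qed
  show "mat_trace (comm_B a b e m X) = mat_trace X" if X: "X \<in> carrier_mat (a * (b * m) * e) (a * (b * m) * e)"
  proof -
    have "mat_trace (comm_B a b e m X) = (\<Sum>i<a * m. \<Sum>j<b * m. \<Sum>k<e * m. if i mod m = j mod m then if k mod m = j mod m then
        X $$ (tri_enc (b * m) e (i div m, j, k div m), tri_enc (b * m) e (i div m, j, k div m)) else 0 else 0)"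
      unfolding mat_trace_tri[OF comm_B_carrier] sum_tri
      by (intro sum.cong refl) (auto simp add: comm_B_index same_msg_def drop_B_def simp del: tri_enc.simps)
    also have "\<dots> = (\<Sum>j<b * m. \<Sum>i<a * m. \<Sum>k<e * m. if i mod m = j mod m then if k mod m = j mod m then
        X $$ (tri_enc (b * m) e (i div m, j, k div m), tri_enc (b * m) e (i div m, j, k div m)) else 0 else 0)"
      by (rule sum.swap)
    also have "\<dots> = (\<Sum>j<b * m. \<Sum>i<a * m. if i mod m = j mod m then (\<Sum>k<e * m. if k mod m = j mod m then
        X $$ (tri_enc (b * m) e (i div m, j, k div m), tri_enc (b * m) e (i div m, j, k div m)) else 0) else 0)"
      by (intro sum.cong refl) simp
    also have "\<dots> = (\<Sum>j<b * m. \<Sum>i<a. \<Sum>k<e. X $$ (tri_enc (b * m) e (i, j, k), tri_enc (b * m) e (i, j, k)))"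
      by (rule sum.cong[OF refl], cases "m = 0")
        (simp_all add: m sum_mod_select div_add1_eq del: tri_enc.simps)
    also have "\<dots> = (\<Sum>i<a. \<Sum>j<b * m. \<Sum>k<e. X $$ (tri_enc (b * m) e (i, j, k), tri_enc (b * m) e (i, j, k)))"
      by (rule sum.swap)
    finally show ?thesis by (simp add: mat_trace_tri[OF X] sum_tri)
  qed
qed

lemma comm_A_lincomb:
  "comm_A a b e m (lincomb (a * m * b * e) c X K) = lincomb (a * m * (b * m) * (e * m)) c (\<lambda>k. comm_A a b e m (X k)) K"
  by (rule tri_mat_eqI[of _ "a * m" "b * m" "e * m"])
    (auto simp: comm_A_index lincomb_index tri_enc_less tri_enc_less[OF drop_A_tri] simp del: tri_enc.simps
      intro!: sum.neutral)

lemma comm_B_lincomb: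
  "comm_B a b e m (lincomb (a * (b * m) * e) c X K) = lincomb (a * m * (b * m) * (e * m)) c (\<lambda>k. comm_B a b e m (X k)) K"
  by (rule tri_mat_eqI[of _ "a * m" "b * m" "e * m"])
    (auto simp: comm_B_index lincomb_index tri_enc_less tri_enc_less[OF drop_B_tri] simp del: tri_enc.simps
      intro!: sum.neutral)

section \<open>LOPC operations as linear, positive and trace preserving maps\<close>

fun tdim :: "dims \<Rightarrow> nat" where
  "tdim (a, b, e) = a * b * e"

text \<open>Linearity is stated for finite combinations, the form in which the blocks of F are
  summed below; the empty combination yields that zero is preserved.\<close>

definition channel :: "nat \<Rightarrow> nat \<Rightarrow> (complex mat \<Rightarrow> complex mat) \<Rightarrow> bool" where
  "channel N N' F \<longleftrightarrow> (\<forall>X\<in>carrier_mat N N. F X \<in> carrier_mat N' N' \<and> mat_trace (F X) = mat_trace X)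
    \<and> (\<forall>X. positive_op N X \<longrightarrow> positive_op N' (F X))
    \<and> (\<forall>c (X :: nat \<Rightarrow> complex mat) K. finite K \<longrightarrow> (\<forall>k\<in>K. X k \<in> carrier_mat N N) \<longrightarrow>
        F (lincomb N c X K) = lincomb N' c (\<lambda>k. F (X k)) K)"

lemma channel_comp: "channel N N' F \<Longrightarrow> channel N' N'' G \<Longrightarrow> channel N N'' (\<lambda>X. G (F X))"
  unfolding channel_def by (intro conjI allI impI ballI) simp_all

lemma channel_lift_op: "cptp d d' \<Lambda> \<Longrightarrow> channel (k * d * l) (k * d' * l) (lift_op k l d d' \<Lambda>)"
  unfolding channel_def using lift_op_positive lift_op_trace lift_op_lincomb by auto

lemma channel_comm_A: "channel (a * m * b * e) (a * m * (b * m) * (e * m)) (comm_A a b e m)"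
  unfolding channel_def using comm_positive(1) comm_trace(1) comm_A_lincomb by auto

lemma channel_comm_B: "channel (a * (b * m) * e) (a * m * (b * m) * (e * m)) (comm_B a b e m)"
  unfolding channel_def using comm_positive(2) comm_trace(2) comm_B_lincomb by auto

lemma lopc_channel: "lopc D D' F \<Longrightarrow> channel (tdim D) (tdim D') F"
proof (induction rule: lopc.induct)
  case lopc_id
  then show ?case by (simp add: channel_def)
next
  case (lopc_local_A a b e F a' \<Lambda>)
  show ?case
    using channel_comp[OF lopc_local_A(3)] channel_lift_op[OF lopc_local_A(2), of 1 "b * e"] by (simp add: mult.assoc)
next
  case (lopc_local_B a b e F b' \<Lambda>)
  show ?case
    using channel_comp[OF lopc_local_B(3)] channel_lift_op[OF lopc_local_B(2), of a e] by simp
next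
  case (lopc_comm_A a m b e F)
  show ?case using channel_comp[OF lopc_comm_A(2)] channel_comm_A[of a m b e] by simp
next
  case (lopc_comm_B a b m e F)
  show ?case using channel_comp[OF lopc_comm_B(2)] channel_comm_B[of a b m e] by simp
qed

text \<open>
  \<open>V\<close> identifies Eve's \<open>g\<close>-dimensional system with \<open>E \<otimes> F\<close>, of dimensions \<open>e\<close> and \<open>f\<close>: the entry \<open>V k n s\<close>
  is \<open>\<langle>k|V|n s\<rangle>\<close>. Working with an arbitrary identification avoids reordering Eve's registers, which is not
  an LOPC operation, and allows choosing an eigenbasis of \<open>F\<close>.
\<close>

definition splits :: "nat \<Rightarrow> nat \<Rightarrow> nat \<Rightarrow> (nat \<Rightarrow> nat \<Rightarrow> nat \<Rightarrow> complex) \<Rightarrow> bool" where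
  "splits g e f V \<longleftrightarrow>
    (\<forall>n<e. \<forall>s<f. \<forall>n'<e. \<forall>s'<f. (\<Sum>k<g. cnj (V k n s) * V k n' s') = (if n = n' \<and> s = s' then 1 else 0)) \<and>
    (\<forall>k<g. \<forall>k'<g. (\<Sum>n<e. \<Sum>s<f. V k n s * cnj (V k' n s)) = (if k = k' then 1 else 0))"

text \<open>The operator on A, B and E that stands in row \<open>s\<close> and column
  \<open>s'\<close> when X is written as a block matrix over F in the coordinates given by
  \<open>V\<close>.\<close>

definition blk :: "dims \<Rightarrow> nat \<Rightarrow> (nat \<Rightarrow> nat \<Rightarrow> nat \<Rightarrow> complex) \<Rightarrow> nat \<Rightarrow> nat \<Rightarrow> complex mat \<Rightarrow> complex mat" where
  "blk D g V s s' X = (case D of (a, b, e) \<Rightarrow> tri_mat a b e (\<lambda>(i, j, n) (i', j', n').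
     \<Sum>k<g. \<Sum>k'<g. cnj (V k n s) * V k' n' s' * X $$ (tri_enc b g (i, j, k), tri_enc b g (i', j', k'))))"

lemma blk_index:
  assumes "i < a" "j < b" "n < e" "i' < a" "j' < b" "n' < e"
  shows "blk (a, b, e) g V s s' X $$ (tri_enc b e (i, j, n), tri_enc b e (i', j', n')) =
    (\<Sum>k<g. \<Sum>k'<g. cnj (V k n s) * V k' n' s' * X $$ (tri_enc b g (i, j, k), tri_enc b g (i', j', k')))"
  using assms unfolding blk_def by (simp add: tri_mat_index del: tri_enc.simps)

lemma blk_carrier [simp]: "blk (a, b, e) g V s s' X \<in> carrier_mat (a * b * e) (a * b * e)"
  by (simp add: blk_def)

text \<open>Moves Alice's index to the middle slot behind a trivial first system, which is the
  grouping used by \<open>lift_op 1 (b * g)\<close>.\<close>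

lemma tri_enc_assoc: "tri_enc b g (i, j, k) = tri_enc a (b * g) (0, i, j * g + k)"
  by (simp add: algebra_simps)

text \<open>A block is a linear combination over Eve's indices, with coefficients from
  \<open>V\<close>, of slices on which the local map acts; linearity lets the two operations
  commute.\<close>

lemma blk_local_A:
  assumes \<Lambda>: "cptp a a' \<Lambda>"
  shows "blk (a', b, e) g V s s' (lift_op 1 (b * g) a a' \<Lambda> Y) = lift_op 1 (b * e) a a' \<Lambda> (blk (a, b, e) g V s s' Y)"
proof (rule tri_mat_eqI[of _ a' b e])
  fix p q assume pq: "p \<in> tri a' b e" "q \<in> tri a' b e"
  obtain i j n i' j' n' where p: "p = (i, j, n)" "q = (i', j', n')" by (cases p, cases q)
  have lt: "i < a'" "j < b" "n < e" "i' < a'" "j' < b" "n' < e" using pq by (auto simp: p)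
  define c where "c = (\<lambda>(k, k'). cnj (V k n s) * V k' n' s')"
  define Z where "Z = (\<lambda>(k, k'). slice a (b * g) Y (0, j * g + k) (0, j' * g + k'))"
  have "slice a (b * e) (blk (a, b, e) g V s s' Y) (0, j * e + n) (0, j' * e + n') = lincomb a c Z ({..<g} \<times> {..<g})"
  proof (rule eq_matI)
    fix u v assume "u < dim_row (lincomb a c Z ({..<g} \<times> {..<g}))" "v < dim_col (lincomb a c Z ({..<g} \<times> {..<g}))"
    then have uv: "u < a" "v < a" by auto
    show "slice a (b * e) (blk (a, b, e) g V s s' Y) (0, j * e + n) (0, j' * e + n') $$ (u, v) = lincomb a c Z ({..<g} \<times> {..<g}) $$ (u, v)"
      using uv lt unfolding slice_index[OF uv] tri_enc_assoc[symmetric]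
      by (simp add: blk_index lincomb_index sum_Times c_def Z_def slice_index flip: tri_enc_assoc del: tri_enc.simps)
  qed simp_all
  then have "\<Lambda> (slice a (b * e) (blk (a, b, e) g V s s' Y) (0, j * e + n) (0, j' * e + n')) $$ (i, i')
    = (\<Sum>k<g. \<Sum>k'<g. cnj (V k n s) * V k' n' s' * \<Lambda> (slice a (b * g) Y (0, j * g + k) (0, j' * g + k')) $$ (i, i'))"
    using cptp_lincomb[OF \<Lambda>, of "{..<g} \<times> {..<g}" Z c] lt
    by (simp add: lincomb_index sum_Times c_def Z_def split_def)
  moreover have "lift_op 1 (b * g) a a' \<Lambda> Y $$ (tri_enc b g (i, j, k), tri_enc b g (i', j', k'))
      = \<Lambda> (slice a (b * g) Y (0, j * g + k) (0, j' * g + k')) $$ (i, i')" if "k < g" "k' < g" for k k'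
    using lt that unfolding tri_enc_assoc[of b g _ _ _ a'] by (subst lift_op_index) (auto intro: mult_index_less)
  moreover have "lift_op 1 (b * e) a a' \<Lambda> (blk (a, b, e) g V s s' Y) $$ (tri_enc b e (i, j, n), tri_enc b e (i', j', n'))
      = \<Lambda> (slice a (b * e) (blk (a, b, e) g V s s' Y) (0, j * e + n) (0, j' * e + n')) $$ (i, i')"
    using lt unfolding tri_enc_assoc[of b e _ _ _ a'] by (subst lift_op_index) (auto intro: mult_index_less)
  ultimately show "blk (a', b, e) g V s s' (lift_op 1 (b * g) a a' \<Lambda> Y) $$ (tri_enc b e p, tri_enc b e q)
    = lift_op 1 (b * e) a a' \<Lambda> (blk (a, b, e) g V s s' Y) $$ (tri_enc b e p, tri_enc b e q)"
    unfolding p using lt by (simp add: blk_index del: tri_enc.simps)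
next
  show "lift_op 1 (b * e) a a' \<Lambda> (blk (a, b, e) g V s s' Y) \<in> carrier_mat (a' * b * e) (a' * b * e)"
    using lift_op_carrier[of 1 "b * e" a a'] by (simp add: mult.assoc)
qed simp

lemma blk_local_B:
  assumes \<Lambda>: "cptp b b' \<Lambda>"
  shows "blk (a, b', e) g V s s' (lift_op a g b b' \<Lambda> Y) = lift_op a e b b' \<Lambda> (blk (a, b, e) g V s s' Y)"
proof (rule tri_mat_eqI[of _ a b' e])
  fix p q assume pq: "p \<in> tri a b' e" "q \<in> tri a b' e"
  obtain i j n i' j' n' where p: "p = (i, j, n)" "q = (i', j', n')" by (cases p, cases q)
  have lt: "i < a" "j < b'" "n < e" "i' < a" "j' < b'" "n' < e" using pq by (auto simp: p)
  define c where "c = (\<lambda>(k, k'). cnj (V k n s) * V k' n' s')"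
  define Z where "Z = (\<lambda>(k, k'). slice b g Y (i, k) (i', k'))"
  have "slice b e (blk (a, b, e) g V s s' Y) (i, n) (i', n') = lincomb b c Z ({..<g} \<times> {..<g})"
    using lt by (intro eq_matI)
      (simp_all add: slice_index blk_index lincomb_index sum_Times c_def Z_def del: tri_enc.simps)
  then show "blk (a, b', e) g V s s' (lift_op a g b b' \<Lambda> Y) $$ (tri_enc b' e p, tri_enc b' e q)
    = lift_op a e b b' \<Lambda> (blk (a, b, e) g V s s' Y) $$ (tri_enc b' e p, tri_enc b' e q)"
    using cptp_lincomb[OF \<Lambda>, of "{..<g} \<times> {..<g}" Z c] lt
    unfolding p by (simp add: blk_index lift_op_index lincomb_index sum_Times c_def Z_def split_def del: tri_enc.simps)
qed simp_all

text \<open>Eve's copy of a message is appended at the end of her system, behind both E and F. Here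
  it is counted to E, while F keeps its coordinates.\<close>

definition msg_split :: "nat \<Rightarrow> (nat \<Rightarrow> nat \<Rightarrow> nat \<Rightarrow> complex) \<Rightarrow> nat \<Rightarrow> nat \<Rightarrow> nat \<Rightarrow> complex" where
  "msg_split m V k n s = (if k mod m = n mod m then V (k div m) (n div m) s else 0)"

lemma splits_msg:
  assumes V: "splits g e f V"
  shows "splits (g * m) (e * m) f (msg_split m V)"
proof -
  have col: "(\<Sum>k<g. cnj (V k n s) * V k n' s') = (if n = n' \<and> s = s' then 1 else 0)"
    if "n < e" "s < f" "n' < e" "s' < f" for n s n' s' using V that by (simp add: splits_def)
  have row: "(\<Sum>n<e. \<Sum>s<f. V k n s * cnj (V k' n s)) = (if k = k' then 1 else 0)"
    if "k < g" "k' < g" for k k' using V that by (simp add: splits_def)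
  have dm: "n = n' \<longleftrightarrow> n div m = n' div m \<and> n mod m = n' mod m" for n n' :: nat
    by (metis div_mult_mod_eq)
  show ?thesis
    unfolding splits_def
  proof (intro conjI allI impI)
    fix n s n' s' assume lt: "n < e * m" "s < f" "n' < e * m" "s' < f"
    have r: "n mod m < m" "n div m < e" "n' div m < e" using index_divmod[OF lt(1)] index_divmod[OF lt(3)] by auto
    have "(\<Sum>k<g * m. cnj (msg_split m V k n s) * msg_split m V k n' s')
      = (\<Sum>k<g * m. if k mod m = n mod m then (if n mod m = n' mod m then cnj (V (k div m) (n div m) s) * V (k div m) (n' div m) s' else 0) else 0)"
      by (intro sum.cong refl) (auto simp: msg_split_def)
    also have "\<dots> = (\<Sum>k<g. if n mod m = n' mod m then cnj (V k (n div m) s) * V k (n' div m) s' else 0)"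
      unfolding sum_mod_select[OF r(1)] using r(1) by (intro sum.cong refl) simp
    also have "\<dots> = (if n = n' \<and> s = s' then 1 else 0)"
      using col[OF r(2) lt(2) r(3) lt(4)] dm[of n n'] by (cases "n mod m = n' mod m") auto
    finally show "(\<Sum>k<g * m. cnj (msg_split m V k n s) * msg_split m V k n' s') = (if n = n' \<and> s = s' then 1 else 0)" .
  next
    fix k k' assume lt: "k < g * m" "k' < g * m"
    have r: "k mod m < m" "k div m < g" "k' div m < g" using index_divmod[OF lt(1)] index_divmod[OF lt(2)] by auto
    have "(\<Sum>n<e * m. \<Sum>s<f. msg_split m V k n s * cnj (msg_split m V k' n s))
      = (\<Sum>n<e * m. if n mod m = k mod m then (if k mod m = k' mod m then (\<Sum>s<f. V (k div m) (n div m) s * cnj (V (k' div m) (n div m) s)) else 0) else 0)"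
      by (intro sum.cong refl) (auto simp: msg_split_def)
    also have "\<dots> = (\<Sum>n<e. if k mod m = k' mod m then (\<Sum>s<f. V (k div m) n s * cnj (V (k' div m) n s)) else 0)"
      unfolding sum_mod_select[OF r(1)] using r(1) by (intro sum.cong refl) simp
    also have "\<dots> = (if k = k' then 1 else 0)"
      using row[OF r(2,3)] dm[of k k'] by (cases "k mod m = k' mod m") auto
    finally show "(\<Sum>n<e * m. \<Sum>s<f. msg_split m V k n s * cnj (msg_split m V k' n s)) = (if k = k' then 1 else 0)" .
  qed
qed

lemma sum_msg_split:
  assumes "n mod m < m" "n' mod m < m"
  shows "(\<Sum>k<g * m. \<Sum>k'<g * m. cnj (msg_split m V k n s) * msg_split m V k' n' s' * F k k')
    = (\<Sum>k<g. \<Sum>k'<g. cnj (V k (n div m) s) * V k' (n' div m) s' * F (k * m + n mod m) (k' * m + n' mod m))"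
proof -
  have "(\<Sum>k<g * m. \<Sum>k'<g * m. cnj (msg_split m V k n s) * msg_split m V k' n' s' * F k k')
    = (\<Sum>k<g * m. if k mod m = n mod m then (\<Sum>k'<g * m. if k' mod m = n' mod m
        then cnj (V (k div m) (n div m) s) * V (k' div m) (n' div m) s' * F k k' else 0) else 0)"
    by (intro sum.cong refl) (auto simp: msg_split_def intro!: sum.cong)
  also have "\<dots> = (\<Sum>k<g. \<Sum>k'<g. cnj (V k (n div m) s) * V k' (n' div m) s' * F (k * m + n mod m) (k' * m + n' mod m))"
    unfolding sum_mod_select[OF assms(1)] sum_mod_select[OF assms(2)]
    using assms by (intro sum.cong refl) simp
  finally show ?thesis .
qed

text \<open>\<open>msg_split\<close> is nonzero only where Eve's message digit agrees on both sides,
  so the test for equal messages can be pulled out of the sum that forms the block.\<close>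

lemma blk_comm_A:
  "blk (a * m, b * m, e * m) (g * m) (msg_split m V) s s' (comm_A a b g m Y) = comm_A a b e m (blk (a * m, b, e) g V s s' Y)"
proof (rule tri_mat_eqI[of _ "a * m" "b * m" "e * m"])
  fix p q assume pq: "p \<in> tri (a * m) (b * m) (e * m)" "q \<in> tri (a * m) (b * m) (e * m)"
  obtain i j n i' j' n' where p: "p = (i, j, n)" "q = (i', j', n')" by (cases p, cases q)
  have lt: "i < a * m" "j < b * m" "n < e * m" "i' < a * m" "j' < b * m" "n' < e * m" using pq by (auto simp: p)
  have r: "n mod m < m" "n' mod m < m" using index_divmod[OF lt(3)] index_divmod[OF lt(6)] by auto
  have d: "j div m < b" "n div m < e" "j' div m < b" "n' div m < e"
    using lt by (auto intro: less_mult_imp_div_less)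
  show "blk (a * m, b * m, e * m) (g * m) (msg_split m V) s s' (comm_A a b g m Y) $$ (tri_enc (b * m) (e * m) p, tri_enc (b * m) (e * m) q)
    = comm_A a b e m (blk (a * m, b, e) g V s s' Y) $$ (tri_enc (b * m) (e * m) p, tri_enc (b * m) (e * m) q)"
    unfolding p
  proof -
    define C where "C \<longleftrightarrow> same_msg m (i, j, n) (i mod m) \<and> same_msg m (i', j', n') (i mod m)"
    have 1: "comm_A a b g m Y $$ (tri_enc (b * m) (g * m) (i, j, k * m + n mod m), tri_enc (b * m) (g * m) (i', j', k' * m + n' mod m))
      = (if C then Y $$ (tri_enc b g (i, j div m, k), tri_enc b g (i', j' div m, k')) else 0)"
      if "k < g" "k' < g" for k k'
    proof -
      have in_tri: "(i, j, k * m + n mod m) \<in> tri (a * m) (b * m) (g * m)" "(i', j', k' * m + n' mod m) \<in> tri (a * m) (b * m) (g * m)"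
        using lt r that by (simp_all add: mult_index_less)
      show ?thesis
        unfolding comm_A_index[OF in_tri] using r by (simp add: C_def same_msg_def drop_A_def del: tri_enc.simps)
    qed
    have 2: "comm_A a b e m (blk (a * m, b, e) g V s s' Y) $$ (tri_enc (b * m) (e * m) (i, j, n), tri_enc (b * m) (e * m) (i', j', n'))
      = (if C then blk (a * m, b, e) g V s s' Y $$ (tri_enc b e (i, j div m, n div m), tri_enc b e (i', j' div m, n' div m)) else 0)"
      unfolding comm_A_index[OF pq[unfolded p]] by (simp add: C_def drop_A_def del: tri_enc.simps)
    have "blk (a * m, b * m, e * m) (g * m) (msg_split m V) s s' (comm_A a b g m Y) $$ (tri_enc (b * m) (e * m) (i, j, n), tri_enc (b * m) (e * m) (i', j', n'))
      = (\<Sum>k<g. \<Sum>k'<g. cnj (V k (n div m) s) * V k' (n' div m) s' *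
          comm_A a b g m Y $$ (tri_enc (b * m) (g * m) (i, j, k * m + n mod m), tri_enc (b * m) (g * m) (i', j', k' * m + n' mod m)))"
      unfolding blk_index[OF lt] by (rule sum_msg_split[OF r])
    also have "\<dots> = (\<Sum>k<g. \<Sum>k'<g. cnj (V k (n div m) s) * V k' (n' div m) s' *
          (if C then Y $$ (tri_enc b g (i, j div m, k), tri_enc b g (i', j' div m, k')) else 0))"
      by (intro sum.cong refl) (simp only: 1 lessThan_iff)
    also have "\<dots> = (if C then blk (a * m, b, e) g V s s' Y $$ (tri_enc b e (i, j div m, n div m), tri_enc b e (i', j' div m, n' div m)) else 0)"
      using lt d by (simp add: blk_index del: tri_enc.simps)
    finally show "blk (a * m, b * m, e * m) (g * m) (msg_split m V) s s' (comm_A a b g m Y) $$ (tri_enc (b * m) (e * m) (i, j, n), tri_enc (b * m) (e * m) (i', j', n'))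
      = comm_A a b e m (blk (a * m, b, e) g V s s' Y) $$ (tri_enc (b * m) (e * m) (i, j, n), tri_enc (b * m) (e * m) (i', j', n'))"
      unfolding 2 .
  qed
qed simp_all

lemma blk_comm_B:
  "blk (a * m, b * m, e * m) (g * m) (msg_split m V) s s' (comm_B a b g m Y) = comm_B a b e m (blk (a, b * m, e) g V s s' Y)"
proof (rule tri_mat_eqI[of _ "a * m" "b * m" "e * m"])
  fix p q assume pq: "p \<in> tri (a * m) (b * m) (e * m)" "q \<in> tri (a * m) (b * m) (e * m)"
  obtain i j n i' j' n' where p: "p = (i, j, n)" "q = (i', j', n')" by (cases p, cases q)
  have lt: "i < a * m" "j < b * m" "n < e * m" "i' < a * m" "j' < b * m" "n' < e * m" using pq by (auto simp: p)
  have r: "n mod m < m" "n' mod m < m" using index_divmod[OF lt(3)] index_divmod[OF lt(6)] by auto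
  have d: "i div m < a" "n div m < e" "i' div m < a" "n' div m < e"
    using lt by (auto intro: less_mult_imp_div_less)
  show "blk (a * m, b * m, e * m) (g * m) (msg_split m V) s s' (comm_B a b g m Y) $$ (tri_enc (b * m) (e * m) p, tri_enc (b * m) (e * m) q)
    = comm_B a b e m (blk (a, b * m, e) g V s s' Y) $$ (tri_enc (b * m) (e * m) p, tri_enc (b * m) (e * m) q)"
    unfolding p
  proof -
    define C where "C \<longleftrightarrow> same_msg m (i, j, n) (i mod m) \<and> same_msg m (i', j', n') (i mod m)"
    have 1: "comm_B a b g m Y $$ (tri_enc (b * m) (g * m) (i, j, k * m + n mod m), tri_enc (b * m) (g * m) (i', j', k' * m + n' mod m))
      = (if C then Y $$ (tri_enc (b * m) g (i div m, j, k), tri_enc (b * m) g (i' div m, j', k')) else 0)"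
      if "k < g" "k' < g" for k k'
    proof -
      have in_tri: "(i, j, k * m + n mod m) \<in> tri (a * m) (b * m) (g * m)" "(i', j', k' * m + n' mod m) \<in> tri (a * m) (b * m) (g * m)"
        using lt r that by (simp_all add: mult_index_less)
      show ?thesis
        unfolding comm_B_index[OF in_tri] using r by (simp add: C_def same_msg_def drop_B_def del: tri_enc.simps)
    qed
    have 2: "comm_B a b e m (blk (a, b * m, e) g V s s' Y) $$ (tri_enc (b * m) (e * m) (i, j, n), tri_enc (b * m) (e * m) (i', j', n'))
      = (if C then blk (a, b * m, e) g V s s' Y $$ (tri_enc (b * m) e (i div m, j, n div m), tri_enc (b * m) e (i' div m, j', n' div m)) else 0)"
      unfolding comm_B_index[OF pq[unfolded p]] by (simp add: C_def drop_B_def del: tri_enc.simps)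
    have "blk (a * m, b * m, e * m) (g * m) (msg_split m V) s s' (comm_B a b g m Y) $$ (tri_enc (b * m) (e * m) (i, j, n), tri_enc (b * m) (e * m) (i', j', n'))
      = (\<Sum>k<g. \<Sum>k'<g. cnj (V k (n div m) s) * V k' (n' div m) s' *
          comm_B a b g m Y $$ (tri_enc (b * m) (g * m) (i, j, k * m + n mod m), tri_enc (b * m) (g * m) (i', j', k' * m + n' mod m)))"
      unfolding blk_index[OF lt] by (rule sum_msg_split[OF r])
    also have "\<dots> = (\<Sum>k<g. \<Sum>k'<g. cnj (V k (n div m) s) * V k' (n' div m) s' *
          (if C then Y $$ (tri_enc (b * m) g (i div m, j, k), tri_enc (b * m) g (i' div m, j', k')) else 0))"
      by (intro sum.cong refl) (simp only: 1 lessThan_iff)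
    also have "\<dots> = (if C then blk (a, b * m, e) g V s s' Y $$ (tri_enc (b * m) e (i div m, j, n div m), tri_enc (b * m) e (i' div m, j', n' div m)) else 0)"
      using lt d by (simp add: blk_index del: tri_enc.simps)
    finally show "blk (a * m, b * m, e * m) (g * m) (msg_split m V) s s' (comm_B a b g m Y) $$ (tri_enc (b * m) (e * m) (i, j, n), tri_enc (b * m) (e * m) (i', j', n'))
      = comm_B a b e m (blk (a, b * m, e) g V s s' Y) $$ (tri_enc (b * m) (e * m) (i, j, n), tri_enc (b * m) (e * m) (i', j', n'))"
      unfolding 2 .
  qed
qed simp_all

text \<open>The same local maps and messages are executed while Eve holds the larger system. Each
  kind of step commutes with taking blocks, and \<open>V'\<close> keeps track of where F is among
  the registers that Eve has received.\<close>

lemma lopc_lift: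
  assumes "lopc (a, b, e) D' \<Lambda>" "splits g e f V"
  shows "\<exists>\<Lambda>' g' V'. lopc (a, b, g) (fst D', fst (snd D'), g') \<Lambda>' \<and> splits g' (snd (snd D')) f V' \<and>
    (\<forall>X s s'. blk D' g' V' s s' (\<Lambda>' X) = \<Lambda> (blk (a, b, e) g V s s' X))"
  using assms(1)
proof (induction rule: lopc.induct)
  case lopc_id
  show ?case using assms(2) lopc.lopc_id by (intro exI[of _ "\<lambda>X. X"] exI[of _ g] exI[of _ V]) simp
next
  case (lopc_local_A a1 b1 e1 F a' \<Lambda>)
  then obtain F' g' V' where IH: "lopc (a, b, g) (a1, b1, g') F'" "splits g' e1 f V'"
    "\<And>X s s'. blk (a1, b1, e1) g' V' s s' (F' X) = F (blk (a, b, e) g V s s' X)" by auto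
  show ?case
    using lopc.lopc_local_A[OF IH(1) lopc_local_A(2)] IH(2,3) blk_local_A[OF lopc_local_A(2)]
    by (intro exI[of _ "\<lambda>X. lift_op 1 (b1 * g') a1 a' \<Lambda> (F' X)"] exI[of _ g'] exI[of _ V']) simp
next
  case (lopc_local_B a1 b1 e1 F b' \<Lambda>)
  then obtain F' g' V' where IH: "lopc (a, b, g) (a1, b1, g') F'" "splits g' e1 f V'"
    "\<And>X s s'. blk (a1, b1, e1) g' V' s s' (F' X) = F (blk (a, b, e) g V s s' X)" by auto
  show ?case
    using lopc.lopc_local_B[OF IH(1) lopc_local_B(2)] IH(2,3) blk_local_B[OF lopc_local_B(2)]
    by (intro exI[of _ "\<lambda>X. lift_op a1 g' b1 b' \<Lambda> (F' X)"] exI[of _ g'] exI[of _ V']) simp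
next
  case (lopc_comm_A a1 m b1 e1 F)
  then obtain F' g' V' where IH: "lopc (a, b, g) (a1 * m, b1, g') F'" "splits g' e1 f V'"
    "\<And>X s s'. blk (a1 * m, b1, e1) g' V' s s' (F' X) = F (blk (a, b, e) g V s s' X)" by auto
  show ?case
    using lopc.lopc_comm_A[OF IH(1)] splits_msg[OF IH(2), of m] IH(3) blk_comm_A
    by (intro exI[of _ "\<lambda>X. comm_A a1 b1 g' m (F' X)"] exI[of _ "g' * m"] exI[of _ "msg_split m V'"]) simp
next
  case (lopc_comm_B a1 b1 m e1 F)
  then obtain F' g' V' where IH: "lopc (a, b, g) (a1, b1 * m, g') F'" "splits g' e1 f V'"
    "\<And>X s s'. blk (a1, b1 * m, e1) g' V' s s' (F' X) = F (blk (a, b, e) g V s s' X)" by auto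
  show ?case
    using lopc.lopc_comm_B[OF IH(1)] splits_msg[OF IH(2), of m] IH(3) blk_comm_B
    by (intro exI[of _ "\<lambda>X. comm_B a1 b1 g' m (F' X)"] exI[of _ "g' * m"] exI[of _ "msg_split m V'"]) simp
qed

section \<open>Measuring and hashing\<close>

lemma sum_tri_1: "(\<Sum>p\<in>tri a b 1. F p) = (\<Sum>i<a. \<Sum>j<b. F (i, j, 0))"
  by (simp add: sum_tri)

text \<open>Measurement in the computational basis followed by relabelling the outcome along
  \<open>h\<close>.\<close>

definition hash_op :: "nat \<Rightarrow> nat \<Rightarrow> (nat \<Rightarrow> nat) \<Rightarrow> complex mat \<Rightarrow> complex mat" where
  "hash_op a m h X = mat m m (\<lambda>(y, y'). if y = y' then (\<Sum>i<a. if h i = y then X $$ (i, i) else 0) else 0)"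

text \<open>For complete positivity, the lifted form is a sum over the outcomes \<open>i\<close> of
  forms of \<open>X\<close> restricted to indices with middle component \<open>i\<close>.\<close>

lemma cptp_hash_op:
  assumes h: "\<And>i. i < a \<Longrightarrow> h i < m"
  shows "cptp a m (hash_op a m h)"
  unfolding cptp_def
proof (intro conjI ballI allI impI)
  fix X Y :: "complex mat" and c assume X: "X \<in> carrier_mat a a" and Y: "Y \<in> carrier_mat a a"
  show "hash_op a m h (X + Y) = hash_op a m h X + hash_op a m h Y"
  proof (rule eq_matI)
    fix y y' assume "y < dim_row (hash_op a m h X + hash_op a m h Y)" "y' < dim_col (hash_op a m h X + hash_op a m h Y)"
    then have y: "y < m" "y' < m" by (auto simp: hash_op_def)
    have "(\<Sum>i<a. if h i = y then (X + Y) $$ (i, i) else 0)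
      = (\<Sum>i<a. (if h i = y then X $$ (i, i) else 0) + (if h i = y then Y $$ (i, i) else 0))"
      using X Y by (intro sum.cong refl) auto
    also have "\<dots> = (\<Sum>i<a. if h i = y then X $$ (i, i) else 0) + (\<Sum>i<a. if h i = y then Y $$ (i, i) else 0)"
      by (rule sum.distrib)
    finally show "hash_op a m h (X + Y) $$ (y, y') = (hash_op a m h X + hash_op a m h Y) $$ (y, y')"
      using y by (cases "y = y'") (simp_all add: hash_op_def)
  qed (simp_all add: hash_op_def)
next
  fix X :: "complex mat" and c assume X: "X \<in> carrier_mat a a"
  show "hash_op a m h (c \<cdot>\<^sub>m X) = c \<cdot>\<^sub>m hash_op a m h X"
    using X by (intro eq_matI) (auto simp: hash_op_def sum_distrib_left intro!: sum.cong)
next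
  fix X :: "complex mat" assume X: "X \<in> carrier_mat a a"
  show "hash_op a m h X \<in> carrier_mat m m" by (simp add: hash_op_def)
  have "mat_trace (hash_op a m h X) = (\<Sum>y<m. \<Sum>i<a. if h i = y then X $$ (i, i) else 0)"
    by (simp add: mat_trace_def hash_op_def)
  also have "\<dots> = (\<Sum>i<a. \<Sum>y<m. if h i = y then X $$ (i, i) else 0)" by (rule sum.swap)
  also have "\<dots> = mat_trace X" using h X by (simp add: mat_trace_def)
  finally show "mat_trace (hash_op a m h X) = mat_trace X" .
next
  fix k and X :: "complex mat" assume "positive_op (k * a) X"
  then have X: "positive_op (k * a * 1) X" by (simp only: mult_1_right)
  have "positive_op (k * m * 1) (lift_op k 1 a m (hash_op a m h) X)"
    unfolding positive_op_tri
  proof (intro conjI allI)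
    fix v :: "nat \<times> nat \<times> nat \<Rightarrow> complex"
    define F where "F i p p' = v (p, h i, 0) * X $$ (tri_enc a 1 (p, i, 0), tri_enc a 1 (p', i, 0)) * cnj (v (p', h i, 0))" for i p p'
    have "(\<Sum>p\<in>tri k m 1. \<Sum>q\<in>tri k m 1. v p * lift_op k 1 a m (hash_op a m h) X $$ (tri_enc m 1 p, tri_enc m 1 q) * cnj (v q))
      = (\<Sum>p<k. \<Sum>y<m. \<Sum>p'<k. \<Sum>y'<m. v (p, y, 0) * hash_op a m h (slice a 1 X (p, 0) (p', 0)) $$ (y, y') * cnj (v (p', y', 0)))"
      unfolding sum_tri_1 by (intro sum.cong refl) (subst lift_op_index; simp)
    also have "\<dots> = (\<Sum>p<k. \<Sum>y<m. \<Sum>p'<k. \<Sum>y'<m. if y' = y then (\<Sum>i<a. if h i = y then F i p p' else 0) else 0)"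
      by (intro sum.cong refl)
        (auto simp: hash_op_def slice_index F_def sum_distrib_left sum_distrib_right simp del: tri_enc.simps One_nat_def
          intro!: sum.cong)
    also have "\<dots> = (\<Sum>p<k. \<Sum>y<m. \<Sum>p'<k. \<Sum>i<a. if h i = y then F i p p' else 0)"
      by (rule sum.cong[OF refl], rule sum.cong[OF refl], rule sum.cong[OF refl]) simp
    also have "\<dots> = (\<Sum>p<k. \<Sum>p'<k. \<Sum>y<m. \<Sum>i<a. if h i = y then F i p p' else 0)"
      by (intro sum.cong refl sum.swap)
    also have "\<dots> = (\<Sum>p<k. \<Sum>p'<k. \<Sum>i<a. \<Sum>y<m. if h i = y then F i p p' else 0)"
      by (intro sum.cong refl sum.swap)
    also have "\<dots> = (\<Sum>p<k. \<Sum>p'<k. \<Sum>i<a. F i p p')"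
      using h by (intro sum.cong refl) simp
    also have "\<dots> = (\<Sum>p<k. \<Sum>i<a. \<Sum>p'<k. F i p p')"
      by (intro sum.cong refl sum.swap)
    also have "\<dots> = (\<Sum>i<a. \<Sum>p<k. \<Sum>p'<k. F i p p')"
      by (rule sum.swap)
    also have "0 \<le> \<dots>"
    proof (rule sum_nonneg)
      fix i assume "i \<in> {..<a}"
      then have "(p, i, 0) \<in> tri k a 1" if "p \<in> {..<k}" for p using that by simp
      then show "0 \<le> (\<Sum>p<k. \<Sum>p'<k. F i p p')"
        unfolding F_def
        by (intro positive_op_select[OF X, where f = "\<lambda>p. tri_enc a 1 (p, i, 0)" and v = "\<lambda>p. v (p, h i, 0)"] tri_enc_less)
    qed
    finally show "0 \<le> (\<Sum>p\<in>tri k m 1. \<Sum>q\<in>tri k m 1. v p * lift_op k 1 a m (hash_op a m h) X $$ (tri_enc m 1 p, tri_enc m 1 q) * cnj (v q))" .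
  qed (rule lift_op_carrier)
  then show "positive_op (k * m) (lift_op k 1 a m (hash_op a m h) X)" by (simp only: mult_1_right)
qed

definition hash_both :: "dims \<Rightarrow> nat \<Rightarrow> (nat \<Rightarrow> nat) \<Rightarrow> complex mat \<Rightarrow> complex mat" where
  "hash_both D m h X = (case D of (a, b, g) \<Rightarrow> lift_op m g b m (hash_op b m h) (lift_op 1 (b * g) a m (hash_op a m h) X))"

lemma lopc_hash_both:
  assumes "lopc D (a, b, g) F" "\<And>i. h i < m"
  shows "lopc D (m, m, g) (\<lambda>X. hash_both (a, b, g) m h (F X))"
  unfolding hash_both_def prod.case
  by (intro lopc.lopc_local_B[of D m b g] lopc.lopc_local_A[of D a] assms cptp_hash_op)

lemma hash_both_index:
  assumes "y < m" "z < m" "k < g" "y' < m" "z' < m" "k' < g"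
  shows "hash_both (a, b, g) m h X $$ (tri_enc m g (y, z, k), tri_enc m g (y', z', k')) =
    (if y = y' \<and> z = z' then (\<Sum>i<a. \<Sum>j<b. if h i = y \<and> h j = z then X $$ (tri_enc b g (i, j, k), tri_enc b g (i, j, k')) else 0) else 0)"
proof -
  define Y where "Y = lift_op 1 (b * g) a m (hash_op a m h) X"
  have Y: "Y $$ (tri_enc b g (y, j, k), tri_enc b g (y', j, k')) =
    (if y = y' then (\<Sum>i<a. if h i = y then X $$ (tri_enc b g (i, j, k), tri_enc b g (i, j, k')) else 0) else 0)"
    if "j < b" for j
  proof -
    have "Y $$ (tri_enc b g (y, j, k), tri_enc b g (y', j, k')) = hash_op a m h (slice a (b * g) X (0, j * g + k) (0, j * g + k')) $$ (y, y')"
      unfolding Y_def tri_enc_assoc[of b g _ _ _ m] using assms that by (subst lift_op_index) (auto intro: mult_index_less)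
    also have "\<dots> = (if y = y' then (\<Sum>i<a. if h i = y then slice a (b * g) X (0, j * g + k) (0, j * g + k') $$ (i, i) else 0) else 0)"
      using assms by (simp add: hash_op_def)
    also have "\<dots> = (if y = y' then (\<Sum>i<a. if h i = y then X $$ (tri_enc b g (i, j, k), tri_enc b g (i, j, k')) else 0) else 0)"
      unfolding tri_enc_assoc[of b g _ _ _ a]
      by (intro if_cong refl sum.cong) (simp_all add: slice_index del: tri_enc.simps)
    finally show ?thesis .
  qed
  have "hash_both (a, b, g) m h X $$ (tri_enc m g (y, z, k), tri_enc m g (y', z', k'))
    = hash_op b m h (slice b g Y (y, k) (y', k')) $$ (z, z')"
    unfolding hash_both_def prod.case Y_def[symmetric] using assms by (subst lift_op_index) auto
  also have "\<dots> = (if z = z' then (\<Sum>j<b. if h j = z then Y $$ (tri_enc b g (y, j, k), tri_enc b g (y', j, k')) else 0) else 0)"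
    using assms by (auto simp: hash_op_def slice_index simp del: tri_enc.simps intro!: sum.cong)
  also have "\<dots> = (if z = z' then (\<Sum>j<b. if h j = z then (if y = y' then (\<Sum>i<a. if h i = y then X $$ (tri_enc b g (i, j, k), tri_enc b g (i, j, k')) else 0) else 0) else 0) else 0)"
    by (intro if_cong refl sum.cong) (simp_all add: Y del: tri_enc.simps)
  also have "\<dots> = (if y = y' \<and> z = z' then (\<Sum>j<b. \<Sum>i<a. if h i = y \<and> h j = z then X $$ (tri_enc b g (i, j, k), tri_enc b g (i, j, k')) else 0) else 0)"
    by (auto intro!: sum.cong sum.neutral)
  also have "(\<Sum>j<b. \<Sum>i<a. if h i = y \<and> h j = z then X $$ (tri_enc b g (i, j, k), tri_enc b g (i, j, k')) else 0)
    = (\<Sum>i<a. \<Sum>j<b. if h i = y \<and> h j = z then X $$ (tri_enc b g (i, j, k), tri_enc b g (i, j, k')) else 0)"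
    by (rule sum.swap)
  finally show ?thesis .
qed


section \<open>Tensor powers\<close>

text \<open>An entrywise product argument that covers tensor products: an eigendecomposition of
  \<open>X\<close> writes the form as a nonnegative combination of forms of \<open>Y\<close> at
  rescaled vectors.\<close>

lemma positive_op_schur:
  assumes X: "positive_op n X" and Y: "positive_op n' Y"
    and f: "\<And>p. p \<in> I \<Longrightarrow> f p < n" and f': "\<And>p. p \<in> I \<Longrightarrow> f' p < n'"
  shows "0 \<le> (\<Sum>p\<in>I. \<Sum>q\<in>I. v p * (X $$ (f p, f q) * Y $$ (f' p, f' q)) * cnj (v q))"
proof -
  obtain U d where U: "unitary_fm n U" "fm n X = U * diagm n d * adj U"
    using spectral_fm[OF psd_adj[OF psd_fm[OF X]] supp_fm] by blast
  have UU: "adj U * U = idm {..<n}" "supp U \<subseteq> {..<n}" using U(1) by (auto simp: unitary_fm_def)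
  have "adj U * fm n X * adj (adj U) = (adj U * U) * diagm n d * (adj U * U)"
    unfolding U(2) by (simp add: mult.assoc)
  also have "\<dots> = diagm n d" using UU by (simp add: idm_times times_idm supp_diagm)
  finally have "psd (diagm n d)" using psd_conj[OF psd_fm[OF X], of "adj U"] by simp
  then have d: "0 \<le> d k" if "k < n" for k using psd_ent_nonneg[of "diagm n d" k] that by (simp add: ent_diagm)
  have X_eq: "X $$ (r, s) = (\<Sum>k<n. of_real (d k) * (ent U r k * cnj (ent U s k)))" if "r < n" "s < n" for r s
  proof -
    have sup: "supp (U * diagm n d) \<subseteq> {..<n}" using supp_times[of U "diagm n d"] UU(2) supp_diagm[of n d] by auto
    have "X $$ (r, s) = ent (fm n X) r s" using that by (simp add: ent_fm)
    also have "\<dots> = (\<Sum>k<n. ent (U * diagm n d) r k * cnj (ent U s k))"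
      unfolding U(2) using sup by (subst ent_times[of "{..<n}"]) auto
    finally show ?thesis by (simp add: ent_times_diagm mult_ac)
  qed
  have "(\<Sum>p\<in>I. \<Sum>q\<in>I. v p * (X $$ (f p, f q) * Y $$ (f' p, f' q)) * cnj (v q))
    = (\<Sum>p\<in>I. \<Sum>q\<in>I. \<Sum>k<n. of_real (d k) * ((v p * ent U (f p) k) * Y $$ (f' p, f' q) * cnj (v q * ent U (f q) k)))"
    using f by (intro sum.cong refl) (simp add: X_eq sum_distrib_left sum_distrib_right mult_ac)
  also have "\<dots> = (\<Sum>p\<in>I. \<Sum>k<n. \<Sum>q\<in>I. of_real (d k) * ((v p * ent U (f p) k) * Y $$ (f' p, f' q) * cnj (v q * ent U (f q) k)))"
    by (intro sum.cong refl sum.swap)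
  also have "\<dots> = (\<Sum>k<n. \<Sum>p\<in>I. \<Sum>q\<in>I. of_real (d k) * ((v p * ent U (f p) k) * Y $$ (f' p, f' q) * cnj (v q * ent U (f q) k)))"
    by (rule sum.swap)
  also have "\<dots> = (\<Sum>k<n. of_real (d k) * (\<Sum>p\<in>I. \<Sum>q\<in>I. (v p * ent U (f p) k) * Y $$ (f' p, f' q) * cnj (v q * ent U (f q) k)))"
    by (simp add: sum_distrib_left)
  also have "0 \<le> \<dots>"
  proof (rule sum_nonneg, rule mult_nonneg_nonneg)
    fix k assume "k \<in> {..<n}"
    then show "0 \<le> complex_of_real (d k)" using d by (simp add: less_eq_complex_def)
    show "0 \<le> (\<Sum>p\<in>I. \<Sum>q\<in>I. (v p * ent U (f p) k) * Y $$ (f' p, f' q) * cnj (v q * ent U (f q) k))"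
      by (rule positive_op_select[OF Y f'])
  qed
  finally show ?thesis .
qed

definition hi :: "nat \<Rightarrow> nat \<Rightarrow> nat \<Rightarrow> nat \<times> nat \<times> nat \<Rightarrow> nat \<times> nat \<times> nat" where
  "hi a b e p = (fst p div a, fst (snd p) div b, snd (snd p) div e)"

definition lo :: "nat \<Rightarrow> nat \<Rightarrow> nat \<Rightarrow> nat \<times> nat \<times> nat \<Rightarrow> nat \<times> nat \<times> nat" where
  "lo a b e p = (fst p mod a, fst (snd p) mod b, snd (snd p) mod e)"

lemma hi_tri: "p \<in> tri (a * a') (b * b') (e * e') \<Longrightarrow> hi a' b' e' p \<in> tri a b e"
  by (cases p) (simp add: hi_def less_mult_imp_div_less)

lemma lo_tri: "p \<in> tri (a * a') (b * b') (e * e') \<Longrightarrow> lo a' b' e' p \<in> tri a' b' e'"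
  by (cases p) (auto simp: lo_def dest: index_divmod)

lemma tri_tensor_carrier [simp]:
  "tri_tensor (a, b, e) X (a', b', e') Y \<in> carrier_mat (a * a' * (b * b') * (e * e')) (a * a' * (b * b') * (e * e'))"
  by simp

lemma tri_tensor_index:
  assumes "p \<in> tri (a * a') (b * b') (e * e')" "q \<in> tri (a * a') (b * b') (e * e')"
  shows "tri_tensor (a, b, e) X (a', b', e') Y $$ (tri_enc (b * b') (e * e') p, tri_enc (b * b') (e * e') q) =
    X $$ (tri_enc b e (hi a' b' e' p), tri_enc b e (hi a' b' e' q)) *
    Y $$ (tri_enc b' e' (lo a' b' e' p), tri_enc b' e' (lo a' b' e' q))"
  using assms unfolding tri_tensor.simps
  by (subst tri_mat_index) (auto simp: hi_def lo_def split: prod.splits)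

lemma tri_tensor_positive:
  assumes "positive_op (a * b * e) X" "positive_op (a' * b' * e') Y"
  shows "positive_op (a * a' * (b * b') * (e * e')) (tri_tensor (a, b, e) X (a', b', e') Y)"
  unfolding positive_op_tri
proof (intro conjI allI)
  fix v :: "nat \<times> nat \<times> nat \<Rightarrow> complex"
  let ?I = "tri (a * a') (b * b') (e * e')"
  have "(\<Sum>p\<in>?I. \<Sum>q\<in>?I. v p * tri_tensor (a, b, e) X (a', b', e') Y $$ (tri_enc (b * b') (e * e') p, tri_enc (b * b') (e * e') q) * cnj (v q))
    = (\<Sum>p\<in>?I. \<Sum>q\<in>?I. v p * (X $$ (tri_enc b e (hi a' b' e' p), tri_enc b e (hi a' b' e' q)) *
      Y $$ (tri_enc b' e' (lo a' b' e' p), tri_enc b' e' (lo a' b' e' q))) * cnj (v q))"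
    by (intro sum.cong refl) (simp only: tri_tensor_index)
  also have "0 \<le> \<dots>"
    by (rule positive_op_schur[OF assms, where f = "\<lambda>p. tri_enc b e (hi a' b' e' p)" and f' = "\<lambda>p. tri_enc b' e' (lo a' b' e' p)"])
      (simp_all only: tri_enc_less hi_tri lo_tri)
  finally show "0 \<le> (\<Sum>p\<in>?I. \<Sum>q\<in>?I. v p * tri_tensor (a, b, e) X (a', b', e') Y $$ (tri_enc (b * b') (e * e') p, tri_enc (b * b') (e * e') q) * cnj (v q))" .
qed (rule tri_tensor_carrier)

lemma sum_tri_mult:
  "(\<Sum>p\<in>tri (a * a') (b * b') (e * e'). F (hi a' b' e' p) (lo a' b' e' p)) = (\<Sum>p\<in>tri a b e. \<Sum>q\<in>tri a' b' e'. F p q)"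
    (is "?L = ?R")
proof -
  have "?L = (\<Sum>i<a. \<Sum>i'<a'. \<Sum>j<b. \<Sum>j'<b'. \<Sum>k<e. \<Sum>k'<e'. F (i, j, k) (i', j', k'))"
    unfolding sum_tri sum_mult_index hi_def lo_def by (intro sum.cong refl) simp
  also have "\<dots> = (\<Sum>i<a. \<Sum>i'<a'. \<Sum>j<b. \<Sum>k<e. \<Sum>j'<b'. \<Sum>k'<e'. F (i, j, k) (i', j', k'))"
    by (intro sum.cong refl sum.swap)
  also have "\<dots> = (\<Sum>i<a. \<Sum>j<b. \<Sum>i'<a'. \<Sum>k<e. \<Sum>j'<b'. \<Sum>k'<e'. F (i, j, k) (i', j', k'))"
    by (intro sum.cong refl sum.swap)
  also have "\<dots> = (\<Sum>i<a. \<Sum>j<b. \<Sum>k<e. \<Sum>i'<a'. \<Sum>j'<b'. \<Sum>k'<e'. F (i, j, k) (i', j', k'))"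
    by (intro sum.cong refl sum.swap)
  finally show ?thesis by (simp add: sum_tri)
qed

lemma tri_tensor_trace:
  assumes "X \<in> carrier_mat (a * b * e) (a * b * e)" "Y \<in> carrier_mat (a' * b' * e') (a' * b' * e')"
  shows "mat_trace (tri_tensor (a, b, e) X (a', b', e') Y) = mat_trace X * mat_trace Y"
proof -
  have "mat_trace (tri_tensor (a, b, e) X (a', b', e') Y) = (\<Sum>p\<in>tri (a * a') (b * b') (e * e').
    X $$ (tri_enc b e (hi a' b' e' p), tri_enc b e (hi a' b' e' p)) * Y $$ (tri_enc b' e' (lo a' b' e' p), tri_enc b' e' (lo a' b' e' p)))"
    unfolding mat_trace_tri[OF tri_tensor_carrier] by (intro sum.cong refl) (simp only: tri_tensor_index)
  also have "\<dots> = (\<Sum>p\<in>tri a b e. \<Sum>q\<in>tri a' b' e'. X $$ (tri_enc b e p, tri_enc b e p) * Y $$ (tri_enc b' e' q, tri_enc b' e' q))"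
    by (rule sum_tri_mult)
  also have "\<dots> = mat_trace X * mat_trace Y"
    by (simp add: mat_trace_tri[OF assms(1)] mat_trace_tri[OF assms(2)] sum_product)
  finally show ?thesis .
qed

definition split_prod :: "nat \<Rightarrow> nat \<Rightarrow> nat \<Rightarrow> (nat \<Rightarrow> nat \<Rightarrow> nat \<Rightarrow> complex) \<Rightarrow> (nat \<Rightarrow> nat \<Rightarrow> nat \<Rightarrow> complex) \<Rightarrow> nat \<Rightarrow> nat \<Rightarrow> nat \<Rightarrow> complex" where
  "split_prod g e f V W k n s = V (k div g) (n div e) (s div f) * W (k mod g) (n mod e) (s mod f)"

lemma splits_prod:
  assumes V: "splits g e f V" and W: "splits g' e' f' W"
  shows "splits (g * g') (e * e') (f * f') (split_prod g' e' f' V W)"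
proof -
  have dm: "n = n' \<longleftrightarrow> n div m = n' div m \<and> n mod m = n' mod m" for n n' m :: nat
    by (metis div_mult_mod_eq)
  show ?thesis
    unfolding splits_def
  proof (intro conjI allI impI)
    fix n s n' s' assume lt: "n < e * e'" "s < f * f'" "n' < e * e'" "s' < f * f'"
    note r = index_divmod[OF lt(1)] index_divmod[OF lt(2)] index_divmod[OF lt(3)] index_divmod[OF lt(4)]
    have "(\<Sum>k<g * g'. cnj (split_prod g' e' f' V W k n s) * split_prod g' e' f' V W k n' s')
      = (\<Sum>k<g. \<Sum>k'<g'. (cnj (V k (n div e') (s div f')) * V k (n' div e') (s' div f')) *
          (cnj (W k' (n mod e') (s mod f')) * W k' (n' mod e') (s' mod f')))"
      unfolding sum_mult_index split_prod_def by (intro sum.cong refl) (simp add: mult_ac)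
    also have "\<dots> = (\<Sum>k<g. cnj (V k (n div e') (s div f')) * V k (n' div e') (s' div f')) *
        (\<Sum>k'<g'. cnj (W k' (n mod e') (s mod f')) * W k' (n' mod e') (s' mod f'))"
      by (simp add: sum_product)
    also have "\<dots> = (if n = n' \<and> s = s' then 1 else 0)"
      using V W r dm[of n n' e'] dm[of s s' f'] by (simp add: splits_def)
    finally show "(\<Sum>k<g * g'. cnj (split_prod g' e' f' V W k n s) * split_prod g' e' f' V W k n' s') = (if n = n' \<and> s = s' then 1 else 0)" .
  next
    fix k k' assume lt: "k < g * g'" "k' < g * g'"
    note r = index_divmod[OF lt(1)] index_divmod[OF lt(2)]
    have "(\<Sum>n<e * e'. \<Sum>s<f * f'. split_prod g' e' f' V W k n s * cnj (split_prod g' e' f' V W k' n s))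
      = (\<Sum>n<e. \<Sum>n'<e'. \<Sum>s<f. \<Sum>s'<f'. (V (k div g') n s * cnj (V (k' div g') n s)) * (W (k mod g') n' s' * cnj (W (k' mod g') n' s')))"
      unfolding sum_mult_index split_prod_def by (intro sum.cong refl) (simp add: mult_ac)
    also have "\<dots> = (\<Sum>n<e. \<Sum>s<f. \<Sum>n'<e'. \<Sum>s'<f'. (V (k div g') n s * cnj (V (k' div g') n s)) * (W (k mod g') n' s' * cnj (W (k' mod g') n' s')))"
      by (intro sum.cong refl sum.swap)
    also have "\<dots> = (\<Sum>n<e. \<Sum>s<f. V (k div g') n s * cnj (V (k' div g') n s)) * (\<Sum>n'<e'. \<Sum>s'<f'. W (k mod g') n' s' * cnj (W (k' mod g') n' s'))"
      unfolding sum_distrib_right unfolding sum_distrib_left by (rule refl)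
    also have "\<dots> = (if k = k' then 1 else 0)"
      using V W r dm[of k k' g'] by (simp add: splits_def)
    finally show "(\<Sum>n<e * e'. \<Sum>s<f * f'. split_prod g' e' f' V W k n s * cnj (split_prod g' e' f' V W k' n s)) = (if k = k' then 1 else 0)" .
  qed
qed

text \<open>This factorisation lets the trace, the sum and the vanishing of the blocks of a tensor
  power be obtained by induction on the number of copies.\<close>

lemma blk_tri_tensor:
  "blk (a * a', b * b', e * e') (g * g') (split_prod g' e' f' V W) s s' (tri_tensor (a, b, g) X (a', b', g') Y) =
    tri_tensor (a, b, e) (blk (a, b, e) g V (s div f') (s' div f') X) (a', b', e') (blk (a', b', e') g' W (s mod f') (s' mod f') Y)"
proof (rule tri_mat_eqI[of _ "a * a'" "b * b'" "e * e'"])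
  fix p q assume pq: "p \<in> tri (a * a') (b * b') (e * e')" "q \<in> tri (a * a') (b * b') (e * e')"
  obtain i j n i' j' n' where p: "p = (i, j, n)" "q = (i', j', n')" by (cases p, cases q)
  have lt: "i < a * a'" "j < b * b'" "n < e * e'" "i' < a * a'" "j' < b * b'" "n' < e * e'" using pq by (auto simp: p)
  have hl: "i div a' < a" "j div b' < b" "n div e' < e" "i' div a' < a" "j' div b' < b" "n' div e' < e"
    "i mod a' < a'" "j mod b' < b'" "n mod e' < e'" "i' mod a' < a'" "j' mod b' < b'" "n' mod e' < e'"
    using lt[THEN index_divmod] by auto
  have "blk (a * a', b * b', e * e') (g * g') (split_prod g' e' f' V W) s s' (tri_tensor (a, b, g) X (a', b', g') Y) $$
      (tri_enc (b * b') (e * e') p, tri_enc (b * b') (e * e') q)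
    = (\<Sum>k<g. \<Sum>\<kappa><g'. \<Sum>k'<g. \<Sum>\<kappa>'<g'.
        (cnj (V k (n div e') (s div f')) * V k' (n' div e') (s' div f') * X $$ (tri_enc b g (i div a', j div b', k), tri_enc b g (i' div a', j' div b', k'))) *
        (cnj (W \<kappa> (n mod e') (s mod f')) * W \<kappa>' (n' mod e') (s' mod f') * Y $$ (tri_enc b' g' (i mod a', j mod b', \<kappa>), tri_enc b' g' (i' mod a', j' mod b', \<kappa>'))))"
    unfolding p blk_index[OF lt] sum_mult_index
  proof (intro sum.cong refl)
    fix k \<kappa> k' \<kappa>' assume "k \<in> {..<g}" "\<kappa> \<in> {..<g'}" "k' \<in> {..<g}" "\<kappa>' \<in> {..<g'}"
    then have kk: "k < g" "\<kappa> < g'" "k' < g" "\<kappa>' < g'" by auto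
    have in_tri: "(i, j, k * g' + \<kappa>) \<in> tri (a * a') (b * b') (g * g')" "(i', j', k' * g' + \<kappa>') \<in> tri (a * a') (b * b') (g * g')"
      using lt kk by (simp_all add: mult_index_less)
    show "cnj (split_prod g' e' f' V W (k * g' + \<kappa>) n s) * split_prod g' e' f' V W (k' * g' + \<kappa>') n' s' *
      tri_tensor (a, b, g) X (a', b', g') Y $$ (tri_enc (b * b') (g * g') (i, j, k * g' + \<kappa>), tri_enc (b * b') (g * g') (i', j', k' * g' + \<kappa>'))
      = (cnj (V k (n div e') (s div f')) * V k' (n' div e') (s' div f') * X $$ (tri_enc b g (i div a', j div b', k), tri_enc b g (i' div a', j' div b', k'))) *
        (cnj (W \<kappa> (n mod e') (s mod f')) * W \<kappa>' (n' mod e') (s' mod f') * Y $$ (tri_enc b' g' (i mod a', j mod b', \<kappa>), tri_enc b' g' (i' mod a', j' mod b', \<kappa>')))"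
      unfolding tri_tensor_index[OF in_tri] using kk
      by (simp add: split_prod_def hi_def lo_def mult_ac del: tri_enc.simps)
  qed
  also have "\<dots> = (\<Sum>k<g. \<Sum>k'<g. \<Sum>\<kappa><g'. \<Sum>\<kappa>'<g'.
        (cnj (V k (n div e') (s div f')) * V k' (n' div e') (s' div f') * X $$ (tri_enc b g (i div a', j div b', k), tri_enc b g (i' div a', j' div b', k'))) *
        (cnj (W \<kappa> (n mod e') (s mod f')) * W \<kappa>' (n' mod e') (s' mod f') * Y $$ (tri_enc b' g' (i mod a', j mod b', \<kappa>), tri_enc b' g' (i' mod a', j' mod b', \<kappa>'))))"
    by (intro sum.cong refl sum.swap)
  also have "\<dots> = tri_tensor (a, b, e) (blk (a, b, e) g V (s div f') (s' div f') X) (a', b', e') (blk (a', b', e') g' W (s mod f') (s' mod f') Y) $$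
      (tri_enc (b * b') (e * e') p, tri_enc (b * b') (e * e') q)"
    unfolding tri_tensor_index[OF pq] unfolding p hi_def lo_def fst_conv snd_conv
    by (simp only: blk_index hl) (simp only: sum_distrib_right, simp only: sum_distrib_left)
  finally show "blk (a * a', b * b', e * e') (g * g') (split_prod g' e' f' V W) s s' (tri_tensor (a, b, g) X (a', b', g') Y) $$
      (tri_enc (b * b') (e * e') p, tri_enc (b * b') (e * e') q)
    = tri_tensor (a, b, e) (blk (a, b, e) g V (s div f') (s' div f') X) (a', b', e') (blk (a', b', e') g' W (s mod f') (s' mod f') Y) $$
      (tri_enc (b * b') (e * e') p, tri_enc (b * b') (e * e') q)" .
qed (rule blk_carrier tri_tensor_carrier)+

text \<open>For one copy E is left alone and F is expanded in the columns of \<open>u\<close>. The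
  freedom in \<open>u\<close> is used to take an eigenbasis of the marginal of F, or the basis in
  which F is classical.\<close>

definition base_split :: "nat \<Rightarrow> (nat \<Rightarrow> nat \<Rightarrow> complex) \<Rightarrow> nat \<Rightarrow> nat \<Rightarrow> nat \<Rightarrow> complex" where
  "base_split f u k n s = (if k div f = n then u (k mod f) s else 0)"

definition orthonormal :: "nat \<Rightarrow> (nat \<Rightarrow> nat \<Rightarrow> complex) \<Rightarrow> bool" where
  "orthonormal f u \<longleftrightarrow> (\<forall>s<f. \<forall>s'<f. (\<Sum>i<f. cnj (u i s) * u i s') = (if s = s' then 1 else 0)) \<and>
    (\<forall>i<f. \<forall>j<f. (\<Sum>s<f. u i s * cnj (u j s)) = (if i = j then 1 else 0))"

lemma orthonormal_unitary:
  assumes U: "unitary f U"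
  shows "orthonormal f (\<lambda>i s. U $$ (i, s))"
proof -
  have car: "U \<in> carrier_mat f f" using U by (simp add: unitary_def)
  show ?thesis
    unfolding orthonormal_def
  proof (intro conjI allI impI)
    fix s s' assume lt: "s < f" "s' < f"
    have "(mat_adjoint U * U) $$ (s, s') = (\<Sum>i<f. cnj (U $$ (i, s)) * U $$ (i, s'))"
      using lt car by (simp add: scalar_prod_def mat_adjoint_index lessThan_atLeast0)
    then show "(\<Sum>i<f. cnj (U $$ (i, s)) * U $$ (i, s')) = (if s = s' then 1 else 0)"
      using U lt by (simp add: unitary_def)
  next
    fix s s' assume lt: "s < f" "s' < f"
    have "(U * mat_adjoint U) $$ (s, s') = (\<Sum>i<f. U $$ (s, i) * cnj (U $$ (s', i)))"
      using lt car by (simp add: scalar_prod_def mat_adjoint_index lessThan_atLeast0)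
    then show "(\<Sum>i<f. U $$ (s, i) * cnj (U $$ (s', i))) = (if s = s' then 1 else 0)"
      using U lt by (simp add: unitary_def)
  qed
qed

lemma splits_base:
  assumes u: "orthonormal f u"
  shows "splits (e * f) e f (base_split f u)"
proof -
  have dm: "k = k' \<longleftrightarrow> k div f = k' div f \<and> k mod f = k' mod f" for k k' :: nat
    by (metis div_mult_mod_eq)
  show ?thesis
    unfolding splits_def
  proof (intro conjI allI impI)
    fix n s n' s' assume lt: "n < e" "s < f" "n' < e" "s' < f"
    have "(\<Sum>k<e * f. cnj (base_split f u k n s) * base_split f u k n' s')
      = (\<Sum>x<e. if x = n then (if n = n' then (\<Sum>i<f. cnj (u i s) * u i s') else 0) else 0)"
      unfolding sum_mult_index base_split_def by (intro sum.cong refl) (auto intro!: sum.cong sum.neutral)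
    also have "\<dots> = (if n = n' \<and> s = s' then 1 else 0)"
      using u lt by (simp add: orthonormal_def)
    finally show "(\<Sum>k<e * f. cnj (base_split f u k n s) * base_split f u k n' s') = (if n = n' \<and> s = s' then 1 else 0)" .
  next
    fix k k' assume "k < e * f" "k' < e * f"
    note r = this[THEN index_divmod]
    have "(\<Sum>n<e. \<Sum>s<f. base_split f u k n s * cnj (base_split f u k' n s))
      = (\<Sum>n<e. if n = k div f then (if k div f = k' div f then (\<Sum>s<f. u (k mod f) s * cnj (u (k' mod f) s)) else 0) else 0)"
      unfolding base_split_def by (intro sum.cong refl) (auto intro!: sum.cong sum.neutral)
    also have "\<dots> = (if k = k' then 1 else 0)"
      using u r dm[of k k'] by (simp add: orthonormal_def)
    finally show "(\<Sum>n<e. \<Sum>s<f. base_split f u k n s * cnj (base_split f u k' n s)) = (if k = k' then 1 else 0)" .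
  qed
qed

fun pow_split :: "nat \<Rightarrow> nat \<Rightarrow> (nat \<Rightarrow> nat \<Rightarrow> complex) \<Rightarrow> nat \<Rightarrow> nat \<Rightarrow> nat \<Rightarrow> nat \<Rightarrow> complex" where
  "pow_split e f u 0 = (\<lambda>_ _ _. 1)"
| "pow_split e f u (Suc n) = split_prod ((e * f) ^ n) (e ^ n) (f ^ n) (base_split f u) (pow_split e f u n)"

lemma splits_pow:
  assumes "orthonormal f u"
  shows "splits ((e * f) ^ n) (e ^ n) (f ^ n) (pow_split e f u n)"
proof (induction n)
  case 0
  show ?case by (simp add: splits_def)
next
  case (Suc n)
  show ?case using splits_prod[OF splits_base[OF assms] Suc] by simp
qed

definition pow_blk :: "dims \<Rightarrow> nat \<Rightarrow> (nat \<Rightarrow> nat \<Rightarrow> complex) \<Rightarrow> complex mat \<Rightarrow> nat \<Rightarrow> nat \<Rightarrow> nat \<Rightarrow> complex mat" where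
  "pow_blk D f u \<rho> n s s' = (case D of (a, b, e) \<Rightarrow>
     blk (a ^ n, b ^ n, e ^ n) ((e * f) ^ n) (pow_split e f u n) s s' (tri_power (a, b, e * f) \<rho> n))"

lemma pow_blk_carrier [simp]: "pow_blk (a, b, e) f u \<rho> n s s' \<in> carrier_mat (a ^ n * b ^ n * e ^ n) (a ^ n * b ^ n * e ^ n)"
  by (simp add: pow_blk_def)

lemma pow_blk_0: "pow_blk (a, b, e) f u \<rho> 0 s s' = 1\<^sub>m 1"
  by (rule eq_matI) (simp_all add: pow_blk_def blk_def tri_mat_def tri_dec_def)

lemma pow_blk_Suc: "pow_blk (a, b, e) f u \<rho> (Suc n) s s' =
  tri_tensor (a, b, e) (blk (a, b, e) (e * f) (base_split f u) (s div f ^ n) (s' div f ^ n) \<rho>)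
    (a ^ n, b ^ n, e ^ n) (pow_blk (a, b, e) f u \<rho> n (s mod f ^ n) (s' mod f ^ n))"
  unfolding pow_blk_def prod.case tri_power.simps(2) pow_split.simps(2) dims_pow.simps power_Suc
  by (rule blk_tri_tensor)

lemma base_blk_index:
  assumes p: "p \<in> tri a b e" and q: "q \<in> tri a b e"
  shows "blk (a, b, e) (e * f) (base_split f u) s s' \<rho> $$ (tri_enc b e p, tri_enc b e q) =
    (\<Sum>i<f. \<Sum>j<f. cnj (u i s) * u j s' * \<rho> $$ (tri_enc b e p * f + i, tri_enc b e q * f + j))"
proof -
  obtain x y n x' y' n' where pq: "p = (x, y, n)" "q = (x', y', n')" by (cases p, cases q)
  have lt: "x < a" "y < b" "n < e" "x' < a" "y' < b" "n' < e" using p q by (auto simp: pq)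
  have enc: "tri_enc b (e * f) (x, y, k * f + i) = tri_enc b e (x, y, k) * f + i" for x y k i
    by (simp add: algebra_simps)
  have "blk (a, b, e) (e * f) (base_split f u) s s' \<rho> $$ (tri_enc b e p, tri_enc b e q)
    = (\<Sum>k<e. \<Sum>i<f. \<Sum>k'<e. \<Sum>j<f. if k' = n' then (if k = n then cnj (u i s) * u j s' *
         \<rho> $$ (tri_enc b e (x, y, n) * f + i, tri_enc b e (x', y', n') * f + j) else 0) else 0)"
    unfolding pq blk_index[OF lt] sum_mult_index enc
    by (intro sum.cong refl) (auto simp: base_split_def simp del: tri_enc.simps)
  also have "\<dots> = (\<Sum>k<e. \<Sum>i<f. \<Sum>k'<e. if k' = n' then (\<Sum>j<f. if k = n then cnj (u i s) * u j s' *
         \<rho> $$ (tri_enc b e (x, y, n) * f + i, tri_enc b e (x', y', n') * f + j) else 0) else 0)"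
    by (intro sum.cong refl) simp
  also have "\<dots> = (\<Sum>k<e. \<Sum>i<f. (\<Sum>j<f. if k = n then cnj (u i s) * u j s' *
         \<rho> $$ (tri_enc b e (x, y, n) * f + i, tri_enc b e (x', y', n') * f + j) else 0))"
    using lt by (simp del: tri_enc.simps)
  also have "\<dots> = (\<Sum>k<e. if k = n then (\<Sum>i<f. \<Sum>j<f. cnj (u i s) * u j s' *
         \<rho> $$ (tri_enc b e (x, y, n) * f + i, tri_enc b e (x', y', n') * f + j)) else 0)"
    by (rule sum.cong[OF refl]) simp
  also have "\<dots> = (\<Sum>i<f. \<Sum>j<f. cnj (u i s) * u j s' *
         \<rho> $$ (tri_enc b e (x, y, n) * f + i, tri_enc b e (x', y', n') * f + j))"
    using lt by (simp del: tri_enc.simps)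
  finally show ?thesis by (simp only: pq)
qed

text \<open>By completeness of \<open>u\<close>, the partial trace may be computed in any
  orthonormal basis.\<close>

lemma sum_base_blk:
  assumes u: "orthonormal f u" and p: "p \<in> tri a b e" "q \<in> tri a b e"
  shows "(\<Sum>s<f. blk (a, b, e) (e * f) (base_split f u) s s \<rho> $$ (tri_enc b e p, tri_enc b e q)) =
    ptrace_snd (a * b * e) f \<rho> $$ (tri_enc b e p, tri_enc b e q)"
proof -
  let ?R = "\<lambda>i j. \<rho> $$ (tri_enc b e p * f + i, tri_enc b e q * f + j)"
  have "(\<Sum>s<f. blk (a, b, e) (e * f) (base_split f u) s s \<rho> $$ (tri_enc b e p, tri_enc b e q))
    = (\<Sum>s<f. \<Sum>i<f. \<Sum>j<f. cnj (u i s) * u j s * ?R i j)"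
    by (simp only: base_blk_index[OF p])
  also have "\<dots> = (\<Sum>i<f. \<Sum>s<f. \<Sum>j<f. cnj (u i s) * u j s * ?R i j)"
    by (rule sum.swap)
  also have "\<dots> = (\<Sum>i<f. \<Sum>j<f. \<Sum>s<f. cnj (u i s) * u j s * ?R i j)"
    by (intro sum.cong refl sum.swap)
  also have "\<dots> = (\<Sum>i<f. \<Sum>j<f. if j = i then ?R i j else 0)"
  proof (intro sum.cong refl)
    fix i j assume ij: "i \<in> {..<f}" "j \<in> {..<f}"
    have "(\<Sum>s<f. cnj (u i s) * u j s * ?R i j) = (\<Sum>s<f. u j s * cnj (u i s)) * ?R i j"
      by (simp only: sum_distrib_right mult_ac)
    also have "(\<Sum>s<f. u j s * cnj (u i s)) = (if j = i then 1 else 0)"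
      using u ij by (simp add: orthonormal_def)
    finally show "(\<Sum>s<f. cnj (u i s) * u j s * ?R i j) = (if j = i then ?R i j else 0)" by simp
  qed
  also have "\<dots> = ptrace_snd (a * b * e) f \<rho> $$ (tri_enc b e p, tri_enc b e q)"
    using tri_enc_less[OF p(1)] tri_enc_less[OF p(2)] by (simp add: ptrace_snd_def del: tri_enc.simps)
  finally show ?thesis .
qed

text \<open>The right side is an entry of the marginal of F in the basis \<open>u\<close>. On the
  diagonal it is an eigenvalue if \<open>u\<close> is an eigenbasis.\<close>

lemma trace_base_blk:
  "mat_trace (blk (a, b, e) (e * f) (base_split f u) s s' \<rho>) =
    (\<Sum>i<f. \<Sum>j<f. cnj (u i s) * u j s' * ptrace_fst (a * b * e) f \<rho> $$ (i, j))"
proof -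
  have "mat_trace (blk (a, b, e) (e * f) (base_split f u) s s' \<rho>)
    = (\<Sum>p\<in>tri a b e. \<Sum>i<f. \<Sum>j<f. cnj (u i s) * u j s' * \<rho> $$ (tri_enc b e p * f + i, tri_enc b e p * f + j))"
    unfolding mat_trace_tri[OF blk_carrier] by (intro sum.cong refl) (simp only: base_blk_index)
  also have "\<dots> = (\<Sum>r<a * b * e. \<Sum>i<f. \<Sum>j<f. cnj (u i s) * u j s' * \<rho> $$ (r * f + i, r * f + j))"
    by (simp only: sum_tri_enc)
  also have "\<dots> = (\<Sum>i<f. \<Sum>r<a * b * e. \<Sum>j<f. cnj (u i s) * u j s' * \<rho> $$ (r * f + i, r * f + j))"
    by (rule sum.swap)
  also have "\<dots> = (\<Sum>i<f. \<Sum>j<f. \<Sum>r<a * b * e. cnj (u i s) * u j s' * \<rho> $$ (r * f + i, r * f + j))"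
    by (intro sum.cong refl sum.swap)
  also have "\<dots> = (\<Sum>i<f. \<Sum>j<f. cnj (u i s) * u j s' * ptrace_fst (a * b * e) f \<rho> $$ (i, j))"
    by (intro sum.cong refl) (simp add: ptrace_fst_def sum_distrib_left)
  finally show ?thesis .
qed

text \<open>The product probability of the string formed by the \<open>n\<close> base
  \<open>f\<close> digits of \<open>s\<close>.\<close>

fun pow_prob :: "nat \<Rightarrow> (nat \<Rightarrow> real) \<Rightarrow> nat \<Rightarrow> nat \<Rightarrow> real" where
  "pow_prob f p 0 s = 1"
| "pow_prob f p (Suc n) s = p (s div f ^ n) * pow_prob f p n (s mod f ^ n)"

lemma trace_pow_blk:
  assumes "\<And>s. s < f \<Longrightarrow> mat_trace (blk (a, b, e) (e * f) (base_split f u) s s \<rho>) = of_real (p s)" "s < f ^ n"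
  shows "mat_trace (pow_blk (a, b, e) f u \<rho> n s s) = of_real (pow_prob f p n s)"
  using assms(2)
proof (induction n arbitrary: s)
  case 0
  show ?case unfolding pow_blk_0 by (simp add: mat_trace_def)
next
  case (Suc n)
  have "s div f ^ n < f \<and> s mod f ^ n < f ^ n" using Suc.prems by (intro index_divmod) simp
  then show ?case
    unfolding pow_blk_Suc tri_tensor_trace[OF blk_carrier pow_blk_carrier] by (simp add: assms(1) Suc.IH)
qed

lemma sum_pow_blk:
  assumes u: "orthonormal f u" and "p \<in> tri (a ^ n) (b ^ n) (e ^ n)" "q \<in> tri (a ^ n) (b ^ n) (e ^ n)"
  shows "(\<Sum>s<f ^ n. pow_blk (a, b, e) f u \<rho> n s s $$ (tri_enc (b ^ n) (e ^ n) p, tri_enc (b ^ n) (e ^ n) q)) =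
    tri_power (a, b, e) (ptrace_snd (a * b * e) f \<rho>) n $$ (tri_enc (b ^ n) (e ^ n) p, tri_enc (b ^ n) (e ^ n) q)"
  using assms(2,3)
proof (induction n arbitrary: p q)
  case 0
  then show ?case by (simp add: pow_blk_0 tri_def)
next
  case (Suc n)
  have pq: "p \<in> tri (a * a ^ n) (b * b ^ n) (e * e ^ n)" "q \<in> tri (a * a ^ n) (b * b ^ n) (e * e ^ n)"
    using Suc.prems by simp_all
  let ?hp = "tri_enc b e (hi (a ^ n) (b ^ n) (e ^ n) p)" and ?hq = "tri_enc b e (hi (a ^ n) (b ^ n) (e ^ n) q)"
  let ?lp = "tri_enc (b ^ n) (e ^ n) (lo (a ^ n) (b ^ n) (e ^ n) p)" and ?lq = "tri_enc (b ^ n) (e ^ n) (lo (a ^ n) (b ^ n) (e ^ n) q)"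
  have "(\<Sum>s<f ^ Suc n. pow_blk (a, b, e) f u \<rho> (Suc n) s s $$ (tri_enc (b ^ Suc n) (e ^ Suc n) p, tri_enc (b ^ Suc n) (e ^ Suc n) q))
    = (\<Sum>t<f. \<Sum>s<f ^ n. blk (a, b, e) (e * f) (base_split f u) t t \<rho> $$ (?hp, ?hq) * pow_blk (a, b, e) f u \<rho> n s s $$ (?lp, ?lq))"
    unfolding power_Suc sum_mult_index pow_blk_Suc tri_tensor_index[OF pq]
    by (intro sum.cong refl) simp
  also have "\<dots> = (\<Sum>t<f. blk (a, b, e) (e * f) (base_split f u) t t \<rho> $$ (?hp, ?hq)) * (\<Sum>s<f ^ n. pow_blk (a, b, e) f u \<rho> n s s $$ (?lp, ?lq))"
    by (simp only: sum_product)
  also have "\<dots> = ptrace_snd (a * b * e) f \<rho> $$ (?hp, ?hq) * tri_power (a, b, e) (ptrace_snd (a * b * e) f \<rho>) n $$ (?lp, ?lq)"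
    using sum_base_blk[OF u hi_tri[OF pq(1)] hi_tri[OF pq(2)], of \<rho>] Suc.IH[OF lo_tri[OF pq(1)] lo_tri[OF pq(2)]] by (simp only:)
  also have "\<dots> = tri_power (a, b, e) (ptrace_snd (a * b * e) f \<rho>) (Suc n) $$ (tri_enc (b ^ Suc n) (e ^ Suc n) p, tri_enc (b ^ Suc n) (e ^ Suc n) q)"
    unfolding tri_power.simps(2) dims_pow.simps power_Suc tri_tensor_index[OF pq] ..
  finally show ?case .
qed

text \<open>Distinct strings differ in the leading digit or in the rest, and one vanishing tensor
  factor makes the block vanish.\<close>

lemma pow_blk_offdiag:
  assumes "\<And>s s'. s < f \<Longrightarrow> s' < f \<Longrightarrow> s \<noteq> s' \<Longrightarrow>
      blk (a, b, e) (e * f) (base_split f u) s s' \<rho> = 0\<^sub>m (a * b * e) (a * b * e)"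
    and "s < f ^ n" "s' < f ^ n" "s \<noteq> s'"
  shows "pow_blk (a, b, e) f u \<rho> n s s' = 0\<^sub>m (a ^ n * b ^ n * e ^ n) (a ^ n * b ^ n * e ^ n)"
  using assms(2-)
proof (induction n arbitrary: s s')
  case 0
  then show ?case by simp
next
  case (Suc n)
  have r: "s div f ^ n < f \<and> s mod f ^ n < f ^ n" "s' div f ^ n < f \<and> s' mod f ^ n < f ^ n"
    using Suc.prems by (auto intro!: index_divmod)
  show ?case
  proof (rule tri_mat_eqI[of _ "a ^ Suc n" "b ^ Suc n" "e ^ Suc n"])
    fix p q assume "p \<in> tri (a ^ Suc n) (b ^ Suc n) (e ^ Suc n)" "q \<in> tri (a ^ Suc n) (b ^ Suc n) (e ^ Suc n)"
    then have pq: "p \<in> tri (a * a ^ n) (b * b ^ n) (e * e ^ n)" "q \<in> tri (a * a ^ n) (b * b ^ n) (e * e ^ n)"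
      by simp_all
    have z: "0\<^sub>m (a * b * e) (a * b * e) $$ (tri_enc b e (hi (a ^ n) (b ^ n) (e ^ n) p), tri_enc b e (hi (a ^ n) (b ^ n) (e ^ n) q)) = (0 :: complex)"
      "0\<^sub>m (a ^ n * b ^ n * e ^ n) (a ^ n * b ^ n * e ^ n) $$ (tri_enc (b ^ n) (e ^ n) (lo (a ^ n) (b ^ n) (e ^ n) p), tri_enc (b ^ n) (e ^ n) (lo (a ^ n) (b ^ n) (e ^ n) q)) = (0 :: complex)"
      using tri_enc_less[OF hi_tri[OF pq(1)]] tri_enc_less[OF hi_tri[OF pq(2)]]
        tri_enc_less[OF lo_tri[OF pq(1)]] tri_enc_less[OF lo_tri[OF pq(2)]] by (simp_all del: tri_enc.simps)
    have "s div f ^ n \<noteq> s' div f ^ n \<or> s mod f ^ n \<noteq> s' mod f ^ n"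
      using Suc.prems(3) by (metis div_mult_mod_eq)
    then have "pow_blk (a, b, e) f u \<rho> (Suc n) s s' $$ (tri_enc (b * b ^ n) (e * e ^ n) p, tri_enc (b * b ^ n) (e * e ^ n) q) = 0"
      unfolding pow_blk_Suc tri_tensor_index[OF pq] using assms(1) Suc.IH r z by auto
    then show "pow_blk (a, b, e) f u \<rho> (Suc n) s s' $$ (tri_enc (b ^ Suc n) (e ^ Suc n) p, tri_enc (b ^ Suc n) (e ^ Suc n) q)
      = 0\<^sub>m (a ^ Suc n * b ^ Suc n * e ^ Suc n) (a ^ Suc n * b ^ Suc n * e ^ Suc n) $$ (tri_enc (b ^ Suc n) (e ^ Suc n) p, tri_enc (b ^ Suc n) (e ^ Suc n) q)"
      using tri_enc_less[OF pq(1)] tri_enc_less[OF pq(2)] by (simp del: tri_enc.simps)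
  qed (rule pow_blk_carrier, rule zero_carrier_mat)
qed

lemma tri_power_positive:
  "positive_op (a * b * e) \<rho> \<Longrightarrow> positive_op (a ^ n * b ^ n * e ^ n) (tri_power (a, b, e) \<rho> n)"
proof (induction n)
  case 0
  show ?case by (simp add: positive_op_iff complex_mult_cnj less_eq_complex_def)
next
  case (Suc n)
  show ?case
    using tri_tensor_positive[OF Suc.prems Suc.IH[OF Suc.prems]]
    by (simp del: tri_tensor.simps)
qed

lemma tri_power_trace:
  assumes "\<rho> \<in> carrier_mat (a * b * e) (a * b * e)" "mat_trace \<rho> = 1"
  shows "tri_power (a, b, e) \<rho> n \<in> carrier_mat (a ^ n * b ^ n * e ^ n) (a ^ n * b ^ n * e ^ n) \<and>
    mat_trace (tri_power (a, b, e) \<rho> n) = 1"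
proof (induction n)
  case 0
  show ?case by (simp add: mat_trace_def)
next
  case (Suc n)
  then show ?case
    using tri_tensor_trace[OF assms(1) conjunct1[OF Suc]] assms(2)
      tri_tensor_carrier[of a b e \<rho> "a ^ n" "b ^ n" "e ^ n" "tri_power (a, b, e) \<rho> n"]
    by (simp del: tri_tensor.simps tri_tensor_carrier)
qed


section \<open>Typical sequences\<close>

fun pow_sum :: "nat \<Rightarrow> (nat \<Rightarrow> real) \<Rightarrow> nat \<Rightarrow> nat \<Rightarrow> real" where
  "pow_sum f x 0 s = 0"
| "pow_sum f x (Suc n) s = x (s div f ^ n) + pow_sum f x n (s mod f ^ n)"

lemma pow_prob_nonneg: "(\<And>i. i < f \<Longrightarrow> 0 \<le> p i) \<Longrightarrow> s < f ^ n \<Longrightarrow> 0 \<le> pow_prob f p n s"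
proof (induction n arbitrary: s)
  case (Suc n)
  have "s div f ^ n < f \<and> s mod f ^ n < f ^ n" using Suc.prems by (intro index_divmod) simp
  then show ?case using Suc by simp
qed simp

text \<open>Total mass, mean and variance of a sum of independent centred digits. The three are
  proved together since each induction step expands into all the lower moments; the cross terms
  vanish because \<open>x\<close> is centred.\<close>

lemma pow_moments:
  assumes p: "(\<Sum>i<f. p i) = 1" and x: "(\<Sum>i<f. p i * x i) = 0"
  shows "(\<Sum>s<f ^ n. pow_prob f p n s) = 1"
    and "(\<Sum>s<f ^ n. pow_prob f p n s * pow_sum f x n s) = 0"
    and "(\<Sum>s<f ^ n. pow_prob f p n s * (pow_sum f x n s)\<^sup>2) = real n * (\<Sum>i<f. p i * (x i)\<^sup>2)"
proof (induction n)
  case (Suc n)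
  have split: "(\<Sum>s<f ^ Suc n. F (s div f ^ n) (s mod f ^ n)) = (\<Sum>i<f. \<Sum>s<f ^ n. F i s)" for F :: "nat \<Rightarrow> nat \<Rightarrow> real"
    unfolding power_Suc sum_mult_index by (intro sum.cong refl) simp
  {
    case 1
    have "(\<Sum>s<f ^ Suc n. pow_prob f p (Suc n) s) = (\<Sum>i<f. \<Sum>s<f ^ n. p i * pow_prob f p n s)"
      unfolding pow_prob.simps by (rule split)
    then show ?case using p Suc(1) by (simp flip: sum_distrib_left)
  next
    case 2
    have "(\<Sum>s<f ^ Suc n. pow_prob f p (Suc n) s * pow_sum f x (Suc n) s)
      = (\<Sum>i<f. \<Sum>s<f ^ n. p i * pow_prob f p n s * (x i + pow_sum f x n s))"
      unfolding pow_prob.simps pow_sum.simps by (rule split)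
    also have "\<dots> = (\<Sum>i<f. p i * x i * (\<Sum>s<f ^ n. pow_prob f p n s) + p i * (\<Sum>s<f ^ n. pow_prob f p n s * pow_sum f x n s))"
      by (simp add: sum_distrib_left algebra_simps sum.distrib)
    also have "\<dots> = 0" using x by (simp add: Suc)
    finally show ?case .
  next
    case 3
    have "(\<Sum>s<f ^ Suc n. pow_prob f p (Suc n) s * (pow_sum f x (Suc n) s)\<^sup>2)
      = (\<Sum>i<f. \<Sum>s<f ^ n. p i * pow_prob f p n s * (x i + pow_sum f x n s)\<^sup>2)"
      unfolding pow_prob.simps pow_sum.simps by (rule split)
    also have "\<dots> = (\<Sum>i<f. p i * (x i)\<^sup>2 * (\<Sum>s<f ^ n. pow_prob f p n s)
      + 2 * (p i * x i) * (\<Sum>s<f ^ n. pow_prob f p n s * pow_sum f x n s)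
      + p i * (\<Sum>s<f ^ n. pow_prob f p n s * (pow_sum f x n s)\<^sup>2))"
      by (simp add: sum_distrib_left algebra_simps sum.distrib power2_eq_square)
    also have "\<dots> = (\<Sum>i<f. p i * (x i)\<^sup>2) + (\<Sum>i<f. p i) * (real n * (\<Sum>i<f. p i * (x i)\<^sup>2))"
      unfolding Suc by (simp add: sum.distrib sum_distrib_right)
    also have "\<dots> = real (Suc n) * (\<Sum>i<f. p i * (x i)\<^sup>2)"
      using p by (simp add: algebra_simps)
    finally show ?case .
  }
qed simp_all

text \<open>\<open>T\<close> collects the strings of probability at least \<open>c\<close>. There
  are at most \<open>1 / c\<close> of them, and Chebyshev's inequality bounds the probability of the
  others; only this one-sided notion of typicality enters.\<close>

lemma typical_set:
  fixes p :: "nat \<Rightarrow> real" and f :: nat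
  assumes p: "\<And>i. i < f \<Longrightarrow> 0 \<le> p i" "(\<Sum>i<f. p i) = 1"
  defines "S \<equiv> - (\<Sum>i<f. p i * log 2 (p i))"
  defines "v \<equiv> \<Sum>i<f. p i * (- log 2 (p i) - S)\<^sup>2"
  assumes n: "0 < n" and \<delta>: "0 < \<delta>"
  shows "\<exists>T\<subseteq>{..<f ^ n}. real (card T) \<le> 2 powr (real n * (S + \<delta>)) \<and>
    (\<Sum>s\<in>{..<f ^ n} - T. pow_prob f p n s) \<le> v / (real n * \<delta>\<^sup>2)"
proof -
  \<comment> \<open>The surprisal minus its mean. The value of the logarithm at probability 0 has
    weight 0 in every moment.\<close>
  define x where "x i = - log 2 (p i) - S" for i
  have x: "(\<Sum>i<f. p i * x i) = 0"
  proof -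
    have "(\<Sum>i<f. p i * x i) = (\<Sum>i<f. - (p i * log 2 (p i)) - p i * S)"
      by (intro sum.cong refl) (simp add: x_def right_diff_distrib)
    also have "\<dots> = - (\<Sum>i<f. p i * log 2 (p i)) - (\<Sum>i<f. p i) * S"
      by (simp only: sum_subtractf sum_negf sum_distrib_right)
    finally show ?thesis using p(2) by (simp add: S_def)
  qed
  note mom = pow_moments[OF p(2) x]
  have pn: "0 \<le> pow_prob f p n s" if "s < f ^ n" for s using pow_prob_nonneg[OF p(1) that] by simp
  \<comment> \<open>Restricted to nonzero probability, where the logarithm of the product is the sum
    of the logarithms.\<close>
  have log: "log 2 (pow_prob f p n s) = - (pow_sum f x n s + real n * S)" if "s < f ^ n" "pow_prob f p n s \<noteq> 0" for n s
    using that
  proof (induction n arbitrary: s)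
    case (Suc n)
    have r: "s div f ^ n < f \<and> s mod f ^ n < f ^ n" using Suc.prems by (intro index_divmod) simp
    then have "0 \<le> p (s div f ^ n)" "0 \<le> pow_prob f p n (s mod f ^ n)"
      using p(1) pow_prob_nonneg[of f p "s mod f ^ n" n] by blast+
    moreover have "p (s div f ^ n) \<noteq> 0" "pow_prob f p n (s mod f ^ n) \<noteq> 0"
      using Suc.prems by auto
    ultimately have pos: "0 < p (s div f ^ n)" "0 < pow_prob f p n (s mod f ^ n)"
      by linarith+
    then have "log 2 (pow_prob f p (Suc n) s) = log 2 (p (s div f ^ n)) + log 2 (pow_prob f p n (s mod f ^ n))"
      by (simp add: log_mult)
    also have "log 2 (pow_prob f p n (s mod f ^ n)) = - (pow_sum f x n (s mod f ^ n) + real n * S)"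
      using r pos by (intro Suc.IH) auto
    finally show ?case by (simp add: x_def[of "s div f ^ n"] algebra_simps)
  qed simp
  define c where "c = 2 powr (- (real n * (S + \<delta>)))"
  have c: "0 < c" by (simp add: c_def)
  define T where "T = {s \<in> {..<f ^ n}. c \<le> pow_prob f p n s}"
  have T: "finite T" "T \<subseteq> {..<f ^ n}" by (auto simp: T_def)
  have "real (card T) * c = (\<Sum>s\<in>T. c)" by simp
  also have "\<dots> \<le> (\<Sum>s\<in>T. pow_prob f p n s)" by (intro sum_mono) (auto simp: T_def)
  also have "\<dots> \<le> (\<Sum>s<f ^ n. pow_prob f p n s)" using T pn by (intro sum_mono2) auto
  also have "\<dots> = 1" by (rule mom)
  finally have "real (card T) \<le> 1 / c" using c by (simp add: field_simps)
  also have "1 / c = 2 powr (real n * (S + \<delta>))" unfolding c_def powr_minus by (simp add: divide_inverse)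
  finally have card: "real (card T) \<le> 2 powr (real n * (S + \<delta>))" .
  have pos: "0 < real n * \<delta>" using n \<delta> by simp
  have "(\<Sum>s\<in>{..<f ^ n} - T. pow_prob f p n s) \<le> (\<Sum>s\<in>{..<f ^ n} - T. pow_prob f p n s * (pow_sum f x n s)\<^sup>2 / (real n * \<delta>)\<^sup>2)"
  proof (rule sum_mono)
    fix s assume s: "s \<in> {..<f ^ n} - T"
    show "pow_prob f p n s \<le> pow_prob f p n s * (pow_sum f x n s)\<^sup>2 / (real n * \<delta>)\<^sup>2"
    proof (cases "pow_prob f p n s = 0")
      case False
      then have pp: "0 < pow_prob f p n s" "pow_prob f p n s < c" using s pn[of s] by (auto simp: T_def)
      have "log 2 (pow_prob f p n s) < log 2 c" using pp c by simp
      also have "log 2 c = - (real n * (S + \<delta>))" by (simp add: c_def)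
      finally have "real n * \<delta> < pow_sum f x n s" using log[of s n] s False by (simp add: algebra_simps)
      then have "(real n * \<delta>)\<^sup>2 \<le> (pow_sum f x n s)\<^sup>2" using pos by (intro power_mono) auto
      then have "1 \<le> (pow_sum f x n s)\<^sup>2 / (real n * \<delta>)\<^sup>2" using n \<delta> by (subst pos_le_divide_eq) simp_all
      then have "pow_prob f p n s * 1 \<le> pow_prob f p n s * ((pow_sum f x n s)\<^sup>2 / (real n * \<delta>)\<^sup>2)"
        using pp by (intro mult_left_mono) auto
      then show ?thesis by simp
    qed simp
  qed
  also have "\<dots> \<le> (\<Sum>s<f ^ n. pow_prob f p n s * (pow_sum f x n s)\<^sup>2 / (real n * \<delta>)\<^sup>2)"
    using pn by (intro sum_mono2) auto
  also have "\<dots> = real n * v / (real n * \<delta>)\<^sup>2"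
    unfolding sum_divide_distrib[symmetric] mom(3) by (simp only: v_def x_def)
  also have "\<dots> = v / (real n * \<delta>\<^sup>2)" using n by (simp add: power2_eq_square)
  finally show ?thesis using card T by blast
qed

section \<open>Distilling a key from a single state\<close>

lemma psd_fmat_select:
  fixes \<phi> :: "'i \<Rightarrow> 'j"
  assumes h: "psd h" and I: "finite I" and inj: "inj_on \<phi> I"
  shows "psd (fmat_of I (\<lambda>p q. ent h (\<phi> p) (\<phi> q)))" (is "psd ?g")
proof (rule psdI[OF _ I])
  show "adj ?g = ?g"
  proof (rule fmat_eqI)
    fix p q
    have "cnj (ent h (\<phi> q) (\<phi> p)) = ent h (\<phi> p) (\<phi> q)"
      using arg_cong[OF psd_adj[OF h], of "\<lambda>g. ent g (\<phi> p) (\<phi> q)"] by simp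
    then show "ent (adj ?g) p q = ent ?g p q" using I by (simp add: ent_fmat_of)
  qed
  show "supp ?g \<subseteq> I" using I by (rule supp_fmat_of)
  fix v :: "'i \<Rightarrow> complex"
  have "(\<Sum>p\<in>I. \<Sum>q\<in>I. v p * ent ?g p q * cnj (v q))
    = (\<Sum>p\<in>I. \<Sum>q\<in>I. v (the_inv_into I \<phi> (\<phi> p)) * ent h (\<phi> p) (\<phi> q) * cnj (v (the_inv_into I \<phi> (\<phi> q))))"
    using I inj by (intro sum.cong refl) (simp add: ent_fmat_of the_inv_into_f_f)
  also have "\<dots> = (\<Sum>p\<in>I. \<Sum>j\<in>\<phi> ` I. v (the_inv_into I \<phi> (\<phi> p)) * ent h (\<phi> p) j * cnj (v (the_inv_into I \<phi> j)))"
    by (simp add: sum.reindex[OF inj])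
  also have "\<dots> = (\<Sum>i\<in>\<phi> ` I. \<Sum>j\<in>\<phi> ` I. v (the_inv_into I \<phi> i) * ent h i j * cnj (v (the_inv_into I \<phi> j)))"
    by (simp add: sum.reindex[OF inj])
  finally show "0 \<le> Re (\<Sum>p\<in>I. \<Sum>q\<in>I. v p * ent ?g p q * cnj (v q))"
    using psdD[OF h finite_imageI[OF I, of \<phi>], of "\<lambda>i. v (the_inv_into I \<phi> i)"] by simp
qed

text \<open>The matrix \<open>M\<close> on a \<open>g\<close>-dimensional space in the coordinates \<open>I\<close> given by \<open>V\<close>, i.e. \<open>V\<^sup>* M V\<close>.\<close>

definition hat :: "nat \<Rightarrow> (nat \<Rightarrow> 'i \<Rightarrow> complex) \<Rightarrow> 'i set \<Rightarrow> (nat \<Rightarrow> nat \<Rightarrow> complex) \<Rightarrow> 'i fmat" where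
  "hat g V I M = fmat_of I (\<lambda>p q. \<Sum>k<g. \<Sum>k'<g. cnj (V k p) * M k k' * V k' q)"

lemma ent_hat: "finite I \<Longrightarrow> ent (hat g V I M) p q =
    (if p \<in> I \<and> q \<in> I then \<Sum>k<g. \<Sum>k'<g. cnj (V k p) * M k k' * V k' q else 0)"
  by (simp add: hat_def ent_fmat_of)

lemma supp_hat: "finite I \<Longrightarrow> supp (hat g V I M) \<subseteq> I"
  by (simp add: hat_def supp_fmat_of)

lemma tr_hat:
  assumes I: "finite I" and row: "\<And>k k'. k < g \<Longrightarrow> k' < g \<Longrightarrow> (\<Sum>p\<in>I. V k p * cnj (V k' p)) = (if k = k' then 1 else 0)"
  shows "tr (hat g V I M) = (\<Sum>k<g. M k k)"
proof -
  have "tr (hat g V I M) = (\<Sum>p\<in>I. \<Sum>k<g. \<Sum>k'<g. cnj (V k p) * M k k' * V k' p)"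
    using I by (subst tr_eq[OF I supp_hat]) (simp_all add: ent_hat)
  also have "\<dots> = (\<Sum>k<g. \<Sum>p\<in>I. \<Sum>k'<g. cnj (V k p) * M k k' * V k' p)"
    by (rule sum.swap)
  also have "\<dots> = (\<Sum>k<g. \<Sum>k'<g. \<Sum>p\<in>I. cnj (V k p) * M k k' * V k' p)"
    by (intro sum.cong refl sum.swap)
  also have "\<dots> = (\<Sum>k<g. \<Sum>k'<g. if k' = k then M k k' else 0)"
  proof (intro sum.cong refl)
    fix k k' assume "k \<in> {..<g}" "k' \<in> {..<g}"
    then have r: "(\<Sum>p\<in>I. V k' p * cnj (V k p)) = (if k' = k then 1 else 0)" by (intro row) auto
    have "(\<Sum>p\<in>I. cnj (V k p) * M k k' * V k' p) = (\<Sum>p\<in>I. V k' p * cnj (V k p)) * M k k'"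
      unfolding sum_distrib_right by (intro sum.cong refl) (simp only: mult_ac)
    then show "(\<Sum>p\<in>I. cnj (V k p) * M k k' * V k' p) = (if k' = k then M k k' else 0)"
      unfolding r by simp
  qed
  finally show ?thesis by simp
qed

lemma hat_mult:
  assumes I: "finite I" and row: "\<And>k k'. k < g \<Longrightarrow> k' < g \<Longrightarrow> (\<Sum>p\<in>I. V k p * cnj (V k' p)) = (if k = k' then 1 else 0)"
  shows "hat g V I M * hat g V I M' = hat g V I (\<lambda>k k'. \<Sum>l<g. M k l * M' l k')"
proof (rule fmat_eqI)
  fix p q
  show "ent (hat g V I M * hat g V I M') p q = ent (hat g V I (\<lambda>k k'. \<Sum>l<g. M k l * M' l k')) p q"
  proof (cases "p \<in> I \<and> q \<in> I")
    case True
    have "ent (hat g V I M * hat g V I M') p q = (\<Sum>r\<in>I. (\<Sum>k<g. \<Sum>l<g. cnj (V k p) * M k l * V l r) * (\<Sum>l'<g. \<Sum>k'<g. cnj (V l' r) * M' l' k' * V k' q))"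
      using I True by (subst ent_times[OF I]) (auto simp: ent_hat supp_hat)
    also have "\<dots> = (\<Sum>r\<in>I. \<Sum>k<g. \<Sum>l<g. \<Sum>l'<g. \<Sum>k'<g. (cnj (V k p) * M k l * V l r) * (cnj (V l' r) * M' l' k' * V k' q))"
      by (simp only: sum_distrib_right, simp only: sum_distrib_left)
    also have "\<dots> = (\<Sum>k<g. \<Sum>r\<in>I. \<Sum>l<g. \<Sum>l'<g. \<Sum>k'<g. (cnj (V k p) * M k l * V l r) * (cnj (V l' r) * M' l' k' * V k' q))"
      by (rule sum.swap)
    also have "\<dots> = (\<Sum>k<g. \<Sum>l<g. \<Sum>r\<in>I. \<Sum>l'<g. \<Sum>k'<g. (cnj (V k p) * M k l * V l r) * (cnj (V l' r) * M' l' k' * V k' q))"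
      by (intro sum.cong refl sum.swap)
    also have "\<dots> = (\<Sum>k<g. \<Sum>l<g. \<Sum>l'<g. \<Sum>r\<in>I. \<Sum>k'<g. (cnj (V k p) * M k l * V l r) * (cnj (V l' r) * M' l' k' * V k' q))"
      by (intro sum.cong refl sum.swap)
    also have "\<dots> = (\<Sum>k<g. \<Sum>l<g. \<Sum>l'<g. \<Sum>k'<g. \<Sum>r\<in>I. (cnj (V k p) * M k l * V l r) * (cnj (V l' r) * M' l' k' * V k' q))"
      by (intro sum.cong refl sum.swap)
    also have "\<dots> = (\<Sum>k<g. \<Sum>l<g. \<Sum>l'<g. if l' = l then (\<Sum>k'<g. cnj (V k p) * (M k l * M' l k') * V k' q) else 0)"
    proof (intro sum.cong refl)
      fix k l l' assume "k \<in> {..<g}" "l \<in> {..<g}" "l' \<in> {..<g}"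
      then have r: "(\<Sum>r\<in>I. V l r * cnj (V l' r)) = (if l = l' then 1 else 0)" by (intro row) auto
      have "(\<Sum>k'<g. \<Sum>r\<in>I. (cnj (V k p) * M k l * V l r) * (cnj (V l' r) * M' l' k' * V k' q))
        = (\<Sum>k'<g. (\<Sum>r\<in>I. V l r * cnj (V l' r)) * (cnj (V k p) * (M k l * M' l' k') * V k' q))"
        unfolding sum_distrib_right by (intro sum.cong refl) (simp only: mult_ac)
      then show "(\<Sum>k'<g. \<Sum>r\<in>I. (cnj (V k p) * M k l * V l r) * (cnj (V l' r) * M' l' k' * V k' q))
        = (if l' = l then (\<Sum>k'<g. cnj (V k p) * (M k l * M' l k') * V k' q) else 0)"
        unfolding r by simp
    qed
    also have "\<dots> = (\<Sum>k<g. \<Sum>l<g. \<Sum>k'<g. cnj (V k p) * (M k l * M' l k') * V k' q)"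
      by (rule sum.cong[OF refl], rule sum.cong[OF refl]) simp
    also have "\<dots> = (\<Sum>k<g. \<Sum>k'<g. \<Sum>l<g. cnj (V k p) * (M k l * M' l k') * V k' q)"
      by (intro sum.cong refl sum.swap)
    also have "\<dots> = (\<Sum>k<g. \<Sum>k'<g. cnj (V k p) * (\<Sum>l<g. M k l * M' l k') * V k' q)"
      by (simp only: sum_distrib_left sum_distrib_right)
    finally show ?thesis using True I by (simp add: ent_hat)
  next
    case False
    have "supp (hat g V I M * hat g V I M') \<subseteq> I"
      using supp_times[of "hat g V I M" "hat g V I M'"] supp_hat[OF I, of g V M] supp_hat[OF I, of g V M'] by blast
    then have "ent (hat g V I M * hat g V I M') p q = 0"
      using False by (intro supp_subsetD[of _ I]) auto
    then show ?thesis using False I by (auto simp: ent_hat)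
  qed
qed

lemma psd_hat:
  assumes M: "positive_op g M" and I: "finite I"
  shows "psd (hat g V I (\<lambda>k k'. M $$ (k, k')))"
  using psd_compress[OF M I, of "\<lambda>p k. cnj (V k p)"] by (simp add: hat_def)

text \<open>A corner \<open>J\<^sup>* K J\<close> of an isometry \<open>K\<close>, for an isometry \<open>J\<close> onto a coordinate subspace.\<close>

lemma contr_compress:
  fixes J :: "nat \<Rightarrow> 'i \<Rightarrow> complex"
  assumes I: "finite I" and K: "supp K \<subseteq> {..<N}" "adj K * K = idm {..<N}"
    and col: "\<And>p q. p \<in> I \<Longrightarrow> q \<in> I \<Longrightarrow> (\<Sum>r<N. cnj (J r p) * J r q) = (if p = q then 1 else 0)"
    and row: "\<And>r s. r < N \<Longrightarrow> s < N \<Longrightarrow> (\<Sum>p\<in>I. J r p * cnj (J s p)) = (if r = s then of_real (w r) else 0)"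
    and w: "\<And>r. r < N \<Longrightarrow> w r \<le> 1"
  shows "contr (fmat_of I (\<lambda>p q. \<Sum>r<N. \<Sum>s<N. cnj (J r p) * ent K r s * J s q))" (is "contr ?C")
  unfolding contr_def
proof (intro allI impI)
  fix \<sigma> :: "'i fmat" assume \<sigma>: "psd \<sigma>"
  \<comment> \<open>\<open>F\<close> is the product of \<open>K\<close> and \<open>J\<close>, hence
    an isometry (\<open>FF\<close>). By cyclicity the trace becomes a sum over \<open>r\<close> of
    forms \<open>B (F r) (F r)\<close>, weighted by the diagonal \<open>w\<close> of
    \<open>J\<close> times its adjoint; dropping the weights leaves the trace of
    \<open>\<sigma>\<close> on \<open>I\<close>.\<close>
  define F where "F r p = (\<Sum>s<N. ent K r s * J s p)" for r p
  define B where "B u v = (\<Sum>q\<in>I. \<Sum>q'\<in>I. u q * ent \<sigma> q q' * cnj (v q'))" for u v :: "'i \<Rightarrow> complex"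
  have C: "ent ?C p q = (\<Sum>r<N. cnj (J r p) * F r q)" if "p \<in> I" "q \<in> I" for p q
    using that I by (simp add: ent_fmat_of F_def sum_distrib_left mult.assoc)
  have KK: "(\<Sum>r<N. cnj (ent K r s) * ent K r t) = (if s = t then 1 else 0)" if "s < N" "t < N" for s t
  proof -
    have "ent (adj K * K) s t = (\<Sum>r<N. cnj (ent K r s) * ent K r t)"
      using K(1) by (subst ent_times[of "{..<N}"]) auto
    then show ?thesis using that by (simp add: K(2) ent_idm)
  qed
  have FF: "(\<Sum>r<N. F r q * cnj (F r q')) = (if q = q' then 1 else 0)" if q: "q \<in> I" "q' \<in> I" for q q'
  proof -
    have "(\<Sum>r<N. F r q * cnj (F r q')) = (\<Sum>r<N. \<Sum>s<N. \<Sum>t<N. (ent K r s * J s q) * cnj (ent K r t * J t q'))"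
      by (simp only: F_def cnj_sum sum_product)
    also have "\<dots> = (\<Sum>s<N. \<Sum>r<N. \<Sum>t<N. (ent K r s * J s q) * cnj (ent K r t * J t q'))"
      by (rule sum.swap)
    also have "\<dots> = (\<Sum>s<N. \<Sum>t<N. \<Sum>r<N. (ent K r s * J s q) * cnj (ent K r t * J t q'))"
      by (intro sum.cong refl sum.swap)
    also have "\<dots> = (\<Sum>s<N. \<Sum>t<N. if t = s then J s q * cnj (J t q') else 0)"
    proof (intro sum.cong refl)
      fix s t assume "s \<in> {..<N}" "t \<in> {..<N}"
      then have k: "(\<Sum>r<N. cnj (ent K r t) * ent K r s) = (if t = s then 1 else 0)" by (intro KK) auto
      have "(\<Sum>r<N. (ent K r s * J s q) * cnj (ent K r t * J t q')) = (\<Sum>r<N. cnj (ent K r t) * ent K r s) * (J s q * cnj (J t q'))"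
        unfolding sum_distrib_right by (intro sum.cong refl) (simp only: complex_cnj_mult mult_ac)
      then show "(\<Sum>r<N. (ent K r s * J s q) * cnj (ent K r t * J t q')) = (if t = s then J s q * cnj (J t q') else 0)"
        unfolding k by simp
    qed
    also have "\<dots> = (\<Sum>s<N. cnj (J s q') * J s q)" by (simp add: mult.commute)
    also have "\<dots> = (if q = q' then 1 else 0)" using col[OF q(2,1)] by auto
    finally show ?thesis .
  qed
  have B0: "0 \<le> Re (B u u)" for u unfolding B_def using psdD[OF \<sigma> I] by simp
  have "(\<Sum>r<N. B (F r) (F r)) = (\<Sum>q\<in>I. \<Sum>r<N. \<Sum>q'\<in>I. F r q * ent \<sigma> q q' * cnj (F r q'))"
    unfolding B_def by (rule sum.swap)
  also have "\<dots> = (\<Sum>q\<in>I. \<Sum>q'\<in>I. \<Sum>r<N. F r q * ent \<sigma> q q' * cnj (F r q'))"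
    by (intro sum.cong refl sum.swap)
  also have "\<dots> = (\<Sum>q\<in>I. \<Sum>q'\<in>I. if q' = q then ent \<sigma> q q' else 0)"
  proof (intro sum.cong refl)
    fix q q' assume q: "q \<in> I" "q' \<in> I"
    have "(\<Sum>r<N. F r q * ent \<sigma> q q' * cnj (F r q')) = (\<Sum>r<N. F r q * cnj (F r q')) * ent \<sigma> q q'"
      unfolding sum_distrib_right by (intro sum.cong refl) (simp only: mult_ac)
    then show "(\<Sum>r<N. F r q * ent \<sigma> q q' * cnj (F r q')) = (if q' = q then ent \<sigma> q q' else 0)"
      unfolding FF[OF q] by simp
  qed
  also have "\<dots> = (\<Sum>q\<in>I. ent \<sigma> q q)" using I by simp
  finally have BF: "(\<Sum>r<N. B (F r) (F r)) = (\<Sum>q\<in>I. ent \<sigma> q q)" .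
  have supC: "supp ?C \<subseteq> I" using I by (rule supp_fmat_of)
  have "tr (?C * \<sigma> * adj ?C) = (\<Sum>p\<in>I. B (ent ?C p) (ent ?C p))"
  proof -
    have sup: "supp (?C * \<sigma> * adj ?C) \<subseteq> I \<union> supp \<sigma>"
      using supp_times[of "?C * \<sigma>" "adj ?C"] supp_times[of ?C \<sigma>] supC by auto
    have e: "ent (?C * \<sigma> * adj ?C) p p = B (ent ?C p) (ent ?C p)" for p
    proof -
      have "ent (?C * \<sigma> * adj ?C) p p = (\<Sum>q'\<in>I. \<Sum>q\<in>I. ent ?C p q * ent \<sigma> q q' * cnj (ent ?C p q'))"
        using I supC by (subst ent_times[of I], simp, simp, subst ent_times[of I]) (auto simp: sum_distrib_right)
      also have "\<dots> = B (ent ?C p) (ent ?C p)" unfolding B_def by (rule sum.swap)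
      finally show ?thesis .
    qed
    have z: "B (ent ?C p) (ent ?C p) = 0" if "p \<notin> I" for p
      using that I by (simp add: B_def ent_fmat_of)
    have "tr (?C * \<sigma> * adj ?C) = (\<Sum>p\<in>I \<union> supp \<sigma>. B (ent ?C p) (ent ?C p))"
      unfolding e[symmetric] using I sup by (intro tr_eq) auto
    also have "\<dots> = (\<Sum>p\<in>I. B (ent ?C p) (ent ?C p))"
      using I z by (intro sum.mono_neutral_right) auto
    finally show ?thesis .
  qed
  also have "\<dots> = (\<Sum>p\<in>I. \<Sum>r<N. \<Sum>s<N. cnj (J r p) * J s p * B (F r) (F s))"
  proof (rule sum.cong[OF refl])
    fix p assume p: "p \<in> I"
    have "B (ent ?C p) (ent ?C p) = (\<Sum>q\<in>I. \<Sum>q'\<in>I. \<Sum>r<N. \<Sum>s<N. cnj (J r p) * J s p * (F r q * ent \<sigma> q q' * cnj (F s q')))"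
      unfolding B_def using C[OF p]
      by (intro sum.cong refl) (simp add: sum_distrib_left sum_distrib_right mult_ac)
    also have "\<dots> = (\<Sum>r<N. \<Sum>s<N. \<Sum>q\<in>I. \<Sum>q'\<in>I. cnj (J r p) * J s p * (F r q * ent \<sigma> q q' * cnj (F s q')))"
      by (rule sum_swap4)
    finally show "B (ent ?C p) (ent ?C p) = (\<Sum>r<N. \<Sum>s<N. cnj (J r p) * J s p * B (F r) (F s))"
      by (simp only: B_def sum_distrib_left)
  qed
  also have "\<dots> = (\<Sum>r<N. \<Sum>p\<in>I. \<Sum>s<N. cnj (J r p) * J s p * B (F r) (F s))"
    by (rule sum.swap)
  also have "\<dots> = (\<Sum>r<N. \<Sum>s<N. \<Sum>p\<in>I. cnj (J r p) * J s p * B (F r) (F s))"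
    by (intro sum.cong refl sum.swap)
  also have "\<dots> = (\<Sum>r<N. \<Sum>s<N. if s = r then of_real (w r) * B (F r) (F s) else 0)"
  proof (intro sum.cong refl)
    fix r s assume "r \<in> {..<N}" "s \<in> {..<N}"
    then have k: "(\<Sum>p\<in>I. J s p * cnj (J r p)) = (if s = r then of_real (w s) else 0)" by (intro row) auto
    have "(\<Sum>p\<in>I. cnj (J r p) * J s p * B (F r) (F s)) = (\<Sum>p\<in>I. J s p * cnj (J r p)) * B (F r) (F s)"
      unfolding sum_distrib_right by (intro sum.cong refl) (simp only: mult_ac)
    then show "(\<Sum>p\<in>I. cnj (J r p) * J s p * B (F r) (F s)) = (if s = r then of_real (w r) * B (F r) (F s) else 0)"
      unfolding k by simp
  qed
  also have "\<dots> = (\<Sum>r<N. of_real (w r) * B (F r) (F r))" by simp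
  finally have "Re (tr (?C * \<sigma> * adj ?C)) = (\<Sum>r<N. w r * Re (B (F r) (F r)))" by simp
  also have "\<dots> \<le> (\<Sum>r<N. 1 * Re (B (F r) (F r)))"
    using w B0 by (intro sum_mono mult_right_mono) auto
  also have "\<dots> = Re (\<Sum>q\<in>I. ent \<sigma> q q)" by (simp flip: BF)
  also have "\<dots> \<le> Re (tr \<sigma>)"
  proof -
    have "Re (tr \<sigma>) = (\<Sum>q\<in>I \<union> supp \<sigma>. Re (ent \<sigma> q q))"
      using I by (subst tr_eq[of "I \<union> supp \<sigma>"]) auto
    moreover have "(\<Sum>q\<in>I. Re (ent \<sigma> q q)) \<le> (\<Sum>q\<in>I \<union> supp \<sigma>. Re (ent \<sigma> q q))"
      using I psd_ent_nonneg[OF \<sigma>] by (intro sum_mono2) auto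
    ultimately show ?thesis by simp
  qed
  finally show "Re (tr (?C * \<sigma> * adj ?C)) \<le> Re (tr \<sigma>)" .
qed

lemma key_state_carrier: "\<tau> \<in> carrier_mat e e \<Longrightarrow> key_state (a, b, e) l \<tau> \<in> carrier_mat (a * b * e) (a * b * e)"
  by (intro carrier_matI) (simp_all add: kron_def mat_sum_def)

lemma key_state_index:
  assumes \<tau>: "\<tau> \<in> carrier_mat e e" and lt: "i < a" "j < b" "n < e" "i' < a" "j' < b" "n' < e"
  shows "key_state (a, b, e) l \<tau> $$ (tri_enc b e (i, j, n), tri_enc b e (i', j', n')) =
    (if i = j \<and> i' = i \<and> j' = i \<and> i < 2 ^ l then of_real (1 / 2 ^ l) * \<tau> $$ (n, n') else 0)"
proof -
  let ?S = "mat_sum (a * b) (\<lambda>i. kron (ketbra (unit_vec a i)) (ketbra (unit_vec b i))) {..<2 ^ l}"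
  have k: "kron (ketbra (unit_vec a x)) (ketbra (unit_vec b x)) $$ (i * b + j, i' * b + j') =
    (if x = i then if i = j \<and> i' = i \<and> j' = i then 1 else 0 else 0)" for x
  proof -
    have "kron (ketbra (unit_vec a x)) (ketbra (unit_vec b x)) $$ (i * b + j, i' * b + j') =
      ketbra (unit_vec a x) $$ (i, i') * ketbra (unit_vec b x) $$ (j, j')"
      using lt mult_index_less[OF lt(1,2)] mult_index_less[OF lt(4,5)] by (simp add: kron_def ketbra_def)
    also have "\<dots> = (if i = x \<and> i' = x then 1 else 0) * (if j = x \<and> j' = x then 1 else 0)"
      using lt by (auto simp: ketbra_def unit_vec_def)
    finally show ?thesis by auto
  qed
  have S: "?S $$ (i * b + j, i' * b + j') = (if i = j \<and> i' = i \<and> j' = i \<and> i < 2 ^ l then 1 else 0)"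
    using mult_index_less[OF lt(1,2)] mult_index_less[OF lt(4,5)]
    by (simp add: mat_sum_def k)
  have r: "(i * b + j) * e + n < a * b * e" "(i' * b + j') * e + n' < a * b * e"
    using mult_index_less[OF mult_index_less[OF lt(1,2)] lt(3)] mult_index_less[OF mult_index_less[OF lt(4,5)] lt(6)] .
  have "kron ?S \<tau> $$ (tri_enc b e (i, j, n), tri_enc b e (i', j', n')) = ?S $$ (i * b + j, i' * b + j') * \<tau> $$ (n, n')"
    using lt r \<tau> by (simp add: kron_def mat_sum_def)
  moreover have "dim_row (kron ?S \<tau>) = a * b * e" "dim_col (kron ?S \<tau>) = a * b * e"
    using \<tau> by (simp_all add: kron_def mat_sum_def)
  ultimately show ?thesis
    using r S by simp
qed

lemma sum_tri_block:
  fixes H :: "nat \<Rightarrow> nat \<Rightarrow> complex"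
  assumes "y < m" "z < m'"
  shows "(\<Sum>r<m * m' * g. case tri_dec m' g r of (y', z', k) \<Rightarrow> if y' = y \<and> z' = z then H k r else 0)
    = (\<Sum>k<g. H k (tri_enc m' g (y, z, k)))"
proof -
  have "(\<Sum>r<m * m' * g. case tri_dec m' g r of (y', z', k) \<Rightarrow> if y' = y \<and> z' = z then H k r else 0)
    = (\<Sum>p\<in>tri m m' g. case p of (y', z', k) \<Rightarrow> if y' = y \<and> z' = z then H k (tri_enc m' g p) else 0)"
    unfolding sum_tri_enc by (intro sum.cong refl) (simp only: tri_dec_enc)
  also have "\<dots> = (\<Sum>y'<m. \<Sum>z'<m'. \<Sum>k<g. if y' = y then if z' = z then H k (tri_enc m' g (y, z, k)) else 0 else 0)"
    unfolding sum_tri by (intro sum.cong refl) auto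
  also have "\<dots> = (\<Sum>y'<m. \<Sum>z'<m'. if y' = y then if z' = z then (\<Sum>k<g. H k (tri_enc m' g (y, z, k))) else 0 else 0)"
    by (intro sum.cong refl) simp
  also have "\<dots> = (\<Sum>y'<m. if y' = y then (\<Sum>k<g. H k (tri_enc m' g (y, z, k))) else 0)"
    using assms by (intro sum.cong refl) simp
  finally show ?thesis using assms by simp
qed

text \<open>An instance of \<open>contr_compress\<close>: \<open>J\<close> maps the coordinates
  \<open>I\<close> through \<open>V\<close> into the block where Alice and Bob hold \<open>y\<close>
  and \<open>z\<close>, and \<open>w\<close> is the indicator of that block.\<close>

lemma contr_block:
  assumes I: "finite I" and K: "supp K \<subseteq> {..<m * m' * g}" "adj K * K = idm {..<m * m' * g}"
    and col: "\<And>p q. p \<in> I \<Longrightarrow> q \<in> I \<Longrightarrow> (\<Sum>k<g. cnj (V k p) * V k q) = (if p = q then 1 else 0)"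
    and row: "\<And>k k'. k < g \<Longrightarrow> k' < g \<Longrightarrow> (\<Sum>p\<in>I. V k p * cnj (V k' p)) = (if k = k' then 1 else 0)"
    and yz: "y < m" "z < m'"
  shows "contr (hat g V I (\<lambda>k k'. ent K (tri_enc m' g (y, z, k)) (tri_enc m' g (y, z, k'))))"
proof -
  define J where "J r p = (case tri_dec m' g r of (y', z', k) \<Rightarrow> if y' = y \<and> z' = z then V k p else 0)" for r p
  define w :: "nat \<Rightarrow> real" where "w r = (case tri_dec m' g r of (y', z', k) \<Rightarrow> if y' = y \<and> z' = z then 1 else 0)" for r
  have "contr (fmat_of I (\<lambda>p q. \<Sum>r<m * m' * g. \<Sum>s<m * m' * g. cnj (J r p) * ent K r s * J s q))"
  proof (rule contr_compress[OF I K])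
    fix p q assume pq: "p \<in> I" "q \<in> I"
    have "(\<Sum>r<m * m' * g. cnj (J r p) * J r q) = (\<Sum>r<m * m' * g. case tri_dec m' g r of (y', z', k) \<Rightarrow>
        if y' = y \<and> z' = z then cnj (V k p) * V k q else 0)"
      by (intro sum.cong refl) (simp add: J_def split: prod.split)
    then show "(\<Sum>r<m * m' * g. cnj (J r p) * J r q) = (if p = q then 1 else 0)"
      unfolding sum_tri_block[OF yz] col[OF pq] .
  next
    fix r s assume "r < m * m' * g" "s < m * m' * g"
    then obtain p q where pq: "p \<in> tri m m' g" "r = tri_enc m' g p" "q \<in> tri m m' g" "s = tri_enc m' g q"
      by (metis tri_enc_surj)
    obtain y1 z1 k1 y2 z2 k2 where p: "p = (y1, z1, k1)" "q = (y2, z2, k2)" by (cases p, cases q)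
    have dec: "tri_dec m' g r = (y1, z1, k1)" "tri_dec m' g s = (y2, z2, k2)"
      using tri_dec_enc[OF pq(1)] tri_dec_enc[OF pq(3)] by (simp_all add: pq(2,4) p del: tri_enc.simps)
    have rs: "r = s \<longleftrightarrow> p = q" using dec unfolding p by (metis p pq(2,4))
    have "(\<Sum>t\<in>I. V k1 t * cnj (V k2 t)) = (if k1 = k2 then 1 else 0)"
      using pq by (intro row) (auto simp: p)
    then show "(\<Sum>p\<in>I. J r p * cnj (J s p)) = (if r = s then of_real (w r) else 0)"
      by (cases "y1 = y \<and> z1 = z"; cases "y2 = y \<and> z2 = z") (auto simp: J_def w_def dec rs p)
  next
    fix r show "w r \<le> 1" by (simp add: w_def split: prod.split)
  qed
  moreover have "(\<Sum>r<m * m' * g. \<Sum>s<m * m' * g. cnj (J r p) * ent K r s * J s q)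
    = (\<Sum>k<g. \<Sum>k'<g. cnj (V k p) * ent K (tri_enc m' g (y, z, k)) (tri_enc m' g (y, z, k')) * V k' q)" for p q
  proof -
    have "(\<Sum>s<m * m' * g. cnj (J r p) * ent K r s * J s q)
      = (\<Sum>k'<g. cnj (J r p) * ent K r (tri_enc m' g (y, z, k')) * V k' q)" for r
    proof -
      have "(\<Sum>s<m * m' * g. cnj (J r p) * ent K r s * J s q)
        = (\<Sum>s<m * m' * g. case tri_dec m' g s of (y', z', k') \<Rightarrow> if y' = y \<and> z' = z then cnj (J r p) * ent K r s * V k' q else 0)"
        by (intro sum.cong refl) (simp add: J_def split: prod.split)
      then show ?thesis unfolding sum_tri_block[OF yz] .
    qed
    then have "(\<Sum>r<m * m' * g. \<Sum>s<m * m' * g. cnj (J r p) * ent K r s * J s q)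
      = (\<Sum>r<m * m' * g. case tri_dec m' g r of (y', z', k) \<Rightarrow> if y' = y \<and> z' = z then
          (\<Sum>k'<g. cnj (V k p) * ent K r (tri_enc m' g (y, z, k')) * V k' q) else 0)"
      by (intro sum.cong refl) (simp add: J_def split: prod.split)
    then show ?thesis unfolding sum_tri_block[OF yz] .
  qed
  ultimately show ?thesis by (simp add: hat_def)
qed

text \<open>
  In \<open>C\<close> one factor \<open>card T\<close> is the dimension of the typical subspace, the other one is the price of
  pinching. The error \<open>\<delta>\<close> is the probability of leaving the typical subspace.
\<close>

lemma distill_step:
  assumes \<Lambda>: "lopc (a, b, e) (a1, b1, e1) \<Lambda>" and V: "splits g e f V"
    and X: "positive_op (a * b * g) X" "mat_trace X = 1"
    and Y: "positive_op (a * b * e) Y"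
    and sumY: "\<And>p q. p \<in> tri a b e \<Longrightarrow> q \<in> tri a b e \<Longrightarrow>
      (\<Sum>s<f. blk (a, b, e) g V s s X $$ (tri_enc b e p, tri_enc b e q)) = Y $$ (tri_enc b e p, tri_enc b e q)"
    and key: "2 ^ l \<le> a1" "2 ^ l \<le> b1" and \<tau>: "density_op e1 \<tau>"
    and T: "T \<subseteq> {..<f}" and \<delta>: "(\<Sum>s\<in>{..<f} - T. Re (mat_trace (blk (a, b, e) g V s s X))) \<le> \<delta>"
    and C: "C = real (card T) * real (card T) \<or> C = real (card T) \<and>
      (\<forall>s<f. \<forall>s'<f. s \<noteq> s' \<longrightarrow> blk (a, b, e) g V s s' X = 0\<^sub>m (a * b * e) (a * b * e))"
    and \<epsilon>: "\<epsilon> = 2 * trace_dist (\<Lambda> Y) (key_state (a1, b1, e1) l \<tau>)"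
  shows "\<exists>P g' \<tau>'. lopc (a, b, g) (2 ^ l', 2 ^ l', g') P \<and> density_op g' \<tau>' \<and>
    0 \<le> trace_dist (P X) (key_state (2 ^ l', 2 ^ l', g') l' \<tau>') \<and>
    2 * trace_dist (P X) (key_state (2 ^ l', 2 ^ l', g') l' \<tau>') \<le>
      2 * \<epsilon> + 2 * (2 * sqrt (\<delta> + \<epsilon>) + (\<delta> + \<epsilon>)) + (if l' = 0 then 0 else 2 * sqrt (2 ^ l' * C / 2 ^ l))"
proof -
  obtain \<Lambda>' g' V' where lift: "lopc (a, b, g) (a1, b1, g') \<Lambda>'" "splits g' e1 f V'"
    "\<And>X s s'. blk (a1, b1, e1) g' V' s s' (\<Lambda>' X) = \<Lambda> (blk (a, b, e) g V s s' X)"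
    using lopc_lift[OF \<Lambda> V] by auto
  have ch: "channel (a * b * e) (a1 * b1 * e1) \<Lambda>" using lopc_channel[OF \<Lambda>] by simp
  have ch': "channel (a * b * g) (a1 * b1 * g') \<Lambda>'" using lopc_channel[OF lift(1)] by simp
  define \<omega> where "\<omega> = \<Lambda>' X"
  have \<omega>: "positive_op (a1 * b1 * g') \<omega>" using ch' X by (simp add: channel_def \<omega>_def)
  have \<omega>c: "\<omega> \<in> carrier_mat (a1 * b1 * g') (a1 * b1 * g')" by (rule positive_op_carrier) fact
  have \<omega>tr: "mat_trace \<omega> = 1" using ch' X positive_op_carrier[OF X(1)] by (simp add: channel_def \<omega>_def)
  define Ly where "Ly = \<Lambda> Y"
  have Ly: "positive_op (a1 * b1 * e1) Ly" using ch Y by (simp add: channel_def Ly_def)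
  have Lyc: "Ly \<in> carrier_mat (a1 * b1 * e1) (a1 * b1 * e1)" by (rule positive_op_carrier) fact
  have \<tau>p: "positive_op e1 \<tau>" "mat_trace \<tau> = 1" using \<tau> by (auto simp: density_op_def)
  have \<tau>c: "\<tau> \<in> carrier_mat e1 e1" by (rule positive_op_carrier) fact
  define B1 where "B1 s s' = blk (a1, b1, e1) g' V' s s' \<omega>" for s s'
  have B1: "B1 s s' = \<Lambda> (blk (a, b, e) g V s s' X)" for s s' by (simp add: B1_def \<omega>_def lift(3))
  \<comment> \<open>The diagonal blocks of \<open>X\<close> sum to \<open>Y\<close> and
    \<open>\<Lambda>\<close> is linear, so discarding F from the new output gives the output
    \<open>Ly\<close> of the original protocol.\<close>
  have sumB: "(\<Sum>s<f. B1 s s $$ (tri_enc b1 e1 p, tri_enc b1 e1 q)) = Ly $$ (tri_enc b1 e1 p, tri_enc b1 e1 q)"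
    if pq: "p \<in> tri a1 b1 e1" "q \<in> tri a1 b1 e1" for p q
  proof -
    have "lincomb (a * b * e) (\<lambda>_. 1) (\<lambda>s. blk (a, b, e) g V s s X) {..<f} = Y"
    proof (rule tri_mat_eqI[of _ a b e])
      fix p q assume pq: "p \<in> tri a b e" "q \<in> tri a b e"
      show "lincomb (a * b * e) (\<lambda>_. 1) (\<lambda>s. blk (a, b, e) g V s s X) {..<f} $$ (tri_enc b e p, tri_enc b e q) = Y $$ (tri_enc b e p, tri_enc b e q)"
        using tri_enc_less[OF pq(1)] tri_enc_less[OF pq(2)] sumY[OF pq] by (simp add: lincomb_index)
    qed (simp_all add: positive_op_carrier[OF Y])
    moreover have "\<Lambda> (lincomb (a * b * e) (\<lambda>_. 1) (\<lambda>s. blk (a, b, e) g V s s X) {..<f})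
      = lincomb (a1 * b1 * e1) (\<lambda>_. 1) (\<lambda>s. \<Lambda> (blk (a, b, e) g V s s X)) {..<f}"
      using ch unfolding channel_def by simp
    ultimately have "Ly = lincomb (a1 * b1 * e1) (\<lambda>_. 1) (\<lambda>s. B1 s s) {..<f}" by (simp add: Ly_def B1)
    then show ?thesis
      using tri_enc_less[OF pq(1)] tri_enc_less[OF pq(2)] by (simp add: lincomb_index)
  qed
  define E S I where "E = {..<e1}" and "S = {..<f}" and "I = E \<times> S"
  have fin: "finite E" "finite S" "finite I" by (auto simp: E_def S_def I_def)
  define W where "W k p = V' k (fst p) (snd p)" for k and p :: "nat \<times> nat"
  have row: "(\<Sum>p\<in>I. W k p * cnj (W k' p)) = (if k = k' then 1 else 0)" if "k < g'" "k' < g'" for k k'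
    using lift(2) that by (simp add: splits_def I_def E_def S_def sum_Times W_def)
  have col: "(\<Sum>k<g'. cnj (W k p) * W k q) = (if p = q then 1 else 0)" if "p \<in> I" "q \<in> I" for p q
    using lift(2) that by (cases p, cases q) (auto simp: splits_def I_def E_def S_def W_def)
  define \<omega>b where "\<omega>b i j = mat g' g' (\<lambda>(k, k'). \<omega> $$ (tri_enc b1 g' (i, j, k), tri_enc b1 g' (i, j, k')))" for i j
  have \<omega>b: "positive_op g' (\<omega>b i j)" if "i < a1" "j < b1" for i j
    unfolding positive_op_iff
  proof (intro conjI allI)
    fix v :: "nat \<Rightarrow> complex"
    have "0 \<le> (\<Sum>k<g'. \<Sum>k'<g'. v k * \<omega> $$ (tri_enc b1 g' (i, j, k), tri_enc b1 g' (i, j, k')) * cnj (v k'))"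
      using that by (intro positive_op_select[OF \<omega>, where f = "\<lambda>k. tri_enc b1 g' (i, j, k)"] tri_enc_less) simp
    then show "0 \<le> (\<Sum>k<g'. \<Sum>k'<g'. v k * \<omega>b i j $$ (k, k') * cnj (v k'))"
      by (simp add: \<omega>b_def del: tri_enc.simps)
  qed (simp add: \<omega>b_def)
  \<comment> \<open>Eve's unnormalised state for the outcomes \<open>i\<close> and \<open>j\<close>,
    in the coordinates of E and F.\<close>
  define \<eta> where "\<eta> i j = hat g' W I (\<lambda>k k'. \<omega>b i j $$ (k, k'))" for i j
  have \<eta>psd: "psd (\<eta> i j)" if "i < a1" "j < b1" for i j
    unfolding \<eta>_def by (rule psd_hat[OF \<omega>b[OF that] fin(3)])
  have \<eta>supp: "supp (\<eta> i j) \<subseteq> E \<times> S" for i j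
    unfolding \<eta>_def I_def[symmetric] by (rule supp_hat[OF fin(3)])
  have \<eta>ent: "ent (\<eta> i j) (n, s) (n', s') = B1 s s' $$ (tri_enc b1 e1 (i, j, n), tri_enc b1 e1 (i, j, n'))"
    if "i < a1" "j < b1" "n < e1" "s < f" "n' < e1" "s' < f" for i j n s n' s'
    using that fin unfolding B1_def
    by (simp add: \<eta>_def ent_hat blk_index W_def \<omega>b_def I_def E_def S_def mult_ac del: tri_enc.simps)
  define t\<eta> where "t\<eta> q = Re (tr (\<eta> (fst q) (snd q)))" for q
  define AB where "AB = {..<a1} \<times> {..<b1}"
  have finAB: "finite AB" by (simp add: AB_def)
  have tr\<eta>: "tr (\<eta> i j) = (\<Sum>k<g'. \<omega> $$ (tri_enc b1 g' (i, j, k), tri_enc b1 g' (i, j, k)))" for i j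
    unfolding \<eta>_def by (subst tr_hat[OF fin(3) row]) (simp_all add: \<omega>b_def del: tri_enc.simps)
  have t\<eta>0: "0 \<le> t\<eta> q" if "q \<in> AB" for q
    unfolding t\<eta>_def using that \<eta>psd by (intro psd_tr) (auto simp: AB_def)
  have "(\<Sum>q\<in>AB. tr (\<eta> (fst q) (snd q))) = mat_trace \<omega>"
    unfolding mat_trace_tri[OF \<omega>c] sum_tri AB_def sum_Times tr\<eta> by simp
  then have t\<eta>sum: "(\<Sum>q\<in>AB. t\<eta> q) = 1" by (simp add: t\<eta>_def \<omega>tr flip: Re_sum)
  have ptr\<eta>: "ent (ptr S (\<eta> i j)) n n' = Ly $$ (tri_enc b1 e1 (i, j, n), tri_enc b1 e1 (i, j, n'))"
    if "i < a1" "j < b1" "n < e1" "n' < e1" for i j n n'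
  proof -
    have "ent (ptr S (\<eta> i j)) n n' = (\<Sum>s<f. B1 s s $$ (tri_enc b1 e1 (i, j, n), tri_enc b1 e1 (i, j, n')))"
      using that by (simp add: ent_ptr S_def \<eta>ent del: tri_enc.simps)
    also have "\<dots> = Ly $$ (tri_enc b1 e1 (i, j, n), tri_enc b1 e1 (i, j, n'))"
      using that by (intro sumB) auto
    finally show ?thesis .
  qed
  define L :: nat where "L = 2 ^ l"
  have L: "0 < L" "L \<le> a1" "L \<le> b1" using key by (auto simp: L_def)
  define ks where "ks = key_state (a1, b1, e1) l \<tau>"
  have ksc: "ks \<in> carrier_mat (a1 * b1 * e1) (a1 * b1 * e1)" unfolding ks_def by (rule key_state_carrier[OF \<tau>c])
  \<comment> \<open>Stated for arbitrary dimensions because it is used twice: for the original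
    output here and for the hashed output at the end.\<close>
  have herm_key: "mat_adjoint (M - key_state (x, y, z) k \<sigma>) = M - key_state (x, y, z) k \<sigma>"
    if M: "positive_op (x * y * z) M" and \<sigma>: "positive_op z \<sigma>" for M x y z k \<sigma>
  proof (rule tri_mat_eqI[of _ x y z])
    have c: "M - key_state (x, y, z) k \<sigma> \<in> carrier_mat (x * y * z) (x * y * z)"
      using key_state_carrier[OF positive_op_carrier[OF \<sigma>]] by (rule minus_carrier_mat)
    then show "mat_adjoint (M - key_state (x, y, z) k \<sigma>) \<in> carrier_mat (x * y * z) (x * y * z)"
      "M - key_state (x, y, z) k \<sigma> \<in> carrier_mat (x * y * z) (x * y * z)" by auto
    fix p q assume pq: "p \<in> tri x y z" "q \<in> tri x y z"
    obtain i j n i' j' n' where p: "p = (i, j, n)" "q = (i', j', n')" by (cases p, cases q)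
    have lt: "i < x" "j < y" "n < z" "i' < x" "j' < y" "n' < z" using pq by (auto simp: p)
    have r: "tri_enc y z p < x * y * z" "tri_enc y z q < x * y * z" using pq by (auto intro!: tri_enc_less simp del: tri_enc.simps)
    have kc: "key_state (x, y, z) k \<sigma> \<in> carrier_mat (x * y * z) (x * y * z)"
      by (rule key_state_carrier[OF positive_op_carrier[OF \<sigma>]])
    have "cnj (key_state (x, y, z) k \<sigma> $$ (tri_enc y z q, tri_enc y z p)) = key_state (x, y, z) k \<sigma> $$ (tri_enc y z p, tri_enc y z q)"
      unfolding p key_state_index[OF positive_op_carrier[OF \<sigma>] lt] key_state_index[OF positive_op_carrier[OF \<sigma>] lt(4-6,1-3)]
      using positive_op_hermitian[OF \<sigma> lt(6,3)] by auto
    moreover have "cnj (M $$ (tri_enc y z q, tri_enc y z p)) = M $$ (tri_enc y z p, tri_enc y z q)"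
      using positive_op_hermitian[OF M r(2,1)] by simp
    ultimately show "mat_adjoint (M - key_state (x, y, z) k \<sigma>) $$ (tri_enc y z p, tri_enc y z q) = (M - key_state (x, y, z) k \<sigma>) $$ (tri_enc y z p, tri_enc y z q)"
      using r c kc positive_op_carrier[OF M] by (simp add: mat_adjoint_index del: key_state.simps)
  qed
  \<comment> \<open>\<open>B\<close> dominates \<open>Ly - ks\<close>. Its blocks at equal outcomes
    become the deviations \<open>D x\<close>, and its diagonal bounds the probability of all other
    outcomes; both draw on the total trace \<epsilon>.\<close>
  obtain B where B: "supp B \<subseteq> {..<a1 * b1 * e1}" "psd B" "psd (B - fm (a1 * b1 * e1) (Ly - ks))" "Re (tr B) = \<epsilon>"
    using trace_dist_witness[OF Lyc ksc] herm_key[OF Ly \<tau>p(1)] by (auto simp: \<epsilon> ks_def Ly_def)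
  define \<beta> where "\<beta> q = (\<Sum>n<e1. Re (ent B (tri_enc b1 e1 (fst q, snd q, n)) (tri_enc b1 e1 (fst q, snd q, n))))" for q
  have \<beta>0: "0 \<le> \<beta> q" for q unfolding \<beta>_def using psd_ent_nonneg[OF B(2)] by (intro sum_nonneg) auto
  have \<beta>sum: "(\<Sum>q\<in>AB. \<beta> q) = \<epsilon>"
  proof -
    have "Re (tr B) = (\<Sum>r<a1 * b1 * e1. Re (ent B r r))" using B(1) by (subst tr_eq[of "{..<a1 * b1 * e1}"]) auto
    then show ?thesis unfolding B(4) sum_tri_enc sum_tri by (simp add: \<beta>_def AB_def sum_Times del: tri_enc.simps)
  qed
  have \<epsilon>0: "0 \<le> \<epsilon>" unfolding \<beta>sum[symmetric] using \<beta>0 by (intro sum_nonneg)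
  \<comment> \<open>The good outcomes: both parties hold the same value, and it lies in the range of
    the key.\<close>
  define Gd where "Gd = (\<lambda>x. (x, x)) ` {..<L}"
  have Gd: "Gd \<subseteq> AB" using L by (auto simp: Gd_def AB_def)
  have sumGd: "(\<Sum>q\<in>Gd. F q) = (\<Sum>x<L. F (x, x))" for F :: "nat \<times> nat \<Rightarrow> real"
    unfolding Gd_def by (subst sum.reindex) (auto simp: inj_on_def)
  \<comment> \<open>The ideal key state vanishes at the other outcomes, so there the diagonal of
    \<open>Ly\<close> lies below that of \<open>B\<close>.\<close>
  have bad: "(\<Sum>q\<in>AB - Gd. t\<eta> q) \<le> \<epsilon>"
  proof -
    have "t\<eta> q \<le> \<beta> q" if q: "q \<in> AB - Gd" for q
    proof -
      obtain i j where ij: "q = (i, j)" "i < a1" "j < b1" "\<not> (i = j \<and> i < L)"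
        using q by (cases q) (auto simp: AB_def Gd_def)
      have "tr (\<eta> i j) = (\<Sum>n<e1. \<Sum>s<f. ent (\<eta> i j) (n, s) (n, s))"
        by (subst tr_eq[OF _ \<eta>supp]) (simp_all add: E_def S_def sum_Times)
      also have "\<dots> = (\<Sum>n<e1. ent (ptr S (\<eta> i j)) n n)" by (simp add: ent_ptr S_def)
      also have "\<dots> = (\<Sum>n<e1. Ly $$ (tri_enc b1 e1 (i, j, n), tri_enc b1 e1 (i, j, n)))"
        using ij by (intro sum.cong refl ptr\<eta>) auto
      finally have "t\<eta> q = (\<Sum>n<e1. Re (Ly $$ (tri_enc b1 e1 (i, j, n), tri_enc b1 e1 (i, j, n))))"
        by (simp add: t\<eta>_def ij(1))
      also have "\<dots> \<le> \<beta> q"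
        unfolding \<beta>_def
      proof (rule sum_mono)
        fix n assume "n \<in> {..<e1}"
        then have n: "n < e1" by simp
        let ?r = "tri_enc b1 e1 (i, j, n)"
        have r: "?r < a1 * b1 * e1" using ij n by (intro tri_enc_less) simp
        have "ks $$ (?r, ?r) = 0"
          unfolding ks_def key_state_index[OF \<tau>c ij(2,3) n ij(2,3) n] using ij(4) by (auto simp: L_def)
        then have "ent (fm (a1 * b1 * e1) (Ly - ks)) ?r ?r = Ly $$ (?r, ?r)"
          using r ksc Lyc by (simp add: ent_fm del: tri_enc.simps)
        then show "Re (Ly $$ (?r, ?r)) \<le> Re (ent B (tri_enc b1 e1 (fst q, snd q, n)) (tri_enc b1 e1 (fst q, snd q, n)))"
          using psd_ent_nonneg[OF B(3), of ?r] by (simp add: ij(1) del: tri_enc.simps)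
      qed
      finally show ?thesis .
    qed
    then have "(\<Sum>q\<in>AB - Gd. t\<eta> q) \<le> (\<Sum>q\<in>AB - Gd. \<beta> q)" by (rule sum_mono)
    also have "\<dots> \<le> (\<Sum>q\<in>AB. \<beta> q)" using finAB \<beta>0 by (intro sum_mono2) auto
    finally show ?thesis using \<beta>sum by simp
  qed
  have e1: "0 < e1"
  proof (rule ccontr)
    assume "\<not> 0 < e1"
    then show False using \<tau>p(2) \<tau>c by (simp add: mat_trace_def)
  qed
  \<comment> \<open>The identity is added to make \<open>A\<close> invertible. The weight is tuned
    so that its trace is \<open>1 / L\<close>, the same as that of the key part, whence the total 2
    in \<open>trA\<close>.\<close>
  define \<kappa> where "\<kappa> = 1 / (real L * real e1)"
  have \<kappa>: "0 < \<kappa>" using L e1 by (simp add: \<kappa>_def)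
  define A where "A = (1 / real L) *\<^sub>R fm e1 \<tau> + \<kappa> *\<^sub>R idm E"
  define D where "D x = fmat_of E (\<lambda>n n'. ent B (tri_enc b1 e1 (x, x, n)) (tri_enc b1 e1 (x, x, n')))" for x
  have inj: "inj_on (\<lambda>n. tri_enc b1 e1 (x, x, n)) E" for x by (auto simp: inj_on_def)
  have supp_sc: "supp (c *\<^sub>R h) \<subseteq> supp h" "supp (h + h') \<subseteq> supp h \<union> supp h'" for c and h h' :: "nat fmat"
    by (auto simp: supp_def)
  have A: "psd A" "supp A \<subseteq> E"
  proof -
    show "psd A" unfolding A_def using \<kappa> by (intro psd_add psd_scaleR psd_fm \<tau>p(1) psd_idm) auto
    show "supp A \<subseteq> E"
      using supp_sc supp_fm[of e1 \<tau>] supp_idm[OF fin(1)] unfolding A_def E_def by blast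
  qed
  have D: "psd (D x)" "supp (D x) \<subseteq> E" for x
    unfolding D_def by (rule psd_fmat_select[OF B(2) fin(1) inj], rule supp_fmat_of[OF fin(1)])
  have trA: "real L * Re (tr A) \<le> 2"
    using L e1 fm_tr[OF \<tau>c] \<tau>p(2) fin(1) by (simp add: A_def tr_idm \<kappa>_def E_def distrib_left)
  have trD: "Re (tr (D x)) = \<beta> (x, x)" for x
    using fin(1) by (subst tr_eq[OF fin(1) D(2)]) (simp add: D_def ent_fmat_of \<beta>_def E_def del: tri_enc.simps)
  have Ai: "\<exists>N. inv_on E A N"
    unfolding E_def
  proof (rule ex_inv_on[OF _ _ \<kappa>])
    show "supp A \<subseteq> {..<e1}" using A by (simp add: E_def)
    have "A - \<kappa> *\<^sub>R idm {..<e1} = (1 / real L) *\<^sub>R fm e1 \<tau>" by (simp add: A_def E_def)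
    then show "psd (A - \<kappa> *\<^sub>R idm {..<e1})" using psd_scaleR[OF psd_fm[OF \<tau>p(1)], of "1 / real L"] by simp
  qed
  have AD: "\<exists>N. inv_on E (A + D x) N" for x
    unfolding E_def
  proof (rule ex_inv_on[OF _ _ \<kappa>])
    show "supp (A + D x) \<subseteq> {..<e1}" using A(2) D(2) supp_sc(2) unfolding E_def by blast
    have "A + D x - \<kappa> *\<^sub>R idm {..<e1} = (1 / real L) *\<^sub>R fm e1 \<tau> + D x" by (simp add: A_def E_def)
    moreover have "psd ((1 / real L) *\<^sub>R fm e1 \<tau> + D x)"
      by (intro psd_add psd_scaleR psd_fm \<tau>p(1) D(1)) simp
    ultimately show "psd (A + D x - \<kappa> *\<^sub>R idm {..<e1})" by (simp only:)
  qed
  \<comment> \<open>The difference is the block of \<open>B - (Ly - ks)\<close> at the outcome pair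
    \<open>x\<close>, \<open>x\<close>, plus the added multiple of the identity.\<close>
  have le: "psd (A + D x - ptr S (\<eta> x x))" if x: "x < L" for x
  proof -
    have lt: "x < a1" "x < b1" using x L by auto
    define R where "R = fmat_of E (\<lambda>n n'. ent (B - fm (a1 * b1 * e1) (Ly - ks)) (tri_enc b1 e1 (x, x, n)) (tri_enc b1 e1 (x, x, n')))"
    have "psd R" unfolding R_def by (rule psd_fmat_select[OF B(3) fin(1) inj])
    moreover have "A + D x - ptr S (\<eta> x x) = R + \<kappa> *\<^sub>R idm E"
    proof (rule fmat_eqI)
      fix n n'
      show "ent (A + D x - ptr S (\<eta> x x)) n n' = ent (R + \<kappa> *\<^sub>R idm E) n n'"
      proof (cases "n < e1 \<and> n' < e1")
        case True
        then have n: "n < e1" "n' < e1" by auto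
        have r: "tri_enc b1 e1 (x, x, n) < a1 * b1 * e1" "tri_enc b1 e1 (x, x, n') < a1 * b1 * e1"
          using lt n by (auto intro!: tri_enc_less simp del: tri_enc.simps)
        have k: "ks $$ (tri_enc b1 e1 (x, x, n), tri_enc b1 e1 (x, x, n')) = of_real (1 / real L) * \<tau> $$ (n, n')"
          unfolding ks_def key_state_index[OF \<tau>c lt n(1) lt n(2)] using x by (simp add: L_def)
        show ?thesis
          using n r lt ksc Lyc fin(1) k ptr\<eta>[OF lt n]
          by (simp add: A_def D_def R_def ent_fmat_of ent_fm E_def del: tri_enc.simps)
      next
        case False
        have z: "ent h n n' = 0" if "supp h \<subseteq> E" for h :: "nat fmat"
          using False that by (intro supp_subsetD[of h E]) (auto simp: E_def)
        have "supp R \<subseteq> E" unfolding R_def by (rule supp_fmat_of[OF fin(1)])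
        then show ?thesis
          using z[OF A(2)] z[OF D(2)] z[OF supp_ptr[OF \<eta>supp]] z[of R] z[of "idm E"] supp_idm[OF fin(1)] by simp
      qed
    qed
    ultimately show ?thesis using psd_add[OF _ psd_scaleR[OF psd_idm less_imp_le[OF \<kappa>]], of R E] by simp
  qed
  have fT: "finite T" "T \<subseteq> S" using T finite_subset by (auto simp: S_def)
  obtain c where c: "0 < c" "real (card T) * c = C"
    and pinch: "\<And>x. x < L \<Longrightarrow> psd (c *\<^sub>R emb T (ptr T (\<eta> x x)) - emb T (idm E) * \<eta> x x * emb T (idm E))"
  proof (cases "C = real (card T) * real (card T)")
    case True
    show ?thesis
    proof (cases "T = {}")
      case True
      \<comment> \<open>\<open>pinching\<close> would give the constant 0 here, but a positive one
        is required; with \<open>T\<close> empty every operator in the inequality is 0, so 1 will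
        do.\<close>
      show ?thesis by (rule that[of 1]) (use True \<open>C = _\<close> in auto)
    next
      case False
      then have "0 < real (card T)" using fT(1) by (simp add: card_gt_0_iff)
      then show ?thesis
        using True L by (intro that[of "real (card T)"] pinching[OF fin(1) \<eta>supp _ fT(1)] \<eta>psd) auto
    qed
  next
    case False
    then have C': "C = real (card T)" and off: "\<And>s s'. s < f \<Longrightarrow> s' < f \<Longrightarrow> s \<noteq> s' \<Longrightarrow> blk (a, b, e) g V s s' X = 0\<^sub>m (a * b * e) (a * b * e)"
      using C by auto
    \<comment> \<open>Vanishing off-diagonal blocks of the input remain zero, so F stays classical
      throughout the protocol.\<close>
    have \<Lambda>0: "\<Lambda> (0\<^sub>m (a * b * e) (a * b * e)) = 0\<^sub>m (a1 * b1 * e1) (a1 * b1 * e1)"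
    proof -
      have "lincomb n (\<lambda>_. 1) F {} = 0\<^sub>m n n" for n and F :: "nat \<Rightarrow> complex mat"
        by (intro eq_matI) (auto simp: lincomb_index)
      moreover have "\<Lambda> (lincomb (a * b * e) (\<lambda>_. 1) F {}) = lincomb (a1 * b1 * e1) (\<lambda>_. 1) (\<lambda>k. \<Lambda> (F k)) {}" for F :: "nat \<Rightarrow> complex mat"
        using ch unfolding channel_def by blast
      ultimately show ?thesis by simp
    qed
    have diag: "diag_snd (\<eta> x x)" if x: "x < L" for x
      unfolding diag_snd_def
    proof (intro allI impI)
      fix n s n' s' :: nat assume s: "s \<noteq> s'"
      show "ent (\<eta> x x) (n, s) (n', s') = 0"
      proof (cases "n < e1 \<and> s < f \<and> n' < e1 \<and> s' < f")
        case True
        have lt: "x < a1" "x < b1" using x L by auto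
        have r: "tri_enc b1 e1 (x, x, n) < a1 * b1 * e1" "tri_enc b1 e1 (x, x, n') < a1 * b1 * e1"
          using lt True by (auto intro!: tri_enc_less simp del: tri_enc.simps)
        show ?thesis using True lt off[of s s'] s r by (simp add: \<eta>ent B1 \<Lambda>0 del: tri_enc.simps)
      next
        case False
        then show ?thesis by (intro supp_subsetD[OF \<eta>supp]) (auto simp: E_def S_def)
      qed
    qed
    show ?thesis
      using C' L by (intro that[of 1] pinching_diag[OF fin(1) \<eta>supp _ fT(1)] \<eta>psd diag) auto
  qed
  have sum_st: "(\<Sum>x<L. Re (tr (emb (S - T) (idm E) * \<eta> x x))) \<le> \<delta>"
  proof -
    have s: "Re (tr (emb (S - T) (idm E) * \<eta> i j)) = (\<Sum>s\<in>S - T. \<Sum>n<e1. Re (ent (\<eta> i j) (n, s) (n, s)))" for i j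
    proof -
      have "tr (emb (S - T) (idm E) * \<eta> i j) = tr (ptr (S - T) (\<eta> i j))"
        using fin by (simp add: tr_emb_times idm_times supp_ptr[OF \<eta>supp])
      also have "\<dots> = (\<Sum>n<e1. \<Sum>s\<in>S - T. ent (\<eta> i j) (n, s) (n, s))"
        by (subst tr_eq[OF fin(1) supp_ptr[OF \<eta>supp]]) (simp add: ent_ptr E_def)
      also have "\<dots> = (\<Sum>s\<in>S - T. \<Sum>n<e1. ent (\<eta> i j) (n, s) (n, s))" by (rule sum.swap)
      finally show ?thesis by simp
    qed
    have nn: "0 \<le> Re (tr (emb (S - T) (idm E) * \<eta> (fst q) (snd q)))" if "q \<in> AB" for q
      unfolding s using that by (intro sum_nonneg psd_ent_nonneg \<eta>psd) (auto simp: AB_def)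
    have "(\<Sum>x<L. Re (tr (emb (S - T) (idm E) * \<eta> x x))) = (\<Sum>q\<in>Gd. Re (tr (emb (S - T) (idm E) * \<eta> (fst q) (snd q))))"
      by (simp add: sumGd)
    also have "\<dots> \<le> (\<Sum>q\<in>AB. Re (tr (emb (S - T) (idm E) * \<eta> (fst q) (snd q))))"
      using finAB Gd nn by (intro sum_mono2) auto
    also have "\<dots> = (\<Sum>q\<in>AB. \<Sum>s\<in>S - T. \<Sum>n<e1. Re (ent (\<eta> (fst q) (snd q)) (n, s) (n, s)))" by (simp only: s)
    also have "\<dots> = (\<Sum>s\<in>S - T. \<Sum>q\<in>AB. \<Sum>n<e1. Re (ent (\<eta> (fst q) (snd q)) (n, s) (n, s)))" by (rule sum.swap)
    also have "\<dots> = (\<Sum>s\<in>S - T. Re (mat_trace (B1 s s)))"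
    proof (rule sum.cong[OF refl])
      fix s assume "s \<in> S - T"
      then have s: "s < f" by (simp add: S_def)
      have "mat_trace (B1 s s) = (\<Sum>i<a1. \<Sum>j<b1. \<Sum>n<e1. B1 s s $$ (tri_enc b1 e1 (i, j, n), tri_enc b1 e1 (i, j, n)))"
        unfolding B1_def mat_trace_tri[OF blk_carrier] sum_tri ..
      also have "\<dots> = (\<Sum>i<a1. \<Sum>j<b1. \<Sum>n<e1. ent (\<eta> i j) (n, s) (n, s))"
        using s by (intro sum.cong refl) (simp add: \<eta>ent del: tri_enc.simps)
      finally show "(\<Sum>q\<in>AB. \<Sum>n<e1. Re (ent (\<eta> (fst q) (snd q)) (n, s) (n, s))) = Re (mat_trace (B1 s s))"
        by (simp add: AB_def sum_Times)
    qed
    also have "\<dots> = (\<Sum>s\<in>{..<f} - T. Re (mat_trace (blk (a, b, e) g V s s X)))"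
    proof -
      have "mat_trace (B1 s s) = mat_trace (blk (a, b, e) g V s s X)" for s
        unfolding B1 using ch blk_carrier[of a b e g V s s X] unfolding channel_def by blast
      then show ?thesis by (simp add: S_def)
    qed
    also note \<delta>
    finally show ?thesis .
  qed
  have sum_D: "(\<Sum>x<L. Re (tr (D x))) \<le> \<epsilon>"
  proof -
    have "(\<Sum>x<L. Re (tr (D x))) = (\<Sum>q\<in>Gd. \<beta> q)" by (simp add: trD sumGd)
    also have "\<dots> \<le> (\<Sum>q\<in>AB. \<beta> q)" using finAB Gd \<beta>0 by (intro sum_mono2) auto
    finally show ?thesis using \<beta>sum by simp
  qed
  define m :: nat where "m = 2 ^ l'"
  have m: "0 < m" by (simp add: m_def)
  have tot: "(\<Sum>x<L. t\<eta> (x, x)) \<le> 1"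
  proof -
    have "(\<Sum>x<L. t\<eta> (x, x)) = (\<Sum>q\<in>Gd. t\<eta> q)" by (simp add: sumGd)
    also have "\<dots> \<le> (\<Sum>q\<in>AB. t\<eta> q)" using finAB Gd t\<eta>0 by (intro sum_mono2) auto
    finally show ?thesis using t\<eta>sum by simp
  qed
  obtain Ain where Ain: "inv_on E A Ain" using Ai by blast
  obtain Nin where Nin: "\<And>x. inv_on E (A + D x) (Nin x)" using AD by metis
  define bound where "bound = 2 * (2 * sqrt (\<delta> + \<epsilon>) + (\<delta> + \<epsilon>)) + (if m = 1 then 0 else 2 * sqrt (real m * real (card T) * c / real L))"
  obtain gh where gh: "\<And>x. x < L \<Longrightarrow> gh x < m"
    "\<And>K. (\<And>y. y < m \<Longrightarrow> contr (K y)) \<Longrightarrow>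
      (\<Sum>y<m. Re (tr (K y * (\<Sum>x<L. (of_bool (gh x = y) - 1 / real m) *\<^sub>R \<eta> x x)))) \<le> bound"
  proof -
    have "\<exists>g. (\<forall>x<L. g x < m) \<and> (\<forall>K. (\<forall>y<m. contr (K y)) \<longrightarrow>
      (\<Sum>y<m. Re (tr (K y * (\<Sum>x<L. (of_bool (g x = y) - 1 / real m) *\<^sub>R \<eta> x x)))) \<le> bound)"
      unfolding bound_def
      by (rule privacy_amplification[OF fin(1,2) fT(2) c(1), where A = A and D = D and Ai = Ain and N = Nin])
        (use L \<eta>psd \<eta>supp A D Ain Nin le pinch trA m sum_st sum_D tot in \<open>auto simp: sum.distrib t\<eta>_def\<close>)
    then show ?thesis using that by blast
  qed
  \<comment> \<open>Outcomes beyond the key range are sent to an arbitrary value; they are bad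
    outcomes, whose probability is already accounted for.\<close>
  define h where "h i = (if i < L then gh i else 0)" for i
  have h: "h i < m" for i using gh(1) m by (simp add: h_def)
  define P where "P = (\<lambda>X. hash_both (a1, b1, g') m h (\<Lambda>' X))"
  have lopcP: "lopc (a, b, g) (m, m, g') P" unfolding P_def by (rule lopc_hash_both[OF lift(1) h])
  have PX: "P X = hash_both (a1, b1, g') m h \<omega>" by (simp add: P_def \<omega>_def)
  have PXp: "positive_op (m * m * g') (P X)"
    using lopc_channel[OF lopcP] X(1) by (simp add: channel_def)
  \<comment> \<open>The ideal state is built with Eve's actual marginal, so only the deviation of
    the key from uniformity is left to estimate.\<close>
  define \<tau>' where "\<tau>' = mat g' g' (\<lambda>(k, k'). \<Sum>i<a1. \<Sum>j<b1. \<omega> $$ (tri_enc b1 g' (i, j, k), tri_enc b1 g' (i, j, k')))"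
  have \<tau>'p: "positive_op g' \<tau>'"
    unfolding positive_op_iff
  proof (intro conjI allI)
    fix v :: "nat \<Rightarrow> complex"
    let ?F = "\<lambda>k k' i j. v k * \<omega>b i j $$ (k, k') * cnj (v k')"
    have "(\<Sum>k<g'. \<Sum>k'<g'. v k * \<tau>' $$ (k, k') * cnj (v k')) = (\<Sum>k<g'. \<Sum>k'<g'. \<Sum>i<a1. \<Sum>j<b1. ?F k k' i j)"
      by (intro sum.cong refl) (simp add: \<tau>'_def \<omega>b_def sum_distrib_left sum_distrib_right del: tri_enc.simps)
    also have "\<dots> = (\<Sum>i<a1. \<Sum>j<b1. \<Sum>k<g'. \<Sum>k'<g'. ?F k k' i j)" by (rule sum_swap4)
    also have "0 \<le> \<dots>"
      by (rule sum_nonneg, rule sum_nonneg) (use \<omega>b in \<open>simp add: positive_op_iff\<close>)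
    finally show "0 \<le> (\<Sum>k<g'. \<Sum>k'<g'. v k * \<tau>' $$ (k, k') * cnj (v k'))" .
  qed (simp add: \<tau>'_def)
  have "mat_trace \<tau>' = (\<Sum>k<g'. \<Sum>i<a1. \<Sum>j<b1. \<omega> $$ (tri_enc b1 g' (i, j, k), tri_enc b1 g' (i, j, k)))"
    by (simp add: mat_trace_def \<tau>'_def del: tri_enc.simps)
  also have "\<dots> = (\<Sum>i<a1. \<Sum>k<g'. \<Sum>j<b1. \<omega> $$ (tri_enc b1 g' (i, j, k), tri_enc b1 g' (i, j, k)))"
    by (rule sum.swap)
  also have "\<dots> = (\<Sum>i<a1. \<Sum>j<b1. \<Sum>k<g'. \<omega> $$ (tri_enc b1 g' (i, j, k), tri_enc b1 g' (i, j, k)))"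
    by (intro sum.cong refl sum.swap)
  also have "\<dots> = mat_trace \<omega>" unfolding mat_trace_tri[OF \<omega>c] sum_tri ..
  finally have \<tau>'d: "density_op g' \<tau>'" using \<tau>'p \<omega>tr by (simp add: density_op_def)
  define ks' where "ks' = key_state (m, m, g') l' \<tau>'"
  have ks'c: "ks' \<in> carrier_mat (m * m * g') (m * m * g')" unfolding ks'_def by (rule key_state_carrier) (simp add: \<tau>'_def)
  have herm': "mat_adjoint (P X - ks') = P X - ks'" unfolding ks'_def by (rule herm_key[OF PXp \<tau>'p])
  \<comment> \<open>\<open>K\<close> expresses the distance to be bounded as a trace, and
    \<open>B'\<close> shows that this distance is nonnegative.\<close>
  obtain K and B' :: "nat fmat" where K: "supp K \<subseteq> {..<m * m * g'}" "adj K * K = idm {..<m * m * g'}"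
    "2 * trace_dist (P X) ks' = Re (tr (K * fm (m * m * g') (P X - ks')))"
    and B': "psd B'" "Re (tr B') = 2 * trace_dist (P X) ks'"
    using trace_dist_witness[OF positive_op_carrier[OF PXp] ks'c herm'] by blast
  \<comment> \<open>The coefficient with which the outcome pair \<open>q\<close> enters the block of
    \<open>P X - ks'\<close> at the hash values \<open>y\<close> and \<open>z\<close>: its actual
    hash values minus the ideal uniform weight on equal pairs.\<close>
  define coef :: "nat \<Rightarrow> nat \<Rightarrow> nat \<times> nat \<Rightarrow> real" where
    "coef y z q = of_bool (h (fst q) = y \<and> h (snd q) = z) - of_bool (y = z) / real m" for y z q
  have Mf: "(P X - ks') $$ (tri_enc m g' (y, z, k), tri_enc m g' (y', z', k')) =
      (if y' = y then if z' = z then \<Sum>q\<in>AB. of_real (coef y z q) * \<omega>b (fst q) (snd q) $$ (k, k') else 0 else 0)"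
    if lt: "y < m" "z < m" "k < g'" "y' < m" "z' < m" "k' < g'" for y z k y' z' k'
  proof -
    let ?r = "tri_enc m g' (y, z, k)" and ?s = "tri_enc m g' (y', z', k')"
    have r: "?r < m * m * g'" "?s < m * m * g'" using lt by (auto intro!: tri_enc_less simp del: tri_enc.simps)
    have 1: "P X $$ (?r, ?s) = (if y = y' \<and> z = z' then \<Sum>q\<in>AB. of_bool (h (fst q) = y \<and> h (snd q) = z) * \<omega>b (fst q) (snd q) $$ (k, k') else 0)"
    proof -
      have "(if h i = y \<and> h j = z then \<omega> $$ (tri_enc b1 g' (i, j, k), tri_enc b1 g' (i, j, k')) else 0)
        = of_bool (h i = y \<and> h j = z) * \<omega>b i j $$ (k, k')" for i j
        using lt by (cases "h i = y \<and> h j = z") (simp_all add: \<omega>b_def del: tri_enc.simps)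
      then show ?thesis unfolding PX hash_both_index[OF lt] AB_def sum_Times by (simp only: fst_conv snd_conv)
    qed
    have 2: "ks' $$ (?r, ?s) = (if y = z \<and> y' = y \<and> z' = y then of_real (1 / real m) * (\<Sum>q\<in>AB. \<omega>b (fst q) (snd q) $$ (k, k')) else 0)"
    proof -
      have "\<tau>' $$ (k, k') = (\<Sum>q\<in>AB. \<omega>b (fst q) (snd q) $$ (k, k'))"
        using lt by (simp add: \<tau>'_def AB_def sum_Times \<omega>b_def del: tri_enc.simps)
      moreover have "\<tau>' \<in> carrier_mat g' g'" by (simp add: \<tau>'_def)
      ultimately show ?thesis
        unfolding ks'_def by (subst key_state_index[OF _ lt]) (use lt in \<open>auto simp: m_def\<close>)
    qed
    have "(P X - ks') $$ (?r, ?s) = P X $$ (?r, ?s) - ks' $$ (?r, ?s)"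
      using r ks'c by (simp del: tri_enc.simps)
    also have "\<dots> = (if y' = y then if z' = z then \<Sum>q\<in>AB. of_real (coef y z q) * \<omega>b (fst q) (snd q) $$ (k, k') else 0 else 0)"
    proof (cases "y' = y \<and> z' = z")
      case True
      have "(\<Sum>q\<in>AB. of_real (coef y z q) * \<omega>b (fst q) (snd q) $$ (k, k'))
        = (\<Sum>q\<in>AB. of_bool (h (fst q) = y \<and> h (snd q) = z) * \<omega>b (fst q) (snd q) $$ (k, k') -
            of_real (of_bool (y = z) / real m) * \<omega>b (fst q) (snd q) $$ (k, k'))"
        by (intro sum.cong refl) (simp add: coef_def left_diff_distrib)
      also have "\<dots> = (\<Sum>q\<in>AB. of_bool (h (fst q) = y \<and> h (snd q) = z) * \<omega>b (fst q) (snd q) $$ (k, k')) -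
            of_real (of_bool (y = z) / real m) * (\<Sum>q\<in>AB. \<omega>b (fst q) (snd q) $$ (k, k'))"
        by (simp only: sum_subtractf sum_distrib_left)
      finally show ?thesis using True unfolding 1 2
        by (cases "y = z") (simp_all only: simp_thms if_True if_False of_bool_eq div_0 of_real_0 mult_zero_left diff_zero)
    next
      case False
      then have n: "\<not> (y = y' \<and> z = z')" "\<not> (y = z \<and> y' = y \<and> z' = y)" by auto
      show ?thesis unfolding 1 2 if_not_P[OF n(1)] if_not_P[OF n(2)] using False by (cases "y' = y") simp_all
    qed
    finally show ?thesis .
  qed
  \<comment> \<open>\<open>P X - ks'\<close> is block diagonal in the hash values, so only the
    diagonal blocks of \<open>K\<close> matter; each of them is a contraction.\<close>
  define Cb where "Cb y z = hat g' W I (\<lambda>k k'. ent K (tri_enc m g' (y, z, k)) (tri_enc m g' (y, z, k')))" for y z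
  have Cb: "contr (Cb y z)" if "y < m" "z < m" for y z
    unfolding Cb_def by (rule contr_block[OF fin(3) K(1,2) col row that])
  define t where "t y z q = Re (tr (Cb y z * \<eta> (fst q) (snd q)))" for y z q
  have t_eq: "tr (Cb y z * \<eta> i j) = (\<Sum>k<g'. \<Sum>k'<g'. ent K (tri_enc m g' (y, z, k)) (tri_enc m g' (y, z, k')) * \<omega>b i j $$ (k', k))" for y z i j
    by (simp add: Cb_def \<eta>_def hat_mult[OF fin(3) row] tr_hat[OF fin(3) row] del: tri_enc.simps)
  have t_le: "\<bar>t y z q\<bar> \<le> t\<eta> q" if "y < m" "z < m" "q \<in> AB" for y z q
  proof -
    have ps: "psd (\<eta> (fst q) (snd q))" using that by (intro \<eta>psd) (auto simp: AB_def)
    have "Re (tr (Cb y z * \<eta> (fst q) (snd q))) \<le> t\<eta> q"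
      unfolding t\<eta>_def by (rule contr_tr_le[OF Cb[OF that(1,2)] ps])
    moreover have "- Re (tr (Cb y z * \<eta> (fst q) (snd q))) \<le> t\<eta> q"
      using contr_tr_le[OF contr_uminus[OF Cb[OF that(1,2)]] ps] by (simp add: t\<eta>_def)
    ultimately show ?thesis unfolding t_def by (rule abs_leI)
  qed
  have "2 * trace_dist (P X) ks' = (\<Sum>y<m. \<Sum>z<m. \<Sum>q\<in>AB. coef y z q * t y z q)"
  proof -
    let ?Kt = "\<lambda>y z k y' z' k'. ent K (tri_enc m g' (y, z, k)) (tri_enc m g' (y', z', k'))"
    have "tr (K * fm (m * m * g') (P X - ks')) = (\<Sum>r<m * m * g'. \<Sum>s<m * m * g'. ent K r s * ent (fm (m * m * g') (P X - ks')) s r)"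
      using K(1) supp_fm by (intro tr_times) auto
    also have "\<dots> = (\<Sum>r<m * m * g'. \<Sum>s<m * m * g'. ent K r s * (P X - ks') $$ (s, r))"
      by (intro sum.cong refl) (simp add: ent_fm)
    also have "\<dots> = (\<Sum>y<m. \<Sum>z<m. \<Sum>k<g'. \<Sum>y'<m. \<Sum>z'<m. \<Sum>k'<g'.
        ?Kt y z k y' z' k' * (P X - ks') $$ (tri_enc m g' (y', z', k'), tri_enc m g' (y, z, k)))"
      unfolding sum_tri_enc sum_tri ..
    also have "\<dots> = (\<Sum>y<m. \<Sum>z<m. \<Sum>k<g'. \<Sum>y'<m. \<Sum>z'<m. \<Sum>k'<g'. if y' = y then if z' = z then
        ?Kt y z k y z k' * (\<Sum>q\<in>AB. of_real (coef y z q) * \<omega>b (fst q) (snd q) $$ (k', k)) else 0 else 0)"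
      by (intro sum.cong refl) (auto simp: Mf simp del: tri_enc.simps)
    also have "\<dots> = (\<Sum>y<m. \<Sum>z<m. \<Sum>k<g'. \<Sum>y'<m. \<Sum>z'<m. if z' = z then if y' = y then (\<Sum>k'<g'.
        ?Kt y z k y z k' * (\<Sum>q\<in>AB. of_real (coef y z q) * \<omega>b (fst q) (snd q) $$ (k', k))) else 0 else 0)"
      by (intro sum.cong refl) auto
    also have "\<dots> = (\<Sum>y<m. \<Sum>z<m. \<Sum>k<g'. \<Sum>k'<g'. ?Kt y z k y z k' * (\<Sum>q\<in>AB. of_real (coef y z q) * \<omega>b (fst q) (snd q) $$ (k', k)))"
      by (rule sum.cong[OF refl], rule sum.cong[OF refl], rule sum.cong[OF refl]) simp
    also have "\<dots> = (\<Sum>y<m. \<Sum>z<m. \<Sum>q\<in>AB. of_real (coef y z q) * tr (Cb y z * \<eta> (fst q) (snd q)))"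
    proof (rule sum.cong[OF refl], rule sum.cong[OF refl])
      fix y z
      have "(\<Sum>k<g'. \<Sum>k'<g'. ?Kt y z k y z k' * (\<Sum>q\<in>AB. of_real (coef y z q) * \<omega>b (fst q) (snd q) $$ (k', k)))
        = (\<Sum>k<g'. \<Sum>k'<g'. \<Sum>q\<in>AB. of_real (coef y z q) * (?Kt y z k y z k' * \<omega>b (fst q) (snd q) $$ (k', k)))"
        unfolding sum_distrib_left by (simp only: mult_ac)
      also have "\<dots> = (\<Sum>k<g'. \<Sum>q\<in>AB. \<Sum>k'<g'. of_real (coef y z q) * (?Kt y z k y z k' * \<omega>b (fst q) (snd q) $$ (k', k)))"
        by (intro sum.cong refl sum.swap)
      also have "\<dots> = (\<Sum>q\<in>AB. \<Sum>k<g'. \<Sum>k'<g'. of_real (coef y z q) * (?Kt y z k y z k' * \<omega>b (fst q) (snd q) $$ (k', k)))"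
        by (rule sum.swap)
      also have "\<dots> = (\<Sum>q\<in>AB. of_real (coef y z q) * tr (Cb y z * \<eta> (fst q) (snd q)))"
        unfolding t_eq by (simp only: sum_distrib_left)
      finally show "(\<Sum>k<g'. \<Sum>k'<g'. ?Kt y z k y z k' * (\<Sum>q\<in>AB. of_real (coef y z q) * \<omega>b (fst q) (snd q) $$ (k', k)))
        = (\<Sum>q\<in>AB. of_real (coef y z q) * tr (Cb y z * \<eta> (fst q) (snd q)))" .
    qed
    finally show ?thesis unfolding K(3) by (simp add: t_def)
  qed
  also have "\<dots> = (\<Sum>y<m. \<Sum>z<m. (\<Sum>q\<in>Gd. coef y z q * t y z q) + (\<Sum>q\<in>AB - Gd. coef y z q * t y z q))"
    unfolding sum.subset_diff[OF Gd finAB] by (simp only: add.commute)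
  also have "\<dots> = (\<Sum>y<m. \<Sum>z<m. \<Sum>q\<in>Gd. coef y z q * t y z q) + (\<Sum>y<m. \<Sum>z<m. \<Sum>q\<in>AB - Gd. coef y z q * t y z q)"
    by (simp only: sum.distrib)
  \<comment> \<open>At a good outcome both parties obtain the same hash value. The coefficient is
    thus 0 unless \<open>y = z\<close>, where it is that of
    \<open>privacy_amplification\<close>.\<close>
  also have "(\<Sum>y<m. \<Sum>z<m. \<Sum>q\<in>Gd. coef y z q * t y z q) \<le> bound"
  proof -
    have "(\<Sum>y<m. \<Sum>z<m. \<Sum>q\<in>Gd. coef y z q * t y z q)
      = (\<Sum>y<m. \<Sum>z<m. if z = y then (\<Sum>x<L. (of_bool (gh x = y) - 1 / real m) * t y y (x, x)) else 0)"
      unfolding sumGd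
    proof (rule sum.cong[OF refl], rule sum.cong[OF refl])
      fix y z
      show "(\<Sum>x<L. coef y z (x, x) * t y z (x, x))
        = (if z = y then (\<Sum>x<L. (of_bool (gh x = y) - 1 / real m) * t y y (x, x)) else 0)"
        by (cases "z = y") (auto simp: coef_def h_def intro!: sum.cong sum.neutral)
    qed
    also have "\<dots> = (\<Sum>y<m. \<Sum>x<L. (of_bool (gh x = y) - 1 / real m) * t y y (x, x))"
      by (rule sum.cong[OF refl]) simp
    also have "\<dots> = (\<Sum>y<m. Re (tr (Cb y y * (\<Sum>x<L. (of_bool (gh x = y) - 1 / real m) *\<^sub>R \<eta> x x))))"
      by (simp add: t_def sum_distrib_left tr_sum)
    also have "\<dots> \<le> bound" using Cb by (intro gh(2)) auto
    finally show ?thesis .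
  qed
  \<comment> \<open>For each bad outcome the actual distribution and the ideal one have total weight
    1 each, hence the factor 2.\<close>
  also have "(\<Sum>y<m. \<Sum>z<m. \<Sum>q\<in>AB - Gd. coef y z q * t y z q) \<le> 2 * \<epsilon>"
  proof -
    have "(\<Sum>y<m. \<Sum>z<m. \<Sum>q\<in>AB - Gd. coef y z q * t y z q)
      \<le> (\<Sum>y<m. \<Sum>z<m. \<Sum>q\<in>AB - Gd. (of_bool (h (fst q) = y \<and> h (snd q) = z) + of_bool (y = z) / real m) * t\<eta> q)"
    proof (intro sum_mono)
      fix y z q assume "y \<in> {..<m}" "z \<in> {..<m}" and q: "q \<in> AB - Gd"
      then have yz: "y < m" "z < m" by auto
      have "coef y z q * t y z q \<le> \<bar>coef y z q\<bar> * \<bar>t y z q\<bar>" unfolding abs_mult[symmetric] by (rule abs_ge_self)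
      also have "\<dots> \<le> (of_bool (h (fst q) = y \<and> h (snd q) = z) + of_bool (y = z) / real m) * t\<eta> q"
        using t_le[OF yz, of q] q m by (intro mult_mono) (auto simp: coef_def abs_le_iff)
      finally show "coef y z q * t y z q \<le> (of_bool (h (fst q) = y \<and> h (snd q) = z) + of_bool (y = z) / real m) * t\<eta> q" .
    qed
    also have "\<dots> = (\<Sum>y<m. \<Sum>q\<in>AB - Gd. \<Sum>z<m. (of_bool (h (fst q) = y \<and> h (snd q) = z) + of_bool (y = z) / real m) * t\<eta> q)"
      by (intro sum.cong refl sum.swap)
    also have "\<dots> = (\<Sum>q\<in>AB - Gd. \<Sum>y<m. \<Sum>z<m. (of_bool (h (fst q) = y \<and> h (snd q) = z) + of_bool (y = z) / real m) * t\<eta> q)"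
      by (rule sum.swap)
    also have "\<dots> = (\<Sum>q\<in>AB - Gd. 2 * t\<eta> q)"
    proof (rule sum.cong[OF refl])
      fix q
      have "(\<Sum>y<m. \<Sum>z<m. of_bool (h (fst q) = y \<and> h (snd q) = z) + of_bool (y = z) / real m)
        = (\<Sum>y<m. \<Sum>z<m. (if z = h (snd q) then of_bool (h (fst q) = y) else 0) + (if z = y then 1 / real m else 0))"
        by (intro sum.cong refl) auto
      also have "\<dots> = (\<Sum>y<m. (if y = h (fst q) then 1 else 0) + 1 / real m)"
        using h by (intro sum.cong refl) (simp add: sum.distrib)
      also have "\<dots> = 2" using h m by (simp add: sum.distrib)
      finally show "(\<Sum>y<m. \<Sum>z<m. (of_bool (h (fst q) = y \<and> h (snd q) = z) + of_bool (y = z) / real m) * t\<eta> q) = 2 * t\<eta> q"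
        by (simp only: flip: sum_distrib_right)
    qed
    also have "\<dots> \<le> 2 * \<epsilon>" using bad by (simp flip: sum_distrib_left)
    finally show ?thesis .
  qed
  finally have fin_bound: "2 * trace_dist (P X) ks' \<le> bound + 2 * \<epsilon>" by simp
  have "bound = 2 * (2 * sqrt (\<delta> + \<epsilon>) + (\<delta> + \<epsilon>)) + (if l' = 0 then 0 else 2 * sqrt (2 ^ l' * C / 2 ^ l))"
    using c(2) by (simp add: bound_def m_def L_def mult.assoc)
  then show ?thesis
    using lopcP \<tau>'d fin_bound psd_tr[OF B'(1)] B'(2) unfolding m_def ks'_def by (intro exI[of _ P] exI[of _ g'] exI[of _ \<tau>']) simp
qed

section \<open>The asymptotic rate\<close>

lemma positive_op_ptrace_fst:
  assumes X: "positive_op (m * n) X"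
  shows "positive_op n (ptrace_fst m n X)"
  unfolding positive_op_iff
proof (intro conjI allI)
  fix v :: "nat \<Rightarrow> complex"
  have "(\<Sum>r<n. \<Sum>c<n. v r * ptrace_fst m n X $$ (r, c) * cnj (v c))
    = (\<Sum>r<n. \<Sum>c<n. \<Sum>k<m. v r * X $$ (k * n + r, k * n + c) * cnj (v c))"
    by (intro sum.cong refl) (simp add: ptrace_fst_def sum_distrib_left sum_distrib_right)
  also have "\<dots> = (\<Sum>r<n. \<Sum>k<m. \<Sum>c<n. v r * X $$ (k * n + r, k * n + c) * cnj (v c))"
    by (intro sum.cong refl sum.swap)
  also have "\<dots> = (\<Sum>k<m. \<Sum>r<n. \<Sum>c<n. v r * X $$ (k * n + r, k * n + c) * cnj (v c))"
    by (rule sum.swap)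
  also have "0 \<le> \<dots>"
  proof (rule sum_nonneg)
    fix k assume "k \<in> {..<m}"
    then show "0 \<le> (\<Sum>r<n. \<Sum>c<n. v r * X $$ (k * n + r, k * n + c) * cnj (v c))"
      by (intro positive_op_select[OF X, where f = "\<lambda>r. k * n + r"] mult_index_less) auto
  qed
  finally show "0 \<le> (\<Sum>r<n. \<Sum>c<n. v r * ptrace_fst m n X $$ (r, c) * cnj (v c))" .
qed (simp add: ptrace_fst_def)

lemma positive_op_ptrace_snd:
  assumes X: "positive_op (m * n) X"
  shows "positive_op m (ptrace_snd m n X)"
  unfolding positive_op_iff
proof (intro conjI allI)
  fix v :: "nat \<Rightarrow> complex"
  have "(\<Sum>r<m. \<Sum>c<m. v r * ptrace_snd m n X $$ (r, c) * cnj (v c))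
    = (\<Sum>r<m. \<Sum>c<m. \<Sum>k<n. v r * X $$ (r * n + k, c * n + k) * cnj (v c))"
    by (intro sum.cong refl) (simp add: ptrace_snd_def sum_distrib_left sum_distrib_right)
  also have "\<dots> = (\<Sum>r<m. \<Sum>k<n. \<Sum>c<m. v r * X $$ (r * n + k, c * n + k) * cnj (v c))"
    by (intro sum.cong refl sum.swap)
  also have "\<dots> = (\<Sum>k<n. \<Sum>r<m. \<Sum>c<m. v r * X $$ (r * n + k, c * n + k) * cnj (v c))"
    by (rule sum.swap)
  also have "0 \<le> \<dots>"
  proof (rule sum_nonneg)
    fix k assume "k \<in> {..<n}"
    then show "0 \<le> (\<Sum>r<m. \<Sum>c<m. v r * X $$ (r * n + k, c * n + k) * cnj (v c))"
      by (intro positive_op_select[OF X, where f = "\<lambda>r. r * n + k"] mult_index_less) auto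
  qed
  finally show "0 \<le> (\<Sum>r<m. \<Sum>c<m. v r * ptrace_snd m n X $$ (r, c) * cnj (v c))" .
qed (simp add: ptrace_snd_def)

lemma trace_ptrace_fst:
  "X \<in> carrier_mat (m * n) (m * n) \<Longrightarrow> mat_trace (ptrace_fst m n X) = mat_trace X"
  unfolding mat_trace_def by (simp add: ptrace_fst_def sum_mult_index) (rule sum.swap)

text \<open>Adding a constant commutes with \<open>limsup\<close>. The vanishing error is therefore
  replaced by an arbitrary positive constant, which is then let tend to 0; this also covers an
  infinite rate.\<close>

lemma key_rate_shift:
  fixes l l' :: "nat \<Rightarrow> nat"
  assumes le: "eventually (\<lambda>n. real (l n) / real n \<le> real (l' n) / real n + (c + e n)) sequentially"
    and e: "e \<longlonglongrightarrow> 0"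
  shows "limsup (\<lambda>n. ereal (real (l n) / real n)) - ereal c \<le> limsup (\<lambda>n. ereal (real (l' n) / real n))"
proof -
  let ?R = "limsup (\<lambda>n. ereal (real (l n) / real n))" and ?R' = "limsup (\<lambda>n. ereal (real (l' n) / real n))"
  have "?R \<le> ?R' + ereal c + ereal \<eta>" if \<eta>: "0 < \<eta>" for \<eta>
  proof -
    have "eventually (\<lambda>n. e n < \<eta>) sequentially" using order_tendstoD(2)[OF e \<eta>] .
    with le have "eventually (\<lambda>n. ereal (real (l n) / real n) \<le> ereal (real (l' n) / real n) + ereal (c + \<eta>)) sequentially"
      by eventually_elim simp
    then have "?R \<le> limsup (\<lambda>n. ereal (real (l' n) / real n) + ereal (c + \<eta>))"
      by (rule Limsup_mono)
    also have "\<dots> = ?R' + ereal (c + \<eta>)" by (rule Limsup_add_ereal_right) auto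
    finally show ?thesis by (simp add: add.assoc)
  qed
  then have "?R \<le> ?R' + ereal c" by (rule ereal_le_epsilon2)
  then show ?thesis by (simp add: ereal_minus_le)
qed

text \<open>Both claims in one: \<kappa> counts how often the size of the typical subspace has to be
  paid, twice in general and once when F is classical in the basis given by
  \<open>U\<close>.\<close>

lemma key_distillation_extension:
  fixes p :: "nat \<Rightarrow> real"
  assumes \<rho>: "density_op (dA * dB * dE * dF) \<rho>"
    and P: "key_distillation (dA, dB, dE) (ptrace_snd (dA * dB * dE) dF \<rho>) P R"
    and U: "unitary dF U"
    and \<rho>F: "ptrace_fst (dA * dB * dE) dF \<rho> = U * mat_diag dF (\<lambda>i. complex_of_real (p i)) * mat_adjoint U"
    and \<kappa>: "\<kappa> = 2 \<or> \<kappa> = 1 \<and> (\<forall>s<dF. \<forall>s'<dF. s \<noteq> s' \<longrightarrow>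
      blk (dA, dB, dE) (dE * dF) (base_split dF (\<lambda>i s. U $$ (i, s))) s s' \<rho> = 0\<^sub>m (dA * dB * dE) (dA * dB * dE))"
  shows "\<exists>P' R'. key_distillation (dA, dB, dE * dF) \<rho> P' R' \<and>
    R' \<ge> R - ereal (\<kappa> * entropy (ptrace_fst (dA * dB * dE) dF \<rho>))"
proof -
  define \<rho>f where "\<rho>f = ptrace_fst (dA * dB * dE) dF \<rho>"
  define \<rho>abe where "\<rho>abe = ptrace_snd (dA * dB * dE) dF \<rho>"
  have \<rho>p: "positive_op (dA * dB * dE * dF) \<rho>" "mat_trace \<rho> = 1" using \<rho> by (auto simp: density_op_def)
  have \<rho>fp: "positive_op dF \<rho>f" unfolding \<rho>f_def by (rule positive_op_ptrace_fst[OF \<rho>p(1)])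
  have \<rho>fc: "\<rho>f \<in> carrier_mat dF dF" by (rule positive_op_carrier) fact
  have \<rho>abep: "positive_op (dA * dB * dE) \<rho>abe" unfolding \<rho>abe_def by (rule positive_op_ptrace_snd[OF \<rho>p(1)])
  have \<rho>p': "positive_op (dA * dB * (dE * dF)) \<rho>" using \<rho>p(1) by (simp add: mult.assoc)
  define u where "u = (\<lambda>i s. U $$ (i, s))"
  have u: "orthonormal dF u" unfolding u_def by (rule orthonormal_unitary) fact
  define Uf where "Uf = fm dF U"
  have Uf: "adj Uf * Uf = idm {..<dF}" "supp Uf \<subseteq> {..<dF}"
    using unitary_fm_fm[OF U] by (auto simp: unitary_fm_def Uf_def)
  have f\<rho>: "fm dF \<rho>f = Uf * diagm dF p * adj Uf"
    unfolding \<rho>f_def \<rho>F Uf_def by (rule fm_decomp[OF U])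
  have diag: "adj Uf * fm dF \<rho>f * Uf = diagm dF p"
  proof -
    have "adj Uf * fm dF \<rho>f * Uf = (adj Uf * Uf) * diagm dF p * (adj Uf * Uf)"
      unfolding f\<rho> by (simp add: mult.assoc)
    then show ?thesis using Uf by (simp add: idm_times times_idm supp_diagm)
  qed
  have "psd (adj Uf * fm dF \<rho>f * adj (adj Uf))" by (intro psd_conj psd_fm \<rho>fp)
  then have "psd (diagm dF p)" by (simp add: diag)
  then have p0: "0 \<le> p i" if "i < dF" for i using psd_ent_nonneg[of "diagm dF p" i] that by (simp add: ent_diagm)
  have "mat_trace \<rho>f = tr (diagm dF p * (adj Uf * Uf))"
    unfolding fm_tr[OF \<rho>fc, symmetric] f\<rho> by (subst mult.assoc, subst tr_commute) (simp add: mult.assoc)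
  also have "\<dots> = of_real (\<Sum>i<dF. p i)" unfolding Uf by (simp add: times_idm supp_diagm tr_diagm)
  finally have p1: "(\<Sum>i<dF. p i) = 1"
    using trace_ptrace_fst[OF positive_op_carrier[OF \<rho>p(1)]] \<rho>p(2) by (metis \<rho>f_def of_real_eq_1_iff)
  define S where "S = - (\<Sum>i<dF. p i * log 2 (p i))"
  have S: "entropy (ptrace_fst (dA * dB * dE) dF \<rho>) = S" unfolding S_def by (rule entropy_eq[OF U \<rho>F])
  have tr_blk: "mat_trace (blk (dA, dB, dE) (dE * dF) (base_split dF u) s s \<rho>) = of_real (p s)" if s: "s < dF" for s
  proof -
    have "mat_trace (blk (dA, dB, dE) (dE * dF) (base_split dF u) s s \<rho>) = (\<Sum>i<dF. \<Sum>j<dF. cnj (u i s) * u j s * \<rho>f $$ (i, j))"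
      by (simp add: trace_base_blk \<rho>f_def)
    also have "\<dots> = (\<Sum>j<dF. \<Sum>i<dF. cnj (u i s) * u j s * \<rho>f $$ (i, j))" by (rule sum.swap)
    also have "\<dots> = (\<Sum>j<dF. (\<Sum>i<dF. cnj (u i s) * \<rho>f $$ (i, j)) * u j s)"
      unfolding sum_distrib_right by (intro sum.cong refl) (simp only: mult_ac)
    also have "\<dots> = ent (adj Uf * fm dF \<rho>f * Uf) s s"
      using Uf(2) s by (subst ent_times[of "{..<dF}"], simp, simp, subst ent_times[of "{..<dF}"]) (simp_all add: ent_fm Uf_def u_def)
    finally show ?thesis using s by (simp add: diag ent_diagm)
  qed
  obtain l \<tau> where l: "lopc_protocol (dA, dB, dE) P"
    "\<And>n. key_fits (fst (P n)) (l n)" "\<And>n. density_op (eve_dim (fst (P n))) (\<tau> n)"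
    "limsup (\<lambda>n. ereal (real (l n) / real n)) = R"
    "(\<lambda>n. trace_dist (snd (P n) (tri_power (dA, dB, dE) \<rho>abe n)) (key_state (fst (P n)) (l n) (\<tau> n))) \<longlonglongrightarrow> 0"
    using P unfolding key_distillation_def \<rho>abe_def by blast
  define \<epsilon> where "\<epsilon> n = 2 * trace_dist (snd (P n) (tri_power (dA, dB, dE) \<rho>abe n)) (key_state (fst (P n)) (l n) (\<tau> n))" for n
  have \<epsilon>: "\<epsilon> \<longlonglongrightarrow> 0" unfolding \<epsilon>_def using tendsto_mult[OF tendsto_const[of 2] l(5)] by simp
  define v where "v = (\<Sum>i<dF. p i * (- log 2 (p i) - S)\<^sup>2)"
  \<comment> \<open>Any choice with \<open>d n \<rightarrow> 0\<close> and \<open>n (d n)\<^sup>2 \<rightarrow> \<infinity>\<close> works.\<close>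
  define d :: "nat \<Rightarrow> real" where "d n = real n powr (- 1 / 3)" for n
  \<comment> \<open>The middle term pays for \<open>C\<close>, which is at most 2 to that power; the
    last one makes the hashing error tend to 0. A negative value is cut off to 0 by
    \<open>nat\<close>.\<close>
  define l' where "l' n = nat \<lfloor>real (l n) - \<kappa> * (real n * (S + d n)) - real n * d n\<rfloor>" for n
  define err where "err n = 2 * \<epsilon> n + 2 * (2 * sqrt (v / (real n * (d n)\<^sup>2) + \<epsilon> n) + (v / (real n * (d n)\<^sup>2) + \<epsilon> n)) + 2 * sqrt (2 powr (- (real n * d n)))" for n
  \<comment> \<open>The error bound is claimed for positive \<open>n\<close> only, since the choice
    of \<open>T\<close> needs \<open>0 < n\<close>, but a protocol must be supplied for
    \<open>n = 0\<close> as well.\<close>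
  have step: "\<exists>P' g' \<tau>'. lopc (dims_pow (dA, dB, dE * dF) n) (2 ^ l' n, 2 ^ l' n, g') P' \<and> density_op g' \<tau>' \<and>
    0 \<le> trace_dist (P' (tri_power (dA, dB, dE * dF) \<rho> n)) (key_state (2 ^ l' n, 2 ^ l' n, g') (l' n) \<tau>') \<and>
    (0 < n \<longrightarrow> 2 * trace_dist (P' (tri_power (dA, dB, dE * dF) \<rho> n)) (key_state (2 ^ l' n, 2 ^ l' n, g') (l' n) \<tau>') \<le> err n)" for n
  proof -
    obtain a1 b1 e1 where fP: "fst (P n) = (a1, b1, e1)" by (cases "fst (P n)")
    let ?X = "tri_power (dA, dB, dE * dF) \<rho> n"
    let ?B = "\<lambda>s s'. blk (dA ^ n, dB ^ n, dE ^ n) ((dE * dF) ^ n) (pow_split dE dF u n) s s' ?X"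
    have B: "?B s s' = pow_blk (dA, dB, dE) dF u \<rho> n s s'" for s s' by (simp add: pow_blk_def)
    have trB: "mat_trace (?B s s) = of_real (pow_prob dF p n s)" if "s < dF ^ n" for s
      unfolding B by (rule trace_pow_blk[OF tr_blk that])
    have \<Lambda>: "lopc (dA ^ n, dB ^ n, dE ^ n) (a1, b1, e1) (snd (P n))"
      using l(1) fP unfolding lopc_protocol_def by (metis dims_pow.simps)
    have Xp: "positive_op (dA ^ n * dB ^ n * (dE * dF) ^ n) ?X" by (rule tri_power_positive[OF \<rho>p'])
    have Xt: "mat_trace ?X = 1" using tri_power_trace[OF positive_op_carrier[OF \<rho>p'] \<rho>p(2)] by blast
    have sumX: "(\<Sum>s<dF ^ n. ?B s s $$ (tri_enc (dB ^ n) (dE ^ n) q, tri_enc (dB ^ n) (dE ^ n) q')) =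
      tri_power (dA, dB, dE) \<rho>abe n $$ (tri_enc (dB ^ n) (dE ^ n) q, tri_enc (dB ^ n) (dE ^ n) q')"
      if "q \<in> tri (dA ^ n) (dB ^ n) (dE ^ n)" "q' \<in> tri (dA ^ n) (dB ^ n) (dE ^ n)" for q q'
      unfolding B \<rho>abe_def by (rule sum_pow_blk[OF u that])
    have off: "\<kappa> = 2 \<or> \<kappa> = 1 \<and> (\<forall>s<dF ^ n. \<forall>s'<dF ^ n. s \<noteq> s' \<longrightarrow> ?B s s' = 0\<^sub>m (dA ^ n * dB ^ n * dE ^ n) (dA ^ n * dB ^ n * dE ^ n))"
    proof (cases "\<kappa> = 2")
      case False
      then have "\<kappa> = 1" and z: "\<And>s s'. s < dF \<Longrightarrow> s' < dF \<Longrightarrow> s \<noteq> s' \<Longrightarrow>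
          blk (dA, dB, dE) (dE * dF) (base_split dF u) s s' \<rho> = 0\<^sub>m (dA * dB * dE) (dA * dB * dE)"
        using \<kappa> unfolding u_def by auto
      then show ?thesis using pow_blk_offdiag[OF z] unfolding B by blast
    qed simp
    have ds: "\<exists>P' g' \<tau>'. lopc (dA ^ n, dB ^ n, (dE * dF) ^ n) (2 ^ l' n, 2 ^ l' n, g') P' \<and> density_op g' \<tau>' \<and>
        0 \<le> trace_dist (P' ?X) (key_state (2 ^ l' n, 2 ^ l' n, g') (l' n) \<tau>') \<and>
        2 * trace_dist (P' ?X) (key_state (2 ^ l' n, 2 ^ l' n, g') (l' n) \<tau>') \<le>
        2 * \<epsilon> n + 2 * (2 * sqrt (\<delta> + \<epsilon> n) + (\<delta> + \<epsilon> n)) + (if l' n = 0 then 0 else 2 * sqrt (2 ^ l' n * C / 2 ^ l n))"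
      if T: "T \<subseteq> {..<dF ^ n}" and \<delta>: "(\<Sum>s\<in>{..<dF ^ n} - T. pow_prob dF p n s) \<le> \<delta>"
        and C: "C = (if \<kappa> = 2 then real (card T) * real (card T) else real (card T))" for T \<delta> C
    proof (rule distill_step[OF \<Lambda> splits_pow[OF u] Xp Xt tri_power_positive[OF \<rho>abep] sumX _ _ _ T])
      show "2 ^ l n \<le> a1" "2 ^ l n \<le> b1" using l(2)[of n] by (auto simp: fP)
      show "density_op e1 (\<tau> n)" using l(3)[of n] by (simp add: fP)
      have "(\<Sum>s\<in>{..<dF ^ n} - T. Re (mat_trace (?B s s))) = (\<Sum>s\<in>{..<dF ^ n} - T. pow_prob dF p n s)"
        by (intro sum.cong refl) (simp add: trB)
      then show "(\<Sum>s\<in>{..<dF ^ n} - T. Re (mat_trace (?B s s))) \<le> \<delta>" using \<delta> by simp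
      show "C = real (card T) * real (card T) \<or> C = real (card T) \<and>
        (\<forall>s<dF ^ n. \<forall>s'<dF ^ n. s \<noteq> s' \<longrightarrow> ?B s s' = 0\<^sub>m (dA ^ n * dB ^ n * dE ^ n) (dA ^ n * dB ^ n * dE ^ n))"
        using off C by auto
      show "\<epsilon> n = 2 * trace_dist (snd (P n) (tri_power (dA, dB, dE) \<rho>abe n)) (key_state (a1, b1, e1) (l n) (\<tau> n))"
        by (simp only: \<epsilon>_def fP)
    qed
    show ?thesis
    proof (cases "n = 0")
      case True
      \<comment> \<open>Any typical set would do, as no error bound is asked for; the empty one is
        taken.\<close>
      from ds[OF empty_subsetI order_refl refl] show ?thesis unfolding dims_pow.simps using True by blast
    next
      case False
      then have n: "0 < n" by simp
      have dn: "0 < d n" using n by (simp add: d_def)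
      obtain T where T: "T \<subseteq> {..<dF ^ n}" "real (card T) \<le> 2 powr (real n * (S + d n))"
        "(\<Sum>s\<in>{..<dF ^ n} - T. pow_prob dF p n s) \<le> v / (real n * (d n)\<^sup>2)"
        using typical_set[OF p0 p1 n dn] unfolding v_def S_def by blast
      define C where "C = (if \<kappa> = 2 then real (card T) * real (card T) else real (card T))"
      have C: "C \<le> 2 powr (\<kappa> * (real n * (S + d n)))"
      proof (cases "\<kappa> = 2")
        case True
        have "C \<le> 2 powr (real n * (S + d n)) * 2 powr (real n * (S + d n))"
          unfolding C_def using T(2) True by (auto intro: mult_mono)
        then show ?thesis using True by (simp flip: powr_add)
      qed (use \<kappa> T(2) in \<open>auto simp: C_def\<close>)
      have sq: "(if l' n = 0 then 0 else 2 * sqrt (2 ^ l' n * C / 2 ^ l n)) \<le> 2 * sqrt (2 powr (- (real n * d n)))"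
      proof (cases "l' n = 0")
        case False
        define x where "x = real (l n) - \<kappa> * (real n * (S + d n)) - real n * d n"
        have "0 < \<lfloor>x\<rfloor>" using False by (simp add: l'_def x_def)
        then have "real (l' n) = of_int \<lfloor>x\<rfloor>" by (simp add: l'_def x_def)
        then have lx: "real (l' n) \<le> x" using of_int_floor_le[of x] by simp
        have "2 ^ l' n * C / 2 ^ l n = 2 powr (real (l' n) - real (l n)) * C"
          by (simp add: powr_diff powr_realpow)
        also have "\<dots> \<le> 2 powr (real (l' n) - real (l n)) * 2 powr (\<kappa> * (real n * (S + d n)))"
          using C by (intro mult_left_mono) auto
        also have "\<dots> = 2 powr (real (l' n) - real (l n) + \<kappa> * (real n * (S + d n)))" by (simp add: powr_add)
        also have "\<dots> \<le> 2 powr (- (real n * d n))" using lx by (intro powr_mono) (auto simp: x_def)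
        finally show ?thesis using False by simp
      qed simp
      let ?td = "\<lambda>P' g' \<tau>'. trace_dist (P' ?X) (key_state (2 ^ l' n, 2 ^ l' n, g') (l' n) \<tau>')"
      obtain P' g' \<tau>' where W: "lopc (dA ^ n, dB ^ n, (dE * dF) ^ n) (2 ^ l' n, 2 ^ l' n, g') P'"
        "density_op g' \<tau>'" "0 \<le> ?td P' g' \<tau>'"
        "2 * ?td P' g' \<tau>' \<le> 2 * \<epsilon> n + 2 * (2 * sqrt (v / (real n * (d n)\<^sup>2) + \<epsilon> n) + (v / (real n * (d n)\<^sup>2) + \<epsilon> n)) +
          (if l' n = 0 then 0 else 2 * sqrt (2 ^ l' n * C / 2 ^ l n))"
        using ds[OF T(1,3) C_def] by blast
      have "2 * ?td P' g' \<tau>' \<le> err n" unfolding err_def using W(4) sq by linarith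
      with W(1-3) show ?thesis unfolding dims_pow.simps by blast
    qed
  qed
  obtain P' g' \<tau>' where P': "\<And>n. lopc (dims_pow (dA, dB, dE * dF) n) (2 ^ l' n, 2 ^ l' n, g' n) (P' n)"
    "\<And>n. density_op (g' n) (\<tau>' n)"
    "\<And>n. 0 \<le> trace_dist (P' n (tri_power (dA, dB, dE * dF) \<rho> n)) (key_state (2 ^ l' n, 2 ^ l' n, g' n) (l' n) (\<tau>' n))"
    "\<And>n. 0 < n \<Longrightarrow> 2 * trace_dist (P' n (tri_power (dA, dB, dE * dF) \<rho> n)) (key_state (2 ^ l' n, 2 ^ l' n, g' n) (l' n) (\<tau>' n)) \<le> err n"
    using step by metis
  have d0: "d \<longlonglongrightarrow> 0" unfolding d_def by real_asymp
  have v0: "(\<lambda>n. v / (real n * (d n)\<^sup>2)) \<longlonglongrightarrow> 0" unfolding d_def by real_asymp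
  have e0: "(\<lambda>n. 2 powr (- (real n * d n))) \<longlonglongrightarrow> 0" unfolding d_def by real_asymp
  have err0: "err \<longlonglongrightarrow> 0"
  proof -
    have "(\<lambda>n. v / (real n * (d n)\<^sup>2) + \<epsilon> n) \<longlonglongrightarrow> 0" using tendsto_add[OF v0 \<epsilon>] by simp
    then have "err \<longlonglongrightarrow> 2 * 0 + 2 * (2 * sqrt 0 + 0) + 2 * sqrt 0"
      unfolding err_def by (intro tendsto_intros \<epsilon> e0)
    then show ?thesis by simp
  qed
  have td: "(\<lambda>n. trace_dist (P' n (tri_power (dA, dB, dE * dF) \<rho> n)) (key_state (2 ^ l' n, 2 ^ l' n, g' n) (l' n) (\<tau>' n))) \<longlonglongrightarrow> 0"
  proof (rule tendsto_sandwich[of "\<lambda>_. 0" _ sequentially "\<lambda>n. err n / 2"])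
    show "eventually (\<lambda>n. 0 \<le> trace_dist (P' n (tri_power (dA, dB, dE * dF) \<rho> n)) (key_state (2 ^ l' n, 2 ^ l' n, g' n) (l' n) (\<tau>' n))) sequentially"
      by (intro always_eventually allI P'(3))
    show "eventually (\<lambda>n. trace_dist (P' n (tri_power (dA, dB, dE * dF) \<rho> n)) (key_state (2 ^ l' n, 2 ^ l' n, g' n) (l' n) (\<tau>' n)) \<le> err n / 2) sequentially"
      using eventually_gt_at_top[of 0]
    proof eventually_elim
      case (elim n)
      from P'(4)[OF elim] show ?case by linarith
    qed
    show "(\<lambda>n. err n / 2) \<longlonglongrightarrow> 0" using tendsto_divide[OF err0 tendsto_const[of 2]] by simp
  qed (rule tendsto_const)
  define P'' :: protocol where "P'' n = ((2 ^ l' n, 2 ^ l' n, g' n), P' n)" for n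
  have kd: "key_distillation (dA, dB, dE * dF) \<rho> P'' (limsup (\<lambda>n. ereal (real (l' n) / real n)))"
    unfolding key_distillation_def
  proof (intro conjI exI[of _ l'] exI[of _ \<tau>'] allI)
    show "lopc_protocol (dA, dB, dE * dF) P''" using P'(1) by (simp add: lopc_protocol_def P''_def del: dims_pow.simps)
    show "(\<lambda>n. trace_dist (snd (P'' n) (tri_power (dA, dB, dE * dF) \<rho> n)) (key_state (fst (P'' n)) (l' n) (\<tau>' n))) \<longlonglongrightarrow> 0"
      unfolding P''_def fst_conv snd_conv by (rule td)
  qed (use P'(2) in \<open>auto simp: P''_def\<close>)
  have "R - ereal (\<kappa> * S) \<le> limsup (\<lambda>n. ereal (real (l' n) / real n))"
    unfolding l(4)[symmetric]
  proof (rule key_rate_shift)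
    \<comment> \<open>The slack subtracted in \<open>l'\<close> is \<kappa> + 1 times
      \<open>d n\<close> for each copy, and rounding down costs at most one bit in all.\<close>
    show "(\<lambda>n. (\<kappa> + 1) * d n + 1 / real n) \<longlonglongrightarrow> 0"
      using tendsto_add[OF tendsto_mult[OF tendsto_const[of "\<kappa> + 1"] d0] lim_1_over_n] by simp
    show "eventually (\<lambda>n. real (l n) / real n \<le> real (l' n) / real n + (\<kappa> * S + ((\<kappa> + 1) * d n + 1 / real n))) sequentially"
      using eventually_gt_at_top[of 0]
    proof eventually_elim
      case (elim n)
      have "real (l n) - \<kappa> * (real n * (S + d n)) - real n * d n - 1 \<le> real (l' n)"
        unfolding l'_def by linarith
      then have "real (l n) \<le> real (l' n) + real n * (\<kappa> * S + ((\<kappa> + 1) * d n + 1 / real n))"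
        using elim by (simp add: algebra_simps)
      then have "real (l n) / real n \<le> (real (l' n) + real n * (\<kappa> * S + ((\<kappa> + 1) * d n + 1 / real n))) / real n"
        by (intro divide_right_mono) auto
      also have "\<dots> = real (l' n) / real n + (\<kappa> * S + ((\<kappa> + 1) * d n + 1 / real n))"
        using elim by (simp add: add_divide_distrib)
      finally show ?case .
    qed
  qed
  then show ?thesis using kd S by auto
qed

text \<open>The basis in which F is classical is itself an eigenbasis of the marginal, with the
  weights \<open>p\<close> as eigenvalues. An arbitrary eigenbasis would not do, since for
  degenerate eigenvalues the off-diagonal blocks need not vanish in it.\<close>

lemma classical_snd_eigenbasis:
  assumes "classical_snd (a * b * e) f \<rho>"
  shows "\<exists>U p. unitary f U \<and>
    ptrace_fst (a * b * e) f \<rho> = U * mat_diag f (\<lambda>i. complex_of_real (p i)) * mat_adjoint U \<and>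
    (\<forall>s<f. \<forall>s'<f. s \<noteq> s' \<longrightarrow>
      blk (a, b, e) (e * f) (base_split f (\<lambda>i s. U $$ (i, s))) s s' \<rho> = 0\<^sub>m (a * b * e) (a * b * e))"
proof -
  let ?m = "a * b * e"
  obtain v p \<sigma> where v: "orthonormal_basis f v" and \<sigma>: "\<And>k. k < f \<Longrightarrow> density_op ?m (\<sigma> k)"
    and \<rho>: "\<rho> = mat_sum (?m * f) (\<lambda>k. complex_of_real (p k) \<cdot>\<^sub>m kron (\<sigma> k) (ketbra (v k))) {..<f}"
    using assms unfolding classical_snd_def by blast
  have vc: "v k \<in> carrier_vec f" if "k < f" for k using v that by (simp add: orthonormal_basis_def)
  have on: "(\<Sum>i<f. v k $ i * cnj (v l $ i)) = (if k = l then 1 else 0)" if "k < f" "l < f" for k l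
  proof -
    have "v k \<bullet>c v l = (if k = l then 1 else 0)" using v that by (simp add: orthonormal_basis_def)
    moreover have "v k \<bullet>c v l = (\<Sum>i<f. v k $ i * cnj (v l $ i))"
      using carrier_vecD[OF vc[OF that(1)]] carrier_vecD[OF vc[OF that(2)]] by (simp add: scalar_prod_def lessThan_atLeast0)
    ultimately show ?thesis by (simp only:)
  qed
  have \<sigma>c: "\<sigma> k \<in> carrier_mat ?m ?m" if "k < f" for k
    using \<sigma>[OF that] by (simp add: density_op_def positive_op_carrier)
  define U where "U = mat f f (\<lambda>(i, k). v k $ i)"
  have Uc: "U \<in> carrier_mat f f" by (simp add: U_def)
  have "mat_adjoint U * U = 1\<^sub>m f"
  proof (rule eq_matI)
    fix k l assume "k < dim_row (1\<^sub>m f)" "l < dim_col (1\<^sub>m f)"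
    then have kl: "k < f" "l < f" by auto
    have "(mat_adjoint U * U) $$ (k, l) = (\<Sum>i<f. v l $ i * cnj (v k $ i))"
      using kl by (simp add: scalar_prod_def mat_adjoint_index lessThan_atLeast0 U_def mult.commute)
    then show "(mat_adjoint U * U) $$ (k, l) = 1\<^sub>m f $$ (k, l)" using on[OF kl(2,1)] kl by auto
  qed (use Uc in auto)
  moreover from this have "U * mat_adjoint U = 1\<^sub>m f"
    using mat_mult_left_right_inverse[OF mat_adjoint_carrier[OF Uc] Uc] by simp
  ultimately have U: "unitary f U" using Uc by (simp add: unitary_def)
  have \<rho>_ent: "\<rho> $$ (r * f + i, c * f + j) = (\<Sum>k<f. of_real (p k) * (\<sigma> k $$ (r, c) * (v k $ i * cnj (v k $ j))))"
    if "r < ?m" "c < ?m" "i < f" "j < f" for r c i j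
  proof -
    have lt: "r * f + i < ?m * f" "c * f + j < ?m * f" using that by (auto intro!: mult_index_less)
    have "(complex_of_real (p k) \<cdot>\<^sub>m kron (\<sigma> k) (ketbra (v k))) $$ (r * f + i, c * f + j)
      = of_real (p k) * (\<sigma> k $$ (r, c) * (v k $ i * cnj (v k $ j)))" if "k < f" for k
      using lt \<open>i < f\<close> \<open>j < f\<close> \<sigma>c[OF that] vc[OF that] by (simp add: kron_def ketbra_def)
    then show ?thesis unfolding \<rho> mat_sum_def using lt by simp
  qed
  have "ptrace_fst ?m f \<rho> = U * mat_diag f (\<lambda>i. complex_of_real (p i)) * mat_adjoint U"
  proof (rule eq_matI)
    fix i j assume "i < dim_row (U * mat_diag f (\<lambda>i. complex_of_real (p i)) * mat_adjoint U)"
      "j < dim_col (U * mat_diag f (\<lambda>i. complex_of_real (p i)) * mat_adjoint U)"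
    then have ij: "i < f" "j < f" using Uc by auto
    have "ptrace_fst ?m f \<rho> $$ (i, j) = (\<Sum>r<?m. \<Sum>k<f. of_real (p k) * (\<sigma> k $$ (r, r) * (v k $ i * cnj (v k $ j))))"
      using ij by (simp add: ptrace_fst_def \<rho>_ent)
    also have "\<dots> = (\<Sum>k<f. \<Sum>r<?m. of_real (p k) * (\<sigma> k $$ (r, r) * (v k $ i * cnj (v k $ j))))" by (rule sum.swap)
    also have "\<dots> = (\<Sum>k<f. of_real (p k) * (v k $ i * cnj (v k $ j)))"
    proof (rule sum.cong[OF refl])
      fix k assume "k \<in> {..<f}"
      then have k: "k < f" by simp
      have "(\<Sum>r<?m. \<sigma> k $$ (r, r)) = 1" using \<sigma>[OF k] \<sigma>c[OF k] by (simp add: density_op_def mat_trace_def)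
      moreover have "(\<Sum>r<?m. of_real (p k) * (\<sigma> k $$ (r, r) * (v k $ i * cnj (v k $ j))))
        = of_real (p k) * ((\<Sum>r<?m. \<sigma> k $$ (r, r)) * (v k $ i * cnj (v k $ j)))"
        by (simp only: sum_distrib_left sum_distrib_right)
      ultimately show "(\<Sum>r<?m. of_real (p k) * (\<sigma> k $$ (r, r) * (v k $ i * cnj (v k $ j)))) = of_real (p k) * (v k $ i * cnj (v k $ j))"
        by simp
    qed
    also have "\<dots> = (U * mat_diag f (\<lambda>i. complex_of_real (p i)) * mat_adjoint U) $$ (i, j)"
      using ij Uc by (simp add: mat_diag_mult_right[OF Uc] scalar_prod_def mat_adjoint_index lessThan_atLeast0)
        (simp add: U_def mult_ac)
    finally show "ptrace_fst ?m f \<rho> $$ (i, j) = (U * mat_diag f (\<lambda>i. complex_of_real (p i)) * mat_adjoint U) $$ (i, j)" .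
  qed (use Uc in \<open>auto simp: ptrace_fst_def\<close>)
  moreover have "blk (a, b, e) (e * f) (base_split f (\<lambda>i s. U $$ (i, s))) s s' \<rho> = 0\<^sub>m ?m ?m"
    if s: "s < f" "s' < f" "s \<noteq> s'" for s s'
  proof (rule tri_mat_eqI[of _ a b e])
    fix q q' assume q: "q \<in> tri a b e" "q' \<in> tri a b e"
    note r = tri_enc_less[OF q(1)] tri_enc_less[OF q(2)]
    let ?r = "tri_enc b e q" and ?c = "tri_enc b e q'"
    have "blk (a, b, e) (e * f) (base_split f (\<lambda>i s. U $$ (i, s))) s s' \<rho> $$ (?r, ?c)
      = (\<Sum>i<f. \<Sum>j<f. \<Sum>k<f. cnj (v s $ i) * v s' $ j * (of_real (p k) * (\<sigma> k $$ (?r, ?c) * (v k $ i * cnj (v k $ j)))))"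
      unfolding base_blk_index[OF q] using s r
      by (intro sum.cong refl) (simp add: U_def \<rho>_ent sum_distrib_left del: tri_enc.simps)
    also have "\<dots> = (\<Sum>i<f. \<Sum>k<f. \<Sum>j<f. cnj (v s $ i) * v s' $ j * (of_real (p k) * (\<sigma> k $$ (?r, ?c) * (v k $ i * cnj (v k $ j)))))"
      by (intro sum.cong refl sum.swap)
    also have "\<dots> = (\<Sum>k<f. \<Sum>i<f. \<Sum>j<f. cnj (v s $ i) * v s' $ j * (of_real (p k) * (\<sigma> k $$ (?r, ?c) * (v k $ i * cnj (v k $ j)))))"
      by (rule sum.swap)
    also have "\<dots> = (\<Sum>k<f. of_real (p k) * \<sigma> k $$ (?r, ?c) * ((\<Sum>i<f. v k $ i * cnj (v s $ i)) * (\<Sum>j<f. v s' $ j * cnj (v k $ j))))"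
    proof (rule sum.cong[OF refl])
      fix k
      show "(\<Sum>i<f. \<Sum>j<f. cnj (v s $ i) * v s' $ j * (of_real (p k) * (\<sigma> k $$ (?r, ?c) * (v k $ i * cnj (v k $ j)))))
        = of_real (p k) * \<sigma> k $$ (?r, ?c) * ((\<Sum>i<f. v k $ i * cnj (v s $ i)) * (\<Sum>j<f. v s' $ j * cnj (v k $ j)))"
        unfolding sum_product unfolding sum_distrib_left
        by (rule sum.cong[OF refl], rule sum.cong[OF refl]) (simp only: mult_ac)
    qed
    \<comment> \<open>A term survives only if \<open>k\<close> equals both \<open>s\<close> and
      \<open>s'\<close>.\<close>
    also have "\<dots> = 0"
      using s by (intro sum.neutral ballI) (auto simp: on)
    finally show "blk (a, b, e) (e * f) (base_split f (\<lambda>i s. U $$ (i, s))) s s' \<rho> $$ (?r, ?c) = 0\<^sub>m ?m ?m $$ (?r, ?c)"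
      using r by (simp del: tri_enc.simps)
  qed simp_all
  ultimately show ?thesis using U by blast
qed

theorem theorem5p1:
  fixes dA dB dE dF :: nat and \<rho> :: "complex mat" and P :: protocol and R :: ereal
  assumes "density_op (dA * dB * dE * dF) \<rho>"
    and "key_distillation (dA, dB, dE) (ptrace_snd (dA * dB * dE) dF \<rho>) P R"
  shows "(\<exists>P' R'. key_distillation (dA, dB, dE * dF) \<rho> P' R'
            \<and> R' \<ge> R - ereal (2 * entropy (ptrace_fst (dA * dB * dE) dF \<rho>)))
       \<and> (classical_snd (dA * dB * dE) dF \<rho> \<longrightarrow>
            (\<exists>P' R'. key_distillation (dA, dB, dE * dF) \<rho> P' R'
              \<and> R' \<ge> R - ereal (entropy (ptrace_fst (dA * dB * dE) dF \<rho>))))"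
proof (intro conjI impI)
  have "positive_op dF (ptrace_fst (dA * dB * dE) dF \<rho>)"
    using assms(1) by (intro positive_op_ptrace_fst) (simp add: density_op_def)
  then obtain U p where "unitary dF U"
    "ptrace_fst (dA * dB * dE) dF \<rho> = U * mat_diag dF (\<lambda>i. complex_of_real (p i)) * mat_adjoint U"
    using spectral_mat[OF positive_op_carrier positive_op_adjoint] by blast
  from key_distillation_extension[OF assms this, of 2]
  show "\<exists>P' R'. key_distillation (dA, dB, dE * dF) \<rho> P' R'
            \<and> R' \<ge> R - ereal (2 * entropy (ptrace_fst (dA * dB * dE) dF \<rho>))" by simp
next
  assume "classical_snd (dA * dB * dE) dF \<rho>"
  then obtain U p where U: "unitary dF U"
    "ptrace_fst (dA * dB * dE) dF \<rho> = U * mat_diag dF (\<lambda>i. complex_of_real (p i)) * mat_adjoint U"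
    "\<forall>s<dF. \<forall>s'<dF. s \<noteq> s' \<longrightarrow>
      blk (dA, dB, dE) (dE * dF) (base_split dF (\<lambda>i s. U $$ (i, s))) s s' \<rho> = 0\<^sub>m (dA * dB * dE) (dA * dB * dE)"
    using classical_snd_eigenbasis by blast
  from key_distillation_extension[OF assms U(1,2), of 1] U(3)
  show "\<exists>P' R'. key_distillation (dA, dB, dE * dF) \<rho> P' R'
            \<and> R' \<ge> R - ereal (entropy (ptrace_fst (dA * dB * dE) dF \<rho>))" by simp
qed

end
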